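(* Let $-\infty\le a<b\le\infty$ and $n\in\mathbb N$. Let $J\in\mathbb C^{n\times n}$ be invertible with $J^*=-J$, and let $q,w\in\mathcal D'^0((a,b))^{n\times n}$ with $q$ Hermitian, $w$ non-negative, and $2J\pm\Delta_q(x)$ invertible for every $x\in(a,b)$. Let $T_{\max}$ be the maximal relation of $Ju'+qu=wf$, $V=D_i\oplus D_{-i}$, and suppose that the deficiency indices $n_\pm=\dim D_{\pm i}$ satisfy $n_+=n_->0$. Then a relation $T$ is a self-adjoint restriction of $T_{\max}$ if and only if there are $n_+$ linearly independent elements $(v_1,g_1),\dots,(v_{n_+},g_{n_+})$ in $V$ with $\langle(v_k,g_k),(g_\ell,-v_\ell)\rangle=0$ for all $1\le k,\ell\le n_+$ such that $$T=\{(u,f)\in T_{\max}:(g_j^*Ju)^-(b)-(g_j^*Ju)^+(a)=0\text{ for }j=1,\dots,n_+\}.$$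
   Context: $\mathcal D'^0((a,b))$ is the space of distributions of order $0$ on $(a,b)$, i.e. set functions that are complex measures on each compact subinterval. Each $q\in\mathcal D'^0((a,b))$ has an antiderivative $Q$ of locally bounded variation with $q=dQ$. For $u$ of locally bounded variation, $u^\pm$ are its right-/left-continuous versions, and $u$ is balanced if $u=u^\#:=(u^++u^-)/2$; $BV^\#_{loc}((a,b))$ is the set of balanced functions of locally bounded variation. $\Delta_q(x)=Q^+(x)-Q^-(x)$ (entrywise for matrices). $qf$ is the distribution $\phi\mapsto\int\phi f\,dQ$. $q$ is Hermitian if $q^*=q$ and $w$ is non-negative if $\alpha^*w\alpha$ is a non-negative distribution for each $\alpha\in\mathbb C^n$. With $\tilde W$ the Radon--Nikodym derivative of $w$ with respect to $\operatorname{tr}w$, $\mathcal L^2(w)$ is the space of $f:(a,b)\to\mathbb C^n$ with $\int f^*\tilde Wf\,\operatorname{tr}w<\infty$, with semi-inner product $\langle f,g\rangle=\int f^*\tilde Wg\,\operatorname{tr}w$, and $L^2(w)$ is the Hilbert space of classes modulo elements of norm zero. On $L^2(w)\times L^2(w)$ the inner product is $\langle(u,f),(v,g)\rangle=\langle u,v\rangle+\langle f,g\rangle$. $\mathcal T_{\max}=\{(u,f)\in\mathcal L^2(w)\times\mathcal L^2(w):u\in BV^\#_{loc}((a,b))^n,\ Ju'+qu=wf\}$, $T_{\max}=\{([u],[f]):(u,f)\in\mathcal T_{\max}\}$, $\mathcal T_{\min}$ and $T_{\min}$ are defined in the same way with the additional requirement that $\operatorname{supp}u$ is compact in $(a,b)$.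 $D_\lambda=\{([u],\lambda[u])\in T_{\max}\}$; $n_\pm$ are the deficiency indices of $T_{\min}$. A restriction of $T_{\max}$ is a linear subspace $T\subset T_{\max}$; it is self-adjoint if $T=T^*=\{(v,g)\in L^2(w)\times L^2(w):\langle g,u\rangle=\langle v,f\rangle\ \forall(u,f)\in T\}$. Boundary terms: if $(v,g)\in V$ then $(g,-v)\in V\subset T_{\max}$. For pairs $(u,f),(r,h)\in\mathcal T_{\max}$ the limits $(r^*Ju)^-(b)=\lim_{x\uparrow b}r^-(x)^*Ju^-(x)$ and $(r^*Ju)^+(a)=\lim_{x\downarrow a}r^+(x)^*Ju^+(x)$ exist, and the difference $(r^*Ju)^-(b)-(r^*Ju)^+(a)$ depends only on the classes $([u],[f])$, $([r],[h])$. The expressions in the claim are computed with balanced representatives of $u$ and $g_j$ satisfying $Ju'+qu=wf$ and $Jg_j'+qg_j=-wv_j$. *)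

theory Defs
  imports "HOL-Analysis.Analysis"
begin

section \<open>Distributions of order zero\<close>

text \<open>
  A distribution of order zero on \<open>(a,b)\<close> is a set function that is a (complex, vector or matrix
  valued) measure on every compact subinterval. It is represented by a total function on
  \<^typ>\<open>real set\<close>, of which only the values on the Borel sets contained in some compact subinterval
  of \<open>(a,b)\<close> are ever used. Two such distributions are equal if they agree on those sets.
\<close>

definition local_borel :: "ereal \<Rightarrow> ereal \<Rightarrow> real set set" where
  "local_borel a b =
     {E \<in> sets borel. \<exists>c d. a < ereal c \<and> ereal d < b \<and> E \<subseteq> {c..d}}"

definition distr0 :: "ereal \<Rightarrow> ereal \<Rightarrow> (real set \<Rightarrow> 'v::real_normed_vector) \<Rightarrow> bool" where
  "distr0 a b \<mu> \<longleftrightarrow>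
     (\<forall>A :: nat \<Rightarrow> real set. disjoint_family A \<and> (\<forall>i. A i \<in> sets borel) \<and>
        (\<Union>i. A i) \<in> local_borel a b \<longrightarrow> (\<lambda>i. \<mu> (A i)) sums \<mu> (\<Union>i. A i))"

definition right_lim :: "(real \<Rightarrow> 'v::t2_space) \<Rightarrow> real \<Rightarrow> 'v" where
  "right_lim u x = Lim (at_right x) u"

definition left_lim :: "(real \<Rightarrow> 'v::t2_space) \<Rightarrow> real \<Rightarrow> 'v" where
  "left_lim u x = Lim (at_left x) u"

definition BV_loc :: "ereal \<Rightarrow> ereal \<Rightarrow> (real \<Rightarrow> 'v::real_normed_vector) \<Rightarrow> bool" where
  "BV_loc a b u \<longleftrightarrow>
     (\<forall>c d. a < ereal c \<and> ereal d < b \<longrightarrow>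
        (\<exists>B. \<forall>(t :: nat \<Rightarrow> real) k. mono t \<and> range t \<subseteq> {c..d} \<longrightarrow>
               (\<Sum>i<k. norm (u (t (Suc i)) - u (t i))) \<le> B))"

definition balanced :: "ereal \<Rightarrow> ereal \<Rightarrow> (real \<Rightarrow> 'v::real_normed_vector) \<Rightarrow> bool" where
  "balanced a b u \<longleftrightarrow>
     (\<forall>x \<in> einterval a b. u x = (1/2) *\<^sub>R (right_lim u x + left_lim u x))"

text \<open>
  \<open>antideriv a b Q \<mu>\<close> says \<open>\<mu> = dQ\<close>, i.e. \<open>\<mu>\<close> is the distributional derivative of \<open>Q\<close>.
  The case \<open>c = d\<close> gives \<open>\<mu>({c}) = Q\<^sup>+(c) - Q\<^sup>-(c)\<close>.
\<close>

definition antideriv ::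
  "ereal \<Rightarrow> ereal \<Rightarrow> (real \<Rightarrow> 'v::real_normed_vector) \<Rightarrow> (real set \<Rightarrow> 'v) \<Rightarrow> bool" where
  "antideriv a b Q \<mu> \<longleftrightarrow> BV_loc a b Q \<and>
     (\<forall>c d. a < ereal c \<and> c \<le> d \<and> ereal d < b \<longrightarrow> \<mu> {c..d} = right_lim Q d - left_lim Q c)"

definition jump :: "ereal \<Rightarrow> ereal \<Rightarrow> (real set \<Rightarrow> 'v::real_normed_vector) \<Rightarrow> real \<Rightarrow> 'v" where
  "jump a b \<mu> x = (let Q = (SOME Q. antideriv a b Q \<mu>) in right_lim Q x - left_lim Q x)"

definition cadjoint :: "complex^'n^'m \<Rightarrow> complex^'m^'n" where
  "cadjoint A = (\<chi> i j. cnj (A $ j $ i))"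

text \<open>\<open>herm x y\<close> is \<open>x\<^sup>* y\<close>, hence conjugate linear in the first argument.\<close>

definition herm :: "complex^'n \<Rightarrow> complex^'n \<Rightarrow> complex" where
  "herm x y = (\<Sum>i\<in>UNIV. cnj (x $ i) * y $ i)"

definition hermitian0 :: "ereal \<Rightarrow> ereal \<Rightarrow> (real set \<Rightarrow> complex^'n^'n) \<Rightarrow> bool" where
  "hermitian0 a b q \<longleftrightarrow> (\<forall>E \<in> local_borel a b. cadjoint (q E) = q E)"

definition nonneg0 :: "ereal \<Rightarrow> ereal \<Rightarrow> (real set \<Rightarrow> complex^'n^'n) \<Rightarrow> bool" where
  "nonneg0 a b w \<longleftrightarrow>
     (\<forall>\<alpha>. \<forall>E \<in> local_borel a b. herm \<alpha> (w E *v \<alpha>) \<in> \<real>\<^sub>\<ge>\<^sub>0)"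

section \<open>Densities and products of distributions with functions\<close>

text \<open>
  Total variation of \<open>\<mu>\<close>, and trace of a non-negative matrix distribution \<open>w\<close>, as (possibly
  infinite) positive measures on the Borel subsets of \<open>(a,b)\<close>.
\<close>

definition variation ::
  "ereal \<Rightarrow> ereal \<Rightarrow> (real set \<Rightarrow> 'v::real_normed_vector) \<Rightarrow> real measure" where
  "variation a b \<mu> =
     measure_of (einterval a b) (sets (restrict_space borel (einterval a b)))
       (\<lambda>E. SUP P \<in> {P. finite P \<and> disjoint P \<and> P \<subseteq> local_borel a b \<and> \<Union>P \<subseteq> E}.
              \<Sum>A\<in>P. ennreal (norm (\<mu> A)))"

definition trace_measure ::
  "ereal \<Rightarrow> ereal \<Rightarrow> (real set \<Rightarrow> complex^'n^'n) \<Rightarrow> real measure" where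
  "trace_measure a b w =
     measure_of (einterval a b) (sets (restrict_space borel (einterval a b)))
       (\<lambda>E. SUP A \<in> {A \<in> local_borel a b. A \<subseteq> E}. ennreal (Re (trace (w A))))"

definition RN_density ::
  "ereal \<Rightarrow> ereal \<Rightarrow> real measure \<Rightarrow> (real set \<Rightarrow> 'v::euclidean_space) \<Rightarrow> real \<Rightarrow> 'v" where
  "RN_density a b M \<mu> =
     (SOME h. h \<in> borel_measurable M \<and>
        (\<forall>E \<in> local_borel a b. set_integrable M E h \<and> \<mu> E = (LINT x:E|M. h x)))"

text \<open>
  \<open>q u\<close> as the distribution \<open>E \<mapsto> \<integral>\<^sub>E dQ u\<close>; integration against the complex measure \<open>dQ = q\<close>
  is integration of the density of \<open>q\<close> against its total variation.
\<close>

definition qmult ::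
  "ereal \<Rightarrow> ereal \<Rightarrow> (real set \<Rightarrow> complex^'n^'n) \<Rightarrow> (real \<Rightarrow> complex^'n) \<Rightarrow> real set \<Rightarrow> complex^'n"
  where
  "qmult a b q u E =
     (LINT x:E|variation a b q. RN_density a b (variation a b q) q x *v u x)"

definition Wt :: "ereal \<Rightarrow> ereal \<Rightarrow> (real set \<Rightarrow> complex^'n^'n) \<Rightarrow> real \<Rightarrow> complex^'n^'n" where
  "Wt a b w = RN_density a b (trace_measure a b w) w"

text \<open>
  \<open>w f\<close> is the distribution with density \<open>Wt f\<close> with respect to \<open>tr w\<close>. For square integrable
  \<open>f\<close> this density is locally integrable, whereas the single products \<open>Wt\<^sub>i\<^sub>j f\<^sub>j\<close> need not be.
\<close>

definition wmult ::
  "ereal \<Rightarrow> ereal \<Rightarrow> (real set \<Rightarrow> complex^'n^'n) \<Rightarrow> (real \<Rightarrow> complex^'n) \<Rightarrow> real set \<Rightarrow> complex^'n"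
  where
  "wmult a b w f E = (LINT x:E|trace_measure a b w. Wt a b w x *v f x)"

section \<open>The Hilbert space of square integrable functions\<close>

definition semi_inner ::
  "ereal \<Rightarrow> ereal \<Rightarrow> (real set \<Rightarrow> complex^'n^'n) \<Rightarrow>
   (real \<Rightarrow> complex^'n) \<Rightarrow> (real \<Rightarrow> complex^'n) \<Rightarrow> complex" where
  "semi_inner a b w f g = (LINT x|trace_measure a b w. herm (f x) (Wt a b w x *v g x))"

definition calL2 ::
  "ereal \<Rightarrow> ereal \<Rightarrow> (real set \<Rightarrow> complex^'n^'n) \<Rightarrow> (real \<Rightarrow> complex^'n) set" where
  "calL2 a b w =
     {f. f \<in> borel_measurable (trace_measure a b w) \<and>
         integrable (trace_measure a b w) (\<lambda>x. herm (f x) (Wt a b w x *v f x))}"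

definition cls ::
  "ereal \<Rightarrow> ereal \<Rightarrow> (real set \<Rightarrow> complex^'n^'n) \<Rightarrow>
   (real \<Rightarrow> complex^'n) \<Rightarrow> (real \<Rightarrow> complex^'n) set" where
  "cls a b w f = {g \<in> calL2 a b w. semi_inner a b w (\<lambda>x. f x - g x) (\<lambda>x. f x - g x) = 0}"

definition L2 ::
  "ereal \<Rightarrow> ereal \<Rightarrow> (real set \<Rightarrow> complex^'n^'n) \<Rightarrow> (real \<Rightarrow> complex^'n) set set" where
  "L2 a b w = cls a b w ` calL2 a b w"

text \<open>
  The operations on classes are computed on representatives; they do not depend on the choice.
  Elements of \<open>L\<^sup>2(w) \<times> L\<^sup>2(w)\<close> are pairs of classes.
\<close>

definition rep :: "(real \<Rightarrow> complex^'n) set \<Rightarrow> real \<Rightarrow> complex^'n" where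
  "rep F = (SOME f. f \<in> F)"

definition l2_inner ::
  "ereal \<Rightarrow> ereal \<Rightarrow> (real set \<Rightarrow> complex^'n^'n) \<Rightarrow>
   (real \<Rightarrow> complex^'n) set \<Rightarrow> (real \<Rightarrow> complex^'n) set \<Rightarrow> complex" where
  "l2_inner a b w F G = semi_inner a b w (rep F) (rep G)"

definition l2_add ::
  "ereal \<Rightarrow> ereal \<Rightarrow> (real set \<Rightarrow> complex^'n^'n) \<Rightarrow>
   (real \<Rightarrow> complex^'n) set \<Rightarrow> (real \<Rightarrow> complex^'n) set \<Rightarrow> (real \<Rightarrow> complex^'n) set" where
  "l2_add a b w F G = cls a b w (\<lambda>x. rep F x + rep G x)"

definition l2_scale ::
  "ereal \<Rightarrow> ereal \<Rightarrow> (real set \<Rightarrow> complex^'n^'n) \<Rightarrow>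
   complex \<Rightarrow> (real \<Rightarrow> complex^'n) set \<Rightarrow> (real \<Rightarrow> complex^'n) set" where
  "l2_scale a b w c F = cls a b w (\<lambda>x. c *s rep F x)"

type_synonym 'n l2pair = "(real \<Rightarrow> complex^'n) set \<times> (real \<Rightarrow> complex^'n) set"

definition pair_inner ::
  "ereal \<Rightarrow> ereal \<Rightarrow> (real set \<Rightarrow> complex^'n^'n) \<Rightarrow> 'n l2pair \<Rightarrow> 'n l2pair \<Rightarrow> complex" where
  "pair_inner a b w X Y = l2_inner a b w (fst X) (fst Y) + l2_inner a b w (snd X) (snd Y)"

definition pair_add ::
  "ereal \<Rightarrow> ereal \<Rightarrow> (real set \<Rightarrow> complex^'n^'n) \<Rightarrow> 'n l2pair \<Rightarrow> 'n l2pair \<Rightarrow> 'n l2pair" where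
  "pair_add a b w X Y = (l2_add a b w (fst X) (fst Y), l2_add a b w (snd X) (snd Y))"

definition pair_scale ::
  "ereal \<Rightarrow> ereal \<Rightarrow> (real set \<Rightarrow> complex^'n^'n) \<Rightarrow> complex \<Rightarrow> 'n l2pair \<Rightarrow> 'n l2pair" where
  "pair_scale a b w c X = (l2_scale a b w c (fst X), l2_scale a b w c (snd X))"

definition pair_zero ::
  "ereal \<Rightarrow> ereal \<Rightarrow> (real set \<Rightarrow> complex^'n^'n) \<Rightarrow> 'n l2pair" where
  "pair_zero a b w = (cls a b w (\<lambda>x. 0), cls a b w (\<lambda>x. 0))"

primrec lincomb ::
  "ereal \<Rightarrow> ereal \<Rightarrow> (real set \<Rightarrow> complex^'n^'n) \<Rightarrow>
   (nat \<Rightarrow> complex) \<Rightarrow> (nat \<Rightarrow> 'n l2pair) \<Rightarrow> nat \<Rightarrow> 'n l2pair" where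
  "lincomb a b w c P 0 = pair_zero a b w"
| "lincomb a b w c P (Suc k) =
     pair_add a b w (lincomb a b w c P k) (pair_scale a b w (c k) (P k))"

definition lin_indep ::
  "ereal \<Rightarrow> ereal \<Rightarrow> (real set \<Rightarrow> complex^'n^'n) \<Rightarrow> (nat \<Rightarrow> 'n l2pair) \<Rightarrow> nat \<Rightarrow> bool" where
  "lin_indep a b w P k \<longleftrightarrow>
     (\<forall>c. lincomb a b w c P k = pair_zero a b w \<longrightarrow> (\<forall>j<k. c j = 0))"

definition linear_subspace ::
  "ereal \<Rightarrow> ereal \<Rightarrow> (real set \<Rightarrow> complex^'n^'n) \<Rightarrow> 'n l2pair set \<Rightarrow> bool" where
  "linear_subspace a b w S \<longleftrightarrow>
     S \<subseteq> L2 a b w \<times> L2 a b w \<and> pair_zero a b w \<in> S \<and>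
     (\<forall>X\<in>S. \<forall>Y\<in>S. pair_add a b w X Y \<in> S) \<and>
     (\<forall>c. \<forall>X\<in>S. pair_scale a b w c X \<in> S)"

definition has_cdim ::
  "ereal \<Rightarrow> ereal \<Rightarrow> (real set \<Rightarrow> complex^'n^'n) \<Rightarrow> 'n l2pair set \<Rightarrow> nat \<Rightarrow> bool" where
  "has_cdim a b w S k \<longleftrightarrow>
     (\<exists>P. (\<forall>j<k. P j \<in> S) \<and> lin_indep a b w P k \<and>
          (\<forall>X\<in>S. \<exists>c. X = lincomb a b w c P k))"

definition rel_adjoint ::
  "ereal \<Rightarrow> ereal \<Rightarrow> (real set \<Rightarrow> complex^'n^'n) \<Rightarrow> 'n l2pair set \<Rightarrow> 'n l2pair set" where
  "rel_adjoint a b w T =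
     {(v, g) \<in> L2 a b w \<times> L2 a b w. \<forall>(u, f) \<in> T. l2_inner a b w g u = l2_inner a b w v f}"

section \<open>The maximal relation\<close>

text \<open>\<open>solves a b J q w u f\<close>: the identity \<open>J u' + q u = w f\<close> between distributions of order zero.\<close>

definition solves ::
  "ereal \<Rightarrow> ereal \<Rightarrow> complex^'n^'n \<Rightarrow> (real set \<Rightarrow> complex^'n^'n) \<Rightarrow> (real set \<Rightarrow> complex^'n^'n) \<Rightarrow>
   (real \<Rightarrow> complex^'n) \<Rightarrow> (real \<Rightarrow> complex^'n) \<Rightarrow> bool" where
  "solves a b J q w u f \<longleftrightarrow>
     (\<exists>du. distr0 a b du \<and> antideriv a b u du \<and>
        (\<forall>E \<in> local_borel a b. J *v du E + qmult a b q u E = wmult a b w f E))"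

definition calTmax ::
  "ereal \<Rightarrow> ereal \<Rightarrow> complex^'n^'n \<Rightarrow> (real set \<Rightarrow> complex^'n^'n) \<Rightarrow> (real set \<Rightarrow> complex^'n^'n) \<Rightarrow>
   ((real \<Rightarrow> complex^'n) \<times> (real \<Rightarrow> complex^'n)) set" where
  "calTmax a b J q w =
     {(u, f) \<in> calL2 a b w \<times> calL2 a b w.
        BV_loc a b u \<and> balanced a b u \<and> solves a b J q w u f}"

definition Tmax ::
  "ereal \<Rightarrow> ereal \<Rightarrow> complex^'n^'n \<Rightarrow> (real set \<Rightarrow> complex^'n^'n) \<Rightarrow> (real set \<Rightarrow> complex^'n^'n) \<Rightarrow>
   'n l2pair set" where
  "Tmax a b J q w = {(cls a b w u, cls a b w f) | u f. (u, f) \<in> calTmax a b J q w}"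

definition Dspace ::
  "ereal \<Rightarrow> ereal \<Rightarrow> complex^'n^'n \<Rightarrow> (real set \<Rightarrow> complex^'n^'n) \<Rightarrow> (real set \<Rightarrow> complex^'n^'n) \<Rightarrow>
   complex \<Rightarrow> 'n l2pair set" where
  "Dspace a b J q w z = {(U, F) \<in> Tmax a b J q w. F = l2_scale a b w z U}"

definition Vspace ::
  "ereal \<Rightarrow> ereal \<Rightarrow> complex^'n^'n \<Rightarrow> (real set \<Rightarrow> complex^'n^'n) \<Rightarrow> (real set \<Rightarrow> complex^'n^'n) \<Rightarrow>
   'n l2pair set" where
  "Vspace a b J q w =
     {pair_add a b w X Y | X Y. X \<in> Dspace a b J q w \<i> \<and> Y \<in> Dspace a b J q w (- \<i>)}"

definition sa_restriction ::
  "ereal \<Rightarrow> ereal \<Rightarrow> complex^'n^'n \<Rightarrow> (real set \<Rightarrow> complex^'n^'n) \<Rightarrow> (real set \<Rightarrow> complex^'n^'n) \<Rightarrow>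
   'n l2pair set \<Rightarrow> bool" where
  "sa_restriction a b J q w T \<longleftrightarrow>
     linear_subspace a b w T \<and> T \<subseteq> Tmax a b J q w \<and> T = rel_adjoint a b w T"

text \<open>\<open>flip (v, g) = (g, - v)\<close>\<close>

definition flip ::
  "ereal \<Rightarrow> ereal \<Rightarrow> (real set \<Rightarrow> complex^'n^'n) \<Rightarrow> 'n l2pair \<Rightarrow> 'n l2pair" where
  "flip a b w X = (snd X, l2_scale a b w (- 1) (fst X))"

text \<open>
  \<open>balanced_rep\<close> is the balanced function \<open>u\<close> of some \<open>(u, f)\<close> which represents the given element
  of \<open>T\<^sub>m\<^sub>a\<^sub>x\<close> and satisfies \<open>J u' + q u = w f\<close>. The function \<open>u\<close> need not be unique, but
  \<open>boundary_form\<close> does not depend on the choice.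
\<close>

definition balanced_rep ::
  "ereal \<Rightarrow> ereal \<Rightarrow> complex^'n^'n \<Rightarrow> (real set \<Rightarrow> complex^'n^'n) \<Rightarrow> (real set \<Rightarrow> complex^'n^'n) \<Rightarrow>
   'n l2pair \<Rightarrow> real \<Rightarrow> complex^'n" where
  "balanced_rep a b J q w X =
     fst (SOME p. p \<in> calTmax a b J q w \<and> X = (cls a b w (fst p), cls a b w (snd p)))"

definition bracket_b ::
  "ereal \<Rightarrow> complex^'n^'n \<Rightarrow> (real \<Rightarrow> complex^'n) \<Rightarrow> (real \<Rightarrow> complex^'n) \<Rightarrow> complex" where
  "bracket_b b J r u =
     Lim (at_left b) (\<lambda>x. herm (left_lim r (real_of_ereal x)) (J *v left_lim u (real_of_ereal x)))"

definition bracket_a ::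
  "ereal \<Rightarrow> complex^'n^'n \<Rightarrow> (real \<Rightarrow> complex^'n) \<Rightarrow> (real \<Rightarrow> complex^'n) \<Rightarrow> complex" where
  "bracket_a a J r u =
     Lim (at_right a) (\<lambda>x. herm (right_lim r (real_of_ereal x)) (J *v right_lim u (real_of_ereal x)))"

definition boundary_form ::
  "ereal \<Rightarrow> ereal \<Rightarrow> complex^'n^'n \<Rightarrow> (real set \<Rightarrow> complex^'n^'n) \<Rightarrow> (real set \<Rightarrow> complex^'n^'n) \<Rightarrow>
   'n l2pair \<Rightarrow> 'n l2pair \<Rightarrow> complex" where
  "boundary_form a b J q w R X =
     bracket_b b J (balanced_rep a b J q w R) (balanced_rep a b J q w X) -
     bracket_a a J (balanced_rep a b J q w R) (balanced_rep a b J q w X)"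

end

theory Submission
  imports Defs "HOL-Library.Function_Algebras"
begin

text \<open>
  Integration by parts gives the Lagrange identity: for \<open>(u, f)\<close> and \<open>(v, g)\<close> in the maximal relation
  \<open>(v\<^sup>* J u)(b) - (v\<^sup>* J u)(a) = \<langle>v, f\<rangle> - \<langle>g, u\<rangle>\<close> (\<open>bracket_difference\<close>). Applied to \<open>(g, -v)\<close> in place of
  \<open>(v, g)\<close>, the boundary condition that an element \<open>(v, g)\<close> of \<open>V\<close> imposes on \<open>(u, f)\<close> reads
  \<open>\<langle>(v, g), (u, f)\<rangle> = 0\<close>. The theorem thereby becomes a statement about linear relations in a Hilbert space.

  Let \<open>rot (u, f) = (f, -u)\<close>, so that the adjoint of \<open>T\<close> consists of all \<open>x\<close> with \<open>rot x\<close> orthogonal to \<open>T\<close>. If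
  \<open>T\<^sub>m\<^sub>a\<^sub>x\<close> is the adjoint of the minimal relation and \<open>S\<close> is the adjoint of \<open>T\<^sub>m\<^sub>a\<^sub>x\<close>, then \<open>T\<^sub>m\<^sub>a\<^sub>x = S \<oplus> V\<close>, where
  \<open>V = D\<^sub>i \<oplus> D\<^sub>-\<^sub>i\<close> consists of the \<open>x\<close> in \<open>T\<^sub>m\<^sub>a\<^sub>x\<close> with \<open>rot x\<close> in \<open>T\<^sub>m\<^sub>a\<^sub>x\<close>, is invariant under \<open>rot\<close> and has dimension
  \<open>2 m\<close>. A self-adjoint \<open>T\<close> contains \<open>S\<close>, hence is determined by \<open>K = {x \<in> V. rot x \<in> T}\<close>. Self-adjointness of
  \<open>T\<close> means \<open>V = K \<oplus> rot K\<close> with orthogonal summands. So \<open>K\<close> has dimension \<open>m\<close>, its bases are the systems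
  \<open>(v\<^sub>j, g\<^sub>j)\<close> of the theorem, and \<open>T\<close> is the orthogonal complement of \<open>K\<close> in \<open>T\<^sub>m\<^sub>a\<^sub>x\<close> (\<open>self_adjoint_iff\<close>).

  Two analytic facts feed this argument. One is the completeness of \<open>L\<^sup>2(w)\<close> (\<open>L_complete\<close>). The other is that
  \<open>T\<^sub>m\<^sub>a\<^sub>x\<close> is the adjoint of the minimal relation (\<open>Tmax_rep_adjoint\<close>). A compactly supported \<open>f\<close> is the
  right-hand side of a compactly supported \<open>u\<close> as soon as it is orthogonal to the solutions of
  \<open>J h' + q h = 0\<close> (\<open>compact_solution\<close>). Suppose \<open>(v, g)\<close> is in the adjoint and \<open>J v\<^sub>1' + q v\<^sub>1 = w g\<close>. Then
  \<open>v - v\<^sub>1\<close> annihilates every such \<open>f\<close>. The solutions \<open>h\<close> form a space of finite dimension, so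
  \<open>v - v\<^sub>1\<close> differs from one of them by a function of norm zero, and the class of \<open>v\<close> has a representative
  that solves \<open>J v' + q v = w g\<close>.

  This needs unique global solvability of initial value problems (\<open>global_solution\<close>). All
  distributions have densities with respect to the sum \<open>M\<close> of the variation of \<open>q\<close> and the trace of \<open>w\<close>, and a
  balanced solution is a balanced primitive of such a density. The equation at an atom is solved by inverting
  \<open>2 J + \<Delta>\<^sub>q\<close>; what remains is a Volterra equation, which Picard iteration solves to the right of a given
  point. Values further to the right can also be prescribed, since by the Lagrange identity a
  fundamental matrix satisfies \<open>\<Phi>\<^sup>* J \<Phi> = J\<close> and is invertible.

  The elements of \<open>L\<^sup>2(w)\<close> are classes, whereas the equation is about functions. The geometry is therefore carried
  out for functions with a semi-inner product, where equality is replaced by distance zero, and is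
  transferred to classes at the end.
\<close>

section \<open>Borel sets with compact closure in the interval\<close>

locale open_interval =
  fixes a b :: ereal
  assumes a_less_b: "a < b"
begin

abbreviation I :: "real set" where "I \<equiv> einterval a b"
abbreviation LB :: "real set set" where "LB \<equiv> local_borel a b"

lemma LB_borel: "E \<in> LB \<Longrightarrow> E \<in> sets borel"
  by (simp add: local_borel_def)

lemma LB_subset_I: "E \<in> LB \<Longrightarrow> E \<subseteq> I"
  by (auto simp: local_borel_def einterval_def)
     (meson atLeastAtMost_iff ereal_less_eq(3) less_le_trans le_less_trans subsetD)+

lemma LB_mono: "E \<in> LB \<Longrightarrow> F \<in> sets borel \<Longrightarrow> F \<subseteq> E \<Longrightarrow> F \<in> LB"
  by (auto simp: local_borel_def)

lemma LB_Int: "E \<in> LB \<Longrightarrow> F \<in> sets borel \<Longrightarrow> E \<inter> F \<in> LB"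
  by (rule LB_mono[of E]) (auto dest: LB_borel)

lemma LB_Diff: "E \<in> LB \<Longrightarrow> F \<in> sets borel \<Longrightarrow> E - F \<in> LB"
  by (rule LB_mono[of E]) (auto dest: LB_borel)

lemma LB_Icc: "c \<in> I \<Longrightarrow> d \<in> I \<Longrightarrow> {c..d} \<in> LB"
  by (auto simp: local_borel_def einterval_def)

lemma LB_empty: "{} \<in> LB"
proof -
  obtain c where "a < ereal c" "ereal c < b" using ereal_dense2[OF a_less_b] by auto
  then show ?thesis by (auto simp: local_borel_def)
qed

lemma LB_Un: assumes "E \<in> LB" "F \<in> LB" shows "E \<union> F \<in> LB"
proof -
  obtain c d where 1: "a < ereal c" "ereal d < b" "E \<subseteq> {c..d}" using assms by (auto simp: local_borel_def)
  obtain c' d' where 2: "a < ereal c'" "ereal d' < b" "F \<subseteq> {c'..d'}" using assms by (auto simp: local_borel_def)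
  have "a < ereal (min c c')" "ereal (max d d') < b" "E \<union> F \<subseteq> {min c c'..max d d'}"
    using 1 2 by (auto simp: min_def max_def)
  then show ?thesis using assms unfolding local_borel_def by blast
qed

lemma LB_Union: "finite P \<Longrightarrow> P \<subseteq> LB \<Longrightarrow> \<Union>P \<in> LB"
  by (induction P rule: finite_induct) (auto intro: LB_empty LB_Un)

lemma LB_exhaustion:
  obtains K where "\<And>n::nat. K n \<in> LB" "incseq K" "(\<Union>n. K n) = I"
    "\<And>n. \<exists>c d. c \<in> I \<and> d \<in> I \<and> c < d \<and> K n = {c..d}"
proof -
  obtain u l :: "nat \<Rightarrow> real" where ul: "I = (\<Union>i. {l i .. u i})" "incseq u" "decseq l"
     "\<And>i. l i < u i" "\<And>i. a < l i" "\<And>i. u i < b"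
    by (rule einterval_Icc_approximation[OF a_less_b]) (rule that, assumption+)
  have lI: "l i \<in> I" "u i \<in> I" for i
    using ul(4-6)[of i] less_trans[of a "ereal (l i)" "ereal (u i)"] less_trans[of "ereal (l i)" "ereal (u i)" b]
    by (auto simp: einterval_def)
  show ?thesis
  proof
    show "{l n..u n} \<in> LB" for n using LB_Icc[OF lI] .
    show "incseq (\<lambda>n. {l n..u n})" using ul(2,3)
      by (intro monoI) (auto simp: incseq_def decseq_def intro: order_trans)
    show "(\<Union>n. {l n..u n}) = I" using ul(1) by (rule sym)
    show "\<exists>c d. c \<in> I \<and> d \<in> I \<and> c < d \<and> {l n..u n} = {c..d}" for n
      using lI ul(4) by blast
  qed
qed

lemma LB_in_sets: "E \<in> LB \<Longrightarrow> E \<in> sets (restrict_space borel I)"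
  using LB_subset_I LB_borel by (auto simp: sets_restrict_space_iff)

lemma sets_restrict_I: "E \<in> sets (restrict_space borel I) \<longleftrightarrow> E \<in> sets borel \<and> E \<subseteq> I"
  by (subst sets_restrict_space_iff) auto

section \<open>Additivity of distributions of order zero\<close>

lemma distr0_empty: assumes "distr0 a b \<mu>" shows "\<mu> {} = 0"
proof -
  have "(\<lambda>i::nat. \<mu> {}) sums \<mu> (\<Union>i::nat. {})"
    using assms[unfolded distr0_def, rule_format, of "\<lambda>_. {}"] LB_empty
    by (auto simp: disjoint_family_on_def)
  then have "(\<lambda>i::nat. \<mu> {}) \<longlonglongrightarrow> 0" using summable_LIMSEQ_zero sums_summable by blast
  then show ?thesis by (simp add: LIMSEQ_const_iff)
qed

lemma distr0_sums:
  assumes "distr0 a b \<mu>" "disjoint_family A" "\<And>i::nat. A i \<in> sets borel" "(\<Union>i. A i) \<in> LB"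
  shows "(\<lambda>i. \<mu> (A i)) sums \<mu> (\<Union>i. A i)"
  using assms unfolding distr0_def by blast

lemma distr0_Un:
  assumes "distr0 a b \<mu>" "E \<in> LB" "F \<in> LB" "E \<inter> F = {}"
  shows "\<mu> (E \<union> F) = \<mu> E + \<mu> F"
proof -
  have "(\<lambda>i. \<mu> (binaryset E F i)) sums \<mu> (\<Union>i. binaryset E F i)"
    using assms LB_borel
    by (intro distr0_sums) (auto simp: disjoint_family_on_def binaryset_def UN_binaryset_eq LB_Un)
  moreover have "(\<lambda>i. \<mu> (binaryset E F i)) sums (\<mu> E + \<mu> F)"
    using binaryset_sums[of \<mu> E F] distr0_empty[OF assms(1)] by simp
  ultimately show ?thesis using sums_unique2 by (simp add: UN_binaryset_eq) blast
qed

lemma distr0_Union: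
  assumes "distr0 a b \<mu>" "finite P" "disjoint P" "P \<subseteq> LB"
  shows "\<mu> (\<Union>P) = (\<Sum>A\<in>P. \<mu> A)"
  using assms(2-4)
proof (induction P rule: finite_induct)
  case empty then show ?case using distr0_empty[OF assms(1)] by simp
next
  case (insert A P)
  have "A \<inter> \<Union>P = {}" using insert by (auto simp: disjoint_def)
  then have "\<mu> (A \<union> \<Union>P) = \<mu> A + \<mu> (\<Union>P)"
    using insert by (intro distr0_Un[OF assms(1)] LB_Union) auto
  then show ?case using insert by (auto simp: pairwise_insert)
qed

lemma distr0_split:
  assumes "distr0 a b \<mu>" "E \<in> LB" "F \<in> LB" "F \<subseteq> E"
  shows "\<mu> E = \<mu> F + \<mu> (E - F)"
proof -
  have "E - F \<in> LB" by (rule LB_mono[OF assms(2)]) (use assms(2,3) LB_borel in auto)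
  moreover have "F \<union> (E - F) = E" using assms(4) by blast
  ultimately show ?thesis using distr0_Un[OF assms(1,3), of "E - F"] by simp
qed

lemma distr0_linear:
  assumes "distr0 a b \<mu>" "bounded_linear f"
  shows "distr0 a b (\<lambda>E. f (\<mu> E))"
  using assms unfolding distr0_def by (auto intro: bounded_linear.sums)

lemma distr0_add:
  assumes "distr0 a b \<mu>" "distr0 a b \<nu>"
  shows "distr0 a b (\<lambda>E. \<mu> E + \<nu> E)"
  using assms unfolding distr0_def by (auto intro: sums_add)

section \<open>Variation\<close>

text \<open>The set function used in \<open>variation\<close>, before it is known to be a measure.\<close>

definition tot_var :: "(real set \<Rightarrow> 'v::real_normed_vector) \<Rightarrow> real set \<Rightarrow> ennreal" where
  "tot_var \<mu> E = (SUP P \<in> {P. finite P \<and> disjoint P \<and> P \<subseteq> LB \<and> \<Union>P \<subseteq> E}.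
              \<Sum>A\<in>P. ennreal (norm (\<mu> A)))"

lemma tot_var_ge:
  assumes "finite P" "disjoint P" "P \<subseteq> LB" "\<Union>P \<subseteq> E"
  shows "(\<Sum>A\<in>P. ennreal (norm (\<mu> A))) \<le> tot_var \<mu> E"
  unfolding tot_var_def using assms by (intro SUP_upper) auto

lemma tot_var_mono: "E \<subseteq> F \<Longrightarrow> tot_var \<mu> E \<le> tot_var \<mu> F"
  unfolding tot_var_def by (intro SUP_subset_mono) auto

lemma tot_var_superadd:
  assumes "distr0 a b \<mu>" "E \<inter> F = {}"
  shows "tot_var \<mu> E + tot_var \<mu> F \<le> tot_var \<mu> (E \<union> F)"
proof -
  let ?S = "\<lambda>E. {P. finite P \<and> disjoint P \<and> P \<subseteq> LB \<and> \<Union>P \<subseteq> E}"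
  let ?s = "\<lambda>P. \<Sum>A\<in>P. ennreal (norm (\<mu> A))"
  have ne: "?S E \<noteq> {}" for E by (auto intro!: exI[of _ "{}"])
  have PQ: "?s P + ?s Q \<le> tot_var \<mu> (E \<union> F)" if P: "P \<in> ?S E" and Q: "Q \<in> ?S F" for P Q
  proof -
    have sub: "P \<inter> Q \<subseteq> {{}}" using assms(2) P Q by blast
    have "?s (P \<inter> Q) = 0" using sub distr0_empty[OF assms(1)]
      by (intro sum.neutral) auto
    then have "?s P + ?s Q = ?s (P \<union> Q)" using P Q by (subst sum.union_inter[symmetric]) auto
    also have "\<dots> \<le> tot_var \<mu> (E \<union> F)"
    proof (intro tot_var_ge)
      have "\<Union>P \<inter> \<Union>Q = {}" using P Q assms(2) by blast
      then show "disjoint (P \<union> Q)" using P Q by (intro disjoint_union) auto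
    qed (use P Q in auto)
    finally show ?thesis .
  qed
  have "tot_var \<mu> E + tot_var \<mu> F = (SUP P\<in>?S E. ?s P + tot_var \<mu> F)"
    unfolding tot_var_def[of \<mu> E] using ne by (subst ennreal_SUP_add_left) auto
  also have "\<dots> = (SUP P\<in>?S E. SUP Q\<in>?S F. ?s P + ?s Q)"
    unfolding tot_var_def[of \<mu> F] using ne by (subst ennreal_SUP_add_right) auto
  also have "\<dots> \<le> tot_var \<mu> (E \<union> F)" using PQ by (intro SUP_least) auto
  finally show ?thesis .
qed

lemma tot_var_empty: assumes "distr0 a b \<mu>" shows "tot_var \<mu> {} = 0"
proof -
  have "tot_var \<mu> {} \<le> 0" unfolding tot_var_def
  proof (intro SUP_least)
    fix P assume "P \<in> {P. finite P \<and> disjoint P \<and> P \<subseteq> LB \<and> \<Union> P \<subseteq> {}}"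
    then have "P \<subseteq> {{}}" by auto
    then show "(\<Sum>A\<in>P. ennreal (norm (\<mu> A))) \<le> 0"
      using distr0_empty[OF assms] by (subst sum.neutral) auto
  qed
  then show ?thesis by simp
qed

text \<open>
  Superadditivity follows by joining partitions. For the converse inequality each set \<open>A\<close> of a
  partition is cut along the sets \<open>E i\<close>, and \<open>|\<mu> A|\<close> is at most the sum over the pieces because \<open>\<mu>\<close> itself is
  countably additive.
\<close>

lemma tot_var_countably_additive:
  assumes d: "distr0 a b \<mu>"
  shows "countably_additive (sets (restrict_space borel I)) (tot_var \<mu>)"
  unfolding countably_additive_def
proof (intro allI impI)
  fix E :: "nat \<Rightarrow> real set"
  assume rE: "range E \<subseteq> sets (restrict_space borel I)" and dE: "disjoint_family E"
  have E: "E i \<in> sets borel" for i using rE sets_restrict_I by blast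
  have fin: "(\<Sum>i<n. tot_var \<mu> (E i)) \<le> tot_var \<mu> (\<Union>i<n. E i)" for n
  proof (induction n)
    case 0 then show ?case by simp
  next
    case (Suc n)
    have "(\<Sum>i<Suc n. tot_var \<mu> (E i)) \<le> tot_var \<mu> (\<Union>i<n. E i) + tot_var \<mu> (E n)"
      using Suc by (simp add: add_right_mono)
    also have "\<dots> \<le> tot_var \<mu> ((\<Union>i<n. E i) \<union> E n)"
    proof (rule tot_var_superadd[OF d])
      have "E i \<inter> E n = {}" if "i < n" for i
        using dE that by (simp add: disjoint_family_on_def)
      then show "(\<Union>i<n. E i) \<inter> E n = {}" by blast
    qed
    also have "(\<Union>i<n. E i) \<union> E n = (\<Union>i<Suc n. E i)" by (auto simp: less_Suc_eq)
    finally show ?case .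
  qed
  have "(\<Sum>i. tot_var \<mu> (E i)) \<le> tot_var \<mu> (\<Union>i. E i)"
    unfolding suminf_eq_SUP
    by (intro SUP_least order_trans[OF fin] tot_var_mono) auto
  moreover have "tot_var \<mu> (\<Union>i. E i) \<le> (\<Sum>i. tot_var \<mu> (E i))"
    unfolding tot_var_def[of \<mu> "\<Union>i. E i"]
  proof (intro SUP_least)
    fix P assume "P \<in> {P. finite P \<and> disjoint P \<and> P \<subseteq> LB \<and> \<Union> P \<subseteq> (\<Union>i. E i)}"
    then have P: "finite P" "disjoint P" "P \<subseteq> LB" "\<Union> P \<subseteq> (\<Union>i. E i)" by auto
    have AE: "A \<inter> E i \<in> LB" if "A \<in> P" for A i
      using P(3) that E[of i] by (intro LB_Int) auto
    have 1: "ennreal (norm (\<mu> A)) \<le> (\<Sum>i. ennreal (norm (\<mu> (A \<inter> E i))))" if A: "A \<in> P" for A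
    proof -
      have AU: "(\<Union>i. A \<inter> E i) = A" using P(4) A by auto
      have "(\<lambda>i. \<mu> (A \<inter> E i)) sums \<mu> (\<Union>i. A \<inter> E i)"
        using dE A P(3) AE[OF A] LB_borel AU
        by (intro distr0_sums[OF d]) (auto simp: disjoint_family_on_def)
      then have "(\<lambda>n. \<Sum>i<n. \<mu> (A \<inter> E i)) \<longlonglongrightarrow> \<mu> A" unfolding AU by (simp add: sums_def)
      then have lim: "(\<lambda>n. ennreal (norm (\<Sum>i<n. \<mu> (A \<inter> E i)))) \<longlonglongrightarrow> ennreal (norm (\<mu> A))"
        by (intro tendsto_ennrealI tendsto_norm)
      have "ennreal (norm (\<Sum>i<n. \<mu> (A \<inter> E i))) \<le> (\<Sum>i. ennreal (norm (\<mu> (A \<inter> E i))))" for n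
      proof -
        have "ennreal (norm (\<Sum>i<n. \<mu> (A \<inter> E i))) \<le> ennreal (\<Sum>i<n. norm (\<mu> (A \<inter> E i)))"
          by (intro ennreal_leI norm_sum)
        also have "\<dots> = (\<Sum>i<n. ennreal (norm (\<mu> (A \<inter> E i))))" by simp
        also have "\<dots> \<le> (\<Sum>i. ennreal (norm (\<mu> (A \<inter> E i))))" by (intro sum_le_suminf) auto
        finally show ?thesis .
      qed
      then show ?thesis by (intro LIMSEQ_le_const2[OF lim]) blast
    qed
    have 2: "(\<Sum>A\<in>P. ennreal (norm (\<mu> (A \<inter> E i)))) \<le> tot_var \<mu> (E i)" for i
    proof -
      have z: "ennreal (norm (\<mu> (A \<inter> E i))) = 0"
        if "A \<in> P" "B \<in> P" "A \<noteq> B" "A \<inter> E i = B \<inter> E i" for A B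
      proof -
        have "A \<inter> B = {}" using that P(2) by (auto simp: disjoint_def)
        then have "A \<inter> E i = {}" using that by blast
        then show ?thesis using distr0_empty[OF d] by simp
      qed
      have "(\<Sum>A\<in>P. ennreal (norm (\<mu> (A \<inter> E i)))) = (\<Sum>B\<in>(\<lambda>A. A \<inter> E i) ` P. ennreal (norm (\<mu> B)))"
        using z P(1) by (subst sum.reindex_nontrivial) (auto simp: o_def)
      also have "\<dots> \<le> tot_var \<mu> (E i)"
      proof (rule tot_var_ge)
        show "disjoint ((\<lambda>A. A \<inter> E i) ` P)" using P(2) unfolding disjoint_def by blast
      qed (use P AE in auto)
      finally show ?thesis .
    qed
    have "(\<Sum>A\<in>P. ennreal (norm (\<mu> A))) \<le> (\<Sum>A\<in>P. \<Sum>i. ennreal (norm (\<mu> (A \<inter> E i))))"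
      by (intro sum_mono 1)
    also have "\<dots> = (\<Sum>i. \<Sum>A\<in>P. ennreal (norm (\<mu> (A \<inter> E i))))"
      by (subst suminf_sum) auto
    also have "\<dots> \<le> (\<Sum>i. tot_var \<mu> (E i))" by (intro suminf_le 2) auto
    finally show "(\<Sum>A\<in>P. ennreal (norm (\<mu> A))) \<le> (\<Sum>i. tot_var \<mu> (E i))" .
  qed
  ultimately show "(\<Sum>i. tot_var \<mu> (E i)) = tot_var \<mu> (\<Union> (range E))" by (rule antisym)
qed

lemma sigma_sets_restrict_I:
  "sigma_sets I (sets (restrict_space borel I)) = sets (restrict_space borel I)"
  using sets.sigma_sets_eq[of "restrict_space borel I"] by (simp add: space_restrict_space)

lemma sets_variation [simp, measurable_cong]:
  "sets (variation a b \<mu>) = sets (restrict_space borel I)"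
  unfolding variation_def using sigma_sets_restrict_I
  by (subst sets_measure_of) (auto simp: sets_restrict_I)

lemma emeasure_variation:
  assumes "distr0 a b \<mu>" "E \<in> sets borel" "E \<subseteq> I"
  shows "emeasure (variation a b \<mu>) E = tot_var \<mu> E"
proof (rule emeasure_measure_of[OF variation_def[of a b \<mu>, folded tot_var_def]])
  show "positive (sets (variation a b \<mu>)) (tot_var \<mu>)"
    using tot_var_empty[OF assms(1)] by (simp add: positive_def)
  show "countably_additive (sets (variation a b \<mu>)) (tot_var \<mu>)"
    using tot_var_countably_additive[OF assms(1)] by simp
qed (use assms in \<open>auto simp: sets_restrict_I\<close>)

text \<open>
  Every partition sum of a nonnegative \<open>\<tau>\<close> equals \<open>\<tau>\<close> of the union. This lets \<open>variation\<close>
  turn nonnegative distributions such as \<open>tr w\<close> into measures.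
\<close>

lemma emeasure_variation_nonneg:
  fixes \<tau> :: "real set \<Rightarrow> real"
  assumes d: "distr0 a b \<tau>" and pos: "\<And>E. E \<in> LB \<Longrightarrow> 0 \<le> \<tau> E" and E: "E \<in> LB"
  shows "emeasure (variation a b \<tau>) E = ennreal (\<tau> E)"
proof -
  have "tot_var \<tau> E \<le> ennreal (\<tau> E)" unfolding tot_var_def
  proof (intro SUP_least)
    fix P assume "P \<in> {P. finite P \<and> disjoint P \<and> P \<subseteq> LB \<and> \<Union> P \<subseteq> E}"
    then have P: "finite P" "disjoint P" "P \<subseteq> LB" "\<Union> P \<subseteq> E" by auto
    have "(\<Sum>A\<in>P. ennreal (norm (\<tau> A))) = (\<Sum>A\<in>P. ennreal (\<tau> A))"
      using pos P(3) by (intro sum.cong) auto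
    also have "\<dots> = ennreal (\<Sum>A\<in>P. \<tau> A)"
      using pos P(3) by (intro sum_ennreal) auto
    also have "\<dots> = ennreal (\<tau> (\<Union>P))" by (subst distr0_Union[OF d]) (use P in auto)
    also have "\<dots> \<le> ennreal (\<tau> E)"
      using distr0_split[OF d E LB_Union[OF P(1,3)] P(4)] pos[of "E - \<Union>P"]
        LB_Diff[OF E LB_borel[OF LB_Union[OF P(1,3)]]]
      by (intro ennreal_leI) auto
    finally show "(\<Sum>A\<in>P. ennreal (norm (\<tau> A))) \<le> ennreal (\<tau> E)" .
  qed
  moreover have "ennreal (\<tau> E) \<le> tot_var \<tau> E"
    using tot_var_ge[of "{E}" E \<tau>] pos[OF E] E by (auto simp: disjoint_def)
  ultimately show ?thesis using emeasure_variation[OF d LB_borel[OF E] LB_subset_I[OF E]] by simp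
qed

lemma norm_le_emeasure_variation:
  assumes d: "distr0 a b \<mu>" and E: "E \<in> LB"
  shows "ennreal (norm (\<mu> E)) \<le> emeasure (variation a b \<mu>) E"
  using tot_var_ge[of "{E}" E \<mu>] E emeasure_variation[OF d LB_borel[OF E] LB_subset_I[OF E]]
  by (auto simp: disjoint_def)

text \<open>
  One step in the proof that the variation is locally finite. A partition with a huge sum
  contains, on its positive or on its negative part, a set \<open>B\<close> with \<open>|\<tau> B|\<close> huge; then \<open>|\<tau> (E - B)|\<close> is large
  as well, and one of \<open>B\<close>, \<open>E - B\<close> still carries infinite variation.
\<close>

lemma tot_var_real_large:
  fixes \<tau> :: "real set \<Rightarrow> real"
  assumes d: "distr0 a b \<tau>" and E: "E \<in> LB" and inf: "tot_var \<tau> E = \<infinity>"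
  shows "\<exists>A\<in>LB. A \<subseteq> E \<and> 1 < \<bar>\<tau> A\<bar> \<and> tot_var \<tau> (E - A) = \<infinity>"
proof -
  \<comment> \<open>Half of \<open>t\<close> exceeds \<open>|\<tau> E| + 1\<close>, so that \<open>B\<close> and its complement in \<open>E\<close> both have measure above 1.\<close>
  define t where "t = 2 * (2 + \<bar>\<tau> E\<bar>)"
  have t0: "0 \<le> t" by (simp add: t_def)
  have "ennreal t < tot_var \<tau> E" using inf by simp
  then obtain P where P: "finite P" "disjoint P" "P \<subseteq> LB" "\<Union> P \<subseteq> E"
    and tP: "ennreal t < (\<Sum>A\<in>P. ennreal (norm (\<tau> A)))"
    unfolding tot_var_def less_SUP_iff by auto
  have tP': "t < (\<Sum>A\<in>P. \<bar>\<tau> A\<bar>)"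
    using tP t0 by (simp add: ennreal_less_iff)
  define Pp where "Pp = {A\<in>P. 0 \<le> \<tau> A}"
  define Pm where "Pm = {A\<in>P. \<tau> A < 0}"
  have sub: "finite Pp" "finite Pm" "disjoint Pp" "disjoint Pm" "Pp \<subseteq> LB" "Pm \<subseteq> LB"
    "\<Union>Pp \<subseteq> E" "\<Union>Pm \<subseteq> E" "P = Pp \<union> Pm" "Pp \<inter> Pm = {}"
    using P by (auto simp: Pp_def Pm_def disjoint_def)
  have "(\<Sum>A\<in>P. \<bar>\<tau> A\<bar>) = (\<Sum>A\<in>Pp. \<bar>\<tau> A\<bar>) + (\<Sum>A\<in>Pm. \<bar>\<tau> A\<bar>)"
    using sub by (simp add: sum.union_disjoint)
  also have "\<dots> = (\<Sum>A\<in>Pp. \<tau> A) + (\<Sum>A\<in>Pm. - \<tau> A)"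
    by (intro arg_cong2[of _ _ _ _ "(+)"] sum.cong) (auto simp: Pp_def Pm_def)
  also have "\<dots> = \<tau> (\<Union>Pp) - \<tau> (\<Union>Pm)"
    using sub by (simp add: distr0_Union[OF d] sum_negf)
  finally have "t < \<tau> (\<Union>Pp) - \<tau> (\<Union>Pm)" using tP' by simp
  then obtain B where B: "B \<in> LB" "B \<subseteq> E" "t / 2 < \<bar>\<tau> B\<bar>"
  proof (cases "t / 2 < \<bar>\<tau> (\<Union>Pp)\<bar>")
    case True then show ?thesis using that[of "\<Union>Pp"] sub LB_Union by auto
  next
    case False
    then have "t / 2 < \<bar>\<tau> (\<Union>Pm)\<bar>" using \<open>t < \<tau> (\<Union>Pp) - \<tau> (\<Union>Pm)\<close> by linarith
    then show ?thesis using that[of "\<Union>Pm"] sub LB_Union by auto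
  qed
  have EB: "E - B \<in> LB" by (rule LB_Diff[OF E LB_borel[OF B(1)]])
  have *: "\<tau> E = \<tau> B + \<tau> (E - B)" by (rule distr0_split[OF d E B(1,2)])
  have big: "1 < \<bar>\<tau> B\<bar>" "1 < \<bar>\<tau> (E - B)\<bar>"
  proof -
    have "2 + \<bar>\<tau> E\<bar> < \<bar>\<tau> B\<bar>" using B(3) by (simp add: t_def)
    then show "1 < \<bar>\<tau> B\<bar>" "1 < \<bar>\<tau> (E - B)\<bar>" using * by linarith+
  qed
  have eV: "emeasure (variation a b \<tau>) X = tot_var \<tau> X" if "X \<in> LB" for X
    using emeasure_variation[OF d LB_borel[OF that] LB_subset_I[OF that]] .
  have "emeasure (variation a b \<tau>) E = emeasure (variation a b \<tau>) B + emeasure (variation a b \<tau>) (E - B)"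
    using plus_emeasure[of B "variation a b \<tau>" "E - B"] LB_in_sets[OF B(1)] LB_in_sets[OF EB] B(2)
    by (simp add: Un_absorb1)
  then have "tot_var \<tau> B = \<infinity> \<or> tot_var \<tau> (E - B) = \<infinity>"
    using eV[OF B(1)] eV[OF EB] eV[OF E] inf ennreal_add_eq_top by (metis infinity_ennreal_def)
  then show ?thesis
  proof
    assume "tot_var \<tau> B = \<infinity>"
    moreover have "E - (E - B) = B" using B by auto
    ultimately show ?thesis using EB big by (intro bexI[of _ "E - B"]) auto
  next
    assume "tot_var \<tau> (E - B) = \<infinity>" then show ?thesis using B big by auto
  qed
qed

text \<open>
  Otherwise infinitely many disjoint sets with \<open>|\<tau>| > 1\<close> could be split off one after the other,
  and the series of their measures would not converge.
\<close>

lemma tot_var_real_finite: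
  fixes \<tau> :: "real set \<Rightarrow> real"
  assumes d: "distr0 a b \<tau>" and E: "E \<in> LB"
  shows "tot_var \<tau> E < \<infinity>"
proof (rule ccontr)
  assume "\<not> tot_var \<tau> E < \<infinity>"
  then have inf: "tot_var \<tau> E = \<infinity>" by (simp add: less_top[symmetric])
  define bad where "bad = {F. F \<in> LB \<and> tot_var \<tau> F = \<infinity>}"
  define pick where "pick F = (SOME A. A \<in> LB \<and> A \<subseteq> F \<and> 1 < \<bar>\<tau> A\<bar> \<and> tot_var \<tau> (F - A) = \<infinity>)" for F
  have pick: "pick F \<in> LB" "pick F \<subseteq> F" "1 < \<bar>\<tau> (pick F)\<bar>" "tot_var \<tau> (F - pick F) = \<infinity>" if "F \<in> bad" for F
  proof -
    have "\<exists>A. A \<in> LB \<and> A \<subseteq> F \<and> 1 < \<bar>\<tau> A\<bar> \<and> tot_var \<tau> (F - A) = \<infinity>"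
      using tot_var_real_large[OF d, of F] that by (auto simp: bad_def)
    from someI_ex[OF this] show "pick F \<in> LB" "pick F \<subseteq> F" "1 < \<bar>\<tau> (pick F)\<bar>" "tot_var \<tau> (F - pick F) = \<infinity>"
      unfolding pick_def by blast+
  qed
  define F where "F n = ((\<lambda>F. F - pick F) ^^ n) E" for n
  have F0: "F 0 = E" and FS: "F (Suc n) = F n - pick (F n)" for n by (auto simp: F_def)
  have Fbad: "F n \<in> bad" for n
  proof (induction n)
    case 0 then show ?case using E inf F0 by (simp add: bad_def)
  next
    case (Suc n)
    have "F n - pick (F n) \<in> LB"
      using Suc pick(1)[OF Suc] by (intro LB_Diff) (auto simp: bad_def dest: LB_borel)
    then show ?case using pick[OF Suc] FS by (simp add: bad_def)
  qed
  have dec: "F (n + k) \<subseteq> F n" for n k by (induction k) (auto simp: FS)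
  have disj: "pick (F m) \<inter> pick (F n) = {}" if "m < n" for m n
  proof -
    have "pick (F n) \<subseteq> F (Suc m)" using pick(2)[OF Fbad] dec[of "Suc m" "n - Suc m"] that by force
    then show ?thesis using FS[of m] by auto
  qed
  have "(\<lambda>i. \<tau> (pick (F i))) sums \<tau> (\<Union>i. pick (F i))"
  proof (rule distr0_sums[OF d])
    show "disjoint_family (\<lambda>i. pick (F i))" unfolding disjoint_family_on_def
      using disj by (metis Int_commute linorder_neqE_nat)
    show "pick (F i) \<in> sets borel" for i using pick(1)[OF Fbad] LB_borel by blast
    have "pick (F i) \<subseteq> E" for i using pick(2)[OF Fbad, of i] dec[of 0 i] F0 by auto
    then show "(\<Union>i. pick (F i)) \<in> LB"
      by (intro LB_mono[OF E]) (auto intro: LB_borel pick(1)[OF Fbad])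
  qed
  then have "(\<lambda>i. \<tau> (pick (F i))) \<longlonglongrightarrow> 0" using summable_LIMSEQ_zero sums_summable by blast
  then have "eventually (\<lambda>i. \<bar>\<tau> (pick (F i))\<bar> < 1) sequentially"
    using order_tendstoD(2)[OF tendsto_rabs[of _ 0], of _ _ 1] by auto
  then obtain i where "\<bar>\<tau> (pick (F i))\<bar> < 1" using eventually_happens by force
  then show False using pick(3)[OF Fbad, of i] by simp
qed

lemma emeasure_variation_finite:
  fixes \<mu> :: "real set \<Rightarrow> 'v::euclidean_space"
  assumes d: "distr0 a b \<mu>" and E: "E \<in> LB"
  shows "emeasure (variation a b \<mu>) E < \<infinity>"
proof -
  have d': "distr0 a b (\<lambda>A. \<mu> A \<bullet> i)" for i
    by (rule distr0_linear[OF d bounded_linear_inner_left])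
  have "tot_var \<mu> E \<le> (\<Sum>i\<in>Basis. tot_var (\<lambda>A. \<mu> A \<bullet> i) E)"
    unfolding tot_var_def[of \<mu>]
  proof (intro SUP_least)
    fix P assume "P \<in> {P. finite P \<and> disjoint P \<and> P \<subseteq> LB \<and> \<Union> P \<subseteq> E}"
    then have P: "finite P" "disjoint P" "P \<subseteq> LB" "\<Union> P \<subseteq> E" by auto
    have "(\<Sum>A\<in>P. ennreal (norm (\<mu> A))) \<le> (\<Sum>A\<in>P. \<Sum>i\<in>Basis. ennreal (norm (\<mu> A \<bullet> i)))"
    proof (intro sum_mono)
      fix A
      have "ennreal (norm (\<mu> A)) \<le> ennreal (\<Sum>i\<in>Basis. \<bar>\<mu> A \<bullet> i\<bar>)"
        by (intro ennreal_leI norm_le_l1)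
      then show "ennreal (norm (\<mu> A)) \<le> (\<Sum>i\<in>Basis. ennreal (norm (\<mu> A \<bullet> i)))" by simp
    qed
    also have "\<dots> = (\<Sum>i\<in>Basis. \<Sum>A\<in>P. ennreal (norm (\<mu> A \<bullet> i)))" by (rule sum.swap)
    also have "\<dots> \<le> (\<Sum>i\<in>Basis. tot_var (\<lambda>A. \<mu> A \<bullet> i) E)"
      by (intro sum_mono tot_var_ge P)
    finally show "(\<Sum>A\<in>P. ennreal (norm (\<mu> A))) \<le> (\<Sum>i\<in>Basis. tot_var (\<lambda>A. \<mu> A \<bullet> i) E)" .
  qed
  also have "\<dots> < \<infinity>" using tot_var_real_finite[OF d' E] by (auto simp: ennreal_sum_less_top)
  finally show ?thesis using emeasure_variation[OF d LB_borel[OF E] LB_subset_I[OF E]] by simp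
qed

end

section \<open>Semi-inner product spaces\<close>

text \<open>
  A homogeneous system with more unknowns than equations, by elimination. It replaces dimension theory
  for the spaces below, in which linear independence is only considered up to vectors of norm zero.
\<close>

lemma homogeneous_system_nontrivial:
  fixes c :: "'i \<Rightarrow> 'j \<Rightarrow> complex"
  assumes "finite B" "finite A" "card B < card A"
  shows "\<exists>\<alpha>. (\<exists>i\<in>A. \<alpha> i \<noteq> 0) \<and> (\<forall>j\<in>B. (\<Sum>i\<in>A. \<alpha> i * c i j) = 0)"
  using assms
proof (induction B arbitrary: A c rule: finite_induct)
  case empty
  then obtain i where "i \<in> A" by fastforce
  then show ?case by (intro exI[of _ "\<lambda>_. 1"]) auto
next
  case (insert b B)
  show ?case
  proof (cases "\<forall>i\<in>A. c i b = 0")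
    case True
    obtain \<alpha> where "\<exists>i\<in>A. \<alpha> i \<noteq> 0" "\<forall>j\<in>B. (\<Sum>i\<in>A. \<alpha> i * c i j) = 0"
      using insert.IH[of A c] insert.prems insert.hyps by auto
    then show ?thesis using True by (intro exI[of _ \<alpha>]) auto
  next
    case False
    then obtain p where p: "p \<in> A" "c p b \<noteq> 0" by auto
    \<comment> \<open>Eliminate the unknown with index \<open>p\<close> by means of equation \<open>b\<close>.\<close>
    define d where "d i j = c i j - c i b / c p b * c p j" for i j
    have "card B < card (A - {p})" using insert.prems insert.hyps p by auto
    then obtain \<alpha> where \<alpha>: "\<exists>i\<in>A - {p}. \<alpha> i \<noteq> 0" "\<forall>j\<in>B. (\<Sum>i\<in>A - {p}. \<alpha> i * d i j) = 0"
      using insert.IH[of "A - {p}" d] insert.prems by auto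
    define \<beta> where "\<beta> i = (if i = p then - (\<Sum>i\<in>A - {p}. \<alpha> i * c i b) / c p b else \<alpha> i)" for i
    have split: "(\<Sum>i\<in>A. \<beta> i * c i j) = \<beta> p * c p j + (\<Sum>i\<in>A - {p}. \<alpha> i * c i j)" for j
      using insert.prems(1) p(1) by (subst sum.remove[of A p]) (auto simp: \<beta>_def intro!: sum.cong)
    have "(\<Sum>i\<in>A. \<beta> i * c i b) = 0" unfolding split using p by (simp add: \<beta>_def)
    moreover have "(\<Sum>i\<in>A. \<beta> i * c i j) = 0" if "j \<in> B" for j
    proof -
      have "(\<Sum>i\<in>A - {p}. \<alpha> i * d i j) =
          (\<Sum>i\<in>A - {p}. \<alpha> i * c i j) - (\<Sum>i\<in>A - {p}. \<alpha> i * c i b) / c p b * c p j"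
      proof -
        have *: "\<alpha> i * d i j = \<alpha> i * c i j - (\<alpha> i * c i b) * (c p j / c p b)" for i
          by (simp add: d_def right_diff_distrib)
        have "(\<Sum>i\<in>A - {p}. \<alpha> i * d i j) =
            (\<Sum>i\<in>A - {p}. \<alpha> i * c i j) - (\<Sum>i\<in>A - {p}. \<alpha> i * c i b) * (c p j / c p b)"
          by (simp only: * sum_subtractf sum_distrib_right)
        then show ?thesis by simp
      qed
      then show ?thesis unfolding split using \<alpha>(2) that by (simp add: \<beta>_def)
    qed
    moreover have "\<exists>i\<in>A. \<beta> i \<noteq> 0" using \<alpha>(1) by (auto simp: \<beta>_def)
    ultimately show ?thesis by (intro exI[of _ \<beta>]) auto
  qed
qed

text \<open>
  The space is a subset \<open>H\<close> of a vector space because square integrable functions form a subspace of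
  the type of all functions. The form may vanish on nonzero vectors; distance zero plays the part of equality.
\<close>

locale semi_inner_space = vector_space scale
  for scale :: "complex \<Rightarrow> 'v::ab_group_add \<Rightarrow> 'v" (infixr "*c" 75) +
  fixes H :: "'v set" and ip :: "'v \<Rightarrow> 'v \<Rightarrow> complex"
  assumes H_subspace: "subspace H"
    and ip_add: "\<And>x y z. x \<in> H \<Longrightarrow> y \<in> H \<Longrightarrow> z \<in> H \<Longrightarrow> ip x (y + z) = ip x y + ip x z"
    and ip_scale: "\<And>x y c. x \<in> H \<Longrightarrow> y \<in> H \<Longrightarrow> ip x (c *c y) = c * ip x y"
    and ip_cnj: "\<And>x y. x \<in> H \<Longrightarrow> y \<in> H \<Longrightarrow> ip y x = cnj (ip x y)"
    and ip_pos: "\<And>x. x \<in> H \<Longrightarrow> 0 \<le> Re (ip x x)"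
begin

lemma H_add [simp, intro]: "x \<in> H \<Longrightarrow> y \<in> H \<Longrightarrow> x + y \<in> H"
  and H_scale [simp, intro]: "x \<in> H \<Longrightarrow> c *c x \<in> H"
  and H_0 [simp, intro]: "0 \<in> H"
  and H_diff [simp, intro]: "x \<in> H \<Longrightarrow> y \<in> H \<Longrightarrow> x - y \<in> H"
  and H_minus [simp, intro]: "x \<in> H \<Longrightarrow> - x \<in> H"
  using H_subspace by (auto simp: subspace_add subspace_scale subspace_0 subspace_diff subspace_neg)

lemma H_sum [intro]: "(\<And>i. i \<in> A \<Longrightarrow> f i \<in> H) \<Longrightarrow> sum f A \<in> H"
  using H_subspace by (rule subspace_sum)

lemma ip_add_left: "x \<in> H \<Longrightarrow> y \<in> H \<Longrightarrow> z \<in> H \<Longrightarrow> ip (x + y) z = ip x z + ip y z"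
  using ip_cnj[of z "x + y"] ip_cnj[of z x] ip_cnj[of z y] ip_add[of z x y] by simp

lemma ip_scale_left: "x \<in> H \<Longrightarrow> y \<in> H \<Longrightarrow> ip (c *c x) y = cnj c * ip x y"
  using ip_cnj[of y "c *c x"] ip_cnj[of y x] ip_scale[of y x c] by simp

lemma ip_minus: "x \<in> H \<Longrightarrow> y \<in> H \<Longrightarrow> ip x (- y) = - ip x y"
  using ip_scale[of x y "- 1"] by (simp add: scale_minus_left)

lemma ip_minus_left: "x \<in> H \<Longrightarrow> y \<in> H \<Longrightarrow> ip (- x) y = - ip x y"
  using ip_scale_left[of x y "- 1"] by (simp add: scale_minus_left)

lemma ip_diff: "x \<in> H \<Longrightarrow> y \<in> H \<Longrightarrow> z \<in> H \<Longrightarrow> ip x (y - z) = ip x y - ip x z"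
  using ip_add[of x y "- z"] ip_minus[of x z] by simp

lemma ip_diff_left: "x \<in> H \<Longrightarrow> y \<in> H \<Longrightarrow> z \<in> H \<Longrightarrow> ip (x - y) z = ip x z - ip y z"
  using ip_add_left[of x "- y" z] ip_minus_left[of y z] by simp

lemma ip_zero [simp]: "x \<in> H \<Longrightarrow> ip x 0 = 0" "x \<in> H \<Longrightarrow> ip 0 x = 0"
  using ip_diff[of x 0 0] ip_diff_left[of 0 0 x] by auto

lemma ip_sum: "x \<in> H \<Longrightarrow> (\<And>i. i \<in> A \<Longrightarrow> f i \<in> H) \<Longrightarrow> ip x (sum f A) = (\<Sum>i\<in>A. ip x (f i))"
  by (induction A rule: infinite_finite_induct) (auto simp: ip_add H_sum)

lemma ip_sum_left: "x \<in> H \<Longrightarrow> (\<And>i. i \<in> A \<Longrightarrow> f i \<in> H) \<Longrightarrow> ip (sum f A) x = (\<Sum>i\<in>A. ip (f i) x)"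
  by (induction A rule: infinite_finite_induct) (auto simp: ip_add_left H_sum)

lemma ip_real: "x \<in> H \<Longrightarrow> ip x x = of_real (Re (ip x x))"
  using ip_cnj[of x x] by (simp add: complex_eq_iff)

lemma ip_swap_zero: "x \<in> H \<Longrightarrow> y \<in> H \<Longrightarrow> ip x y = 0 \<longleftrightarrow> ip y x = 0"
  using ip_cnj[of x y] by auto

definition nrm :: "'v \<Rightarrow> real" where "nrm x = sqrt (Re (ip x x))"

lemma nrm_nonneg [simp]: "x \<in> H \<Longrightarrow> 0 \<le> nrm x"
  by (simp add: nrm_def ip_pos)

lemma nrm_sq: "x \<in> H \<Longrightarrow> (nrm x)\<^sup>2 = Re (ip x x)"
  by (simp add: nrm_def ip_pos)

lemma ip_self: "x \<in> H \<Longrightarrow> ip x x = of_real ((nrm x)\<^sup>2)"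
  using ip_real nrm_sq by metis

lemma Re_ip_diff:
  assumes "x \<in> H" "y \<in> H"
  shows "Re (ip (x - c *c y) (x - c *c y)) = Re (ip x x) - 2 * Re (c * ip x y) + (cmod c)\<^sup>2 * Re (ip y y)"
proof -
  have "ip (x - c *c y) (x - c *c y) = ip x x - c * ip x y - cnj c * ip y x + (c * cnj c) * ip y y"
    using assms by (simp add: ip_diff ip_diff_left ip_scale ip_scale_left algebra_simps)
  moreover have "cnj c * ip y x = cnj (c * ip x y)" using ip_cnj[of x y] assms by simp
  moreover have "c * cnj c = of_real ((cmod c)\<^sup>2)" by (rule complex_norm_square[symmetric])
  ultimately have "ip (x - c *c y) (x - c *c y)
      = ip x x - c * ip x y - cnj (c * ip x y) + of_real ((cmod c)\<^sup>2) * ip y y" by (simp only:)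
  then show ?thesis by (simp del: of_real_power)
qed

text \<open>The variational argument for projections: the linear term dominates for small \<open>t\<close>.\<close>

lemma quadratic_nonneg_imp_zero:
  fixes s r :: real
  assumes "\<And>t. t > 0 \<Longrightarrow> 0 \<le> - (2 * t * s) + t\<^sup>2 * r" "0 \<le> s"
  shows "s = 0"
proof (rule ccontr)
  assume "s \<noteq> 0"
  then have s: "s > 0" using assms by simp
  \<comment> \<open>With this \<open>t\<close> the quadratic term is at most half of the linear one.\<close>
  define t where "t = s / (\<bar>r\<bar> + 1)"
  have t: "t > 0" using s by (simp add: t_def)
  have "2 * s \<le> t * r"
  proof -
    have "t\<^sup>2 * r = t * (t * r)" "2 * t * s = t * (2 * s)" by (simp_all add: power2_eq_square)
    then have "t * (2 * s) \<le> t * (t * r)" using assms(1)[OF t] by linarith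
    then show ?thesis by (rule mult_left_le_imp_le) (rule t)
  qed
  also have "t * r \<le> t * (\<bar>r\<bar> + 1)" using t by (intro mult_left_mono) auto
  also have "\<dots> = s" by (simp add: t_def)
  finally show False using s by simp
qed

lemma cauchy_schwarz_sq:
  assumes "x \<in> H" "y \<in> H"
  shows "(cmod (ip x y))\<^sup>2 \<le> Re (ip x x) * Re (ip y y)"
proof -
  define s where "s = ip x y"
  define p where "p = Re (ip x x)"
  define r where "r = Re (ip y y)"
  have pr: "0 \<le> p" "0 \<le> r" using assms by (auto simp: p_def r_def ip_pos)
  have main: "0 \<le> p - 2 * t * (cmod s)\<^sup>2 + t\<^sup>2 * (cmod s)\<^sup>2 * r" for t :: real
  proof -
    have "0 \<le> Re (ip (x - (of_real t * cnj s) *c y) (x - (of_real t * cnj s) *c y))"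
      using assms by (intro ip_pos) auto
    also have "\<dots> = p - 2 * Re (of_real t * cnj s * s) + (cmod (of_real t * cnj s))\<^sup>2 * r"
      using Re_ip_diff[OF assms, of "of_real t * cnj s"] by (simp add: s_def p_def r_def)
    also have "Re (of_real t * cnj s * s) = t * (cmod s)\<^sup>2"
      unfolding cmod_power2 by (simp add: power2_eq_square algebra_simps)
    also have "(cmod (of_real t * cnj s))\<^sup>2 = t\<^sup>2 * (cmod s)\<^sup>2"
      by (simp add: norm_mult power_mult_distrib)
    finally show ?thesis by (simp add: mult.assoc)
  qed
  show ?thesis
  proof (cases "r = 0")
    case True
    have "(cmod s)\<^sup>2 = 0"
    proof (rule ccontr)
      assume ne: "(cmod s)\<^sup>2 \<noteq> 0"
      then have "0 \<le> p - 2 * ((p + 1) / (cmod s)\<^sup>2) * (cmod s)\<^sup>2"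
        \<comment> \<open>Any \<open>t\<close> above \<open>p / (2 |s|\<^sup>2)\<close> makes the form negative.\<close>
        using main[of "(p + 1) / (cmod s)\<^sup>2"] True by simp
      then show False using ne pr by simp
    qed
    then show ?thesis using pr True by (simp add: s_def p_def r_def)
  next
    case False
    then have "r > 0" using pr by simp
    then have "0 \<le> p - (cmod s)\<^sup>2 / r" using main[of "1 / r"] by (simp add: power2_eq_square field_simps)
    then show ?thesis using \<open>r > 0\<close> by (simp add: s_def[symmetric] p_def[symmetric] r_def[symmetric] field_simps)
  qed
qed

lemma cauchy_schwarz: "x \<in> H \<Longrightarrow> y \<in> H \<Longrightarrow> cmod (ip x y) \<le> nrm x * nrm y"
  by (rule power2_le_imp_le) (use cauchy_schwarz_sq[of x y] in \<open>auto simp: power_mult_distrib nrm_sq\<close>)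

lemma null_ip: "x \<in> H \<Longrightarrow> y \<in> H \<Longrightarrow> nrm x = 0 \<Longrightarrow> ip x y = 0" "x \<in> H \<Longrightarrow> y \<in> H \<Longrightarrow> nrm x = 0 \<Longrightarrow> ip y x = 0"
  using cauchy_schwarz[of x y] cauchy_schwarz[of y x] by auto

lemma nrm_triangle: assumes "x \<in> H" "y \<in> H" shows "nrm (x + y) \<le> nrm x + nrm y"
proof (rule power2_le_imp_le)
  have "(nrm (x + y))\<^sup>2 = Re (ip x x) + Re (ip y y) + 2 * Re (ip x y)"
    using assms ip_cnj[of x y] by (simp add: nrm_sq ip_add ip_add_left)
  also have "\<dots> \<le> (nrm x)\<^sup>2 + (nrm y)\<^sup>2 + 2 * (nrm x * nrm y)"
    using cauchy_schwarz[OF assms] complex_Re_le_cmod[of "ip x y"] assms by (simp add: nrm_sq)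
  finally show "(nrm (x + y))\<^sup>2 \<le> (nrm x + nrm y)\<^sup>2" by (simp add: power2_sum)
qed (use assms in auto)

lemma nrm_scale: "x \<in> H \<Longrightarrow> nrm (c *c x) = cmod c * nrm x"
proof -
  assume x: "x \<in> H"
  have "ip (c *c x) (c *c x) = of_real ((cmod c)\<^sup>2) * ip x x"
    using x complex_norm_square[of c] by (simp add: ip_scale ip_scale_left algebra_simps)
  then show ?thesis by (simp add: nrm_def real_sqrt_mult del: of_real_power)
qed

lemma nrm_minus: "x \<in> H \<Longrightarrow> nrm (- x) = nrm x"
  by (simp add: nrm_def ip_minus ip_minus_left)

lemma nrm_diff_commute: "x \<in> H \<Longrightarrow> y \<in> H \<Longrightarrow> nrm (x - y) = nrm (y - x)"
  using nrm_minus[of "x - y"] by simp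

lemma nrm_triangle_diff: "x \<in> H \<Longrightarrow> y \<in> H \<Longrightarrow> z \<in> H \<Longrightarrow> nrm (x - z) \<le> nrm (x - y) + nrm (y - z)"
  using nrm_triangle[of "x - y" "y - z"] by simp

lemma nrm_0 [simp]: "nrm 0 = 0" by (simp add: nrm_def)

lemma null_add: "x \<in> H \<Longrightarrow> y \<in> H \<Longrightarrow> nrm x = 0 \<Longrightarrow> nrm y = 0 \<Longrightarrow> nrm (x + y) = 0"
  using nrm_triangle[of x y] nrm_nonneg[of "x + y"] by (simp add: antisym)

lemma null_congr: "x \<in> H \<Longrightarrow> y \<in> H \<Longrightarrow> z \<in> H \<Longrightarrow> nrm (x - y) = 0 \<Longrightarrow> ip z x = ip z y"
  "x \<in> H \<Longrightarrow> y \<in> H \<Longrightarrow> z \<in> H \<Longrightarrow> nrm (x - y) = 0 \<Longrightarrow> ip x z = ip y z"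
  using null_ip[of "x - y" z] by (auto simp: ip_diff ip_diff_left)

lemma nrm_zero_iff: "x \<in> H \<Longrightarrow> nrm x = 0 \<longleftrightarrow> ip x x = 0"
  using ip_real[of x] by (auto simp: nrm_def)

definition comb :: "('i \<Rightarrow> complex) \<Rightarrow> ('i \<Rightarrow> 'v) \<Rightarrow> 'i set \<Rightarrow> 'v" where
  "comb c P A = (\<Sum>i\<in>A. c i *c P i)"

definition indep :: "('i \<Rightarrow> 'v) \<Rightarrow> 'i set \<Rightarrow> bool" where
  "indep P A \<longleftrightarrow> (\<forall>c. nrm (comb c P A) = 0 \<longrightarrow> (\<forall>i\<in>A. c i = 0))"

definition spans :: "('i \<Rightarrow> 'v) \<Rightarrow> 'i set \<Rightarrow> 'v set \<Rightarrow> bool" where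
  "spans P A S \<longleftrightarrow> (\<forall>x\<in>S. \<exists>c. nrm (x - comb c P A) = 0)"

definition orthonormal :: "('i \<Rightarrow> 'v) \<Rightarrow> 'i set \<Rightarrow> bool" where
  "orthonormal e A \<longleftrightarrow> (\<forall>i\<in>A. \<forall>j\<in>A. ip (e i) (e j) = (if i = j then 1 else 0))"

lemma comb_H [intro]: "(\<And>i. i \<in> A \<Longrightarrow> P i \<in> H) \<Longrightarrow> comb c P A \<in> H"
  unfolding comb_def by (intro H_sum) auto

lemma comb_Plus:
  "finite A \<Longrightarrow> finite B \<Longrightarrow> comb c P (A <+> B) = comb (c \<circ> Inl) (P \<circ> Inl) A + comb (c \<circ> Inr) (P \<circ> Inr) B"
  unfolding comb_def by (subst sum.Plus) (auto simp: o_def)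

lemma ip_comb: "x \<in> H \<Longrightarrow> (\<And>i. i \<in> A \<Longrightarrow> P i \<in> H) \<Longrightarrow> ip x (comb c P A) = (\<Sum>i\<in>A. c i * ip x (P i))"
  unfolding comb_def by (subst ip_sum) (auto simp: ip_scale)

lemma ip_comb_left: "x \<in> H \<Longrightarrow> (\<And>i. i \<in> A \<Longrightarrow> P i \<in> H) \<Longrightarrow> ip (comb c P A) x = (\<Sum>i\<in>A. cnj (c i) * ip (P i) x)"
  unfolding comb_def by (subst ip_sum_left) (auto simp: ip_scale_left)

lemma orthonormal_indep:
  assumes "finite A" "\<And>i. i \<in> A \<Longrightarrow> e i \<in> H" "orthonormal e A"
  shows "indep e A"
  unfolding indep_def
proof (intro allI impI ballI)
  fix c i assume n: "nrm (comb c e A) = 0" and i: "i \<in> A"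
  have "0 = ip (e i) (comb c e A)" using n assms i by (subst null_ip(2)) auto
  also have "\<dots> = (\<Sum>j\<in>A. c j * ip (e i) (e j))" using assms i by (intro ip_comb) auto
  also have "\<dots> = (\<Sum>j\<in>A. if i = j then c i else 0)"
    using assms(3) i by (intro sum.cong) (auto simp: orthonormal_def)
  also have "\<dots> = c i" using assms(1) i by simp
  finally show "c i = 0" by simp
qed

lemma null_sum:
  assumes "finite A" "\<And>i. i \<in> A \<Longrightarrow> x i \<in> H \<and> nrm (x i) = 0"
  shows "nrm (sum x A) = 0"
  using assms
proof (induction A rule: finite_induct)
  case (insert i A)
  then show ?case using null_add[of "x i" "sum x A"] H_sum[of A x] by simp
qed simp

text \<open>The Steinitz inequality, with linear relations understood up to vectors of norm zero.\<close>

lemma indep_card_le: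
  assumes fin: "finite A" "finite B" and P: "\<And>i. i \<in> A \<Longrightarrow> P i \<in> S" and SH: "S \<subseteq> H"
    and Q: "\<And>j. j \<in> B \<Longrightarrow> Q j \<in> H" and ind: "indep P A" and sp: "spans Q B S"
  shows "card A \<le> card B"
proof (rule ccontr)
  assume "\<not> card A \<le> card B"
  have "\<exists>c. nrm (P i - comb c Q B) = 0" if "i \<in> A" for i using sp P[OF that] by (auto simp: spans_def)
  then obtain c where c: "\<And>i. i \<in> A \<Longrightarrow> nrm (P i - comb (c i) Q B) = 0" by metis
  obtain \<alpha> where \<alpha>: "\<exists>i\<in>A. \<alpha> i \<noteq> 0" "\<forall>j\<in>B. (\<Sum>i\<in>A. \<alpha> i * c i j) = 0"
    using homogeneous_system_nontrivial[OF fin(2,1), of c] \<open>\<not> card A \<le> card B\<close> by auto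
  have PH: "P i \<in> H" if "i \<in> A" for i using P[OF that] SH by auto
  have "(\<Sum>i\<in>A. \<alpha> i *c comb (c i) Q B) = (\<Sum>i\<in>A. \<Sum>j\<in>B. (\<alpha> i * c i j) *c Q j)"
    by (simp add: comb_def scale_sum_right)
  also have "\<dots> = (\<Sum>j\<in>B. \<Sum>i\<in>A. (\<alpha> i * c i j) *c Q j)" by (rule sum.swap)
  also have "\<dots> = (\<Sum>j\<in>B. (\<Sum>i\<in>A. \<alpha> i * c i j) *c Q j)" by (simp add: scale_sum_left)
  also have "\<dots> = 0" using \<alpha>(2) by simp
  finally have "comb \<alpha> P A = (\<Sum>i\<in>A. \<alpha> i *c (P i - comb (c i) Q B))"
    by (simp add: comb_def scale_right_diff_distrib sum_subtractf)
  also have "nrm \<dots> = 0"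
  proof (rule null_sum[OF fin(1)])
    fix i assume i: "i \<in> A"
    have m: "P i - comb (c i) Q B \<in> H" using PH[OF i] Q by auto
    then show "\<alpha> i *c (P i - comb (c i) Q B) \<in> H \<and> nrm (\<alpha> i *c (P i - comb (c i) Q B)) = 0"
      using c[OF i] nrm_scale[OF m] by simp
  qed
  finally show False using ind \<alpha>(1) unfolding indep_def by blast
qed

text \<open>
  An orthonormal system of maximal length spans, since otherwise the normalized remainder of a vector
  outside the span would prolong it. The bound on the length stands in for finite dimension.
\<close>

lemma orthonormal_basis_exists:
  assumes S: "subspace S" "S \<subseteq> H"
    and bound: "\<And>k e. (\<forall>i<k. e i \<in> S) \<Longrightarrow> orthonormal e {..<k} \<Longrightarrow> k \<le> (N::nat)"
  obtains k and e :: "nat \<Rightarrow> 'v" where "\<And>i. i < k \<Longrightarrow> e i \<in> S" "orthonormal e {..<k}" "spans e {..<k} S"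
proof -
  define ok where "ok k \<longleftrightarrow> (\<exists>e. (\<forall>i<k. e i \<in> S) \<and> orthonormal e {..<k})" for k :: nat
  have "ok 0" by (auto simp: ok_def orthonormal_def)
  moreover have "\<forall>k. ok k \<longrightarrow> k \<le> N" using bound by (auto simp: ok_def)
  ultimately obtain k where k: "ok k" "\<And>k'. ok k' \<Longrightarrow> k' \<le> k" using Greatest_le_nat GreatestI_nat by metis
  then obtain e where e: "\<And>i. i < k \<Longrightarrow> e i \<in> S" "orthonormal e {..<k}" by (auto simp: ok_def)
  have eH: "e i \<in> H" if "i < k" for i using e(1)[OF that] S by auto
  have "spans e {..<k} S" unfolding spans_def
  proof (rule ccontr, simp)
    assume "\<exists>x\<in>S. \<forall>c. nrm (x - comb c e {..<k}) \<noteq> 0"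
    then obtain x where x: "x \<in> S" "\<And>c. nrm (x - comb c e {..<k}) \<noteq> 0" by auto
    define r where "r = x - comb (\<lambda>j. ip (e j) x) e {..<k}"
    have xH: "x \<in> H" using x S by auto
    have rS: "r \<in> S" unfolding r_def comb_def using S(1) x(1) e(1)
      by (intro subspace_diff subspace_sum subspace_scale) auto
    then have rH: "r \<in> H" using S by auto
    have rn: "nrm r \<noteq> 0" using x(2) unfolding r_def by blast
    have er: "ip (e i) r = 0" if i: "i < k" for i
    proof -
      have "ip (e i) (comb (\<lambda>j. ip (e j) x) e {..<k}) = (\<Sum>j<k. ip (e j) x * ip (e i) (e j))"
        using eH i by (intro ip_comb) auto
      also have "\<dots> = (\<Sum>j<k. if i = j then ip (e i) x else 0)"
        using e(2) i by (intro sum.cong) (auto simp: orthonormal_def)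
      also have "\<dots> = ip (e i) x" using i by simp
      finally show ?thesis using eH i xH unfolding r_def by (subst ip_diff) (auto intro!: comb_H)
    qed
    define r' where "r' = of_real (1 / nrm r) *c r"
    have r'S: "r' \<in> S" unfolding r'_def using rS S(1) by (simp add: subspace_scale)
    have r'r': "ip r' r' = 1"
      using rH rn ip_self[OF rH] by (simp add: r'_def ip_scale ip_scale_left power2_eq_square)
    have er': "ip (e i) r' = 0" "ip r' (e i) = 0" if "i < k" for i
      using er[OF that] rH eH[OF that] ip_swap_zero[of "e i" r] by (simp_all add: r'_def ip_scale ip_scale_left)
    have "ok (Suc k)" unfolding ok_def
    proof (intro exI[of _ "e(k := r')"] conjI)
      show "orthonormal (e(k := r')) {..<Suc k}"
        using e(2) r'r' er' by (auto simp: orthonormal_def less_Suc_eq)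
    qed (use e(1) r'S in \<open>auto simp: less_Suc_eq\<close>)
    then show False using k(2) by fastforce
  qed
  then show ?thesis using that e by blast
qed

end

locale semi_hilbert = semi_inner_space +
  assumes complete: "\<And>X :: nat \<Rightarrow> 'a. (\<And>n. X n \<in> H) \<Longrightarrow>
      (\<And>e. e > 0 \<Longrightarrow> \<exists>N. \<forall>m\<ge>N. \<forall>n\<ge>N. nrm (X m - X n) < e) \<Longrightarrow> \<exists>x\<in>H. (\<lambda>n. nrm (X n - x)) \<longlonglongrightarrow> 0"
begin

text \<open>
  A minimizing sequence for the distance is a Cauchy sequence by the parallelogram identity; its limit is the
  foot of the perpendicular. Closedness of \<open>S\<close> is a hypothesis on sequences, and includes that \<open>S\<close> contains
  every vector at distance zero from one of its own.
\<close>

lemma projection_exists: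
  assumes S: "subspace S" "S \<subseteq> H"
    and closed: "\<And>X x. (\<And>n::nat. X n \<in> S) \<Longrightarrow> x \<in> H \<Longrightarrow> (\<lambda>n. nrm (X n - x)) \<longlonglongrightarrow> 0 \<Longrightarrow> x \<in> S"
    and x: "x \<in> H"
  shows "\<exists>y\<in>S. \<forall>z\<in>S. ip z (x - y) = 0"
proof -
  have SH: "z \<in> H" if "z \<in> S" for z using S(2) that by auto
  define d where "d = Inf ((\<lambda>z. (nrm (x - z))\<^sup>2) ` S)"
  have bdd: "bdd_below ((\<lambda>z. (nrm (x - z))\<^sup>2) ` S)" by (rule bdd_belowI[of _ 0]) auto
  have dle: "d \<le> (nrm (x - z))\<^sup>2" if "z \<in> S" for z
    unfolding d_def using that by (intro cInf_lower bdd) auto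
  have "\<exists>z\<in>S. (nrm (x - z))\<^sup>2 < d + 1 / real (Suc n)" for n
  proof -
    have "(\<lambda>z. (nrm (x - z))\<^sup>2) ` S \<noteq> {}" using subspace_0[OF S(1)] by auto
    moreover have "Inf ((\<lambda>z. (nrm (x - z))\<^sup>2) ` S) < d + 1 / real (Suc n)" by (simp add: d_def)
    ultimately show ?thesis using cInf_less_iff[OF _ bdd] by auto
  qed
  then obtain y where y: "\<And>n. y n \<in> S" "\<And>n. (nrm (x - y n))\<^sup>2 < d + 1 / real (Suc n)" by metis
  have par: "(nrm (y m - y n))\<^sup>2 \<le> 2 / real (Suc m) + 2 / real (Suc n)" for m n
  proof -
    define p where "p = x - y m"
    define q where "q = x - y n"
    have H: "p \<in> H" "q \<in> H" using x y(1) SH by (auto simp: p_def q_def)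
    define z where "z = (1/2) *c (y m + y n)"
    have z: "z \<in> S" unfolding z_def using S(1) y(1) by (intro subspace_scale subspace_add) auto
    have "p + q = 2 *c (x - z)"
    proof -
      have "2 *c x = x + x" using scale_left_distrib[of 1 1 x] by simp
      moreover have "2 *c z = y m + y n" by (simp add: z_def)
      ultimately show ?thesis by (simp add: p_def q_def scale_right_diff_distrib)
    qed
    then have "nrm (p + q) = 2 * nrm (x - z)" using nrm_scale[of "x - z" 2] x z SH by simp
    then have 4: "(nrm (p + q))\<^sup>2 = 4 * (nrm (x - z))\<^sup>2" by (simp add: power_mult_distrib)
    have "(nrm (p + q))\<^sup>2 + (nrm (p - q))\<^sup>2 = 2 * (nrm p)\<^sup>2 + 2 * (nrm q)\<^sup>2"
      using H by (simp add: nrm_sq ip_add ip_add_left ip_diff ip_diff_left)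
    moreover have "nrm (p - q) = nrm (y m - y n)"
      using nrm_diff_commute[of "y m" "y n"] y(1) SH by (simp add: p_def q_def)
    ultimately have "(nrm (y m - y n))\<^sup>2 = 2 * (nrm p)\<^sup>2 + 2 * (nrm q)\<^sup>2 - 4 * (nrm (x - z))\<^sup>2"
      using 4 by simp
    also have "\<dots> \<le> 2 * (d + 1 / real (Suc m)) + 2 * (d + 1 / real (Suc n)) - 4 * d"
    proof -
      have "2 * A + 2 * B - 4 * D \<le> 2 * (d + u) + 2 * (d + v) - 4 * d"
        if "A < d + u" "B < d + v" "d \<le> D" for A B D u v :: real using that by argo
      then show ?thesis using y(2)[of m] y(2)[of n] dle[OF z] unfolding p_def q_def by blast
    qed
    finally show ?thesis by simp
  qed
  have "\<exists>N. \<forall>m\<ge>N. \<forall>n\<ge>N. nrm (y m - y n) < e" if e: "e > 0" for e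
  proof -
    obtain N where N: "1 / real (Suc N) < e\<^sup>2 / 4" using e by (metis nat_approx_posE zero_less_divide_iff zero_less_numeral zero_less_power)
    have "nrm (y m - y n) < e" if "m \<ge> N" "n \<ge> N" for m n
    proof -
      have "1 / real (Suc m) \<le> 1 / real (Suc N)" "1 / real (Suc n) \<le> 1 / real (Suc N)"
        using that by (auto intro!: divide_left_mono)
      then have "(nrm (y m - y n))\<^sup>2 < e\<^sup>2" using par[of m n] N by simp
      then show ?thesis using e by (simp add: power_less_imp_less_base)
    qed
    then show ?thesis by blast
  qed
  then obtain l where l: "l \<in> H" "(\<lambda>n. nrm (y n - l)) \<longlonglongrightarrow> 0"
    using complete[of y] y(1) SH by blast
  have lS: "l \<in> S" by (rule closed[OF y(1) l])
  have "nrm (x - l) \<le> sqrt d"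
  proof -
    have "nrm (x - l) \<le> sqrt (d + 1 / real (Suc n)) + nrm (y n - l)" for n
    proof -
      have "nrm (x - y n) \<le> sqrt (d + 1 / real (Suc n))" using y(2)[of n] by (intro real_le_rsqrt) simp
      then show ?thesis using nrm_triangle_diff[OF x SH[OF y(1)] l(1), of n] by simp
    qed
    moreover have "(\<lambda>n. sqrt (d + 1 / real (Suc n)) + nrm (y n - l)) \<longlonglongrightarrow> sqrt (d + 0) + 0"
      using LIMSEQ_Suc[OF lim_1_over_n] l(2) by (intro tendsto_intros) auto
    ultimately show ?thesis by (intro LIMSEQ_le_const[of _ "sqrt d"]) auto
  qed
  moreover have d0: "0 \<le> d" unfolding d_def
    using subspace_0[OF S(1)] by (intro cInf_greatest) auto
  ultimately have min: "(nrm (x - l))\<^sup>2 \<le> d"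
    using power_mono[of "nrm (x - l)" "sqrt d" 2] x l by simp
  have "ip z (x - l) = 0" if z: "z \<in> S" for z
  proof -
    define w where "w = x - l"
    have wH: "w \<in> H" and zH: "z \<in> H" using x l z SH by (auto simp: w_def)
    define s where "s = ip w z"
    have "0 \<le> - (2 * t * (cmod s)\<^sup>2) + t\<^sup>2 * ((cmod s)\<^sup>2 * Re (ip z z))" if t: "t > 0" for t
    proof -
      have "(nrm w)\<^sup>2 \<le> (nrm (x - (l + (of_real t * cnj s) *c z)))\<^sup>2"
        using min dle[of "l + (of_real t * cnj s) *c z"] S(1) lS z
        by (auto simp: w_def subspace_add subspace_scale)
      also have "x - (l + (of_real t * cnj s) *c z) = w - (of_real t * cnj s) *c z" by (simp add: w_def)
      finally have fin: "0 \<le> - (2 * Re (of_real t * cnj s * s)) + (cmod (of_real t * cnj s))\<^sup>2 * Re (ip z z)"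
        using Re_ip_diff[OF wH zH, of "of_real t * cnj s"] wH zH by (simp add: nrm_sq s_def)
      have re: "Re (of_real t * cnj s * s) = t * (cmod s)\<^sup>2"
        unfolding cmod_power2 by (simp add: power2_eq_square algebra_simps)
      have cm: "(cmod (of_real t * cnj s))\<^sup>2 = t\<^sup>2 * (cmod s)\<^sup>2"
        by (simp add: norm_mult power_mult_distrib)
      show ?thesis using fin unfolding re cm by (simp only: mult.assoc)
    qed
    from quadratic_nonneg_imp_zero[OF this] have "(cmod s)\<^sup>2 = 0" by simp
    then show ?thesis using ip_swap_zero[OF wH zH] by (simp add: s_def w_def)
  qed
  then show ?thesis using lS by blast
qed

end

section \<open>Self-adjoint restrictions in a semi-Hilbert space\<close>

text \<open>
  \<open>JJ\<close> abstracts the rotation \<open>(u, f) \<mapsto> (f, -u)\<close> of a space of pairs, in terms of which the adjoint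
  of a linear relation is an orthogonal complement.
\<close>

locale linear_relation = semi_hilbert +
  fixes JJ :: "'a \<Rightarrow> 'a" and Tmin0 Tmax0 :: "'a set"
  assumes JJ_H: "\<And>x. x \<in> H \<Longrightarrow> JJ x \<in> H"
    and JJ_add: "\<And>x y. JJ (x + y) = JJ x + JJ y"
    and JJ_scale: "\<And>c x. JJ (c *c x) = c *c JJ x"
    and JJ_JJ: "\<And>x. JJ (JJ x) = - x"
    and ip_JJ: "\<And>x y. x \<in> H \<Longrightarrow> y \<in> H \<Longrightarrow> ip (JJ x) (JJ y) = ip x y"
    and Tmin_subset: "Tmin0 \<subseteq> Tmax0"
    and Tmax_adjoint: "Tmax0 = {x \<in> H. \<forall>y\<in>Tmin0. ip (JJ x) y = 0}"
begin

definition adj :: "'a set \<Rightarrow> 'a set" where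
  "adj T = {x \<in> H. \<forall>y\<in>T. ip (JJ x) y = 0}"

lemma Tmax_adj: "Tmax0 = adj Tmin0" using Tmax_adjoint by (simp add: adj_def)

lemma Tmax_H: "Tmax0 \<subseteq> H" using Tmax_adjoint by auto

lemma adj_H: "adj T \<subseteq> H" by (auto simp: adj_def)

lemma JJ_0: "JJ 0 = 0" using JJ_scale[of 0 0] by simp

lemma JJ_minus: "JJ (- x) = - JJ x" using JJ_scale[of "- 1" x] by (simp add: scale_minus_left)

lemma JJ_diff: "JJ (x - y) = JJ x - JJ y" using JJ_add[of x "- y"] JJ_minus[of y] by simp

lemma JJ_comb: "JJ (comb c P A) = comb c (JJ \<circ> P) A"
  by (induction A rule: infinite_finite_induct) (auto simp: comb_def JJ_0 JJ_add JJ_scale)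

lemma nrm_JJ: "x \<in> H \<Longrightarrow> nrm (JJ x) = nrm x" by (simp add: nrm_def ip_JJ)

lemma ip_JJ_left: "x \<in> H \<Longrightarrow> y \<in> H \<Longrightarrow> ip (JJ x) y = - ip x (JJ y)"
  using ip_JJ[of x "JJ y"] JJ_JJ[of y] JJ_H[of x] JJ_H[of y] ip_minus[of "JJ x" y]
  by (simp add: minus_equation_iff)

lemma adj_subspace: assumes "T \<subseteq> H" shows "subspace (adj T)"
proof (rule subspaceI)
  have TH: "y \<in> H" if "y \<in> T" for y using assms that by auto
  show "0 \<in> adj T" using TH by (auto simp: adj_def JJ_0)
  show "x + y \<in> adj T" if "x \<in> adj T" "y \<in> adj T" for x y
    using that TH by (auto simp: adj_def JJ_add ip_add_left JJ_H)
  show "c *c x \<in> adj T" if "x \<in> adj T" for c x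
    using that TH by (auto simp: adj_def JJ_scale ip_scale_left JJ_H)
qed

lemma adj_null: assumes "T \<subseteq> H" "x \<in> adj T" "y \<in> H" "nrm (x - y) = 0" shows "y \<in> adj T"
proof -
  have x: "x \<in> H" using assms by (auto simp: adj_def)
  have "nrm (JJ x - JJ y) = 0" using nrm_JJ[of "x - y"] assms x by (simp add: JJ_diff)
  then have "ip (JJ y) z = ip (JJ x) z" if "z \<in> T" for z
    using null_congr(2)[of "JJ x" "JJ y" z] x assms that by (auto simp: JJ_H)
  then show ?thesis using assms by (auto simp: adj_def)
qed

lemma adj_antimono: "T \<subseteq> T' \<Longrightarrow> adj T' \<subseteq> adj T" by (auto simp: adj_def)

lemma subset_adj_adj: assumes "T \<subseteq> H" shows "T \<subseteq> adj (adj T)"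
proof
  fix x assume x: "x \<in> T"
  then have xH: "x \<in> H" using assms by auto
  have "ip (JJ x) y = 0" if "y \<in> adj T" for y
    using that x xH ip_JJ_left[of x y] ip_swap_zero[of x "JJ y"] by (auto simp: adj_def JJ_H)
  then show "x \<in> adj (adj T)" using xH by (auto simp: adj_def)
qed

text \<open>The closure of the minimal relation, obtained as a double adjoint.\<close>

definition S where "S = adj Tmax0"

lemma S_H: "S \<subseteq> H" by (simp add: S_def adj_H)

lemma S_subspace: "subspace S" unfolding S_def by (rule adj_subspace[OF Tmax_H])

lemma Tmax_subspace: "subspace Tmax0"
  using Tmin_subset Tmax_H adj_subspace[of Tmin0] Tmax_adj by auto

lemma S_subset_Tmax: "S \<subseteq> Tmax0"
  using adj_antimono[OF Tmin_subset] Tmax_adj[symmetric] by (simp add: S_def)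

text \<open>Taking adjoints is an antitone Galois connection, so the adjoint of \<open>Tmin0\<close> equals its own double adjoint.\<close>

lemma adj_S: "adj S = Tmax0"
proof
  have "Tmin0 \<subseteq> adj (adj Tmin0)" using Tmin_subset Tmax_H by (intro subset_adj_adj) auto
  then have "Tmin0 \<subseteq> S" unfolding S_def using Tmax_adj[symmetric] by simp
  then show "adj S \<subseteq> Tmax0" using adj_antimono Tmax_adj by simp
  show "Tmax0 \<subseteq> adj S" unfolding S_def by (rule subset_adj_adj[OF Tmax_H])
qed

definition V where "V = {x \<in> Tmax0. JJ x \<in> Tmax0}"

lemma V_H: "V \<subseteq> H" using Tmax_H by (auto simp: V_def)

lemma V_subspace: "subspace V"
  unfolding V_def using Tmax_subspace
  by (intro subspaceI) (auto simp: JJ_0 JJ_add JJ_scale subspace_0 subspace_add subspace_scale)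

lemma JJ_V: "x \<in> V \<Longrightarrow> JJ x \<in> V"
  using subspace_neg[OF Tmax_subspace] by (auto simp: V_def JJ_JJ)

lemma S_perp_V: "s \<in> S \<Longrightarrow> v \<in> V \<Longrightarrow> ip s v = 0"
  using ip_JJ[of s v] V_H S_H by (auto simp: S_def adj_def V_def)

lemma S_perp_JJ_Tmax: "s \<in> S \<Longrightarrow> x \<in> Tmax0 \<Longrightarrow> ip (JJ s) x = 0"
  by (auto simp: S_def adj_def)

text \<open>
  \<open>v\<close> is the component of \<open>x\<close> orthogonal to the closed space \<open>S\<close>. Orthogonality to \<open>S\<close> means that
  \<open>JJ v\<close> is in the adjoint of \<open>S\<close>, which is \<open>Tmax0\<close>.
\<close>

lemma von_Neumann_decomposition:
  assumes x: "x \<in> Tmax0"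
  obtains s v where "s \<in> S" "v \<in> V" "x = s + v"
proof -
  have xH: "x \<in> H" using x Tmax_H by auto
  \<comment> \<open>\<open>S\<close> is an adjoint, hence defined by equations that are continuous for the seminorm.\<close>
  have closed: "y \<in> S" if X: "\<And>n::nat. X n \<in> S" and y: "y \<in> H" and lim: "(\<lambda>n. nrm (X n - y)) \<longlonglongrightarrow> 0" for X y
  proof -
    have "ip (JJ y) z = 0" if z: "z \<in> Tmax0" for z
    proof -
      have zH: "z \<in> H" using z Tmax_H by auto
      have XH: "X n \<in> H" for n using X S_H by auto
      have "cmod (ip (JJ y) z) \<le> nrm (X n - y) * nrm z" for n
      proof -
        have "ip (JJ (X n - y)) z = - ip (JJ y) z"
          using S_perp_JJ_Tmax[OF X z] XH y zH by (simp add: JJ_diff ip_diff_left JJ_H)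
        then have "cmod (ip (JJ y) z) = cmod (ip (JJ (X n - y)) z)" by simp
        also have "\<dots> \<le> nrm (JJ (X n - y)) * nrm z" using XH y zH by (intro cauchy_schwarz) (auto intro: JJ_H)
        finally show ?thesis using XH y by (simp add: nrm_JJ)
      qed
      moreover have "(\<lambda>n. nrm (X n - y) * nrm z) \<longlonglongrightarrow> 0 * nrm z" using lim by (intro tendsto_intros)
      ultimately have "cmod (ip (JJ y) z) \<le> 0 * nrm z" by (intro LIMSEQ_le_const) auto
      then show ?thesis by simp
    qed
    then show ?thesis using y by (auto simp: S_def adj_def)
  qed
  have "\<exists>s\<in>S. \<forall>z\<in>S. ip z (x - s) = 0"
    by (rule projection_exists[OF S_subspace S_H _ xH]) (rule closed)
  then obtain s where s: "s \<in> S" "\<And>z. z \<in> S \<Longrightarrow> ip z (x - s) = 0" by auto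
  define v where "v = x - s"
  have sH: "s \<in> H" using s S_H by auto
  have vT: "v \<in> Tmax0" unfolding v_def using x s S_subset_Tmax by (intro subspace_diff Tmax_subspace) auto
  have vH: "v \<in> H" using vT Tmax_H by auto
  have "JJ v \<in> adj S"
    using s(2) vH S_H ip_swap_zero[of v] by (auto simp: adj_def JJ_H JJ_JJ ip_minus_left v_def[symmetric])
  then have "v \<in> V" using vT by (simp add: V_def adj_S)
  then show ?thesis using that[OF s(1)] by (simp add: v_def)
qed

text \<open>
  The deficiency spaces: pairs \<open>(u, f)\<close> with \<open>f = z u\<close>. The equation is expressed by \<open>JJ x = z x\<close>,
  which is equivalent for \<open>z = \<i>\<close> and \<open>z = -\<i>\<close>.
\<close>

definition D where "D z = {x \<in> Tmax0. nrm (JJ x - z *c x) = 0}"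

lemma D_H: "D z \<subseteq> H" using Tmax_H by (auto simp: D_def)

lemma D_perp:
  assumes p: "p \<in> D \<i>" and m: "m \<in> D (- \<i>)"
  shows "ip p m = 0"
proof -
  have H: "p \<in> H" "m \<in> H" using p m D_H by auto
  have "ip p m = ip (JJ p) (JJ m)" using H by (simp add: ip_JJ)
  also have "\<dots> = ip (\<i> *c p) (JJ m)" using p H by (intro null_congr) (auto simp: D_def JJ_H)
  also have "\<dots> = ip (\<i> *c p) ((- \<i>) *c m)" using m H by (intro null_congr(1)) (auto simp: D_def JJ_H simp del: scale_minus_left)
  also have "\<dots> = cnj \<i> * (- \<i>) * ip p m" using H by (simp only: ip_scale ip_scale_left H_scale) simp
  finally show ?thesis by simp
qed

lemma Tmax_null: "x \<in> Tmax0 \<Longrightarrow> y \<in> H \<Longrightarrow> nrm (x - y) = 0 \<Longrightarrow> y \<in> Tmax0"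
  using Tmin_subset Tmax_H adj_null[of Tmin0 x y] Tmax_adj by auto

lemma D_subset_V: assumes "x \<in> D z" shows "x \<in> V"
proof -
  have x: "x \<in> Tmax0" "nrm (JJ x - z *c x) = 0" "x \<in> H" using assms D_H by (auto simp: D_def)
  have "z *c x \<in> Tmax0" using x(1) Tmax_subspace by (simp add: subspace_scale)
  then have "JJ x \<in> Tmax0"
    using x Tmax_null[of "z *c x" "JJ x"] nrm_diff_commute[of "JJ x" "z *c x"] by (simp add: JJ_H)
  then show ?thesis using x by (simp add: V_def)
qed

text \<open>
  \<open>JJ\<close> has square \<open>-1\<close>, so \<open>V\<close> is the sum of the eigenspaces for \<open>\<i>\<close> and \<open>-\<i>\<close>, with
  projections \<open>(1 \<mp> \<i> JJ) / 2\<close>.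
\<close>

lemma V_eq: "V = {x + y | x y. x \<in> D \<i> \<and> y \<in> D (- \<i>)}"
proof safe
  fix v assume v: "v \<in> V"
  define p where "p = (1/2) *c v + (- \<i> / 2) *c JJ v"
  define m where "m = (1/2) *c v + (\<i> / 2) *c JJ v"
  have T: "v \<in> Tmax0" "JJ v \<in> Tmax0" using v by (auto simp: V_def)
  have "p \<in> Tmax0" "m \<in> Tmax0" unfolding p_def m_def
    by (intro subspace_add[OF Tmax_subspace] subspace_scale[OF Tmax_subspace] T)+
  moreover have "JJ p = \<i> *c p" "JJ m = (- \<i>) *c m"
    by (simp_all add: p_def m_def JJ_scale JJ_add JJ_diff JJ_JJ scale_right_distrib scale_right_diff_distrib)
  ultimately have "p \<in> D \<i>" "m \<in> D (- \<i>)" by (auto simp: D_def)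
  moreover have "v = p + m"
    using scale_left_distrib[of "1/2" "1/2" v] by (simp add: p_def m_def)
  ultimately show "\<exists>x y. v = x + y \<and> x \<in> D \<i> \<and> y \<in> D (- \<i>)" by blast
next
  fix x y assume "x \<in> D \<i>" "y \<in> D (- \<i>)"
  then show "x + y \<in> V" using D_subset_V V_subspace by (simp add: subspace_add)
qed

end

locale equal_deficiency = linear_relation +
  fixes m :: nat and Pp Pm :: "nat \<Rightarrow> 'a"
  assumes Pp: "\<And>j. j < m \<Longrightarrow> Pp j \<in> D \<i>" "indep Pp {..<m}" "spans Pp {..<m} (D \<i>)"
    and Pm: "\<And>j. j < m \<Longrightarrow> Pm j \<in> D (- \<i>)" "indep Pm {..<m}" "spans Pm {..<m} (D (- \<i>))"
begin

definition Q :: "nat + nat \<Rightarrow> 'a" where "Q = case_sum Pp Pm"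

abbreviation QI :: "(nat + nat) set" where "QI \<equiv> {..<m} <+> {..<m}"

lemma Q_comps: "Q \<circ> Inl = Pp" "Q \<circ> Inr = Pm" by (auto simp: Q_def)

lemma Q_V: "j \<in> QI \<Longrightarrow> Q j \<in> V"
  by (auto simp: Q_def intro: D_subset_V[OF Pp(1)] D_subset_V[OF Pm(1)])

lemma D_subspace: "subspace (D z)"
proof (rule subspaceI)
  show "0 \<in> D z" using Tmax_subspace by (auto simp: D_def JJ_0 subspace_0)
  show "x + y \<in> D z" if "x \<in> D z" "y \<in> D z" for x y
  proof -
    have H: "x \<in> H" "y \<in> H" using that D_H by auto
    have "nrm ((JJ x - z *c x) + (JJ y - z *c y)) = 0"
      by (rule null_add) (use that H in \<open>auto simp: D_def JJ_H\<close>)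
    then show ?thesis using that Tmax_subspace
      by (auto simp: D_def subspace_add JJ_add scale_right_distrib algebra_simps)
  qed
  show "c *c x \<in> D z" if "x \<in> D z" for c x
  proof -
    have H: "x \<in> H" using that D_H by auto
    have "nrm (c *c (JJ x - z *c x)) = 0"
      using that H by (subst nrm_scale) (auto simp: D_def JJ_H)
    then show ?thesis using that Tmax_subspace
      by (auto simp: D_def subspace_scale JJ_scale scale_right_diff_distrib mult.commute)
  qed
qed

lemma comb_subspace: "subspace X \<Longrightarrow> (\<And>i. i \<in> A \<Longrightarrow> P i \<in> X) \<Longrightarrow> comb c P A \<in> X"
  unfolding comb_def by (intro subspace_sum subspace_scale) auto

text \<open>The two deficiency spaces are orthogonal, so the union of their bases is independent.\<close>

lemma Q_indep: "indep Q QI"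
  unfolding indep_def
proof (intro allI impI ballI)
  fix c i assume n: "nrm (comb c Q QI) = 0" and i: "i \<in> QI"
  define p where "p = comb (c \<circ> Inl) Pp {..<m}"
  define r where "r = comb (c \<circ> Inr) Pm {..<m}"
  have pD: "p \<in> D \<i>" and rD: "r \<in> D (- \<i>)"
    unfolding p_def r_def using Pp(1) Pm(1) by (auto intro!: comb_subspace D_subspace)
  then have H: "p \<in> H" "r \<in> H" using D_H by auto
  have n': "nrm (p + r) = 0" using n by (simp add: comb_Plus Q_comps p_def r_def)
  have pr: "ip p r = 0" "ip r p = 0" using D_perp[OF pD rD] ip_swap_zero H by auto
  have "ip (p + r) p = 0" "ip (p + r) r = 0" using n' H by (auto intro!: null_ip(1))
  then have "nrm p = 0" "nrm r = 0" using pr H by (auto simp: ip_add_left nrm_def)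
  then have "\<forall>i<m. c (Inl i) = 0" "\<forall>i<m. c (Inr i) = 0"
    using Pp(2) Pm(2) by (auto simp: indep_def p_def r_def)
  then show "c i = 0" using i by auto
qed

lemma Q_spans: "spans Q QI V"
  unfolding spans_def
proof
  fix v assume "v \<in> V"
  then obtain x y where xy: "v = x + y" "x \<in> D \<i>" "y \<in> D (- \<i>)" unfolding V_eq by auto
  obtain c where c: "nrm (x - comb c Pp {..<m}) = 0" using Pp(3) xy by (auto simp: spans_def)
  obtain d where d: "nrm (y - comb d Pm {..<m}) = 0" using Pm(3) xy by (auto simp: spans_def)
  have H: "x \<in> H" "y \<in> H" "comb c Pp {..<m} \<in> H" "comb d Pm {..<m} \<in> H"
    using xy D_H Pp(1) Pm(1) by (auto intro!: comb_H)
  have "v - comb (case_sum c d) Q QI = (x - comb c Pp {..<m}) + (y - comb d Pm {..<m})"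
    by (simp add: comb_Plus Q_comps xy case_sum_o_inj)
  also have "nrm \<dots> = 0" by (rule null_add) (use H c d in auto)
  finally show "\<exists>c. nrm (v - comb c Q QI) = 0" by blast
qed

lemma card_QI: "card QI = 2 * m" by (simp add: card_Plus)

lemma indep_V_card:
  assumes "finite A" "\<And>i. i \<in> A \<Longrightarrow> P i \<in> V" "indep P A"
  shows "card A \<le> 2 * m"
  using indep_card_le[OF assms(1) _ assms(2) V_H _ assms(3) Q_spans] Q_V V_H card_QI by auto

lemma spans_V_card:
  assumes "finite B" "\<And>i. i \<in> B \<Longrightarrow> P i \<in> V" "spans P B V"
  shows "2 * m \<le> card B"
  using indep_card_le[OF _ assms(1) _ V_H _ Q_indep assms(3)] Q_V V_H card_QI assms(2) by auto

text \<open>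
  The span of \<open>P\<close> and its image under \<open>JJ\<close> are orthogonal and both have dimension \<open>m\<close>, so together they
  exhaust \<open>V\<close>. A vector orthogonal to \<open>P\<close> outside the span of \<open>JJ P\<close> would give \<open>2 m + 1\<close> independent vectors.
\<close>

lemma isotropic_complement:
  assumes P: "\<And>j. j < m \<Longrightarrow> P j \<in> V" "indep P {..<m}"
    and iso: "\<And>k l. k < m \<Longrightarrow> l < m \<Longrightarrow> ip (P k) (JJ (P l)) = 0"
    and v: "v \<in> V" "\<And>j. j < m \<Longrightarrow> ip (P j) v = 0"
  shows "\<exists>c. nrm (v - comb c (JJ \<circ> P) {..<m}) = 0"
proof (rule ccontr)
  assume no: "\<not> ?thesis"
  define F :: "nat + (nat + unit) \<Rightarrow> 'a" where "F = case_sum P (case_sum (JJ \<circ> P) (\<lambda>_. v))"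
  let ?A = "{..<m} <+> ({..<m} <+> {()})"
  have PH: "P j \<in> H" "JJ (P j) \<in> H" if "j < m" for j using P(1)[OF that] V_H JJ_H by auto
  have vH: "v \<in> H" using v V_H by auto
  have "indep F ?A" unfolding indep_def
  proof (intro allI impI ballI)
    fix c i assume n: "nrm (comb c F ?A) = 0" and i: "i \<in> ?A"
    define p where "p = comb (c \<circ> Inl) P {..<m}"
    define r where "r = comb (c \<circ> Inr \<circ> Inl) (JJ \<circ> P) {..<m}"
    define t where "t = c (Inr (Inr ()))"
    have H: "p \<in> H" "r \<in> H" unfolding p_def r_def using PH by (auto intro!: comb_H)
    have eq: "comb c F ?A = p + (r + t *c v)"
      by (simp add: comb_Plus F_def o_def p_def r_def t_def) (simp add: comb_def)
    have "ip (P k) r = 0" if "k < m" for k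
      unfolding r_def using iso that PH by (subst ip_comb) auto
    then have pr: "ip p (r + t *c v) = 0"
      unfolding p_def using v PH H vH by (subst ip_comb_left) (auto simp: ip_add ip_scale)
    have "ip (p + (r + t *c v)) p = 0" using n H vH unfolding eq by (intro null_ip) auto
    then have "ip p p = 0" using pr H vH ip_swap_zero[of p "r + t *c v"] by (simp add: ip_add_left)
    then have p0: "nrm p = 0" using H by (simp add: nrm_zero_iff)
    then have a: "\<forall>j<m. c (Inl j) = 0" using P(2) by (auto simp: indep_def p_def)
    have "nrm ((p + (r + t *c v)) + (- p)) = 0"
      by (rule null_add) (use n H vH p0 eq in \<open>auto simp: nrm_minus\<close>)
    then have rt: "nrm (r + t *c v) = 0" by simp
    have t0: "t = 0"
    proof (rule ccontr)
      assume t: "t \<noteq> 0"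
      have "(1 / t) *c r = comb (\<lambda>j. (c \<circ> Inr \<circ> Inl) j / t) (JJ \<circ> P) {..<m}"
        by (simp add: r_def comb_def scale_sum_right)
      then have "(1 / t) *c (r + t *c v) = v - comb (\<lambda>j. - ((c \<circ> Inr \<circ> Inl) j / t)) (JJ \<circ> P) {..<m}"
        using t by (simp add: scale_right_distrib comb_def sum_negf)
      moreover have "nrm ((1 / t) *c (r + t *c v)) = 0" using rt H vH by (subst nrm_scale) auto
      ultimately show False using no by metis
    qed
    then have "nrm (JJ (comb (c \<circ> Inr \<circ> Inl) P {..<m})) = 0" using rt by (simp add: JJ_comb r_def)
    then have "nrm (comb (c \<circ> Inr \<circ> Inl) P {..<m}) = 0" using PH by (subst (asm) nrm_JJ) (auto intro!: comb_H)
    then have "\<forall>j<m. c (Inr (Inl j)) = 0" using P(2) by (auto simp: indep_def)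
    then show "c i = 0" using i a t0 t_def by auto
  qed
  moreover have "F i \<in> V" if "i \<in> ?A" for i using that P(1) JJ_V v by (auto simp: F_def)
  ultimately have "card ?A \<le> 2 * m" by (intro indep_V_card[of ?A F]) auto
  then show False by (simp add: card_Plus)
qed

text \<open>
  From \<open>T\<close> to \<open>P\<close>: for self-adjoint \<open>T\<close> the space \<open>K = {x \<in> V. JJ x \<in> T}\<close> is orthogonal to \<open>JJ K\<close>, and
  \<open>V = K + JJ K\<close> because a vector \<open>r\<close> of \<open>V\<close> orthogonal to both satisfies \<open>JJ r \<in> T\<close>, hence lies in \<open>K\<close> and is
  null. Counting dimensions, \<open>K\<close> has an orthonormal basis of length \<open>m\<close>, which serves as \<open>P\<close>. From \<open>P\<close> to \<open>T\<close>:
  isotropy puts \<open>JJ P\<close> into \<open>T\<close>, so \<open>T\<close> contains its adjoint, and the opposite inclusion holds because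
  the part of \<open>T\<close> in \<open>V\<close> is spanned by \<open>JJ P\<close>.
\<close>

theorem self_adjoint_iff:
  assumes TH: "T \<subseteq> H" and sat: "\<And>x y. x \<in> T \<Longrightarrow> y \<in> H \<Longrightarrow> nrm (x - y) = 0 \<Longrightarrow> y \<in> T"
  shows "subspace T \<and> T \<subseteq> Tmax0 \<and> T = adj T \<longleftrightarrow>
    (\<exists>P. (\<forall>j<m. P j \<in> V) \<and> indep P {..<m} \<and> (\<forall>k<m. \<forall>l<m. ip (P k) (JJ (P l)) = 0) \<and>
       T = {x \<in> Tmax0. \<forall>j<m. ip (P j) x = 0})" (is "?L \<longleftrightarrow> ?R")
proof
  assume ?L
  then have Ts: "subspace T" and TT: "T \<subseteq> Tmax0" and Ta: "T = adj T" by auto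
  have ST: "S \<subseteq> T" unfolding S_def using adj_antimono[OF TT] Ta by simp
  have Tperp: "ip (JJ x) y = 0" if "x \<in> T" "y \<in> T" for x y using that Ta by (auto simp: adj_def)
  define K where "K = {x \<in> V. JJ x \<in> T}"
  have KV: "K \<subseteq> V" by (auto simp: K_def)
  then have KH: "K \<subseteq> H" using V_H by auto
  have Ks: "subspace K" unfolding K_def using V_subspace Ts
    by (intro subspaceI) (auto simp: JJ_0 JJ_add JJ_scale subspace_0 subspace_add subspace_scale)
  have Kperp: "ip x (JJ y) = 0" if "x \<in> K" "y \<in> K" for x y
  proof -
    have "ip (JJ (JJ x)) (JJ y) = 0" using Tperp[of "JJ x" "JJ y"] that by (auto simp: K_def)
    moreover have "x \<in> H" "JJ y \<in> H" using that KH JJ_H by auto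
    ultimately show ?thesis by (simp add: JJ_JJ ip_minus_left)
  qed
  \<comment> \<open>An orthonormal system in \<open>K\<close> doubles to one in \<open>V\<close>, which bounds its length by \<open>m\<close>.\<close>
  have two: "orthonormal (case_sum e (JJ \<circ> e)) ({..<k} <+> {..<k})"
    if e: "\<forall>i<k. e i \<in> K" "orthonormal e {..<k}" for e and k :: nat
  proof -
    have eH: "e i \<in> H" if "i < k" for i using e(1) that KH by auto
    have 1: "ip (e i) (e j) = (if i = j then 1 else 0)" "ip (e i) (JJ (e j)) = 0" "ip (JJ (e i)) (e j) = 0"
      if "i < k" "j < k" for i j
    proof -
      show "ip (e i) (e j) = (if i = j then 1 else 0)" using e(2) that by (auto simp: orthonormal_def)
      show *: "ip (e i) (JJ (e j)) = 0" using Kperp e(1) that by blast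
      show "ip (JJ (e i)) (e j) = 0" using * eH that by (simp add: ip_JJ_left)
    qed
    show ?thesis unfolding orthonormal_def
      by (intro ballI) (auto simp: ip_JJ JJ_H eH 1 split: if_splits)
  qed
  have inV: "case_sum e (JJ \<circ> e) i \<in> V" if "i \<in> {..<k} <+> {..<k}" "\<forall>i<k. e i \<in> K" for e i and k :: nat
    using that KV JJ_V by auto
  have bound: "k \<le> m" if e: "\<forall>i<k. e i \<in> K" "orthonormal e {..<k}" for e k
  proof -
    have "indep (case_sum e (JJ \<circ> e)) ({..<k} <+> {..<k})"
      using inV[of _ k e] e V_H by (intro orthonormal_indep two) auto
    then have "card ({..<k} <+> {..<k}) \<le> 2 * m"
      using inV[of _ k e] e by (intro indep_V_card[of _ "case_sum e (JJ \<circ> e)"]) auto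
    then show ?thesis by (simp add: card_Plus)
  qed
  obtain k and e :: "nat \<Rightarrow> 'a" where e: "\<And>i. i < k \<Longrightarrow> e i \<in> K" "orthonormal e {..<k}" "spans e {..<k} K"
  proof (rule orthonormal_basis_exists[OF Ks KH])
    fix k and e :: "nat \<Rightarrow> 'a" assume "\<forall>i<k. e i \<in> K" "orthonormal e {..<k}"
    then show "k \<le> m" by (rule bound)
  qed (rule that)
  have eH: "e i \<in> H" if "i < k" for i using e(1) that KH by auto
  have perpK: "ip x y = 0" if x: "x \<in> H" "\<And>i. i < k \<Longrightarrow> ip x (e i) = 0" and y: "y \<in> K" for x y
  proof -
    obtain c where c: "nrm (y - comb c e {..<k}) = 0" using e(3) y by (auto simp: spans_def)
    have "ip x y = ip x (comb c e {..<k})" using c x y KH eH by (intro null_congr) (auto intro!: comb_H)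
    also have "\<dots> = 0" using x eH by (subst ip_comb) auto
    finally show ?thesis .
  qed
  have VT: "JJ v \<in> K" "v = - JJ (JJ v)" if "v \<in> V" "v \<in> T" for v
    using that JJ_V subspace_neg[OF Ts] by (auto simp: K_def JJ_JJ)
  have Tdec: "\<exists>s v. s \<in> S \<and> v \<in> V \<and> v \<in> T \<and> y = s + v" if y: "y \<in> T" for y
  proof -
    obtain s v where sv: "s \<in> S" "v \<in> V" "y = s + v" using von_Neumann_decomposition y TT by blast
    have "y - s \<in> T" by (rule subspace_diff[OF Ts y]) (use sv ST in auto)
    then have "v \<in> T" using sv(3) by simp
    then show ?thesis using sv by blast
  qed
  \<comment> \<open>The doubled basis of \<open>K\<close> spans \<open>V\<close>, which bounds its length below by \<open>2 m\<close>.\<close>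
  have "spans (case_sum e (JJ \<circ> e)) ({..<k} <+> {..<k}) V"
    unfolding spans_def
  proof
    fix v assume v: "v \<in> V"
    let ?A = "{..<k} <+> {..<k}" and ?f = "case_sum e (JJ \<circ> e)"
    define r where "r = v - comb (\<lambda>i. ip (?f i) v) ?f ?A"
    have fV: "?f i \<in> V" if "i \<in> ?A" for i using inV[OF that] e(1) by blast
    then have fH: "?f i \<in> H" if "i \<in> ?A" for i using V_H that by blast
    have rV: "r \<in> V" unfolding r_def using v fV V_subspace by (intro subspace_diff comb_subspace) auto
    have vH: "v \<in> H" and rH: "r \<in> H" using rV v V_H by auto
    have fr: "ip (?f i) r = 0" if i: "i \<in> ?A" for i
    proof -
      have "ip (?f i) (comb (\<lambda>i. ip (?f i) v) ?f ?A) = (\<Sum>j\<in>?A. ip (?f j) v * ip (?f i) (?f j))"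
        using fH i by (intro ip_comb) auto
      also have "\<dots> = (\<Sum>j\<in>?A. if i = j then ip (?f i) v else 0)"
        using two[of k e] e(1,2) i by (intro sum.cong) (auto simp: orthonormal_def)
      also have "\<dots> = ip (?f i) v" using i by simp
      finally show ?thesis unfolding r_def using fH i vH by (subst ip_diff) (auto intro!: comb_H)
    qed
    have r1: "ip r (e i) = 0" "ip r (JJ (e i)) = 0" if "i < k" for i
      using fr[of "Inl i"] fr[of "Inr i"] fH[of "Inl i"] fH[of "Inr i"] that rH ip_swap_zero by auto
    have rK: "ip r y = 0" if "y \<in> K" for y using perpK[OF rH r1(1) that] .
    have rJK: "ip r (JJ y) = 0" if "y \<in> K" for y
    proof -
      have "ip (JJ r) (e i) = 0" if "i < k" for i using r1(2)[OF that] rH eH[OF that] by (simp add: ip_JJ_left)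
      then have "ip (JJ r) y = 0" using perpK[of "JJ r" y] rH that JJ_H by auto
      then show ?thesis using rH that KH ip_JJ_left[of r y] by auto
    qed
    have "ip (JJ (JJ r)) y = 0" if y: "y \<in> T" for y
    proof -
      obtain s u where su: "s \<in> S" "u \<in> V" "u \<in> T" "y = s + u" using Tdec[OF y] by blast
      have H: "s \<in> H" "u \<in> H" using su S_H V_H by auto
      have "ip r s = 0" using S_perp_V[OF su(1) rV] ip_swap_zero H rH by auto
      moreover have "ip r u = 0"
        using rJK[OF VT(1)[OF su(2,3)]] H rH by (simp add: JJ_JJ ip_minus)
      ultimately show ?thesis using su H rH by (simp add: JJ_JJ ip_minus_left ip_add)
    qed
    then have "JJ r \<in> T" using Ta rH by (auto simp: adj_def JJ_H)
    then have "r \<in> K" using rV by (simp add: K_def)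
    then have "nrm r = 0" using rK rH by (simp add: nrm_zero_iff)
    then show "\<exists>c. nrm (v - comb c ?f ?A) = 0" unfolding r_def by blast
  qed
  then have "2 * m \<le> card ({..<k} <+> {..<k})"
    using inV[of _ k e] e(1) by (intro spans_V_card[of _ "case_sum e (JJ \<circ> e)"]) auto
  then have "m \<le> k" by (simp add: card_Plus)
  moreover have "k \<le> m" using bound e by blast
  ultimately have km: "k = m" by simp
  show ?R
  proof (intro exI[of _ e] conjI allI impI)
    show "e j \<in> V" if "j < m" for j using e(1) KV that km by auto
    show "indep e {..<m}" using e eH km by (intro orthonormal_indep) auto
    show "ip (e i) (JJ (e l)) = 0" if "i < m" "l < m" for i l using Kperp e(1) that km by auto
    show "T = {x \<in> Tmax0. \<forall>j<m. ip (e j) x = 0}"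
    proof safe
      fix x assume x: "x \<in> T" then show "x \<in> Tmax0" using TT by auto
      fix j assume j: "j < m"
      have "ip (JJ (JJ (e j))) x = 0" using Tperp[of "JJ (e j)" x] e(1) j km x by (auto simp: K_def)
      then show "ip (e j) x = 0" using eH j km x TH by (auto simp: JJ_JJ ip_minus_left)
    next
      fix x assume x: "x \<in> Tmax0" "\<forall>j<m. ip (e j) x = 0"
      have xH: "x \<in> H" using x Tmax_H by auto
      have xK: "ip x y = 0" if "y \<in> K" for y
        using x(2) km eH ip_swap_zero xH by (intro perpK[OF xH _ that]) auto
      have "ip (JJ x) y = 0" if y: "y \<in> T" for y
      proof -
        obtain s u where su: "s \<in> S" "u \<in> V" "u \<in> T" "y = s + u" using Tdec[OF y] by blast
        have H: "s \<in> H" "u \<in> H" using su S_H V_H by auto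
        have "ip x (JJ s) = 0" using S_perp_JJ_Tmax[OF su(1) x(1)] ip_swap_zero[of x "JJ s"] H xH by (auto simp: JJ_H)
        then have "ip (JJ x) s = 0" using H xH by (simp add: ip_JJ_left)
        moreover have "ip (JJ x) u = 0"
          using xK[OF VT(1)[OF su(2,3)]] H xH by (simp add: ip_JJ_left)
        ultimately show ?thesis using su H xH by (simp add: ip_add JJ_H)
      qed
      then show "x \<in> T" using Ta xH by (auto simp: adj_def)
    qed
  qed
next
  assume ?R
  then obtain P where P: "\<And>j. j < m \<Longrightarrow> P j \<in> V" "indep P {..<m}"
    and iso: "\<And>k l. k < m \<Longrightarrow> l < m \<Longrightarrow> ip (P k) (JJ (P l)) = 0"
    and T: "T = {x \<in> Tmax0. \<forall>j<m. ip (P j) x = 0}" by auto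
  have PH: "P j \<in> H" "JJ (P j) \<in> H" if "j < m" for j using P(1)[OF that] V_H JJ_H by auto
  have Tmx: "x \<in> H" if "x \<in> Tmax0" for x using that Tmax_H by auto
  have Ts: "subspace T" unfolding T using Tmax_subspace PH Tmx
    by (intro subspaceI) (auto simp: subspace_0 subspace_add subspace_scale ip_add ip_scale)
  have TT: "T \<subseteq> Tmax0" by (auto simp: T)
  have ST: "S \<subseteq> T"
  proof
    fix s assume s: "s \<in> S"
    have "ip (P j) s = 0" if "j < m" for j
      using S_perp_V[OF s P(1)[OF that]] ip_swap_zero PH[OF that] s S_H by auto
    then show "s \<in> T" using s S_subset_Tmax by (auto simp: T)
  qed
  have Tdec: "\<exists>s v. s \<in> S \<and> v \<in> V \<and> v \<in> T \<and> y = s + v" if y: "y \<in> T" for y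
  proof -
    obtain s v where sv: "s \<in> S" "v \<in> V" "y = s + v" using von_Neumann_decomposition y TT by blast
    have "y - s \<in> T" by (rule subspace_diff[OF Ts y]) (use sv ST in auto)
    then have "v \<in> T" using sv(3) by simp
    then show ?thesis using sv by blast
  qed
  have "T \<subseteq> adj T"
  proof
    fix x assume x: "x \<in> T"
    then have xH: "x \<in> H" using TH by auto
    have "ip (JJ x) y = 0" if y: "y \<in> T" for y
    proof -
      obtain s v where sv: "s \<in> S" "v \<in> V" "v \<in> T" "x = s + v" using Tdec[OF x] by blast
      obtain s' v' where sv': "s' \<in> S" "v' \<in> V" "v' \<in> T" "y = s' + v'" using Tdec[OF y] by blast
      have H: "s \<in> H" "v \<in> H" "s' \<in> H" "v' \<in> H" "y \<in> H" using sv sv' S_H V_H y TH by auto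
      have "ip (JJ s) y = 0" using S_perp_JJ_Tmax[OF sv(1)] y TT by auto
      moreover have "ip (JJ v) s' = 0"
        using S_perp_V[OF sv'(1) JJ_V[OF sv(2)]] H ip_swap_zero JJ_H by auto
      moreover have "ip (JJ v) v' = 0"
      proof -
        obtain c where c: "nrm (v - comb c (JJ \<circ> P) {..<m}) = 0"
          using isotropic_complement[OF P iso sv(2)] sv(3) T by auto
        have cH: "comb c (JJ \<circ> P) {..<m} \<in> H" "comb c P {..<m} \<in> H" using PH by (auto intro!: comb_H)
        have "nrm (JJ v - JJ (comb c (JJ \<circ> P) {..<m})) = 0"
          using c H cH nrm_JJ[of "v - comb c (JJ \<circ> P) {..<m}"] by (simp add: JJ_diff)
        moreover have "JJ (comb c (JJ \<circ> P) {..<m}) = - comb c P {..<m}"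
          using JJ_JJ[of "comb c P {..<m}"] by (simp add: JJ_comb)
        ultimately have "ip (JJ v) v' = ip (- comb c P {..<m}) v'"
          using H cH by (intro null_congr) (auto simp: JJ_H)
        also have "\<dots> = - (\<Sum>j<m. cnj (c j) * ip (P j) v')"
          using H cH PH ip_comb_left[of v' "{..<m}" P c] by (simp add: ip_minus_left)
        also have "\<dots> = 0" using sv'(3) by (simp add: T)
        finally show ?thesis .
      qed
      ultimately show ?thesis using H sv(4) sv'(4) by (simp add: JJ_add ip_add_left ip_add JJ_H)
    qed
    then show "x \<in> adj T" using xH by (auto simp: adj_def)
  qed
  moreover have "adj T \<subseteq> T"
  proof
    fix x assume x: "x \<in> adj T"
    then have xT: "x \<in> Tmax0" using adj_antimono[OF ST] adj_S by auto
    have xH: "x \<in> H" using xT Tmx by auto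
    have "ip (P j) x = 0" if j: "j < m" for j
    proof -
      have "JJ (P j) \<in> T" using P(1)[OF j] iso j by (auto simp: T V_def)
      then have "ip (JJ x) (JJ (P j)) = 0" using x by (auto simp: adj_def)
      then show ?thesis using xH PH[OF j] ip_swap_zero by (simp add: ip_JJ)
    qed
    then show "x \<in> T" using xT by (auto simp: T)
  qed
  ultimately show ?L using Ts TT by blast
qed

end

context open_interval
begin

section \<open>Densities\<close>

definition loc_finite :: "real measure \<Rightarrow> bool" where
  "loc_finite M \<longleftrightarrow> sets M = sets (restrict_space borel I) \<and> (\<forall>E\<in>LB. emeasure M E < \<infinity>)"

lemma loc_finite_sets: "loc_finite M \<Longrightarrow> E \<in> sets M \<longleftrightarrow> E \<in> sets borel \<and> E \<subseteq> I"
  by (simp add: loc_finite_def sets_restrict_I)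

lemma loc_finite_space: "loc_finite M \<Longrightarrow> space M = I"
  using sets_eq_imp_space_eq[of M "restrict_space borel I"] by (simp add: loc_finite_def space_restrict_space)

lemma loc_finite_LB: "loc_finite M \<Longrightarrow> E \<in> LB \<Longrightarrow> E \<in> sets M"
  using LB_in_sets by (simp add: loc_finite_def)

lemma loc_finite_emeasure: "loc_finite M \<Longrightarrow> E \<in> LB \<Longrightarrow> emeasure M E < \<infinity>"
  by (simp add: loc_finite_def)

lemma loc_finite_emeasure_eq: "loc_finite M \<Longrightarrow> E \<in> LB \<Longrightarrow> emeasure M E = ennreal (measure M E)"
  using loc_finite_emeasure[of M E] by (intro emeasure_eq_ennreal_measure) auto

lemma loc_finite_sigma_finite: assumes "loc_finite M" shows "sigma_finite_measure M"
proof -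
  obtain K where K: "\<And>n::nat. K n \<in> LB" "(\<Union>n. K n) = I" using LB_exhaustion by metis
  show ?thesis
    using loc_finite_LB[OF assms K(1)] loc_finite_emeasure[OF assms K(1)] K(2) loc_finite_space[OF assms]
    by unfold_locales (intro exI[of _ "range K"], auto simp: less_top)
qed

lemma loc_finite_variation:
  fixes \<mu> :: "real set \<Rightarrow> 'v::euclidean_space"
  shows "distr0 a b \<mu> \<Longrightarrow> loc_finite (variation a b \<mu>)"
  using emeasure_variation_finite[of \<mu>] by (simp add: loc_finite_def)

lemma null_if_locally_null:
  assumes M: "loc_finite M" and E: "E \<in> sets M" and 0: "\<And>F. F \<in> LB \<Longrightarrow> F \<subseteq> E \<Longrightarrow> emeasure M F = 0"
  shows "emeasure M E = 0"
proof -
  obtain K where K: "\<And>n::nat. K n \<in> LB" "(\<Union>n. K n) = I" using LB_exhaustion by metis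
  have "K n \<inter> E \<in> LB" for n using LB_Int[OF K(1)] E loc_finite_sets[OF M] by blast
  then have "emeasure M (\<Union>n. K n \<inter> E) = 0"
    using loc_finite_LB[OF M] by (intro emeasure_UN_eq_0) (auto intro!: 0)
  moreover have "(\<Union>n. K n \<inter> E) = E" using K(2) E loc_finite_sets[OF M] by blast
  ultimately show ?thesis by simp
qed

lemma AE_locally:
  assumes M: "loc_finite M" and P: "\<And>E. E \<in> LB \<Longrightarrow> AE x in M. x \<in> E \<longrightarrow> P x"
  shows "AE x in M. P x"
proof -
  obtain K where K: "\<And>n::nat. K n \<in> LB" "(\<Union>n. K n) = I" using LB_exhaustion by metis
  have "AE x in M. \<forall>n. x \<in> K n \<longrightarrow> P x" unfolding AE_all_countable using P K by auto
  then show ?thesis using AE_space[of M]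
    by eventually_elim (use K(2) loc_finite_space[OF M] in blast)
qed

lemma distr0_measure: assumes M: "loc_finite M" shows "distr0 a b (measure M)"
  unfolding distr0_def
proof (intro allI impI, elim conjE)
  fix A :: "nat \<Rightarrow> real set"
  assume A: "disjoint_family A" "\<forall>i. A i \<in> sets borel" "(\<Union>i. A i) \<in> LB"
  show "(\<lambda>i. measure M (A i)) sums measure M (\<Union>i. A i)"
  proof (rule measure_UNION)
    have "A i \<in> LB" for i using A by (intro LB_mono[OF A(3)]) auto
    then show "range A \<subseteq> sets M" using loc_finite_LB[OF M] by auto
    show "emeasure M (\<Union>i. A i) \<noteq> \<infinity>" using loc_finite_emeasure[OF M A(3)] by auto
  qed (use A in auto)
qed

lemma nonneg_density_exists:
  assumes M: "loc_finite M" and N: "loc_finite N" and ac: "absolutely_continuous M N"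
  obtains h :: "real \<Rightarrow> real" where "h \<in> borel_measurable M" "\<And>x. 0 \<le> h x" "N = density M (\<lambda>x. ennreal (h x))"
proof -
  interpret M: sigma_finite_measure M by (rule loc_finite_sigma_finite[OF M])
  have sN: "sigma_finite_measure N" by (rule loc_finite_sigma_finite[OF N])
  have "sets N = sets M" using M N by (simp add: loc_finite_def)
  from M.Radon_Nikodym[OF ac this] obtain f where f[measurable]: "f \<in> borel_measurable M" and fN: "density M f = N" by auto
  have fin: "AE x in M. f x \<noteq> \<infinity>" using M.sigma_finite_iff_density_finite[OF f] sN fN by simp
  have "N = density M (\<lambda>x. ennreal (enn2real (f x)))"
    unfolding fN[symmetric] using fin by (intro density_cong) (auto simp: less_top elim!: eventually_mono)
  then show ?thesis using that[of "\<lambda>x. enn2real (f x)"] by auto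
qed

lemma set_integrable_const: "loc_finite M \<Longrightarrow> E \<in> LB \<Longrightarrow> set_integrable M E (\<lambda>_. c :: 'v::{banach,second_countable_topology})"
  unfolding set_integrable_def using loc_finite_LB[of M E] loc_finite_emeasure[of M E]
  by (intro integrable_scaleR_left) (auto simp: integrable_indicator_iff)

lemma set_integral_const: "loc_finite M \<Longrightarrow> E \<in> LB \<Longrightarrow> (LINT x:E|M. c :: 'v::{banach,second_countable_topology}) = measure M E *\<^sub>R c"
  using loc_finite_LB[of M E] loc_finite_emeasure[of M E]
  by (intro Set_Integral.set_integral_const) auto

lemma density_set_integral:
  fixes g :: "real \<Rightarrow> 'v::{banach,second_countable_topology}"
  assumes h[measurable]: "h \<in> borel_measurable M" and "\<And>x. 0 \<le> h x" and g: "g \<in> borel_measurable M" and E: "E \<in> sets M"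
  shows "set_integrable (density M (\<lambda>x. ennreal (h x))) E g \<longleftrightarrow> set_integrable M E (\<lambda>x. h x *\<^sub>R g x)"
    and "(LINT x:E|density M (\<lambda>x. ennreal (h x)). g x) = (LINT x:E|M. h x *\<^sub>R g x)"
proof -
  have gE: "(\<lambda>x. indicat_real E x *\<^sub>R g x) \<in> borel_measurable M" using g E by measurable
  have eq: "h x *\<^sub>R indicat_real E x *\<^sub>R g x = indicat_real E x *\<^sub>R h x *\<^sub>R g x" for x by (rule scaleR_left_commute)
  show "set_integrable (density M (\<lambda>x. ennreal (h x))) E g \<longleftrightarrow> set_integrable M E (\<lambda>x. h x *\<^sub>R g x)"
    unfolding set_integrable_def eq[symmetric] using integrable_density[OF gE h] assms(2) by simp
  show "(LINT x:E|density M (\<lambda>x. ennreal (h x)). g x) = (LINT x:E|M. h x *\<^sub>R g x)"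
    unfolding set_lebesgue_integral_def eq[symmetric] using integral_density[OF gE h] assms(2) by simp
qed

text \<open>
  Adding \<open>C\<close> times the measure makes \<open>\<tau>\<close> nonnegative, so the Radon--Nikodym theorem for measures
  applies.
\<close>

lemma real_density_exists:
  fixes \<tau> :: "real set \<Rightarrow> real"
  assumes M: "loc_finite M" and d: "distr0 a b \<tau>" and le: "\<And>E. E \<in> LB \<Longrightarrow> \<bar>\<tau> E\<bar> \<le> C * measure M E"
  shows "\<exists>h\<in>borel_measurable M. \<forall>E\<in>LB. set_integrable M E h \<and> \<tau> E = (LINT x:E|M. h x)"
proof -
  define \<rho> where "\<rho> E = \<tau> E + C * measure M E" for E
  have d\<rho>: "distr0 a b \<rho>" unfolding \<rho>_def
    using distr0_add[OF d distr0_linear[OF distr0_measure[OF M] bounded_linear_mult_right[of C]]] by simp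
  have pos: "0 \<le> \<rho> E" if "E \<in> LB" for E using le[OF that] by (auto simp: \<rho>_def)
  define N where "N = variation a b \<rho>"
  have eN: "emeasure N E = ennreal (\<rho> E)" if "E \<in> LB" for E
    unfolding N_def by (rule emeasure_variation_nonneg[OF d\<rho> pos that])
  have N: "loc_finite N" unfolding N_def by (rule loc_finite_variation[OF d\<rho>])
  have ac: "absolutely_continuous M N" unfolding absolutely_continuous_def
  proof
    fix E assume E: "E \<in> null_sets M"
    have EN: "E \<in> sets N" using E M N by (auto simp: loc_finite_def)
    moreover have "emeasure N E = 0"
    proof (rule null_if_locally_null[OF N EN])
      fix F assume F: "F \<in> LB" "F \<subseteq> E"
      have "emeasure M F = 0" using E F(2) loc_finite_LB[OF M F(1)] by (auto intro: emeasure_eq_0)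
      then have "measure M F = 0" by (simp add: measure_def)
      then have "\<rho> F = 0" using le[OF F(1)] by (simp add: \<rho>_def)
      then show "emeasure N F = 0" using eN[OF F(1)] by simp
    qed
    ultimately show "E \<in> null_sets N" by auto
  qed
  obtain h where h: "h \<in> borel_measurable M" "\<And>x. 0 \<le> h x" "N = density M (\<lambda>x. ennreal (h x))"
    using nonneg_density_exists[OF M N ac] by blast
  have hE: "set_integrable M E h \<and> \<rho> E = (LINT x:E|M. h x)" if E: "E \<in> LB" for E
  proof -
    have EM: "E \<in> sets M" by (rule loc_finite_LB[OF M E])
    have "set_integrable N E (\<lambda>_. 1::real)" by (rule set_integrable_const[OF N E])
    moreover have "(LINT x:E|N. (1::real)) = \<rho> E"
      using set_integral_const[OF N E, of "1::real"] eN[OF E] pos[OF E] by (simp add: measure_def)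
    ultimately show ?thesis
      using density_set_integral[OF h(1,2) _ EM, of "\<lambda>_. 1::real"] h(3) by simp
  qed
  show ?thesis
  proof (intro bexI[of _ "\<lambda>x. h x - C"] ballI)
    fix E assume E: "E \<in> LB"
    show "set_integrable M E (\<lambda>x. h x - C) \<and> \<tau> E = (LINT x:E|M. h x - C)"
      using hE[OF E] set_integrable_const[OF M E, of C] set_integral_const[OF M E, of C]
      by (simp add: set_integral_diff \<rho>_def algebra_simps)
  qed (use h in measurable)
qed

lemma density_exists:
  fixes \<mu> :: "real set \<Rightarrow> 'v::euclidean_space"
  assumes M: "loc_finite M" and d: "distr0 a b \<mu>" and le: "\<And>E. E \<in> LB \<Longrightarrow> norm (\<mu> E) \<le> C * measure M E"
  shows "\<exists>h\<in>borel_measurable M. \<forall>E\<in>LB. set_integrable M E h \<and> \<mu> E = (LINT x:E|M. h x)"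
proof -
  have "\<exists>h\<in>borel_measurable M. \<forall>E\<in>LB. set_integrable M E h \<and> \<mu> E \<bullet> i = (LINT x:E|M. h x)" if "i \<in> Basis" for i
  proof (rule real_density_exists[OF M, of _ C])
    show "distr0 a b (\<lambda>E. \<mu> E \<bullet> i)" by (rule distr0_linear[OF d bounded_linear_inner_left])
    show "\<bar>\<mu> E \<bullet> i\<bar> \<le> C * measure M E" if "E \<in> LB" for E
      using le[OF that] Basis_le_norm[OF \<open>i \<in> Basis\<close>, of "\<mu> E"] by simp
  qed
  then obtain h where h: "\<And>i. i \<in> Basis \<Longrightarrow> h i \<in> borel_measurable M"
    "\<And>i E. i \<in> Basis \<Longrightarrow> E \<in> LB \<Longrightarrow> set_integrable M E (h i) \<and> \<mu> E \<bullet> i = (LINT x:E|M. h i x)"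
    by metis
  show ?thesis
  proof (intro bexI[of _ "\<lambda>x. \<Sum>i\<in>Basis. h i x *\<^sub>R i"] ballI conjI)
    fix E assume E: "E \<in> LB"
    have eq: "indicat_real E x *\<^sub>R (\<Sum>i\<in>Basis. h i x *\<^sub>R i) = (\<Sum>i\<in>Basis. (indicat_real E x *\<^sub>R h i x) *\<^sub>R i)"
      for x :: real by (simp add: scaleR_sum_right)
    have int: "integrable M (\<lambda>x. (indicat_real E x *\<^sub>R h i x) *\<^sub>R i)" if "i \<in> Basis" for i
      using h(2)[OF that E] unfolding set_integrable_def by (intro integrable_scaleR_left) auto
    show "set_integrable M E (\<lambda>x. \<Sum>i\<in>Basis. h i x *\<^sub>R i)"
      unfolding set_integrable_def eq using int by auto
    have "(LINT x:E|M. (\<Sum>i\<in>Basis. h i x *\<^sub>R i)) = (\<Sum>i\<in>Basis. (LINT x:E|M. h i x) *\<^sub>R i)"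
      unfolding set_lebesgue_integral_def eq using int h(2)[OF _ E]
      by (subst Bochner_Integration.integral_sum) (auto simp: set_integrable_def intro!: sum.cong)
    also have "\<dots> = (\<Sum>i\<in>Basis. (\<mu> E \<bullet> i) *\<^sub>R i)" using h(2)[OF _ E] by (intro sum.cong) auto
    also have "\<dots> = \<mu> E" by (rule euclidean_representation)
    finally show "\<mu> E = (LINT x:E|M. (\<Sum>i\<in>Basis. h i x *\<^sub>R i))" by simp
  qed (use h(1) in measurable)
qed

lemma RN_density_props:
  fixes \<mu> :: "real set \<Rightarrow> 'v::euclidean_space"
  assumes M: "loc_finite M" and d: "distr0 a b \<mu>" and le: "\<And>E. E \<in> LB \<Longrightarrow> norm (\<mu> E) \<le> C * measure M E"
  shows "RN_density a b M \<mu> \<in> borel_measurable M"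
    "\<And>E. E \<in> LB \<Longrightarrow> set_integrable M E (RN_density a b M \<mu>)"
    "\<And>E. E \<in> LB \<Longrightarrow> \<mu> E = (LINT x:E|M. RN_density a b M \<mu> x)"
proof -
  have *: "\<exists>h. h \<in> borel_measurable M \<and> (\<forall>E\<in>LB. set_integrable M E h \<and> \<mu> E = (LINT x:E|M. h x))"
    using density_exists[OF M d le] by auto
  have "RN_density a b M \<mu> \<in> borel_measurable M \<and> (\<forall>E\<in>LB. set_integrable M E (RN_density a b M \<mu>)
      \<and> \<mu> E = (LINT x:E|M. RN_density a b M \<mu> x))"
    unfolding RN_density_def by (rule someI_ex[OF *])
  then show "RN_density a b M \<mu> \<in> borel_measurable M"
    "\<And>E. E \<in> LB \<Longrightarrow> set_integrable M E (RN_density a b M \<mu>)"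
    "\<And>E. E \<in> LB \<Longrightarrow> \<mu> E = (LINT x:E|M. RN_density a b M \<mu> x)"
    by blast+
qed

text \<open>
  Used to see pointwise properties of densities: nonnegativity of \<open>w\<close> and symmetry of \<open>q\<close> hold on
  sets, that is for averages, and are closed conditions.
\<close>

lemma density_in_closed:
  fixes h :: "real \<Rightarrow> 'v::euclidean_space"
  assumes M: "loc_finite M" and h: "\<And>E. E \<in> LB \<Longrightarrow> set_integrable M E h"
    and S: "closed S" and av: "\<And>E. E \<in> LB \<Longrightarrow> measure M E > 0 \<Longrightarrow> (1 / measure M E) *\<^sub>R (LINT x:E|M. h x) \<in> S"
  shows "AE x in M. h x \<in> S"
proof (rule AE_locally[OF M])
  fix E assume E: "E \<in> LB"
  have EM: "E \<in> sets M" "E \<inter> space M \<in> sets M" using loc_finite_LB[OF M E] by auto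
  define R where "R = restrict_space M E"
  have sR: "A \<in> sets R \<longleftrightarrow> A \<in> sets M \<and> A \<subseteq> E" for A
    unfolding R_def using EM by (subst sets_restrict_space_iff) auto
  interpret R: finite_measure R
    by standard (use EM loc_finite_emeasure[OF M E] in \<open>auto simp: R_def emeasure_restrict_space space_restrict_space sets.sets_into_space Int_absorb2 less_top\<close>)
  have "AE x in R. h x \<in> S"
  proof (rule R.averaging_theorem[OF _ S])
    show "integrable R h" using h[OF E] EM unfolding R_def set_integrable_def
      by (subst integrable_restrict_space) auto
    fix A assume A: "A \<in> sets R" "0 < measure R A"
    have AM: "A \<in> sets M" "A \<subseteq> E" using A sR by auto
    have ALB: "A \<in> LB" using AM loc_finite_sets[OF M] by (intro LB_mono[OF E]) auto
    have mA: "measure R A = measure M A" unfolding R_def using AM EM by (intro measure_restrict_space) auto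
    have "set_lebesgue_integral R A h = (LINT x:A|M. h x)"
      unfolding R_def set_lebesgue_integral_def using EM AM(2)
      by (subst integral_restrict_space) (auto intro!: Bochner_Integration.integral_cong simp: indicator_def)
    then show "(1 / measure R A) *\<^sub>R set_lebesgue_integral R A h \<in> S" using av[OF ALB] A mA by simp
  qed
  then show "AE x in M. x \<in> E \<longrightarrow> h x \<in> S" unfolding R_def using EM by (subst (asm) AE_restrict_space_iff) auto
qed

end

section \<open>Positive semidefinite matrices\<close>

lemma herm_add: "herm x (y + z) = herm x y + herm x z"
  by (simp add: herm_def distrib_left sum.distrib)

lemma herm_add_left: "herm (x + y) z = herm x z + herm y z"
  by (simp add: herm_def distrib_right sum.distrib)

lemma herm_diff: "herm x (y - z) = herm x y - herm x z"
  by (simp add: herm_def right_diff_distrib sum_subtractf)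

lemma herm_diff_left: "herm (x - y) z = herm x z - herm y z"
  by (simp add: herm_def left_diff_distrib sum_subtractf)

lemma herm_scale: "herm x (c *s y) = c * herm x y"
  by (simp add: herm_def sum_distrib_left algebra_simps)

lemma herm_scale_left: "herm (c *s x) y = cnj c * herm x y"
  by (simp add: herm_def sum_distrib_left algebra_simps)

lemma herm_scaleR: "herm x (c *\<^sub>R y) = of_real c * herm x y"
  unfolding herm_def vector_scaleR_component sum_distrib_left
  by (intro sum.cong) (simp_all add: scaleR_conv_of_real)

lemma herm_scaleR_left: "herm (c *\<^sub>R x) y = of_real c * herm x y"
  unfolding herm_def vector_scaleR_component sum_distrib_left
  by (intro sum.cong) (simp_all add: scaleR_conv_of_real)

lemma herm_cnj: "herm y x = cnj (herm x y)"
  by (simp add: herm_def mult.commute)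

lemma herm_0 [simp]: "herm 0 x = 0" "herm x 0 = 0"
  by (simp_all add: herm_def)

lemma herm_minus: "herm x (- y) = - herm x y" "herm (- x) y = - herm x y"
  by (simp_all add: herm_def sum_negf)

lemma herm_adjoint: "herm (A *v x) y = herm x (cadjoint A *v y)"
proof -
  have "herm (A *v x) y = (\<Sum>i\<in>UNIV. \<Sum>j\<in>UNIV. cnj (A $ i $ j) * cnj (x $ j) * y $ i)"
    by (simp add: herm_def matrix_vector_mult_def sum_distrib_right)
  also have "\<dots> = (\<Sum>j\<in>UNIV. \<Sum>i\<in>UNIV. cnj (A $ i $ j) * cnj (x $ j) * y $ i)" by (rule sum.swap)
  also have "\<dots> = herm x (cadjoint A *v y)"
    by (simp add: herm_def matrix_vector_mult_def cadjoint_def sum_distrib_left algebra_simps)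
  finally show ?thesis .
qed

lemma herm_axis: "herm (axis i 1) x = x $ i"
proof -
  have "herm (axis i 1) x = (\<Sum>j\<in>UNIV. if j = i then x $ i else 0)"
    unfolding herm_def by (intro sum.cong) (auto simp: axis_def)
  then show ?thesis by simp
qed

lemma herm_self: "herm x x = of_real ((norm x)\<^sup>2)"
proof -
  have "(norm x)\<^sup>2 = (\<Sum>i\<in>UNIV. (cmod (x $ i))\<^sup>2)"
    by (simp add: norm_vec_def L2_set_def sum_nonneg)
  then show ?thesis
    by (simp add: herm_def of_real_sum) (intro sum.cong, auto simp: complex_norm_square[symmetric] mult.commute)
qed

definition psd :: "complex^'n^'n \<Rightarrow> bool" where
  "psd B \<longleftrightarrow> (\<forall>\<alpha>. herm \<alpha> (B *v \<alpha>) \<in> \<real>\<^sub>\<ge>\<^sub>0)"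

lemma psd_nonneg: "psd B \<Longrightarrow> 0 \<le> Re (herm x (B *v x))" "psd B \<Longrightarrow> Im (herm x (B *v x)) = 0"
  by (auto simp: psd_def complex_nonneg_Reals_iff)

text \<open>Polarization: a form that is real on the diagonal is Hermitian.\<close>

lemma psd_hermitian: assumes "psd B" shows "herm y (B *v x) = cnj (herm x (B *v y))"
proof -
  have 1: "Im (herm (x + y) (B *v (x + y))) = 0" using psd_nonneg(2)[OF assms] .
  have 2: "Im (herm (x + \<i> *s y) (B *v (x + \<i> *s y))) = 0" using psd_nonneg(2)[OF assms] .
  have lin: "B *v (\<i> *s y) = \<i> *s (B *v y)" by (simp add: matrix_vector_mult_def vector_scalar_mult_def vec_eq_iff sum_distrib_left algebra_simps)
  have "Im (herm x (B *v y)) + Im (herm y (B *v x)) = 0"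
    using 1 psd_nonneg(2)[OF assms] by (simp add: matrix_vector_right_distrib herm_add herm_add_left)
  moreover have "Re (herm x (B *v y)) - Re (herm y (B *v x)) = 0"
    using 2 psd_nonneg(2)[OF assms]
    by (simp add: matrix_vector_right_distrib herm_add herm_add_left lin herm_scale herm_scale_left)
  ultimately show ?thesis by (simp add: complex_eq_iff)
qed

lemma matrix_vector_mult_scale: "B *v (c *s y) = c *s (B *v y)" for B :: "complex^'n^'m"
  by (simp add: matrix_vector_mult_def vector_scalar_mult_def vec_eq_iff sum_distrib_left algebra_simps)

lemma psd_semi_inner: assumes "psd B" shows "semi_inner_space (*s) UNIV (\<lambda>x y. herm x (B *v y))"
proof -
  interpret vector_space "(*s) :: complex \<Rightarrow> complex^'n \<Rightarrow> complex^'n" by (rule vec.vector_space_axioms)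
  show ?thesis
    by unfold_locales
      (auto simp: matrix_vector_right_distrib herm_add matrix_vector_mult_scale herm_scale psd_nonneg[OF assms]
         intro: psd_hermitian[OF assms])
qed

lemma psd_cauchy_schwarz:
  assumes "psd B" shows "(cmod (herm x (B *v y)))\<^sup>2 \<le> Re (herm x (B *v x)) * Re (herm y (B *v y))"
proof -
  interpret semi_inner_space "(*s)" UNIV "\<lambda>x y. herm x (B *v y)" by (rule psd_semi_inner[OF assms])
  show ?thesis using cauchy_schwarz_sq[of x y] by simp
qed

lemma psd_amgm:
  assumes "psd B" shows "cmod (herm x (B *v y)) \<le> Re (herm x (B *v x)) + Re (herm y (B *v y))"
proof (rule power2_le_imp_le)
  have "Re (herm x (B *v x)) * Re (herm y (B *v y)) \<le> (Re (herm x (B *v x)) + Re (herm y (B *v y)))\<^sup>2"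
    using psd_nonneg[OF assms] by (simp add: power2_sum)
  then show "(cmod (herm x (B *v y)))\<^sup>2 \<le> (Re (herm x (B *v x)) + Re (herm y (B *v y)))\<^sup>2"
    using psd_cauchy_schwarz[OF assms, of x y] by linarith
qed (use psd_nonneg[OF assms] in auto)

lemma matrix_axis_entry: "herm (axis i 1) (B *v axis j 1) = B $ i $ j"
proof -
  have "(B *v axis j 1) $ i = B $ i $ j"
    by (simp add: matrix_vector_mult_def axis_def mult_delta_right)
  then show ?thesis by (simp add: herm_axis)
qed

text \<open>
  Cauchy--Schwarz for the form of \<open>B\<close> in each coordinate. For trace 1 this is \<open>|B z|\<^sup>2 \<le> z\<^sup>* B z\<close>, on which
  the local integrability of \<open>w f\<close> and the completeness of \<open>L\<^sup>2(w)\<close> rest.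
\<close>

lemma psd_norm_mult_sq:
  assumes "psd B" shows "(norm (B *v z))\<^sup>2 \<le> Re (trace B) * Re (herm z (B *v z))"
proof -
  have "(norm (B *v z))\<^sup>2 = (\<Sum>i\<in>UNIV. (cmod (herm (axis i 1) (B *v z)))\<^sup>2)"
    by (simp add: norm_vec_def L2_set_def sum_nonneg herm_axis)
  also have "\<dots> \<le> (\<Sum>i\<in>UNIV. Re (B $ i $ i) * Re (herm z (B *v z)))"
    using psd_cauchy_schwarz[OF assms] by (intro sum_mono) (metis matrix_axis_entry)
  also have "\<dots> = Re (trace B) * Re (herm z (B *v z))"
    by (simp add: trace_def sum_distrib_right)
  finally show ?thesis .
qed

lemma psd_entry_le: assumes "psd B" shows "cmod (B $ i $ j) \<le> Re (trace B)"
proof (rule power2_le_imp_le)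
  have d: "0 \<le> Re (B $ k $ k)" for k using psd_nonneg(1)[OF assms, of "axis k 1"] by (simp add: matrix_axis_entry)
  have tr: "Re (B $ k $ k) \<le> Re (trace B)" for k
    unfolding trace_def using d by (subst Re_sum) (auto intro!: member_le_sum)
  have "(cmod (B $ i $ j))\<^sup>2 \<le> Re (B $ i $ i) * Re (B $ j $ j)"
    using psd_cauchy_schwarz[OF assms, of "axis i 1" "axis j 1"] by (simp add: matrix_axis_entry)
  also have "\<dots> \<le> Re (trace B) * Re (trace B)" using d tr by (intro mult_mono) (auto intro: order_trans)
  finally show "(cmod (B $ i $ j))\<^sup>2 \<le> (Re (trace B))\<^sup>2" by (simp add: power2_eq_square)
  show "0 \<le> Re (trace B)" using d tr order_trans by blast
qed

lemma norm_matrix_le: "norm (B :: complex^'n^'m) \<le> (\<Sum>i\<in>UNIV. \<Sum>j\<in>UNIV. cmod (B $ i $ j))"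
proof -
  have "norm B \<le> (\<Sum>i\<in>UNIV. norm (B $ i))" by (simp add: norm_vec_def L2_set_le_sum)
  also have "\<dots> \<le> (\<Sum>i\<in>UNIV. \<Sum>j\<in>UNIV. cmod (B $ i $ j))"
    by (intro sum_mono) (simp add: norm_vec_def L2_set_le_sum)
  finally show ?thesis .
qed

lemma psd_norm_le: fixes B :: "complex^'n^'n" assumes "psd B" shows "norm B \<le> of_nat (CARD('n) * CARD('n)) * Re (trace B)"
proof -
  have "norm B \<le> (\<Sum>i\<in>(UNIV::'n set). \<Sum>j\<in>(UNIV::'n set). Re (trace B))"
    by (rule order_trans[OF norm_matrix_le]) (intro sum_mono psd_entry_le assms)
  then show ?thesis by (simp add: algebra_simps)
qed

section \<open>Balanced primitives\<close>

locale interval_measure = open_interval +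
  fixes M :: "real measure"
  assumes loc_finite_M: "loc_finite M"
begin

sublocale sigma_finite_measure M by (rule loc_finite_sigma_finite[OF loc_finite_M])

lemma sets_M: "E \<in> sets M \<longleftrightarrow> E \<in> sets borel \<and> E \<subseteq> I"
  by (rule loc_finite_sets[OF loc_finite_M])

lemma LB_M: "E \<in> LB \<Longrightarrow> E \<in> sets M"
  by (rule loc_finite_LB[OF loc_finite_M])

lemma space_M [simp]: "space M = I"
  by (rule loc_finite_space[OF loc_finite_M])

lemma id_measurable [measurable]: "(\<lambda>x. x) \<in> borel_measurable M"
proof (rule measurableI)
  fix A :: "real set" assume "A \<in> sets borel"
  then show "(\<lambda>x. x) -` A \<inter> space M \<in> sets M" by (auto simp: sets_M)
qed auto

lemma I_interval: "s \<in> I \<Longrightarrow> t \<in> I \<Longrightarrow> s \<le> x \<Longrightarrow> x \<le> t \<Longrightarrow> x \<in> I"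
  by (auto simp: einterval_def) (meson ereal_less_eq(3) le_less_trans less_le_trans)+

lemma I_right: assumes "x \<in> I" shows "\<exists>d\<in>I. x < d"
proof -
  have "ereal x < b" "a < ereal x" using assms by (auto simp: einterval_def)
  then obtain d where "ereal x < ereal d" "ereal d < b" using ereal_dense2 by blast
  then show ?thesis using \<open>a < ereal x\<close> by (intro bexI[of _ d]) (auto simp: einterval_def intro: less_trans)
qed

lemma I_left: assumes "x \<in> I" shows "\<exists>d\<in>I. d < x"
proof -
  have "ereal x < b" "a < ereal x" using assms by (auto simp: einterval_def)
  then obtain d where d: "ereal d < ereal x" "a < ereal d" using ereal_dense2 by blast
  then show ?thesis using \<open>ereal x < b\<close> less_trans[OF d(1), of b]
    by (intro bexI[of _ d]) (auto simp: einterval_def)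
qed

lemma I_endpoints: "a < ereal c \<Longrightarrow> c \<le> d \<Longrightarrow> ereal d < b \<Longrightarrow> c \<in> I \<and> d \<in> I"
  using less_le_trans[of a "ereal c" "ereal d"] le_less_trans[of "ereal c" "ereal d" b]
  by (auto simp: einterval_def)

lemma at_left_less: "eventually (\<lambda>t. t < x) (at_left x)" for x :: real
  by (simp add: eventually_at_filter)

lemma LB_intervals:
  assumes "s \<in> I" "t \<in> I"
  shows "{s..t} \<in> LB" "{s..<t} \<in> LB" "{s<..t} \<in> LB" "{s<..<t} \<in> LB"
  by (auto intro: LB_mono[OF LB_Icc[OF assms]])

lemma LB_singleton: "x \<in> I \<Longrightarrow> {x} \<in> LB"
  using LB_intervals(1)[of x x] by simp

definition loc_int :: "(real \<Rightarrow> 'v::euclidean_space) \<Rightarrow> bool" where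
  "loc_int k \<longleftrightarrow> (\<forall>E\<in>LB. set_integrable M E k)"

lemma loc_int_E: "loc_int k \<Longrightarrow> E \<in> LB \<Longrightarrow> set_integrable M E k"
  by (simp add: loc_int_def)

lemma loc_int_linear: assumes "loc_int k" "bounded_linear L" shows "loc_int (\<lambda>x. L (k x))"
proof -
  have "L (indicat_real E x *\<^sub>R k x) = indicat_real E x *\<^sub>R L (k x)" for E x
    using assms(2) by (simp add: linear_simps)
  then show ?thesis using assms(1) integrable_bounded_linear[OF assms(2)]
    unfolding loc_int_def set_integrable_def by fastforce
qed

lemma set_integral_linear:
  assumes "set_integrable M E k" "bounded_linear L"
  shows "(LINT x:E|M. L (k x)) = L (LINT x:E|M. k x)"
proof -
  have "L (indicat_real E x *\<^sub>R k x) = indicat_real E x *\<^sub>R L (k x)" for E x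
    using assms(2) by (simp add: linear_simps)
  then show ?thesis
    using integral_bounded_linear[OF assms(2), of M "\<lambda>x. indicat_real E x *\<^sub>R k x"] assms(1)
    unfolding set_integrable_def set_lebesgue_integral_def by simp
qed

lemma loc_int_add: "loc_int k \<Longrightarrow> loc_int h \<Longrightarrow> loc_int (\<lambda>x. k x + h x)"
  by (simp add: loc_int_def set_integral_add)

lemma loc_int_diff: "loc_int k \<Longrightarrow> loc_int h \<Longrightarrow> loc_int (\<lambda>x. k x - h x)"
  by (simp add: loc_int_def set_integral_diff)

lemma loc_int_norm: assumes "loc_int k" shows "loc_int (\<lambda>x. norm (k x))"
  unfolding loc_int_def set_integrable_def
proof
  fix E assume "E \<in> LB"
  then have "integrable M (\<lambda>x. norm (indicat_real E x *\<^sub>R k x))"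
    using loc_int_E[OF assms] unfolding set_integrable_def by (intro integrable_norm) auto
  then show "integrable M (\<lambda>x. indicat_real E x *\<^sub>R norm (k x))" by simp
qed

lemma loc_int_measurable: assumes "loc_int k" shows "k \<in> borel_measurable M"
proof -
  obtain K where K: "\<And>n::nat. K n \<in> LB" "incseq K" "(\<Union>n. K n) = I" using LB_exhaustion by metis
  show ?thesis
  proof (rule borel_measurable_LIMSEQ_metric)
    show "(\<lambda>x. indicat_real (K n) x *\<^sub>R k x) \<in> borel_measurable M" for n
      using loc_int_E[OF assms K(1)] by (auto simp: set_integrable_def)
    fix x assume "x \<in> space M"
    then obtain n where "x \<in> K n" using K(3) by auto
    then have "x \<in> K m" if "m \<ge> n" for m using K(2) that by (auto simp: incseq_def)
    then have "eventually (\<lambda>m. indicat_real (K m) x *\<^sub>R k x = k x) sequentially"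
      by (intro eventually_sequentiallyI[of n]) auto
    then show "(\<lambda>n. indicat_real (K n) x *\<^sub>R k x) \<longlonglongrightarrow> k x" by (rule tendsto_eventually)
  qed
qed

lemma LINT_Un:
  assumes "loc_int k" "A \<in> LB" "B \<in> LB" "A \<inter> B = {}"
  shows "(LINT x:A \<union> B|M. k x) = (LINT x:A|M. k x) + (LINT x:B|M. k x)"
  using assms loc_int_E by (intro set_integral_Un) auto

lemma LINT_singleton: assumes "x \<in> I" shows "(LINT y:{x}|M. k y) = measure M {x} *\<^sub>R (k x :: 'v::euclidean_space)"
proof -
  have "(LINT y:{x}|M. k y) = (LINT y:{x}|M. k x)"
    unfolding set_lebesgue_integral_def by (intro Bochner_Integration.integral_cong) (auto simp: indicator_def)
  then show ?thesis using set_integral_const[OF loc_finite_M LB_singleton[OF assms], of "k x"] by simp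
qed

text \<open>
  The increment over \<open>[s, t]\<close> of a balanced function whose derivative has density \<open>k\<close>: atoms at the
  endpoints count one half.
\<close>

definition Phi :: "(real \<Rightarrow> 'v::euclidean_space) \<Rightarrow> real \<Rightarrow> real \<Rightarrow> 'v" where
  "Phi k s t = (1/2) *\<^sub>R ((LINT x:{s..<t}|M. k x) + (LINT x:{s<..t}|M. k x))"

text \<open>
  \<open>u\<close> is a balanced primitive of \<open>k M\<close>. In contrast to \<open>antideriv\<close> this mentions no one-sided limits;
  those are given by \<open>lft\<close> and \<open>rgt\<close>, as shown in \<open>prim_limits\<close>.
\<close>

definition prim :: "(real \<Rightarrow> 'v::euclidean_space) \<Rightarrow> (real \<Rightarrow> 'v) \<Rightarrow> bool" where
  "prim k u \<longleftrightarrow> (\<forall>s\<in>I. \<forall>t\<in>I. s \<le> t \<longrightarrow> u t - u s = Phi k s t)"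

definition atom :: "(real \<Rightarrow> 'v::euclidean_space) \<Rightarrow> real \<Rightarrow> 'v" where
  "atom k x = measure M {x} *\<^sub>R k x"

definition lft :: "(real \<Rightarrow> 'v::euclidean_space) \<Rightarrow> (real \<Rightarrow> 'v) \<Rightarrow> real \<Rightarrow> 'v" where
  "lft k u x = u x - (1/2) *\<^sub>R atom k x"

definition rgt :: "(real \<Rightarrow> 'v::euclidean_space) \<Rightarrow> (real \<Rightarrow> 'v) \<Rightarrow> real \<Rightarrow> 'v" where
  "rgt k u x = u x + (1/2) *\<^sub>R atom k x"

lemma primD: "prim k u \<Longrightarrow> s \<in> I \<Longrightarrow> t \<in> I \<Longrightarrow> s \<le> t \<Longrightarrow> u t - u s = Phi k s t"
  by (simp add: prim_def)

lemma
  assumes k: "loc_int k" and st: "s \<in> I" "t \<in> I"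
  shows LINT_Icc_left: "s \<le> t \<Longrightarrow> (LINT x:{s..t}|M. k x) = atom k s + (LINT x:{s<..t}|M. k x)"
    and LINT_Icc_right: "s \<le> t \<Longrightarrow> (LINT x:{s..t}|M. k x) = (LINT x:{s..<t}|M. k x) + atom k t"
    and LINT_Ico_left: "s < t \<Longrightarrow> (LINT x:{s..<t}|M. k x) = atom k s + (LINT x:{s<..<t}|M. k x)"
    and LINT_Ioc_right: "s < t \<Longrightarrow> (LINT x:{s<..t}|M. k x) = (LINT x:{s<..<t}|M. k x) + atom k t"
proof -
  note LB = LB_intervals[OF st] LB_singleton[OF st(1)] LB_singleton[OF st(2)]
  have S: "(LINT x:{s}|M. k x) = atom k s" "(LINT x:{t}|M. k x) = atom k t"
    using LINT_singleton[OF st(1)] LINT_singleton[OF st(2)] by (simp_all add: atom_def)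
  { assume "s \<le> t"
    then have "{s..t} = {s} \<union> {s<..t}" by auto
    then show "(LINT x:{s..t}|M. k x) = atom k s + (LINT x:{s<..t}|M. k x)"
      using LINT_Un[OF k, of "{s}" "{s<..t}"] LB S by simp }
  { assume "s \<le> t"
    then have "{s..t} = {s..<t} \<union> {t}" by auto
    then show "(LINT x:{s..t}|M. k x) = (LINT x:{s..<t}|M. k x) + atom k t"
      using LINT_Un[OF k, of "{s..<t}" "{t}"] LB S by simp }
  { assume "s < t"
    then have "{s..<t} = {s} \<union> {s<..<t}" by auto
    then show "(LINT x:{s..<t}|M. k x) = atom k s + (LINT x:{s<..<t}|M. k x)"
      using LINT_Un[OF k, of "{s}" "{s<..<t}"] LB S by simp }
  { assume "s < t"
    then have "{s<..t} = {s<..<t} \<union> {t}" by auto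
    then show "(LINT x:{s<..t}|M. k x) = (LINT x:{s<..<t}|M. k x) + atom k t"
      using LINT_Un[OF k, of "{s<..<t}" "{t}"] LB S by simp }
qed

lemma Phi_refl [simp]: "Phi k s s = 0"
  by (simp add: Phi_def set_lebesgue_integral_def)

lemma Phi_alt:
  assumes "loc_int k" "s \<in> I" "t \<in> I" "s \<le> t"
  shows "Phi k s t = (LINT x:{s..<t}|M. k x) + (1/2) *\<^sub>R (atom k t - atom k s)"
proof -
  have "(LINT x:{s<..t}|M. k x) = (LINT x:{s..<t}|M. k x) + atom k t - atom k s"
    using LINT_Icc_left[OF assms] LINT_Icc_right[OF assms] by (simp add: algebra_simps)
  then show ?thesis unfolding Phi_def by (simp add: scaleR_add_right scaleR_diff_right flip: scaleR_add_left)
qed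

lemma LINT_Ico_add:
  assumes "loc_int k" "s \<in> I" "t \<in> I" "r \<in> I" "s \<le> t" "t \<le> r"
  shows "(LINT x:{s..<r}|M. k x) = (LINT x:{s..<t}|M. k x) + (LINT x:{t..<r}|M. k x)"
proof -
  have "{s..<r} = {s..<t} \<union> {t..<r}" using assms by auto
  then show ?thesis using LINT_Un[OF assms(1) LB_intervals(2)[OF assms(2,3)] LB_intervals(2)[OF assms(3,4)]] by auto
qed

lemma Phi_add:
  assumes "loc_int k" "s \<in> I" "t \<in> I" "r \<in> I" "s \<le> t" "t \<le> r"
  shows "Phi k s r = Phi k s t + Phi k t r"
  using assms by (simp add: Phi_alt LINT_Ico_add[of k s t r] algebra_simps)

lemma prim_iff_lft:
  assumes "loc_int k"
  shows "prim k u \<longleftrightarrow> (\<forall>s\<in>I. \<forall>t\<in>I. s \<le> t \<longrightarrow> lft k u t - lft k u s = (LINT x:{s..<t}|M. k x))"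
proof -
  have "u t - u s = Phi k s t \<longleftrightarrow> lft k u t - lft k u s = (LINT x:{s..<t}|M. k x)"
    if "s \<in> I" "t \<in> I" "s \<le> t" for s t
    unfolding Phi_alt[OF assms that] lft_def by (auto simp: scaleR_diff_right algebra_simps)
  then show ?thesis unfolding prim_def by metis
qed

lemma prim_lft: "prim k u \<Longrightarrow> loc_int k \<Longrightarrow> s \<in> I \<Longrightarrow> t \<in> I \<Longrightarrow> s \<le> t \<Longrightarrow> lft k u t - lft k u s = (LINT x:{s..<t}|M. k x)"
  using prim_iff_lft[of k u] by blast

lemma prim_exists: assumes k: "loc_int k" and x0: "x0 \<in> I"
  shows "\<exists>u. prim k u \<and> u x0 = y0"
proof (intro exI conjI)
  let ?u = "\<lambda>x. if x0 \<le> x then y0 + Phi k x0 x else y0 - Phi k x x0"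
  show "prim k ?u" unfolding prim_def
  proof (intro ballI impI)
    fix s t assume st: "s \<in> I" "t \<in> I" "s \<le> t"
    consider "x0 \<le> s" | "s < x0" "x0 \<le> t" | "t < x0" using st by linarith
    then show "?u t - ?u s = Phi k s t"
    proof cases
      case 1 then show ?thesis using Phi_add[OF k x0 st(1,2) 1 st(3)] st(3) by simp
    next
      case 2 then show ?thesis using Phi_add[OF k st(1) x0 st(2)] by simp
    next
      case 3 then show ?thesis using Phi_add[OF k st(1,2) x0 st(3)] st(3) by simp
    qed
  qed
qed auto

lemma prim_linear: assumes "prim k u" "loc_int k" "bounded_linear L" shows "prim (\<lambda>x. L (k x)) (\<lambda>x. L (u x))"
  unfolding prim_def
proof (intro ballI impI)
  interpret L: bounded_linear L by fact
  fix s t assume st: "s \<in> I" "t \<in> I" "s \<le> t"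
  note LB = LB_intervals[OF st(1,2)]
  have "L (u t) - L (u s) = L (Phi k s t)" using primD[OF assms(1) st] by (simp add: L.diff[symmetric])
  also have "\<dots> = Phi (\<lambda>x. L (k x)) s t"
    unfolding Phi_def using loc_int_E[OF assms(2)] LB
    by (simp add: L.scaleR L.add set_integral_linear[OF _ assms(3)])
  finally show "L (u t) - L (u s) = Phi (\<lambda>x. L (k x)) s t" .
qed

lemma prim_add: assumes "prim k u" "prim h v" "loc_int k" "loc_int h" shows "prim (\<lambda>x. k x + h x) (\<lambda>x. u x + v x)"
  unfolding prim_def
proof (intro ballI impI)
  fix s t assume st: "s \<in> I" "t \<in> I" "s \<le> t"
  note LB = LB_intervals[OF st(1,2)]
  have "Phi (\<lambda>x. k x + h x) s t = Phi k s t + Phi h s t"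
    unfolding Phi_def using loc_int_E[OF assms(3)] loc_int_E[OF assms(4)] LB
    by (simp add: set_integral_add algebra_simps)
  then show "u t + v t - (u s + v s) = Phi (\<lambda>x. k x + h x) s t"
    using primD[OF assms(1) st] primD[OF assms(2) st] by (simp add: algebra_simps)
qed

lemma norm_LINT_le:
  assumes "loc_int k" "E \<in> LB" shows "norm (LINT x:E|M. k x) \<le> (LINT x:E|M. norm (k x))"
  unfolding set_lebesgue_integral_def
  by (rule order_trans[OF integral_norm_bound]) (simp add: mult.commute)

lemma LINT_nonneg_mono:
  fixes k :: "real \<Rightarrow> real"
  assumes "loc_int k" "E \<in> LB" "F \<in> LB" "F \<subseteq> E" "\<And>x. 0 \<le> k x"
  shows "(LINT x:F|M. k x) \<le> (LINT x:E|M. k x)"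
  unfolding set_lebesgue_integral_def
proof (rule integral_mono)
  show "integrable M (\<lambda>x. indicat_real F x *\<^sub>R k x)" "integrable M (\<lambda>x. indicat_real E x *\<^sub>R k x)"
    using loc_int_E[OF assms(1)] assms(2,3) by (auto simp: set_integrable_def)
  show "indicat_real F x *\<^sub>R k x \<le> indicat_real E x *\<^sub>R k x" for x
    using assms(4,5) by (auto simp: indicator_def)
qed

lemma norm_prim_diff_le:
  assumes "prim k u" "loc_int k" "s \<in> I" "t \<in> I" "s \<le> t"
  shows "norm (u t - u s) \<le> Phi (\<lambda>x. norm (k x)) s t"
proof -
  note LB = LB_intervals[OF assms(3,4)]
  have "norm (u t - u s) \<le> (1/2) * (norm (LINT x:{s..<t}|M. k x) + norm (LINT x:{s<..t}|M. k x))"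
    unfolding primD[OF assms(1,3,4,5)] Phi_def by (simp add: norm_triangle_ineq)
  also have "\<dots> \<le> (1/2) * ((LINT x:{s..<t}|M. norm (k x)) + (LINT x:{s<..t}|M. norm (k x)))"
    by (intro mult_left_mono add_mono norm_LINT_le assms(2) LB) auto
  finally show ?thesis by (simp add: Phi_def)
qed

lemma LINT_norm_right_lim:
  assumes k: "loc_int k" and x: "x \<in> I"
  shows "((\<lambda>t. LINT s:{x<..t}|M. norm (k s)) \<longlongrightarrow> 0) (at_right x)"
proof -
  obtain d where d: "x < d" "d \<in> I" using I_right[OF x] by auto
  show ?thesis
  proof (rule tendsto_at_right_sequentially[OF d(1)])
    fix S :: "nat \<Rightarrow> real" assume S: "\<And>n. x < S n" "\<And>n. S n < d" "decseq S" "S \<longlonglongrightarrow> x"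
    have SI: "S n \<in> I" for n using I_interval[OF x d(2)] S(1,2)[of n] by auto
    have "(\<lambda>n. LINT s:{x<..S n}|M. norm (k s)) \<longlonglongrightarrow> (LINT s:(\<Inter>n. {x<..S n})|M. norm (k s))"
    proof (rule set_integral_cont_down)
      show "{x<..S n} \<in> sets M" for n using LB_M LB_intervals[OF x SI] by auto
      show "decseq (\<lambda>n. {x<..S n})" unfolding decseq_def
      proof (intro allI impI)
        fix m n :: nat assume "m \<le> n"
        then have "S n \<le> S m" using S(3) by (simp add: decseq_def)
        then show "{x<..S n} \<subseteq> {x<..S m}" by auto
      qed
      show "set_integrable M {x<..S 0} (\<lambda>s. norm (k s))"
        using loc_int_E[OF loc_int_norm[OF k]] LB_intervals[OF x SI] by auto
    qed
    moreover have "(\<Inter>n. {x<..S n}) = {}"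
    proof -
      have "y \<notin> (\<Inter>n. {x<..S n})" for y
      proof (cases "x < y")
        case True
        obtain n where "S n < y" using order_tendstoD(2)[OF S(4) True] unfolding eventually_sequentially by blast
        then show ?thesis by (auto simp: not_le intro!: exI[of _ n])
      qed auto
      then show ?thesis by blast
    qed
    ultimately show "(\<lambda>n. LINT s:{x<..S n}|M. norm (k s)) \<longlonglongrightarrow> 0" by (simp add: set_lebesgue_integral_def)
  qed
qed

lemma LINT_norm_left_lim:
  assumes k: "loc_int k" and x: "x \<in> I"
  shows "((\<lambda>t. LINT s:{t..<x}|M. norm (k s)) \<longlongrightarrow> 0) (at_left x)"
proof -
  obtain d where d: "d < x" "d \<in> I" using I_left[OF x] by auto
  show ?thesis
  proof (rule tendsto_at_left_sequentially[OF d(1)])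
    fix S :: "nat \<Rightarrow> real" assume S: "\<And>n. S n < x" "\<And>n. d < S n" "incseq S" "S \<longlonglongrightarrow> x"
    have SI: "S n \<in> I" for n using I_interval[OF d(2) x] S(1,2)[of n] by auto
    have "(\<lambda>n. LINT s:{S n..<x}|M. norm (k s)) \<longlonglongrightarrow> (LINT s:(\<Inter>n. {S n..<x})|M. norm (k s))"
    proof (rule set_integral_cont_down)
      show "{S n..<x} \<in> sets M" for n using LB_M LB_intervals[OF SI x] by auto
      show "decseq (\<lambda>n. {S n..<x})" unfolding decseq_def
      proof (intro allI impI)
        fix m n :: nat assume "m \<le> n"
        then have "S m \<le> S n" using S(3) by (simp add: incseq_def)
        then show "{S n..<x} \<subseteq> {S m..<x}" by auto
      qed
      show "set_integrable M {S 0..<x} (\<lambda>s. norm (k s))"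
        using loc_int_E[OF loc_int_norm[OF k]] LB_intervals[OF SI x] by auto
    qed
    moreover have "(\<Inter>n. {S n..<x}) = {}"
    proof -
      have "y \<notin> (\<Inter>n. {S n..<x})" for y
      proof (cases "y < x")
        case True
        obtain n where "y < S n" using order_tendstoD(1)[OF S(4) True] unfolding eventually_sequentially by blast
        then show ?thesis by (auto simp: not_le intro!: exI[of _ n])
      qed auto
      then show ?thesis by blast
    qed
    ultimately show "(\<lambda>n. LINT s:{S n..<x}|M. norm (k s)) \<longlonglongrightarrow> 0" by (simp add: set_lebesgue_integral_def)
  qed
qed

lemma eventually_in_I:
  assumes "x \<in> I" shows "eventually (\<lambda>t. t \<in> I) (at_right x)" "eventually (\<lambda>t. t \<in> I) (at_left x)"
proof -
  have "eventually (\<lambda>t. t \<in> I) (nhds x)" using assms by (intro eventually_nhds_in_open open_einterval)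
  then show "eventually (\<lambda>t. t \<in> I) (at_right x)" "eventually (\<lambda>t. t \<in> I) (at_left x)"
    by (auto simp: eventually_at_filter elim: eventually_mono)
qed

lemma prim_limits:
  assumes p: "prim k u" and k: "loc_int k" and x: "x \<in> I"
  shows "(u \<longlongrightarrow> rgt k u x) (at_right x)" "(u \<longlongrightarrow> lft k u x) (at_left x)"
proof -
  show "(u \<longlongrightarrow> rgt k u x) (at_right x)"
  proof (rule Lim_transform[OF tendsto_const], rule Lim_null_comparison[OF _ LINT_norm_right_lim[OF k x]])
    show "\<forall>\<^sub>F t in at_right x. norm (u t - rgt k u x) \<le> (LINT s:{x<..t}|M. norm (k s))"
      using eventually_in_I(1)[OF x] eventually_at_right_less[of x]
    proof eventually_elim
      case (elim t)
      note LB = LB_intervals[OF x elim(1)]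
      have "u t - rgt k u x = (1/2) *\<^sub>R ((LINT s:{x<..<t}|M. k s) + (LINT s:{x<..t}|M. k s))"
        using primD[OF p x elim(1)] elim LINT_Ico_left[OF k x elim]
        by (simp add: rgt_def Phi_def algebra_simps)
      then have "norm (u t - rgt k u x) \<le> (1/2) * (norm (LINT s:{x<..<t}|M. k s) + norm (LINT s:{x<..t}|M. k s))"
        by (simp add: norm_triangle_ineq)
      also have "\<dots> \<le> (1/2) * ((LINT s:{x<..<t}|M. norm (k s)) + (LINT s:{x<..t}|M. norm (k s)))"
        by (intro mult_left_mono add_mono norm_LINT_le k LB) auto
      also have "(LINT s:{x<..<t}|M. norm (k s)) \<le> (LINT s:{x<..t}|M. norm (k s))"
        by (intro LINT_nonneg_mono loc_int_norm k LB) auto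
      finally show ?case by simp
    qed
  qed
  show "(u \<longlongrightarrow> lft k u x) (at_left x)"
  proof (rule Lim_transform[OF tendsto_const], rule Lim_null_comparison[OF _ LINT_norm_left_lim[OF k x]])
    show "\<forall>\<^sub>F t in at_left x. norm (u t - lft k u x) \<le> (LINT s:{t..<x}|M. norm (k s))"
      using eventually_in_I(2)[OF x] at_left_less[of x]
    proof eventually_elim
      case (elim t)
      note LB = LB_intervals[OF elim(1) x]
      have "lft k u x - u t = (1/2) *\<^sub>R ((LINT s:{t..<x}|M. k s) + (LINT s:{t<..<x}|M. k s))"
        using primD[OF p elim(1) x] elim LINT_Ioc_right[OF k elim(1) x elim(2)]
        by (simp add: lft_def Phi_def algebra_simps)
      then have "norm (u t - lft k u x) \<le> (1/2) * (norm (LINT s:{t..<x}|M. k s) + norm (LINT s:{t<..<x}|M. k s))"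
        by (subst norm_minus_commute) (simp add: norm_triangle_ineq)
      also have "\<dots> \<le> (1/2) * ((LINT s:{t..<x}|M. norm (k s)) + (LINT s:{t<..<x}|M. norm (k s)))"
        by (intro mult_left_mono add_mono norm_LINT_le k LB) auto
      also have "(LINT s:{t<..<x}|M. norm (k s)) \<le> (LINT s:{t..<x}|M. norm (k s))"
        by (intro LINT_nonneg_mono loc_int_norm k LB) auto
      finally show ?case by simp
    qed
  qed
qed

lemma prim_one_sided:
  assumes "prim k u" "loc_int k" "x \<in> I"
  shows "right_lim u x = rgt k u x" "left_lim u x = lft k u x"
  unfolding right_lim_def left_lim_def
  using prim_limits[OF assms] by (auto intro!: tendsto_Lim)

lemma prim_balanced: "prim k u \<Longrightarrow> loc_int k \<Longrightarrow> balanced a b u"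
  unfolding balanced_def by (simp add: prim_one_sided rgt_def lft_def algebra_simps flip: scaleR_add_left)

lemma prim_BV_loc:
  assumes p: "prim k u" and k: "loc_int k" shows "BV_loc a b u"
  unfolding BV_loc_def
proof (intro allI impI, elim conjE)
  fix c d assume cd: "a < ereal c" "ereal d < b"
  let ?n = "\<lambda>x. norm (k x)"
  have n: "loc_int ?n" by (rule loc_int_norm[OF k])
  show "\<exists>B. \<forall>(t :: nat \<Rightarrow> real) k. mono t \<and> range t \<subseteq> {c..d} \<longrightarrow> (\<Sum>i<k. norm (u (t (Suc i)) - u (t i))) \<le> B"
  proof (intro exI allI impI, elim conjE)
    fix t :: "nat \<Rightarrow> real" and m assume t: "mono t" "range t \<subseteq> {c..d}"
    have tcd: "c \<le> t i" "t i \<le> d" for i using t(2) by (auto dest!: subsetD[OF _ rangeI[of t i]])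
    have "c \<le> d" using tcd[of 0] by simp
    then have cI: "c \<in> I" "d \<in> I" using cd I_endpoints by auto
    have tI: "t i \<in> I" for i using I_interval[OF cI tcd] .
    have mono: "t i \<le> t (Suc i)" "t 0 \<le> t i" for i using t(1) by (auto simp: mono_def)
    have "(\<Sum>i<m. norm (u (t (Suc i)) - u (t i))) \<le> (\<Sum>i<m. Phi ?n (t i) (t (Suc i)))"
      by (intro sum_mono norm_prim_diff_le p k tI mono)
    also have "\<dots> = Phi ?n (t 0) (t m)"
      by (induction m) (use Phi_add[OF n tI tI tI mono(2,1)] in auto)
    also have "\<dots> \<le> Phi ?n c (t 0) + Phi ?n (t 0) (t m) + Phi ?n (t m) d"
    proof -
      have "0 \<le> Phi ?n x y" for x y unfolding Phi_def set_lebesgue_integral_def by simp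
      then show ?thesis by simp
    qed
    also have "\<dots> = Phi ?n c d"
      using Phi_add[OF n cI(1) tI[of 0] tI[of m] tcd(1)[of 0] mono(2)[of m]]
        Phi_add[OF n cI(1) tI[of m] cI(2) tcd(1)[of m] tcd(2)[of m]] by simp
    finally show "(\<Sum>i<m. norm (u (t (Suc i)) - u (t i))) \<le> Phi ?n c d" .
  qed
qed

lemma distr0_LINT: assumes k: "loc_int k" shows "distr0 a b (\<lambda>E. LINT x:E|M. k x)"
  unfolding distr0_def
proof (intro allI impI, elim conjE)
  fix A :: "nat \<Rightarrow> real set"
  assume A: "disjoint_family A" "\<forall>i. A i \<in> sets borel" "(\<Union>i. A i) \<in> LB"
  have AL: "A i \<in> LB" for i by (rule LB_mono[OF A(3)]) (use A in auto)
  define B where "B n = (\<Union>i<n. A i)" for n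
  have BL: "B n \<in> LB" for n unfolding B_def by (rule LB_mono[OF A(3)]) (use A in auto)
  have BU: "(\<Union>n. B n) = (\<Union>i. A i)" by (auto simp: B_def)
  have part: "(\<Sum>i<n. LINT x:A i|M. k x) = (LINT x:B n|M. k x)" for n
  proof (induction n)
    case (Suc n)
    have "A i \<inter> A n = {}" if "i < n" for i using A(1) that by (simp add: disjoint_family_on_def)
    then have "B n \<inter> A n = {}" by (auto simp: B_def)
    moreover have "B (Suc n) = B n \<union> A n" by (auto simp: B_def less_Suc_eq)
    ultimately show ?case using Suc LINT_Un[OF k BL AL] by simp
  qed (simp add: B_def set_lebesgue_integral_def)
  have "(\<lambda>n. LINT x:B n|M. k x) \<longlonglongrightarrow> (LINT x:(\<Union>n. B n)|M. k x)"
  proof (rule set_integral_cont_up)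
    show "incseq B" unfolding incseq_def B_def by (intro allI impI UN_mono) auto
    show "set_integrable M (\<Union>n. B n) k" unfolding BU by (rule loc_int_E[OF k A(3)])
  qed (use BL LB_M in auto)
  then show "(\<lambda>i. LINT x:A i|M. k x) sums (LINT x:(\<Union>i. A i)|M. k x)"
    unfolding sums_def part BU .
qed

lemma prim_antideriv:
  assumes "prim k u" "loc_int k" shows "antideriv a b u (\<lambda>E. LINT x:E|M. k x)"
  unfolding antideriv_def
proof (intro conjI allI impI prim_BV_loc[OF assms], elim conjE)
  fix c d assume cd: "a < ereal c" "c \<le> d" "ereal d < b"
  then have I: "c \<in> I" "d \<in> I" using I_endpoints by auto
  have "u d = u c + (LINT x:{c..<d}|M. k x) + (1/2) *\<^sub>R (atom k d - atom k c)"
    using primD[OF assms(1) I cd(2)] unfolding Phi_alt[OF assms(2) I cd(2)] by (simp add: algebra_simps)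
  then have "rgt k u d - lft k u c = (LINT x:{c..<d}|M. k x) + ((1/2) *\<^sub>R atom k d + (1/2) *\<^sub>R atom k d)"
    by (simp add: rgt_def lft_def scaleR_diff_right)
  also have "(1/2) *\<^sub>R atom k d + (1/2) *\<^sub>R atom k d = atom k d" by (simp flip: scaleR_add_left)
  finally show "(LINT x:{c..d}|M. k x) = right_lim u d - left_lim u c"
    using LINT_Icc_right[OF assms(2) I cd(2)]
    by (simp add: prim_one_sided[OF assms I(1)] prim_one_sided[OF assms I(2)])
qed

lemma half_sum_diff:
  fixes A L x y :: "'v::real_vector"
  shows "(1/2) *\<^sub>R (A + L + x + (A + L)) - (1/2) *\<^sub>R (A + y + A) = L + (1/2) *\<^sub>R (x - y)"
proof -
  have "(1/2) *\<^sub>R (A + L + x + (A + L)) - (1/2) *\<^sub>R (A + y + A) = (1/2) *\<^sub>R ((L + L) + (x - y))"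
    unfolding scaleR_diff_right[symmetric] by (simp add: algebra_simps)
  then show ?thesis by (simp only: scaleR_add_right[of _ "L + L"] scaleR_half_double)
qed

text \<open>
  Conversely, a balanced antiderivative of a distribution with density \<open>k\<close> is a balanced primitive, since
  both one-sided limits at both ends are known from the values on \<open>[s, t]\<close>, \<open>{s}\<close> and \<open>{t}\<close>.
\<close>

lemma antideriv_balanced_prim:
  assumes k: "loc_int k" and u: "antideriv a b u du" "balanced a b u"
    and du: "\<And>E. E \<in> LB \<Longrightarrow> du E = (LINT x:E|M. k x)"
  shows "prim k u"
  unfolding prim_def
proof (intro ballI impI)
  have ad: "right_lim u d - left_lim u c = (LINT x:{c..d}|M. k x)" if "c \<in> I" "d \<in> I" "c \<le> d" for c d
    using u(1) du[OF LB_intervals(1)[OF that(1,2)]] that unfolding antideriv_def by (auto simp: einterval_def)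
  have one: "right_lim u c - left_lim u c = atom k c" if "c \<in> I" for c
    using ad[of c c] LINT_singleton[OF that, of k] that by (simp add: atom_def)
  have half: "u x = (1/2) *\<^sub>R (right_lim u x + left_lim u x)" if "x \<in> I" for x
    using u(2) that by (simp add: balanced_def)
  fix s t assume st: "s \<in> I" "t \<in> I" "s \<le> t"
  have 1: "right_lim u t = left_lim u s + (LINT x:{s..<t}|M. k x) + atom k t"
    using ad[OF st] LINT_Icc_right[OF k st] by (simp add: algebra_simps)
  have 2: "left_lim u t = right_lim u t - atom k t" "right_lim u s = left_lim u s + atom k s"
    using one[OF st(1)] one[OF st(2)] by (auto simp: algebra_simps)
  show "u t - u s = Phi k s t"
    unfolding half[OF st(1)] half[OF st(2)] Phi_alt[OF k st] 2 1
    using half_sum_diff[of "left_lim u s" "LINT x:{s..<t}|M. k x" "atom k t" "atom k s"] by (simp add: algebra_simps)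
qed

end

section \<open>The product rule for balanced functions\<close>

context interval_measure
begin

lemma prim_bounded:
  assumes p: "prim k u" and k: "loc_int k" and cd: "c \<in> I" "d \<in> I"
  shows "\<exists>B. \<forall>x\<in>{c..d}. norm (u x) \<le> B"
proof (intro exI ballI)
  fix x assume x: "x \<in> {c..d}"
  let ?n = "\<lambda>x. norm (k x)"
  have n: "loc_int ?n" by (rule loc_int_norm[OF k])
  have xI: "x \<in> I" using I_interval[OF cd] x by auto
  have "norm (u x) \<le> norm (u c) + norm (u x - u c)" using norm_triangle_ineq[of "u c" "u x - u c"] by simp
  also have "norm (u x - u c) \<le> Phi ?n c x" using x by (intro norm_prim_diff_le p k cd xI) auto
  also have "Phi ?n c x \<le> Phi ?n c d"
  proof -
    have "0 \<le> Phi ?n x d" unfolding Phi_def set_lebesgue_integral_def by simp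
    then show ?thesis using Phi_add[OF n cd(1) xI cd(2)] x by simp
  qed
  finally show "norm (u x) \<le> norm (u c) + Phi ?n c d" by simp
qed

text \<open>
  The weight \<open>heaviside x r\<close> is \<open>1\<close> for \<open>r < x\<close> and \<open>1/2\<close> for \<open>r = x\<close>. Balanced primitives
  are integrals against it, and \<open>heaviside x r + heaviside r x = 1\<close> is what makes the product rule
  for balanced functions free of correction terms.
\<close>

definition heaviside :: "real \<Rightarrow> real \<Rightarrow> real" where
  "heaviside x r = (if r < x then 1 else if r = x then 1/2 else 0)"

lemma heaviside_sum: "heaviside x r + heaviside r x = 1" by (auto simp: heaviside_def)

lemma heaviside_bounds: "0 \<le> heaviside x r" "heaviside x r \<le> 1" by (auto simp: heaviside_def)

lemma heaviside_measurable [measurable]: "(\<lambda>(x, r). heaviside x r) \<in> borel_measurable (M \<Otimes>\<^sub>M M)"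
  unfolding heaviside_def case_prod_beta by measurable

lemma heaviside_measurable2 [measurable]: "heaviside x \<in> borel_measurable M" "(\<lambda>r. heaviside r x) \<in> borel_measurable M"
  unfolding heaviside_def by measurable

lemma integrable_weighted:
  assumes k: "loc_int k" and E: "E \<in> LB" and h: "h \<in> borel_measurable M" "\<And>x. \<bar>h x\<bar> \<le> 1"
  shows "integrable M (\<lambda>r. h r *\<^sub>R (indicat_real E r *\<^sub>R k r))"
proof (rule Bochner_Integration.integrable_bound)
  show i: "integrable M (\<lambda>r. indicat_real E r *\<^sub>R k r)" using loc_int_E[OF k E] by (simp add: set_integrable_def)
  show "(\<lambda>r. h r *\<^sub>R (indicat_real E r *\<^sub>R k r)) \<in> borel_measurable M"
    by (rule borel_measurable_scaleR[OF h(1) borel_measurable_integrable[OF i]])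
  show "AE x in M. norm (h x *\<^sub>R indicat_real E x *\<^sub>R k x) \<le> norm (indicat_real E x *\<^sub>R k x)"
  proof (intro AE_I2)
    fix x show "norm (h x *\<^sub>R indicat_real E x *\<^sub>R k x) \<le> norm (indicat_real E x *\<^sub>R k x)"
      using mult_right_mono[OF h(2)[of x], of "norm (k x)"] by (cases "x \<in> E") auto
  qed
qed

lemma prim_heaviside:
  assumes p: "prim k u" and k: "loc_int k" and st: "s \<in> I" "t \<in> I" and x: "x \<in> {s..<t}"
  shows "u x - lft k u s = (LINT r|M. heaviside x r *\<^sub>R (indicat_real {s..<t} r *\<^sub>R k r))"
proof -
  have xI: "x \<in> I" using I_interval[OF st] x by auto
  note LB = LB_intervals[OF st(1) xI]
  have eq: "heaviside x r *\<^sub>R (indicat_real {s..<t} r *\<^sub>R k r) =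
      (1/2) *\<^sub>R (indicat_real {s..<x} r *\<^sub>R k r) + (1/2) *\<^sub>R (indicat_real {s..x} r *\<^sub>R k r)" for r
    using x by (auto simp: heaviside_def indicator_def simp flip: scaleR_add_left)
  have i: "integrable M (\<lambda>r. indicat_real {s..<x} r *\<^sub>R k r)" "integrable M (\<lambda>r. indicat_real {s..x} r *\<^sub>R k r)"
    using loc_int_E[OF k] LB by (auto simp: set_integrable_def)
  have "(LINT r|M. heaviside x r *\<^sub>R (indicat_real {s..<t} r *\<^sub>R k r)) =
      (1/2) *\<^sub>R (LINT r:{s..<x}|M. k r) + (1/2) *\<^sub>R (LINT r:{s..x}|M. k r)"
    unfolding eq set_lebesgue_integral_def integral_scaleR_right[symmetric]
    by (rule Bochner_Integration.integral_add; rule integrable_scaleR_right; rule i)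
  also have "\<dots> = Phi k s x + (1/2) *\<^sub>R atom k s"
    using LINT_Icc_left[OF k st(1) xI] x by (simp add: Phi_def scaleR_add_right)
  finally show ?thesis using primD[OF p st(1) xI] x by (simp add: lft_def algebra_simps)
qed

text \<open>
  An integral depending on a parameter through the measurable kernel \<open>heaviside\<close> is measurable; on the
  intervals of an exhaustion \<open>u\<close> has this form.
\<close>

lemma prim_measurable:
  assumes p: "prim k u" and k: "loc_int k"
  shows "u \<in> borel_measurable M"
proof -
  obtain K where K: "incseq K" "(\<Union>n. K n) = I" "\<And>n::nat. \<exists>c d. c \<in> I \<and> d \<in> I \<and> c < d \<and> K n = {c..d}"
    using LB_exhaustion by metis
  then obtain c d where cd: "\<And>n. c n \<in> I" "\<And>n. d n \<in> I" "\<And>n. c n < d n" "\<And>n. K n = {c n..d n}" by metis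
  have "\<exists>e\<in>I. d n < e" for n by (rule I_right[OF cd(2)])
  then obtain e where e: "\<And>n. e n \<in> I" "\<And>n. d n < e n" by metis
  define v where "v n x = lft k u (c n) + (LINT r|M. heaviside x r *\<^sub>R (indicat_real {c n..<e n} r *\<^sub>R k r))" for n x
  have [measurable]: "k \<in> borel_measurable M" by (rule loc_int_measurable[OF k])
  have vm: "v n \<in> borel_measurable M" for n
  proof -
    have [measurable]: "{c n..<e n} \<in> sets M" using LB_M LB_intervals[OF cd(1) e(1)] by auto
    have "(\<lambda>x. LINT r|M. heaviside x r *\<^sub>R (indicat_real {c n..<e n} r *\<^sub>R k r)) \<in> borel_measurable M"
      by (rule borel_measurable_lebesgue_integral) measurable
    then show ?thesis unfolding v_def by measurable
  qed
  show ?thesis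
  proof (rule borel_measurable_LIMSEQ_metric[OF vm])
    fix x assume "x \<in> space M"
    then obtain n where "x \<in> K n" using K(2) by auto
    then have "x \<in> K m" if "m \<ge> n" for m using K(1) that by (auto simp: incseq_def)
    then have "v m x = u x" if "m \<ge> n" for m
      using prim_heaviside[OF p k cd(1) e(1), of x m m] that cd(4)[of m] e(2)[of m] by (force simp: v_def algebra_simps)
    then show "(\<lambda>n. v n x) \<longlonglongrightarrow> u x"
      by (intro tendsto_eventually eventually_sequentiallyI[of n]) auto
  qed
qed

lemma loc_int_mult_bounded:
  assumes k: "loc_int k" and h: "h \<in> borel_measurable M"
    and le: "\<And>c d. c \<in> I \<Longrightarrow> d \<in> I \<Longrightarrow> \<exists>B. \<forall>x\<in>{c..d}. norm (h x) \<le> B * norm (k x)"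
  shows "loc_int h"
  unfolding loc_int_def set_integrable_def
proof
  fix E assume E: "E \<in> LB"
  obtain c d where cd: "a < ereal c" "ereal d < b" "E \<subseteq> {c..d}" using E by (auto simp: local_borel_def)
  show "integrable M (\<lambda>x. indicat_real E x *\<^sub>R h x)"
  proof (cases "c \<le> d")
    case False then have "E = {}" using cd(3) by auto
    then show ?thesis by simp
  next
    case True
    then have "c \<in> I" "d \<in> I" using I_endpoints cd by auto
    from le[OF this] obtain B where B: "\<And>x. x \<in> {c..d} \<Longrightarrow> norm (h x) \<le> B * norm (k x)" by blast
    show ?thesis
    proof (rule Bochner_Integration.integrable_bound)
      show "integrable M (\<lambda>x. B *\<^sub>R (indicat_real E x *\<^sub>R k x))"
        using loc_int_E[OF k E] unfolding set_integrable_def by (rule integrable_scaleR_right)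
      show "(\<lambda>x. indicat_real E x *\<^sub>R h x) \<in> borel_measurable M" using h LB_M[OF E] by measurable
      show "AE x in M. norm (indicat_real E x *\<^sub>R h x) \<le> norm (B *\<^sub>R indicat_real E x *\<^sub>R k x)"
      proof (intro AE_I2)
        fix x
        have "B * norm (k x) \<le> \<bar>B\<bar> * norm (k x)" by (intro mult_right_mono) auto
        then have "norm (h x) \<le> \<bar>B\<bar> * norm (k x)" if "x \<in> E" using order_trans[OF B[of x]] that cd(3) by blast
        then show "norm (indicat_real E x *\<^sub>R h x) \<le> norm (B *\<^sub>R indicat_real E x *\<^sub>R k x)"
          by (cases "x \<in> E") simp_all
      qed
    qed
  qed
qed

lemma loc_int_product:
  assumes p: "prim k u" "loc_int k" and h: "loc_int h" and bil: "bounded_bilinear bil"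
  shows "loc_int (\<lambda>x. bil (u x) (h x))"
proof (rule loc_int_mult_bounded[OF h])
  interpret bounded_bilinear bil by fact
  have "continuous_on UNIV (\<lambda>z. bil (fst z) (snd z))"
    by (intro bounded_bilinear.continuous_on[OF bil] continuous_on_fst continuous_on_snd continuous_on_id)
  then have "(\<lambda>z. bil (fst z) (snd z)) \<in> borel_measurable borel" by (rule borel_measurable_continuous_onI)
  moreover have "(\<lambda>x. (u x, h x)) \<in> borel_measurable M"
    by (intro borel_measurable_Pair prim_measurable[OF p] loc_int_measurable[OF h])
  ultimately show "(\<lambda>x. bil (u x) (h x)) \<in> borel_measurable M"
    using measurable_compose[of "\<lambda>x. (u x, h x)" M borel "\<lambda>z. bil (fst z) (snd z)" borel] by simp
  obtain K where K: "\<And>x y. norm (bil x y) \<le> norm x * norm y * K" "K > 0" using pos_bounded by blast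
  fix c d assume "c \<in> I" "d \<in> I"
  from prim_bounded[OF p this] obtain B where B: "\<And>x. x \<in> {c..d} \<Longrightarrow> norm (u x) \<le> B" by blast
  have "norm (bil (u x) (h x)) \<le> (B * K) * norm (h x)" if "x \<in> {c..d}" for x
  proof -
    have "norm (bil (u x) (h x)) \<le> norm (u x) * norm (h x) * K" by (rule K(1))
    also have "\<dots> \<le> B * norm (h x) * K" using B[OF that] K(2) by (intro mult_right_mono) auto
    finally show ?thesis by (simp add: algebra_simps)
  qed
  then show "\<exists>B. \<forall>x\<in>{c..d}. norm (bil (u x) (h x)) \<le> B * norm (h x)" by blast
qed

text \<open>
  Both orders of integration of \<open>heaviside x r \<phi>(r) \<gamma>(x)\<close> over the square are computed with
  \<open>prim_heaviside\<close>. One gives \<open>\<integral> f \<gamma>\<close>; the other, after \<open>heaviside x r = 1 - heaviside r x\<close>, gives \<open>\<integral> \<phi> g\<close>.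
  On the half-open interval the boundary terms are the left limits.
\<close>

lemma prim_product_rule:
  fixes f g \<phi> \<gamma> :: "real \<Rightarrow> 'v::{real_normed_field,euclidean_space}"
  assumes f: "prim \<phi> f" "loc_int \<phi>" and g: "prim \<gamma> g" "loc_int \<gamma>"
    and st: "s \<in> I" "t \<in> I" "s \<le> t"
  shows "lft \<phi> f t * lft \<gamma> g t - lft \<phi> f s * lft \<gamma> g s = (LINT x:{s..<t}|M. f x * \<gamma> x + \<phi> x * g x)"
proof -
  let ?X = "{s..<t}"
  note LB = LB_intervals(2)[OF st(1,2)]
  interpret P: pair_sigma_finite M M by unfold_locales
  define p where "p r = indicat_real ?X r *\<^sub>R \<phi> r" for r
  define c where "c x = indicat_real ?X x *\<^sub>R \<gamma> x" for x
  have pi: "integrable M p" unfolding p_def using loc_int_E[OF f(2) LB] by (simp add: set_integrable_def)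
  have ci: "integrable M c" unfolding c_def using loc_int_E[OF g(2) LB] by (simp add: set_integrable_def)
  have [measurable]: "p \<in> borel_measurable M" "c \<in> borel_measurable M" using pi ci by auto
  define P where "P = (LINT r|M. p r)"
  define C where "C = (LINT r|M. c r)"
  have P: "lft \<phi> f t - lft \<phi> f s = P" and C: "lft \<gamma> g t - lft \<gamma> g s = C"
    using prim_lft[OF f st] prim_lft[OF g st] by (simp_all add: P_def C_def p_def c_def set_lebesgue_integral_def)
  define F where "F = (\<lambda>(x, r). heaviside x r *\<^sub>R (p r * c x))"
  have Fm[measurable]: "F \<in> borel_measurable (M \<Otimes>\<^sub>M M)" unfolding F_def case_prod_beta by measurable
  have hp: "integrable M (\<lambda>r. heaviside x r *\<^sub>R p r)" for x
    unfolding p_def by (rule integrable_weighted[OF f(2) LB]) (use heaviside_bounds[of x] in auto)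
  have hc1: "integrable M (\<lambda>x. heaviside x r *\<^sub>R c x)" for r
    unfolding c_def by (rule integrable_weighted[OF g(2) LB]) (use heaviside_bounds in auto)
  have hc2: "integrable M (\<lambda>x. heaviside r x *\<^sub>R c x)" for r
    unfolding c_def by (rule integrable_weighted[OF g(2) LB]) (use heaviside_bounds in auto)
  have pc: "integrable (M \<Otimes>\<^sub>M M) (\<lambda>(x, r). p r * c x)"
  proof (rule P.Fubini_integrable)
    show "(\<lambda>(x, r). p r * c x) \<in> borel_measurable (M \<Otimes>\<^sub>M M)" unfolding case_prod_beta by measurable
    show "integrable M (\<lambda>x. LINT y|M. norm (case (x, y) of (x, r) \<Rightarrow> p r * c x))"
      using ci pi by (simp add: norm_mult)
    show "AE x in M. integrable M (\<lambda>y. case (x, y) of (x, r) \<Rightarrow> p r * c x)" using pi by simp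
  qed
  have Fi: "integrable (M \<Otimes>\<^sub>M M) F"
  proof (rule Bochner_Integration.integrable_bound[OF pc Fm])
    show "AE z in M \<Otimes>\<^sub>M M. norm (F z) \<le> norm (case z of (x, r) \<Rightarrow> p r * c x)"
      using heaviside_bounds by (intro AE_I2) (auto simp: F_def norm_mult intro!: mult_left_le_one_le)
  qed
  have swap: "(LINT x|M. LINT r|M. F (x, r)) = (LINT r|M. LINT x|M. F (x, r))"
    using P.Fubini_integral[OF Fi[unfolded F_def]] by (simp add: F_def case_prod_beta)
  have in1: "(LINT r|M. F (x, r)) = f x * c x - lft \<phi> f s * c x" for x
  proof -
    have "(LINT r|M. F (x, r)) = (LINT r|M. (heaviside x r *\<^sub>R p r) * c x)" by (simp add: F_def)
    also have "\<dots> = (LINT r|M. heaviside x r *\<^sub>R p r) * c x" by (rule integral_mult_left_zero)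
    also have "\<dots> = (f x - lft \<phi> f s) * c x"
    proof (cases "x \<in> ?X")
      case True then show ?thesis using prim_heaviside[OF f st(1,2) True] by (simp add: p_def)
    qed (simp add: c_def)
    finally show ?thesis by (simp add: algebra_simps)
  qed
  have in2: "(LINT x|M. F (x, r)) = p r * (C + lft \<gamma> g s) - p r * g r" for r
  proof -
    have e: "heaviside x r *\<^sub>R c x = c x - heaviside r x *\<^sub>R c x" for x
      using heaviside_sum[of x r] by (metis add_diff_cancel_right' scaleR_left_diff_distrib scaleR_one)
    have "(LINT x|M. F (x, r)) = (LINT x|M. p r * (heaviside x r *\<^sub>R c x))" by (simp add: F_def algebra_simps)
    also have "\<dots> = p r * (LINT x|M. heaviside x r *\<^sub>R c x)" by (rule integral_mult_right_zero)
    also have "(LINT x|M. heaviside x r *\<^sub>R c x) = C - (LINT x|M. heaviside r x *\<^sub>R c x)"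
      unfolding e C_def using ci hc2 by (rule Bochner_Integration.integral_diff)
    also have "p r * \<dots> = p r * (C - (g r - lft \<gamma> g s))"
    proof (cases "r \<in> ?X")
      case True then show ?thesis using prim_heaviside[OF g st(1,2) True] by (simp add: c_def)
    qed (simp add: p_def)
    finally show ?thesis by (simp add: algebra_simps)
  qed
  have fc: "integrable M (\<lambda>x. f x * c x)"
  proof -
    have "integrable M (\<lambda>x. (LINT r|M. F (x, r)) + lft \<phi> f s * c x)"
      using P.integrable_fst[OF Fi[unfolded F_def]] ci by (intro Bochner_Integration.integrable_add) (auto simp: F_def)
    then show ?thesis by (simp add: in1)
  qed
  have pg: "integrable M (\<lambda>r. p r * g r)"
  proof -
    have "integrable M (\<lambda>r. p r * (C + lft \<gamma> g s) - (LINT x|M. F (x, r)))"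
      using P.integrable_snd[OF Fi[unfolded F_def]] pi by (intro Bochner_Integration.integrable_diff) (auto simp: F_def)
    then show ?thesis by (simp add: in2)
  qed
  have "(LINT x|M. f x * c x) - lft \<phi> f s * C = P * (C + lft \<gamma> g s) - (LINT r|M. p r * g r)"
    using swap unfolding in1 in2 using fc pg ci pi
    by (simp add: P_def C_def Bochner_Integration.integral_diff)
  moreover have "(LINT x:?X|M. f x * \<gamma> x + \<phi> x * g x) = (LINT x|M. f x * c x) + (LINT r|M. p r * g r)"
    unfolding set_lebesgue_integral_def
    by (subst Bochner_Integration.integral_add[OF fc pg, symmetric])
       (auto intro!: Bochner_Integration.integral_cong simp: p_def c_def algebra_simps)
  moreover have "lft \<phi> f t * lft \<gamma> g t = (lft \<phi> f s + P) * (lft \<gamma> g s + C)" using P C by (simp add: algebra_simps)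
  ultimately show ?thesis by (simp add: algebra_simps)
qed

lemma bounded_linear_cnj_nth: "bounded_linear (\<lambda>z::complex^'n. cnj (z $ i))"
  using bounded_linear_compose[OF bounded_linear_cnj bounded_linear_vec_nth] .

lemma bounded_linear_matrix_nth: "bounded_linear (\<lambda>z::complex^'n. ((J :: complex^'n^'m) *v z) $ i)"
  using bounded_linear_compose[OF bounded_linear_vec_nth matrix_vector_mul_bounded_linear] .

end

section \<open>Volterra equations\<close>

lemma bounded_bilinear_matrix_vector:
  "bounded_bilinear ((*v) :: complex^'n^'m \<Rightarrow> complex^'n \<Rightarrow> complex^'m)"
  unfolding bilinear_conv_bounded_bilinear[symmetric] bilinear_def
  by (auto intro!: linearI simp: vec_eq_iff matrix_vector_mult_def sum.distrib algebra_simps scaleR_sum_right)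

lemma bilinear_measurable:
  fixes f :: "'a \<Rightarrow> 'b::euclidean_space" and g :: "'a \<Rightarrow> 'c::euclidean_space" and bil :: "'b \<Rightarrow> 'c \<Rightarrow> 'd::euclidean_space"
  assumes bil: "bounded_bilinear bil" and fg: "f \<in> borel_measurable M" "g \<in> borel_measurable M"
  shows "(\<lambda>x. bil (f x) (g x)) \<in> borel_measurable M"
proof -
  have "continuous_on UNIV (\<lambda>z. bil (fst z) (snd z))"
    by (intro bounded_bilinear.continuous_on[OF bil] continuous_on_fst continuous_on_snd continuous_on_id)
  then have "(\<lambda>z. bil (fst z) (snd z)) \<in> borel_measurable borel" by (rule borel_measurable_continuous_onI)
  from measurable_compose[OF borel_measurable_Pair[OF fg] this] show ?thesis by simp
qed

context interval_measure
begin

lemma LINT_Ico_measurable: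
  fixes k :: "real \<Rightarrow> 'v::euclidean_space"
  assumes [measurable]: "k \<in> borel_measurable M"
  shows "(\<lambda>x. LINT y:{c..<x}|M. k y) \<in> borel_measurable M"
proof -
  have "(\<lambda>x. LINT y|M. (if c \<le> y \<and> y < x then k y else 0)) \<in> borel_measurable M"
    by (rule borel_measurable_lebesgue_integral) measurable
  moreover have "(LINT y:{c..<x}|M. k y) = (LINT y|M. (if c \<le> y \<and> y < x then k y else 0))" for x
    unfolding set_lebesgue_integral_def by (intro Bochner_Integration.integral_cong) (auto simp: indicator_def)
  ultimately show ?thesis by simp
qed

text \<open>
  In the presence of atoms \<open>d(\<beta>\<^sup>n\<^sup>+\<^sup>1) = (n + 1) \<beta>\<^sup>n d\<beta>\<close> fails, but the density of
  \<open>\<beta>\<^sup>n\<^sup>+\<^sup>1\<close> still dominates, because balanced values are at least the left limits.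
\<close>

lemma power_density:
  fixes \<rho> :: "real \<Rightarrow> real"
  assumes \<rho>: "loc_int \<rho>" "\<And>x. 0 \<le> \<rho> x" and c: "c \<in> I"
  defines "\<beta> \<equiv> \<lambda>x. LINT y:{c..<x}|M. \<rho> y"
  shows "\<exists>\<pi>. loc_int \<pi> \<and> (\<forall>x\<in>I. c \<le> x \<longrightarrow> real (Suc n) * \<beta> x ^ n * \<rho> x \<le> \<pi> x \<and> (LINT y:{c..<x}|M. \<pi> y) = \<beta> x ^ Suc n)"
proof (induction n)
  case 0 then show ?case using \<rho> by (intro exI[of _ \<rho>]) (auto simp: \<beta>_def)
next
  case (Suc n)
  then obtain \<pi> where \<pi>: "loc_int \<pi>" "\<And>x. x \<in> I \<Longrightarrow> c \<le> x \<Longrightarrow> real (Suc n) * \<beta> x ^ n * \<rho> x \<le> \<pi> x"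
    "\<And>x. x \<in> I \<Longrightarrow> c \<le> x \<Longrightarrow> (LINT y:{c..<x}|M. \<pi> y) = \<beta> x ^ Suc n" by blast
  obtain f where f: "prim \<rho> f" "f c = (1/2) *\<^sub>R atom \<rho> c" using prim_exists[OF \<rho>(1) c] by blast
  obtain g where g: "prim \<pi> g" "g c = (1/2) *\<^sub>R atom \<pi> c" using prim_exists[OF \<pi>(1) c] by blast
  have c0: "lft \<rho> f c = 0" "lft \<pi> g c = 0" using f(2) g(2) by (auto simp: lft_def)
  have fl: "lft \<rho> f x = \<beta> x" and gl: "lft \<pi> g x = \<beta> x ^ Suc n" if x: "x \<in> I" "c \<le> x" for x
    using prim_lft[OF f(1) \<rho>(1) c x] prim_lft[OF g(1) \<pi>(1) c x] c0 \<pi>(3)[OF x] by (auto simp: \<beta>_def)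
  have \<beta>0: "0 \<le> \<beta> x" for x unfolding \<beta>_def set_lebesgue_integral_def using \<rho>(2) by (intro integral_nonneg_AE) auto
  define \<pi>' where "\<pi>' x = f x * \<pi> x + \<rho> x * g x" for x
  have l': "loc_int \<pi>'" unfolding \<pi>'_def
    using loc_int_product[OF f(1) \<rho>(1) \<pi>(1) bounded_bilinear_mult] loc_int_product[OF g(1) \<pi>(1) \<rho>(1) bounded_bilinear_mult]
    by (intro loc_int_add) (auto simp: mult.commute)
  show ?case
  proof (intro exI[of _ \<pi>'] conjI l' ballI impI)
    fix x assume x: "x \<in> I" "c \<le> x"
    have p0: "0 \<le> \<pi> x" using \<pi>(2)[OF x] \<beta>0[of x] \<rho>(2)[of x] by (meson mult_nonneg_nonneg of_nat_0_le_iff order_trans zero_le_power)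
    have "\<beta> x \<le> f x" "\<beta> x ^ Suc n \<le> g x"
      using fl[OF x] gl[OF x] mult_nonneg_nonneg[OF measure_nonneg p0, of M "{x}"]
        mult_nonneg_nonneg[OF measure_nonneg \<rho>(2), of M "{x}" x]
      by (auto simp: lft_def atom_def)
    then have "\<beta> x * (real (Suc n) * \<beta> x ^ n * \<rho> x) + \<rho> x * \<beta> x ^ Suc n \<le> \<pi>' x"
      unfolding \<pi>'_def using \<pi>(2)[OF x] \<beta>0[of x] \<rho>(2)[of x] p0 by (intro add_mono mult_mono) auto
    then show "real (Suc (Suc n)) * \<beta> x ^ Suc n * \<rho> x \<le> \<pi>' x" by (simp add: algebra_simps)
    show "(LINT y:{c..<x}|M. \<pi>' y) = \<beta> x ^ Suc (Suc n)"
      using prim_product_rule[OF f(1) \<rho>(1) g(1) \<pi>(1) c x] c0 fl[OF x] gl[OF x] by (simp add: \<pi>'_def)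
  qed
qed

text \<open>
  The bound \<open>\<beta>\<^sup>n\<^sup>+\<^sup>1 / (n + 1)\<close> makes Picard iteration converge like an exponential series although
  the measure may have atoms.
\<close>

lemma power_integral_le:
  fixes \<rho> :: "real \<Rightarrow> real"
  assumes \<rho>: "loc_int \<rho>" "\<And>x. 0 \<le> \<rho> x" and c: "c \<in> I" and x: "x \<in> I" "c \<le> x"
  defines "\<beta> \<equiv> \<lambda>x. LINT y:{c..<x}|M. \<rho> y"
  shows "set_integrable M {c..<x} (\<lambda>y. \<rho> y * \<beta> y ^ n)"
    and "(LINT y:{c..<x}|M. \<rho> y * \<beta> y ^ n) \<le> \<beta> x ^ Suc n / real (Suc n)"
proof -
  obtain \<pi> where \<pi>: "loc_int \<pi>" "\<And>x. x \<in> I \<Longrightarrow> c \<le> x \<Longrightarrow> real (Suc n) * \<beta> x ^ n * \<rho> x \<le> \<pi> x"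
    "\<And>x. x \<in> I \<Longrightarrow> c \<le> x \<Longrightarrow> (LINT y:{c..<x}|M. \<pi> y) = \<beta> x ^ Suc n"
    using power_density[OF \<rho> c, of n] unfolding \<beta>_def by blast
  have \<beta>0: "0 \<le> \<beta> x" for x unfolding \<beta>_def set_lebesgue_integral_def using \<rho>(2) by (intro integral_nonneg_AE) auto
  note LB = LB_intervals(2)[OF c x(1)]
  have [measurable]: "\<rho> \<in> borel_measurable M" by (rule loc_int_measurable[OF \<rho>(1)])
  have [measurable]: "\<beta> \<in> borel_measurable M" unfolding \<beta>_def by (rule LINT_Ico_measurable) measurable
  have [measurable]: "{c..<x} \<in> sets M" by (rule LB_M[OF LB])
  have le: "\<rho> y * \<beta> y ^ n \<le> \<pi> y / real (Suc n)" "0 \<le> \<rho> y * \<beta> y ^ n" if "y \<in> {c..<x}" for y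
  proof -
    have "y \<in> I" "c \<le> y" using that I_interval[OF c x(1)] by auto
    then show "\<rho> y * \<beta> y ^ n \<le> \<pi> y / real (Suc n)" using \<pi>(2)[of y] by (simp add: field_simps)
    show "0 \<le> \<rho> y * \<beta> y ^ n" using \<rho>(2) \<beta>0 by simp
  qed
  have \<pi>i: "set_integrable M {c..<x} (\<lambda>y. \<pi> y / real (Suc n))" using loc_int_E[OF \<pi>(1) LB] by simp
  show i: "set_integrable M {c..<x} (\<lambda>y. \<rho> y * \<beta> y ^ n)"
    unfolding set_integrable_def
  proof (rule Bochner_Integration.integrable_bound)
    show "integrable M (\<lambda>y. indicat_real {c..<x} y *\<^sub>R (\<pi> y / real (Suc n)))" using \<pi>i unfolding set_integrable_def .
    show "AE y in M. norm (indicat_real {c..<x} y *\<^sub>R (\<rho> y * \<beta> y ^ n)) \<le> norm (indicat_real {c..<x} y *\<^sub>R (\<pi> y / real (Suc n)))"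
    proof (intro AE_I2)
      fix y show "norm (indicat_real {c..<x} y *\<^sub>R (\<rho> y * \<beta> y ^ n)) \<le> norm (indicat_real {c..<x} y *\<^sub>R (\<pi> y / real (Suc n)))"
        using le[of y] by (cases "y \<in> {c..<x}") (auto simp del: abs_divide abs_mult)
    qed
  qed measurable
  have "(LINT y:{c..<x}|M. \<rho> y * \<beta> y ^ n) \<le> (LINT y:{c..<x}|M. \<pi> y / real (Suc n))"
    using le(1) by (intro set_integral_mono i \<pi>i) auto
  also have "\<dots> = \<beta> x ^ Suc n / real (Suc n)" using \<pi>(3)[OF x] by simp
  finally show "(LINT y:{c..<x}|M. \<rho> y * \<beta> y ^ n) \<le> \<beta> x ^ Suc n / real (Suc n)" .
qed

text \<open>
  Picard iteration. Its increments \<open>Y n\<close> are bounded by a constant times \<open>\<beta>\<^sup>n / n!\<close>, where \<open>\<beta> x\<close> is the mass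
  of \<open>|B|\<close> on \<open>[c, x)\<close>, so they can be summed and the sum can be integrated term by term.
\<close>

lemma volterra_solution:
  fixes B :: "real \<Rightarrow> complex^'n^'n" and l :: "real \<Rightarrow> complex^'n"
  assumes B: "loc_int B" and l: "loc_int l" and c: "c \<in> I"
  shows "\<exists>y. y \<in> borel_measurable M \<and>
     (\<forall>x\<in>I. c \<le> x \<longrightarrow> y x = y0 + (LINT s:{c..<x}|M. B s *v y s + l s)) \<and>
     (\<forall>d\<in>I. \<exists>C. \<forall>x\<in>{c..d}. norm (y x) \<le> C)"
proof -
  obtain K where K: "K > 0" "\<And>A z. norm ((A :: complex^'n^'n) *v z) \<le> norm A * norm z * K"
    using bounded_bilinear.pos_bounded[OF bounded_bilinear_matrix_vector] by blast
  define \<rho> where "\<rho> s = K * norm (B s)" for s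
  have \<rho>: "loc_int \<rho>" "0 \<le> \<rho> x" for x
    using loc_int_linear[OF loc_int_norm[OF B] bounded_linear_mult_right[of K]] K(1) by (auto simp: \<rho>_def[abs_def])
  have bB: "norm (B s *v z) \<le> \<rho> s * norm z" for s z using K(2)[of "B s" z] by (simp add: \<rho>_def mult.commute mult.left_commute)
  define \<beta> where "\<beta> x = (LINT y:{c..<x}|M. \<rho> y)" for x
  have \<beta>0: "0 \<le> \<beta> x" for x unfolding \<beta>_def set_lebesgue_integral_def using \<rho>(2) by (intro integral_nonneg_AE) auto
  note pow = power_integral_le[OF \<rho> c, folded \<beta>_def]
  define Y where "Y = rec_nat (\<lambda>x. y0 + (LINT s:{c..<x}|M. l s)) (\<lambda>n f x. LINT s:{c..<x}|M. B s *v f s)"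
  have Y0: "Y 0 = (\<lambda>x. y0 + (LINT s:{c..<x}|M. l s))" and YS: "Y (Suc n) = (\<lambda>x. LINT s:{c..<x}|M. B s *v Y n s)" for n
    by (simp_all add: Y_def)
  have Ym: "Y n \<in> borel_measurable M" for n
  proof (induction n)
    case 0 show ?case unfolding Y0
      by (intro borel_measurable_add borel_measurable_const LINT_Ico_measurable loc_int_measurable[OF l])
  next
    case (Suc n) show ?case unfolding YS
      by (intro LINT_Ico_measurable bilinear_measurable[OF bounded_bilinear_matrix_vector] Suc loc_int_measurable[OF B])
  qed
  have BYm: "(\<lambda>s. B s *v Y n s) \<in> borel_measurable M" for n
    by (rule bilinear_measurable[OF bounded_bilinear_matrix_vector loc_int_measurable[OF B] Ym])
  \<comment> \<open>A bound for the initial function \<open>Y 0\<close> on \<open>[c, d]\<close>.\<close>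
  define C0 where "C0 d = norm y0 + (LINT s:{c..d}|M. norm (l s))" for d
  have C00: "0 \<le> C0 d" for d unfolding C0_def set_lebesgue_integral_def by (intro add_nonneg_nonneg integral_nonneg_AE) auto
  have main: "(\<forall>x\<in>I. c \<le> x \<and> x \<le> d \<longrightarrow> norm (Y n x) \<le> C0 d * (\<beta> x ^ n / fact n))"
    if d: "d \<in> I" for d n
  proof (induction n)
    case 0
    show ?case
    proof (intro ballI impI)
      fix x assume x: "x \<in> I" "c \<le> x \<and> x \<le> d"
      have "norm (Y 0 x) \<le> norm y0 + norm (LINT s:{c..<x}|M. l s)" unfolding Y0 by (rule norm_triangle_ineq)
      also have "norm (LINT s:{c..<x}|M. l s) \<le> (LINT s:{c..<x}|M. norm (l s))"
        by (rule norm_LINT_le[OF l LB_intervals(2)[OF c x(1)]])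
      also have "\<dots> \<le> (LINT s:{c..d}|M. norm (l s))"
        using x by (intro LINT_nonneg_mono loc_int_norm l LB_intervals c d) auto
      finally show "norm (Y 0 x) \<le> C0 d * (\<beta> x ^ 0 / fact 0)" by (simp add: C0_def)
    qed
  next
    case (Suc n)
    show ?case
    proof (intro ballI impI)
      fix x assume x: "x \<in> I" "c \<le> x \<and> x \<le> d"
      have le: "norm (B s *v Y n s) \<le> (C0 d / fact n) * (\<rho> s * \<beta> s ^ n)" if "s \<in> {c..<x}" for s
      proof -
        have "s \<in> I" using that I_interval[OF c x(1)] by auto
        then have "norm (Y n s) \<le> C0 d * (\<beta> s ^ n / fact n)" using Suc that x by auto
        then have "\<rho> s * norm (Y n s) \<le> \<rho> s * (C0 d * (\<beta> s ^ n / fact n))" using \<rho>(2) by (intro mult_left_mono) auto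
        then show ?thesis using bB[of s "Y n s"] by (simp add: algebra_simps)
      qed
      have "norm (Y (Suc n) x) \<le> (LINT s:{c..<x}|M. (C0 d / fact n) * (\<rho> s * \<beta> s ^ n))"
        unfolding YS set_lebesgue_integral_def
      proof (rule Bochner_Integration.integral_norm_bound_integral)
        show i: "integrable M (\<lambda>s. indicat_real {c..<x} s *\<^sub>R ((C0 d / fact n) * (\<rho> s * \<beta> s ^ n)))"
          using set_integrable_mult_right[of "C0 d / fact n", OF pow(1)[of x n]] x unfolding set_integrable_def by blast
        show "integrable M (\<lambda>s. indicat_real {c..<x} s *\<^sub>R (B s *v Y n s))"
        proof (rule Bochner_Integration.integrable_bound[OF i])
          show "(\<lambda>s. indicat_real {c..<x} s *\<^sub>R (B s *v Y n s)) \<in> borel_measurable M"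
            using BYm LB_M[OF LB_intervals(2)[OF c x(1)]] by measurable
          show "AE s in M. norm (indicat_real {c..<x} s *\<^sub>R (B s *v Y n s)) \<le> norm (indicat_real {c..<x} s *\<^sub>R ((C0 d / fact n) * (\<rho> s * \<beta> s ^ n)))"
          proof (intro AE_I2)
            fix s show "norm (indicat_real {c..<x} s *\<^sub>R (B s *v Y n s)) \<le> norm (indicat_real {c..<x} s *\<^sub>R ((C0 d / fact n) * (\<rho> s * \<beta> s ^ n)))"
              using order_trans[OF le[of s] abs_ge_self] by (cases "s \<in> {c..<x}") (auto simp del: abs_divide abs_mult)
          qed
        qed
        show "norm (indicat_real {c..<x} s *\<^sub>R (B s *v Y n s)) \<le> indicat_real {c..<x} s *\<^sub>R ((C0 d / fact n) * (\<rho> s * \<beta> s ^ n))" for s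
          using le[of s] by (cases "s \<in> {c..<x}") auto
      qed
      also have "\<dots> = (C0 d / fact n) * (LINT s:{c..<x}|M. \<rho> s * \<beta> s ^ n)" by (rule set_integral_mult_right)
      also have "\<dots> \<le> (C0 d / fact n) * (\<beta> x ^ Suc n / real (Suc n))"
        using pow(2)[of x n] x C00 by (intro mult_left_mono) auto
      finally show "norm (Y (Suc n) x) \<le> C0 d * (\<beta> x ^ Suc n / fact (Suc n))" by (simp add: field_simps)
    qed
  qed
  have expsum: "summable (\<lambda>n. r ^ n / fact n)" for r :: real
    using summable_exp[of r] by (simp add: divide_inverse mult.commute)
  have Ysum: "summable (\<lambda>n. norm (Y n x))" and Yle: "norm (\<Sum>n. Y n x) \<le> C0 d * exp (\<beta> x)"
    if x: "x \<in> I" "c \<le> x" "x \<le> d" "d \<in> I" for x d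
  proof -
    have s: "summable (\<lambda>n. C0 d * (\<beta> x ^ n / fact n))" by (intro summable_mult expsum)
    have le: "norm (Y n x) \<le> C0 d * (\<beta> x ^ n / fact n)" for n using main[OF x(4)] x by auto
    show sY: "summable (\<lambda>n. norm (Y n x))" by (rule summable_comparison_test_ev[OF _ s]) (use le in auto)
    have "norm (\<Sum>n. Y n x) \<le> (\<Sum>n. norm (Y n x))" by (rule summable_norm[OF sY])
    also have "\<dots> \<le> (\<Sum>n. C0 d * (\<beta> x ^ n / fact n))" by (rule suminf_le[OF le sY s])
    also have "\<dots> = C0 d * exp (\<beta> x)"
      by (subst suminf_mult[OF expsum]) (simp add: exp_def divide_inverse mult.commute)
    finally show "norm (\<Sum>n. Y n x) \<le> C0 d * exp (\<beta> x)" .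
  qed
  define y where "y x = (\<Sum>n. Y n x)" for x
  show ?thesis
  proof (intro exI[of _ y] conjI ballI impI)
    show "y \<in> borel_measurable M" unfolding y_def[abs_def] by (rule borel_measurable_suminf[OF Ym])
  next
    fix d assume d: "d \<in> I"
    show "\<exists>C. \<forall>x\<in>{c..d}. norm (y x) \<le> C"
    proof (intro exI ballI)
      fix x assume x: "x \<in> {c..d}"
      have xI: "x \<in> I" using I_interval[OF c d] x by auto
      have "\<beta> x \<le> \<beta> d" unfolding \<beta>_def using x \<rho> by (intro LINT_nonneg_mono LB_intervals c d xI) auto
      then have "C0 d * exp (\<beta> x) \<le> C0 d * exp (\<beta> d)" using C00 by (intro mult_left_mono) auto
      then show "norm (y x) \<le> C0 d * exp (\<beta> d)" using Yle[of x d] xI x d by (auto simp: y_def)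
    qed
  next
    fix x assume x: "x \<in> I" "c \<le> x"
    note LB = LB_intervals(2)[OF c x(1)]
    define f where "f n s = indicat_real {c..<x} s *\<^sub>R (B s *v Y n s)" for n s
    have le: "norm (f n s) \<le> indicat_real {c..<x} s *\<^sub>R ((C0 x / fact n) * (\<rho> s * \<beta> s ^ n))" for n s
    proof (cases "s \<in> {c..<x}")
      case True
      then have "s \<in> I" using I_interval[OF c x(1)] by auto
      then have "norm (Y n s) \<le> C0 x * (\<beta> s ^ n / fact n)" using main[OF x(1)] True by auto
      then have "\<rho> s * norm (Y n s) \<le> \<rho> s * (C0 x * (\<beta> s ^ n / fact n))" using \<rho>(2) by (intro mult_left_mono) auto
      then show ?thesis using bB[of s "Y n s"] True by (simp add: f_def algebra_simps)
    qed (simp add: f_def)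
    have gi: "integrable M (\<lambda>s. indicat_real {c..<x} s *\<^sub>R ((C0 x / fact n) * (\<rho> s * \<beta> s ^ n)))" for n
      using set_integrable_mult_right[of "C0 x / fact n", OF pow(1)[of x n]] x unfolding set_integrable_def by blast
    have fm: "f n \<in> borel_measurable M" for n
      unfolding f_def using BYm LB_M[OF LB] by measurable
    have fi: "integrable M (f n)" for n
    proof (rule Bochner_Integration.integrable_bound[OF gi fm])
      show "AE s in M. norm (f n s) \<le> norm (indicat_real {c..<x} s *\<^sub>R ((C0 x / fact n) * (\<rho> s * \<beta> s ^ n)))"
        using order_trans[OF le abs_ge_self] by (intro AE_I2) (simp only: real_norm_def)
    qed
    have bnd: "(LINT s|M. norm (f n s)) \<le> C0 x * (\<beta> x ^ Suc n / fact (Suc n))" for n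
    proof -
      have "(LINT s|M. norm (f n s)) \<le> (LINT s:{c..<x}|M. (C0 x / fact n) * (\<rho> s * \<beta> s ^ n))"
        unfolding set_lebesgue_integral_def using fi gi le by (intro integral_mono) auto
      also have "\<dots> = (C0 x / fact n) * (LINT s:{c..<x}|M. \<rho> s * \<beta> s ^ n)" by (rule set_integral_mult_right)
      also have "\<dots> \<le> (C0 x / fact n) * (\<beta> x ^ Suc n / real (Suc n))"
        using pow(2)[of x n] x C00 by (intro mult_left_mono) auto
      finally show ?thesis by (simp add: field_simps)
    qed
    have fsums: "(\<lambda>n. f n s) sums (indicat_real {c..<x} s *\<^sub>R (B s *v y s))"
      and fsummable: "summable (\<lambda>n. norm (f n s))" for s
    proof -
      have "(\<lambda>n. f n s) sums (indicat_real {c..<x} s *\<^sub>R (B s *v y s)) \<and> summable (\<lambda>n. norm (f n s))"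
      proof (cases "s \<in> {c..<x}")
        case True
        then have sI: "s \<in> I" using I_interval[OF c x(1)] by auto
        have sY: "summable (\<lambda>n. norm (Y n s))" using Ysum[of s x] sI True x by auto
        have "(\<lambda>n. Y n s) sums y s" unfolding y_def using summable_norm_cancel[OF sY] by (rule summable_sums)
        then have "(\<lambda>n. B s *v Y n s) sums (B s *v y s)"
          by (rule bounded_linear.sums[OF matrix_vector_mul_bounded_linear])
        moreover have "summable (\<lambda>n. norm (B s *v Y n s))"
          by (rule summable_comparison_test_ev[OF _ summable_mult[OF sY, of "\<rho> s"]]) (use bB in auto)
        ultimately show ?thesis using True by (simp add: f_def)
      qed (simp add: f_def)
      then show "(\<lambda>n. f n s) sums (indicat_real {c..<x} s *\<^sub>R (B s *v y s))" "summable (\<lambda>n. norm (f n s))" by auto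
    qed
    have suml: "summable (\<lambda>n. LINT s|M. norm (f n s))"
    proof (rule summable_comparison_test_ev)
      show "summable (\<lambda>n. C0 x * (\<beta> x ^ Suc n / fact (Suc n)))"
        using expsum[of "\<beta> x"] by (intro summable_mult) (subst summable_Suc_iff[of "\<lambda>n. \<beta> x ^ n / fact n"])
      show "\<forall>\<^sub>F n in sequentially. norm (LINT s|M. norm (f n s)) \<le> C0 x * (\<beta> x ^ Suc n / fact (Suc n))"
        using bnd by (intro always_eventually allI) simp
    qed
    have eq: "(\<Sum>n. f n s) = indicat_real {c..<x} s *\<^sub>R (B s *v y s)" for s using fsums[of s] by (rule sums_unique[symmetric])
    have ae: "AE s in M. summable (\<lambda>n. norm (f n s))" using fsummable by simp
    have yi: "set_integrable M {c..<x} (\<lambda>s. B s *v y s)"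
      using integrable_suminf[OF fi ae suml] unfolding eq set_integrable_def .
    have "(\<lambda>n. LINT s|M. f n s) sums (LINT s:{c..<x}|M. B s *v y s)"
      using sums_integral[OF fi ae suml] unfolding eq set_lebesgue_integral_def .
    moreover have "(LINT s|M. f n s) = Y (Suc n) x" for n by (simp add: YS f_def set_lebesgue_integral_def)
    ultimately have "(\<lambda>n. Y (Suc n) x) sums (LINT s:{c..<x}|M. B s *v y s)" by simp
    then have "(\<lambda>n. Y n x) sums ((LINT s:{c..<x}|M. B s *v y s) + Y 0 x)" by (rule sums_Suc)
    then have "y x = (LINT s:{c..<x}|M. B s *v y s) + Y 0 x" unfolding y_def by (rule sums_unique[symmetric])
    also have "\<dots> = y0 + (LINT s:{c..<x}|M. B s *v y s + l s)"
      using set_integral_add(2)[OF yi loc_int_E[OF l LB]] by (simp add: Y0)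
    finally show "y x = y0 + (LINT s:{c..<x}|M. B s *v y s + l s)" .
  qed
qed

section \<open>Atoms\<close>

lemma atom_bound:
  assumes k: "loc_int k" and cd: "c \<in> I" "d \<in> I" and F: "finite F" "F \<subseteq> {c..d}"
  shows "(\<Sum>x\<in>F. norm (atom k x)) \<le> (LINT s:{c..d}|M. norm (k s))"
proof -
  let ?n = "\<lambda>x. norm (k x)"
  have n: "loc_int ?n" by (rule loc_int_norm[OF k])
  have FI: "x \<in> I" if "x \<in> F" for x using F(2) that I_interval[OF cd] by auto
  have FL: "F \<in> LB" by (rule LB_mono[OF LB_intervals(1)[OF cd]]) (use F in \<open>auto simp: borel_closed finite_imp_closed\<close>)
  have "(\<Sum>x\<in>F. norm (atom k x)) = (\<Sum>x\<in>F. LINT s:{x}|M. ?n s)"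
    using FI LINT_singleton[of _ ?n] by (intro sum.cong) (auto simp: atom_def)
  also have "\<dots> = (LINT s:(\<Union>x\<in>F. {x})|M. ?n s)"
    using FI F(1) LB_M[OF LB_singleton] loc_int_E[OF n LB_singleton]
    by (intro set_integral_finite_Union[symmetric]) (auto simp: disjoint_family_on_def)
  also have "\<dots> \<le> (LINT s:{c..d}|M. ?n s)"
    using F FL by (intro LINT_nonneg_mono n LB_intervals cd) auto
  finally show ?thesis .
qed

lemma atom_le:
  assumes "loc_int k" "c \<in> I" "d \<in> I" "x \<in> {c..d}"
  shows "norm (atom k x) \<le> (LINT s:{c..d}|M. norm (k s))"
  using atom_bound[OF assms(1-3), of "{x}"] assms(4) by simp

lemma large_atoms_finite:
  assumes k: "loc_int k" and cd: "c \<in> I" "d \<in> I" and e: "e > 0"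
  shows "finite {x \<in> {c..d}. e < norm (atom k x)}" (is "finite ?F")
proof -
  let ?T = "LINT s:{c..d}|M. norm (k s)"
  have "card G \<le> nat \<lceil>?T / e\<rceil>" if G: "G \<subseteq> ?F" "finite G" for G
  proof -
    have "real (card G) * e = (\<Sum>x\<in>G. e)" by simp
    also have "\<dots> \<le> (\<Sum>x\<in>G. norm (atom k x))" using G by (intro sum_mono) auto
    also have "\<dots> \<le> ?T" using G by (intro atom_bound k cd) auto
    finally have "real (card G) \<le> ?T / e" using e by (simp add: field_simps)
    then show ?thesis by linarith
  qed
  then show ?thesis using finite_if_finite_subsets_card_bdd by blast
qed

lemma countable_atoms:
  assumes k: "loc_int k" shows "countable {x \<in> I. atom k x \<noteq> 0}"
proof -
  obtain K where K: "(\<Union>n. K n) = I" "\<And>n::nat. \<exists>c d. c \<in> I \<and> d \<in> I \<and> c < d \<and> K n = {c..d}"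
    using LB_exhaustion by metis
  have "{x \<in> I. atom k x \<noteq> 0} \<subseteq> (\<Union>n. \<Union>m. {x \<in> K n. 1 / real (Suc m) < norm (atom k x)})"
  proof
    fix x assume x: "x \<in> {x \<in> I. atom k x \<noteq> 0}"
    then obtain n where n: "x \<in> K n" using K(1) by auto
    obtain m where "1 / real (Suc m) < norm (atom k x)" using x nat_approx_posE[of "norm (atom k x)"] by auto
    then show "x \<in> (\<Union>n. \<Union>m. {x \<in> K n. 1 / real (Suc m) < norm (atom k x)})" using n by blast
  qed
  moreover have "countable {x \<in> K n. 1 / real (Suc m) < norm (atom k x)}" for n m
    using K(2)[of n] large_atoms_finite[OF k, of _ _ "1 / real (Suc m)"] by (auto intro!: countable_finite)
  ultimately show ?thesis by (auto intro: countable_subset)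
qed

text \<open>There are only countably many atoms, and changing a constant on a countable set keeps it measurable.\<close>

lemma measurable_if_atoms:
  assumes k: "loc_int k" and eq: "\<And>x. x \<in> I \<Longrightarrow> atom k x = 0 \<Longrightarrow> h x = h0"
  shows "h \<in> borel_measurable M"
proof (rule measurable_discrete_difference[of "\<lambda>_. h0" M borel "{x \<in> I. atom k x \<noteq> 0}"])
  show "countable {x \<in> I. atom k x \<noteq> 0}" by (rule countable_atoms[OF k])
  show "{x} \<in> sets M" if "x \<in> {x \<in> I. atom k x \<noteq> 0}" for x using that LB_M[OF LB_singleton] by auto
qed (use eq in auto)

end

section \<open>Solutions of the differential equation\<close>

lemma
  fixes A :: "complex^'n^'n"
  assumes "invertible A"
  shows matrix_inv_right: "A ** matrix_inv A = mat 1" and matrix_inv_left: "matrix_inv A ** A = mat 1"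
  using someI_ex[OF assms[unfolded invertible_def]] by (simp_all add: matrix_inv_def)

lemma norm_axis_complex: "norm (axis j (1::complex)) = 1"
proof -
  have "complex_of_real ((norm (axis j (1::complex)))\<^sup>2) = 1"
    unfolding herm_self[symmetric] herm_axis by (simp add: axis_def)
  then have "(norm (axis j (1::complex)))\<^sup>2 = 1" using of_real_eq_1_iff by blast
  then show ?thesis using norm_ge_zero[of "axis j (1::complex)"] by (simp add: power2_eq_1_iff)
qed

lemma matrix_inv_mult_vec:
  fixes A :: "complex^'n^'n"
  assumes "invertible A"
  shows "A *v (matrix_inv A *v z) = z" "matrix_inv A *v (A *v z) = z"
  using matrix_inv_left[OF assms] matrix_inv_right[OF assms] by (simp_all add: matrix_vector_mul_assoc)

lemma matrix_vector_scaleR_left: "(r *\<^sub>R A) *v z = r *\<^sub>R (A *v z)" for A :: "complex^'n^'m"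
  by (simp add: matrix_vector_mult_def vec_eq_iff scaleR_sum_right)

lemma matrix_vector_scaleR_right: "A *v (r *\<^sub>R z) = r *\<^sub>R (A *v z)" for A :: "complex^'n^'m"
  by (simp add: matrix_vector_mult_def vec_eq_iff scaleR_sum_right)

lemma matrix_vector_diff: "A *v (x - y) = A *v x - A *v y" for A :: "complex^'n^'m"
  by (simp add: matrix_vector_mult_def vec_eq_iff right_diff_distrib sum_subtractf)

lemma matrix_vector_minus: "A *v (- x) = - (A *v x)" for A :: "complex^'n^'m"
  by (simp add: matrix_vector_mult_def vec_eq_iff sum_negf)

lemma matrix_vector_minus_left: "(- A) *v x = - (A *v x)" for A :: "complex^'n^'m"
  by (simp add: matrix_vector_mult_def vec_eq_iff sum_negf)

lemma herm_bounded_bilinear: "bounded_bilinear (herm :: complex^'n \<Rightarrow> complex^'n \<Rightarrow> complex)"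
  unfolding bilinear_conv_bounded_bilinear[symmetric] bilinear_def
  by (auto intro!: linearI simp: herm_add herm_add_left herm_scaleR herm_scaleR_left)
    (simp_all add: scaleR_conv_of_real)

text \<open>
  The equation \<open>J u' + q u = k\<close> with \<open>q = Hq M\<close>. Inverting \<open>2 J + \<Delta>\<^sub>q\<close> expresses the
  balanced value at an atom by the left limit.
\<close>

locale canonical_system = interval_measure +
  fixes J :: "complex^'n^'n" and Hq :: "real \<Rightarrow> complex^'n^'n"
  assumes J_inv: "invertible J" and J_skew: "cadjoint J = - J"
    and Hq: "loc_int Hq" and Hq_herm: "\<And>x. cadjoint (Hq x) = Hq x"
    and regular: "\<And>x. x \<in> I \<Longrightarrow> invertible (2 *\<^sub>R J + atom Hq x)"
begin

definition Ji :: "complex^'n^'n" where "Ji = matrix_inv J"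

lemma J_Ji: "J *v (Ji *v z) = z" and Ji_J: "Ji *v (J *v z) = z"
  using matrix_inv_mult_vec[OF J_inv] by (simp_all add: Ji_def)

text \<open>
  \<open>sol_on X k u\<close>: on \<open>X\<close> the balanced function \<open>u\<close> solves \<open>J u' + q u = k\<close>. Outside \<open>X\<close>
  the function is an arbitrary balanced primitive, so solutions on half-lines are still total.
\<close>

definition sol_on :: "real set \<Rightarrow> (real \<Rightarrow> complex^'n) \<Rightarrow> (real \<Rightarrow> complex^'n) \<Rightarrow> bool" where
  "sol_on X k u \<longleftrightarrow> (\<exists>\<kappa>. loc_int \<kappa> \<and> prim \<kappa> u \<and> (\<forall>x\<in>X. J *v \<kappa> x = k x - Hq x *v u x))"

lemma sol_on_mono: "sol_on X k u \<Longrightarrow> Y \<subseteq> X \<Longrightarrow> sol_on Y k u"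
  unfolding sol_on_def by blast

lemma left_lim_prim: "prim \<kappa> u \<Longrightarrow> loc_int \<kappa> \<Longrightarrow> x \<in> I \<Longrightarrow> left_lim u x = lft \<kappa> u x"
  by (rule prim_one_sided)

lemma sol_on_add_scale:
  assumes u: "sol_on X k u" and v: "sol_on X h v"
  shows "sol_on X (\<lambda>x. k x + c *s h x) (\<lambda>x. u x + c *s v x)"
    and "x \<in> I \<Longrightarrow> left_lim (\<lambda>x. u x + c *s v x) x = left_lim u x + c *s left_lim v x"
proof -
  obtain \<kappa> where \<kappa>: "loc_int \<kappa>" "prim \<kappa> u" "\<And>x. x \<in> X \<Longrightarrow> J *v \<kappa> x = k x - Hq x *v u x" using u by (auto simp: sol_on_def)
  obtain \<mu> where \<mu>: "loc_int \<mu>" "prim \<mu> v" "\<And>x. x \<in> X \<Longrightarrow> J *v \<mu> x = h x - Hq x *v v x" using v by (auto simp: sol_on_def)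
  have bl: "bounded_linear (\<lambda>z::complex^'n. c *s z)"
    by (auto intro!: linearI simp: linear_conv_bounded_linear[symmetric] vec_eq_iff algebra_simps)
  have li: "loc_int (\<lambda>x. \<kappa> x + c *s \<mu> x)" by (rule loc_int_add[OF \<kappa>(1) loc_int_linear[OF \<mu>(1) bl]])
  have pr: "prim (\<lambda>x. \<kappa> x + c *s \<mu> x) (\<lambda>x. u x + c *s v x)"
    by (rule prim_add[OF \<kappa>(2) prim_linear[OF \<mu>(2,1) bl] \<kappa>(1) loc_int_linear[OF \<mu>(1) bl]])
  show "sol_on X (\<lambda>x. k x + c *s h x) (\<lambda>x. u x + c *s v x)" unfolding sol_on_def
  proof (intro exI[of _ "\<lambda>x. \<kappa> x + c *s \<mu> x"] conjI ballI li pr)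
    fix x assume x: "x \<in> X"
    show "J *v (\<kappa> x + c *s \<mu> x) = k x + c *s h x - Hq x *v (u x + c *s v x)"
      by (simp add: matrix_vector_right_distrib matrix_vector_mult_scale \<kappa>(3)[OF x] \<mu>(3)[OF x]
          vec_eq_iff algebra_simps)
  qed
  show "left_lim (\<lambda>x. u x + c *s v x) x = left_lim u x + c *s left_lim v x" if x: "x \<in> I"
    unfolding left_lim_prim[OF pr li x] left_lim_prim[OF \<kappa>(2,1) x] left_lim_prim[OF \<mu>(2,1) x]
    by (simp add: lft_def atom_def vec_eq_iff algebra_simps)
qed

lemma sol_on_sum:
  assumes "finite S" "\<And>i. i \<in> S \<Longrightarrow> sol_on X (\<lambda>_. 0) (h i)"
  shows "sol_on X (\<lambda>_. 0) (\<lambda>x. \<Sum>i\<in>S. c i *s h i x) \<and>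
    (\<forall>x\<in>I. left_lim (\<lambda>x. \<Sum>i\<in>S. c i *s h i x) x = (\<Sum>i\<in>S. c i *s left_lim (h i) x))"
  using assms
proof (induction S rule: finite_induct)
  case empty
  have li: "loc_int (\<lambda>_. 0 :: complex^'n)" by (simp add: loc_int_def set_integrable_def)
  have pr: "prim (\<lambda>_. 0) (\<lambda>_. 0 :: complex^'n)" by (simp add: prim_def Phi_def set_lebesgue_integral_def)
  show ?case using li pr left_lim_prim[OF pr li] by (auto simp: sol_on_def lft_def atom_def intro!: exI[of _ "\<lambda>_. 0"])
next
  case (insert i S)
  have "sol_on X (\<lambda>_. 0) (\<lambda>x. \<Sum>i\<in>S. c i *s h i x)" "sol_on X (\<lambda>_. 0) (h i)" using insert by auto
  from sol_on_add_scale[OF this, where c = "c i"] insert show ?case by (simp add: add.commute)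
qed

text \<open>With the jump \<open>J (u\<^sup>+ - u\<^sup>-) = \<Delta>\<^sub>k - \<Delta>\<^sub>q u\<close> and \<open>2 u = u\<^sup>+ + u\<^sup>-\<close>, eliminate \<open>u\<^sup>+\<close>.\<close>

lemma sol_on_pointwise:
  assumes u: "sol_on X k u" and x: "x \<in> X" "x \<in> I"
  shows "(2 *\<^sub>R J + atom Hq x) *v u x = 2 *\<^sub>R (J *v left_lim u x) + atom k x"
proof -
  obtain \<kappa> where \<kappa>: "loc_int \<kappa>" "prim \<kappa> u" "\<And>x. x \<in> X \<Longrightarrow> J *v \<kappa> x = k x - Hq x *v u x" using u by (auto simp: sol_on_def)
  have 1: "J *v atom \<kappa> x = atom k x - atom Hq x *v u x"
    using \<kappa>(3)[OF x(1)]
    by (simp add: atom_def matrix_vector_scaleR_right matrix_vector_scaleR_left scaleR_diff_right)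
  have "2 *\<^sub>R (J *v left_lim u x) = 2 *\<^sub>R (J *v u x) - J *v atom \<kappa> x"
    unfolding left_lim_prim[OF \<kappa>(2,1) x(2)] lft_def
    by (simp add: matrix_vector_diff matrix_vector_scaleR_right scaleR_diff_right)
  then show ?thesis unfolding 1
    by (simp add: matrix_vector_mult_add_rdistrib matrix_vector_scaleR_left)
qed

lemma sol_on_zero_if:
  assumes "sol_on X k u" "x \<in> X" "x \<in> I" "left_lim u x = 0" "k x = 0"
  shows "u x = 0"
proof -
  have "(2 *\<^sub>R J + atom Hq x) *v u x = 0" using sol_on_pointwise[OF assms(1-3)] assms(4,5) by (simp add: atom_def)
  then show ?thesis using matrix_inv_mult_vec(2)[OF regular[OF assms(3)], of "u x"] by simp
qed

lemma lft_linear: "bounded_linear L \<Longrightarrow> lft (\<lambda>x. L (k x)) (\<lambda>x. L (u x)) x = L (lft k u x)"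
  by (simp add: lft_def atom_def linear_simps)

definition pairing :: "(real \<Rightarrow> complex^'n) \<Rightarrow> (real \<Rightarrow> complex^'n) \<Rightarrow> real \<Rightarrow> complex" where
  "pairing v u x = herm (left_lim v x) (J *v left_lim u x)"

text \<open>Where \<open>J\<^sup>* = -J\<close> and the symmetry of \<open>Hq\<close> enter: the terms with \<open>Hq\<close> cancel.\<close>

lemma lagrange_density:
  assumes "J *v \<kappa> = k - Hq x *v u" "J *v \<mu> = h - Hq x *v v"
  shows "herm v (J *v \<kappa>) + herm \<mu> (J *v u) = herm v k - herm h u"
proof -
  have "herm \<mu> (J *v u) = herm (cadjoint J *v \<mu>) u"
    using herm_adjoint[of "cadjoint J" \<mu> u] by (simp add: cadjoint_def vec_eq_iff)
  also have "\<dots> = - herm (J *v \<mu>) u" by (simp add: J_skew matrix_vector_minus_left herm_minus)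
  also have "\<dots> = - herm h u + herm v (Hq x *v u)"
    using assms(2) herm_adjoint[of "Hq x" v u] Hq_herm by (simp add: herm_diff_left)
  finally show ?thesis using assms(1) by (simp add: herm_diff)
qed

text \<open>The product rule, applied to each summand of \<open>v\<^sup>* (J u)\<close>.\<close>

lemma lagrange_identity:
  assumes u: "sol_on X k u" and v: "sol_on X h v" and st: "s \<in> I" "t \<in> I" "s \<le> t" and X: "{s..<t} \<subseteq> X"
  shows "pairing v u t - pairing v u s = (LINT x:{s..<t}|M. herm (v x) (k x) - herm (h x) (u x))"
proof -
  obtain \<kappa> where \<kappa>: "loc_int \<kappa>" "prim \<kappa> u" "\<And>x. x \<in> X \<Longrightarrow> J *v \<kappa> x = k x - Hq x *v u x" using u by (auto simp: sol_on_def)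
  obtain \<mu> where \<mu>: "loc_int \<mu>" "prim \<mu> v" "\<And>x. x \<in> X \<Longrightarrow> J *v \<mu> x = h x - Hq x *v v x" using v by (auto simp: sol_on_def)
  define P where "P i = (\<lambda>z::complex^'n. cnj (z $ i))" for i
  define N where "N i = (\<lambda>z::complex^'n. (J *v z) $ i)" for i
  have bl: "bounded_linear (P i)" "bounded_linear (N i)" for i
    unfolding P_def N_def by (rule bounded_linear_cnj_nth bounded_linear_matrix_nth)+
  have hPN: "herm y (J *v z) = (\<Sum>i\<in>UNIV. P i y * N i z)" for y z by (simp add: herm_def P_def N_def)
  have pr: "prim (\<lambda>x. P i (\<mu> x)) (\<lambda>x. P i (v x))" "loc_int (\<lambda>x. P i (\<mu> x))"
    "prim (\<lambda>x. N i (\<kappa> x)) (\<lambda>x. N i (u x))" "loc_int (\<lambda>x. N i (\<kappa> x))" for i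
    by (rule prim_linear loc_int_linear; fact)+
  have li: "loc_int (\<lambda>x. P i (v x) * N i (\<kappa> x) + P i (\<mu> x) * N i (u x))" for i
    using loc_int_product[OF pr(1,2,4) bounded_bilinear_mult] loc_int_product[OF pr(3,4,2) bounded_bilinear_mult]
    by (intro loc_int_add) (auto simp: mult.commute)
  have lftP: "pairing v u x = (\<Sum>i\<in>UNIV. lft (\<lambda>x. P i (\<mu> x)) (\<lambda>x. P i (v x)) x * lft (\<lambda>x. N i (\<kappa> x)) (\<lambda>x. N i (u x)) x)"
    if "x \<in> I" for x
    unfolding pairing_def left_lim_prim[OF \<kappa>(2,1) that] left_lim_prim[OF \<mu>(2,1) that] hPN
    by (intro sum.cong refl) (simp only: lft_linear[OF bl(1)] lft_linear[OF bl(2)])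
  have "pairing v u t - pairing v u s = (\<Sum>i\<in>UNIV. (LINT x:{s..<t}|M. P i (v x) * N i (\<kappa> x) + P i (\<mu> x) * N i (u x)))"
    unfolding lftP[OF st(1)] lftP[OF st(2)] sum_subtractf[symmetric]
    by (intro sum.cong refl prim_product_rule pr st)
  also have "\<dots> = (LINT x:{s..<t}|M. (\<Sum>i\<in>UNIV. P i (v x) * N i (\<kappa> x) + P i (\<mu> x) * N i (u x)))"
    unfolding set_lebesgue_integral_def scaleR_sum_right
    using loc_int_E[OF li LB_intervals(2)[OF st(1,2)]]
    by (intro Bochner_Integration.integral_sum[symmetric]) (auto simp: set_integrable_def)
  also have "\<dots> = (LINT x:{s..<t}|M. herm (v x) (k x) - herm (h x) (u x))"
  proof (rule set_lebesgue_integral_cong)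
    show "{s..<t} \<in> sets M" by (rule LB_M[OF LB_intervals(2)[OF st(1,2)]])
    show "\<forall>x. x \<in> {s..<t} \<longrightarrow> (\<Sum>i\<in>UNIV. P i (v x) * N i (\<kappa> x) + P i (\<mu> x) * N i (u x)) = herm (v x) (k x) - herm (h x) (u x)"
    proof (intro allI impI)
      fix x assume "x \<in> {s..<t}"
      then have x: "x \<in> X" using X by auto
      have "(\<Sum>i\<in>UNIV. P i (v x) * N i (\<kappa> x) + P i (\<mu> x) * N i (u x)) = herm (v x) (J *v \<kappa> x) + herm (\<mu> x) (J *v u x)"
        by (simp add: hPN sum.distrib)
      also have "\<dots> = herm (v x) (k x) - herm (h x) (u x)"
        by (rule lagrange_density[OF \<kappa>(3)[OF x] \<mu>(3)[OF x]])
      finally show "(\<Sum>i\<in>UNIV. P i (v x) * N i (\<kappa> x) + P i (\<mu> x) * N i (u x)) = herm (v x) (k x) - herm (h x) (u x)" .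
    qed
  qed
  finally show ?thesis .
qed

section \<open>Initial value problems\<close>

text \<open>
  The inverse that solves the equation at an atom. Off the atoms it is constant, which also fixes its
  value outside the interval.
\<close>

definition R :: "real \<Rightarrow> complex^'n^'n" where
  "R x = (if x \<in> I then matrix_inv (2 *\<^sub>R J + atom Hq x) else matrix_inv (2 *\<^sub>R J))"

lemma R_inverse: "x \<in> I \<Longrightarrow> (2 *\<^sub>R J + atom Hq x) *v (R x *v z) = z"
  and R_inverse2: "x \<in> I \<Longrightarrow> R x *v ((2 *\<^sub>R J + atom Hq x) *v z) = z"
  using matrix_inv_mult_vec[OF regular] by (auto simp: R_def)

lemma R_measurable: "R \<in> borel_measurable M"
  by (rule measurable_if_atoms[OF Hq, of _ "matrix_inv (2 *\<^sub>R J)"]) (auto simp: R_def)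

text \<open>
  A compact interval contains only finitely many atoms that are not small compared with \<open>2 J\<close>. At
  all other points \<open>2 J + \<Delta>\<^sub>q\<close> is bounded below uniformly.
\<close>

lemma R_bounded:
  assumes cd: "c \<in> I" "d \<in> I" shows "\<exists>B. \<forall>x\<in>{c..d}. norm (R x) \<le> B"
proof -
  have xI: "x \<in> I" if "x \<in> {c..d}" for x using that I_interval[OF cd] by auto
  have "inj ((*v) (2 *\<^sub>R J))"
  proof (rule injI)
    fix x y assume "(2 *\<^sub>R J) *v x = (2 *\<^sub>R J) *v y"
    then have "J *v x = J *v y" by (simp add: matrix_vector_scaleR_left)
    then show "x = y" using Ji_J by metis
  qed
  then obtain e where e: "e > 0" "\<And>x. e * norm x \<le> norm ((2 *\<^sub>R J) *v x)"
    using linear_inj_bounded_below_pos[of "(*v) (2 *\<^sub>R J)"]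
    by (auto intro: bounded_linear.linear[OF matrix_vector_mul_bounded_linear])
  obtain K where K: "K > 0" "\<And>A z. norm ((A :: complex^'n^'n) *v z) \<le> norm A * norm z * K"
    using bounded_bilinear.pos_bounded[OF bounded_bilinear_matrix_vector] by blast
  \<comment> \<open>Outside \<open>F\<close> the perturbation takes away at most half of the lower bound \<open>e\<close> for \<open>2 J\<close>.\<close>
  define F where "F = {x \<in> {c..d}. e / (2 * K) < norm (atom Hq x)}"
  have fF: "finite F" unfolding F_def using e K by (intro large_atoms_finite Hq cd) simp
  define N where "N = of_nat (CARD('n) * CARD('n)) * (2 / e)"
  have small: "norm (R x) \<le> N" if x: "x \<in> {c..d}" "x \<notin> F" for x
  proof -
    have "norm (atom Hq x) \<le> e / (2 * K)" using x by (auto simp: F_def)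
    then have aK: "norm (atom Hq x) * K \<le> e / 2" using K(1) by (simp add: field_simps)
    have Rz: "norm (R x *v z) \<le> 2 / e * norm z" for z
    proof -
      let ?r = "R x *v z"
      have "norm (atom Hq x *v ?r) \<le> norm (atom Hq x) * norm ?r * K" by (rule K(2))
      also have "\<dots> = (norm (atom Hq x) * K) * norm ?r" by simp
      also have "\<dots> \<le> e / 2 * norm ?r" using aK by (rule mult_right_mono) simp
      finally have 1: "norm (atom Hq x *v ?r) \<le> e / 2 * norm ?r" .
      have "z = (2 *\<^sub>R J) *v ?r + atom Hq x *v ?r"
        using R_inverse[OF xI[OF x(1)], of z] by (simp add: matrix_vector_mult_add_rdistrib)
      then have "norm ((2 *\<^sub>R J) *v ?r) \<le> norm z + norm (atom Hq x *v ?r)"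
        by (metis norm_triangle_sub add_diff_cancel_right' norm_triangle_ineq4)
      then have "e * norm ?r \<le> norm z + e / 2 * norm ?r" using e(2)[of ?r] 1 by linarith
      then show ?thesis using e(1) by (simp add: field_simps)
    qed
    have "cmod (R x $ i $ j) \<le> 2 / e" for i j
    proof -
      have "R x $ i $ j = (R x *v axis j 1) $ i" by (simp add: matrix_vector_mult_def axis_def mult_delta_right)
      also have "cmod \<dots> \<le> norm (R x *v axis j 1)" by (rule Finite_Cartesian_Product.norm_nth_le)
      also have "\<dots> \<le> 2 / e * norm (axis j (1::complex))" by (rule Rz)
      finally show ?thesis by (simp add: norm_axis_complex)
    qed
    then have "(\<Sum>i\<in>UNIV. \<Sum>j\<in>UNIV. cmod (R x $ i $ j)) \<le> (\<Sum>i\<in>(UNIV::'n set). \<Sum>j\<in>(UNIV::'n set). 2 / e)"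
      by (intro sum_mono)
    then show ?thesis using norm_matrix_le[of "R x"] by (simp add: N_def)
  qed
  have "norm (R x) \<le> Max (insert N ((norm \<circ> R) ` F))" if "x \<in> {c..d}" for x
  proof (cases "x \<in> F")
    case True then show ?thesis using fF by (intro Max_ge) auto
  next
    case False
    then show ?thesis using small[OF that] fF by (intro order_trans[OF _ Max_ge[of _ N]]) auto
  qed
  then show ?thesis by blast
qed

lemma loc_int_Hq_R:
  assumes z: "z \<in> borel_measurable M" and bd: "\<And>c d. c \<in> I \<Longrightarrow> d \<in> I \<Longrightarrow> \<exists>C. \<forall>x\<in>{c..d}. norm (z x) \<le> C"
  shows "loc_int (\<lambda>x. Hq x *v (R x *v (z x :: complex^'n)))"
proof (rule loc_int_mult_bounded[OF Hq])
  note bm = bilinear_measurable[OF bounded_bilinear_matrix_vector]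
  show "(\<lambda>x. Hq x *v (R x *v z x)) \<in> borel_measurable M"
    by (intro bm loc_int_measurable[OF Hq] R_measurable z)
  obtain K where K: "K > 0" "\<And>A z. norm ((A :: complex^'n^'n) *v z) \<le> norm A * norm z * K"
    using bounded_bilinear.pos_bounded[OF bounded_bilinear_matrix_vector] by blast
  fix c d assume cd: "c \<in> I" "d \<in> I"
  obtain B where B: "\<And>x. x \<in> {c..d} \<Longrightarrow> norm (R x) \<le> B" using R_bounded[OF cd] by blast
  obtain C where C: "\<And>x. x \<in> {c..d} \<Longrightarrow> norm (z x) \<le> C" using bd[OF cd] by blast
  have "norm (Hq x *v (R x *v z x)) \<le> (B * C * K * K) * norm (Hq x)" if x: "x \<in> {c..d}" for x
  proof -
    have "norm (R x) * norm (z x) \<le> B * C" using B[OF x] C[OF x] order_trans[OF norm_ge_zero B[OF x]] by (intro mult_mono) auto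
    then have "norm (R x *v z x) \<le> B * C * K" using K(1) order_trans[OF K(2) mult_right_mono] by auto
    then have "norm (Hq x) * norm (R x *v z x) * K \<le> norm (Hq x) * (B * C * K) * K"
      using K(1) by (intro mult_right_mono mult_left_mono) auto
    then show ?thesis using K(2)[of "Hq x" "R x *v z x"] by (simp add: algebra_simps)
  qed
  then show "\<exists>B. \<forall>x\<in>{c..d}. norm (Hq x *v (R x *v z x)) \<le> B * norm (Hq x)" by blast
qed

text \<open>
  Local integrability of a matrix function can be tested on vectors, so that only the vectors
  \<open>R x v\<close> have to be estimated.
\<close>

lemma matrix_loc_int:
  fixes B :: "real \<Rightarrow> complex^'n^'n"
  assumes "\<And>z. loc_int (\<lambda>x. B x *v z)" shows "loc_int B"
proof -
  have "loc_int (\<lambda>x. \<Sum>j\<in>S. (\<chi> i k. if k = j then (B x *v axis j 1) $ i else 0))" for S :: "'n set"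
  proof (induction S rule: infinite_finite_induct)
    case (insert j S)
    have "linear (\<lambda>z::complex^'n. (\<chi> i k. if k = j then z $ i else 0) :: complex^'n^'n)"
      by (intro linearI) (auto simp: vec_eq_iff)
    then have "loc_int (\<lambda>x. (\<chi> i k. if k = j then (B x *v axis j 1) $ i else 0))"
      using loc_int_linear[OF assms[of "axis j 1"]] by (simp add: linear_conv_bounded_linear)
    then show ?case using insert by (simp add: loc_int_add)
  qed (simp_all add: loc_int_def set_integrable_def)
  moreover have "(\<Sum>j\<in>UNIV. (\<chi> i k. if k = j then (B x *v axis j 1) $ i else 0)) = B x" for x
    by (simp add: vec_eq_iff matrix_vector_mult_def axis_def mult_delta_right)
  ultimately show ?thesis by (metis (no_types, lifting) ext)
qed

text \<open>
  At an atom the balanced value is \<open>u = R (2 J u\<^sup>- + \<Delta>k)\<close>. Substituting this turns the equation into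
  a Volterra equation for the left limit, which is solvable forward from any point.
\<close>

lemma forward_solution:
  assumes k: "loc_int k" and c: "c \<in> I"
  shows "\<exists>u. sol_on {x \<in> I. c \<le> x} k u \<and> left_lim u c = y0"
proof -
  define B where "B x = - (Ji ** (Hq x ** (R x ** (2 *\<^sub>R J))))" for x
  have Bz: "B x *v z = - (Ji *v (Hq x *v (R x *v (2 *\<^sub>R (J *v z)))))" for x z
    by (simp add: B_def matrix_vector_minus_left matrix_vector_mul_assoc[symmetric] matrix_vector_scaleR_left)
  define l where "l x = Ji *v (k x - Hq x *v (R x *v atom k x))" for x
  have atm: "atom k \<in> borel_measurable M" by (rule measurable_if_atoms[OF k, of _ 0])
  have li: "loc_int l" unfolding l_def
  proof (rule loc_int_linear[OF _ matrix_vector_mul_bounded_linear], rule loc_int_diff[OF k], rule loc_int_Hq_R[OF atm])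
    show "\<exists>C. \<forall>x\<in>{c..d}. norm (atom k x) \<le> C" if "c \<in> I" "d \<in> I" for c d using atom_le[OF k that] by blast
  qed
  have Bi: "loc_int B"
  proof (rule matrix_loc_int)
    fix z :: "complex^'n"
    have "loc_int (\<lambda>x. Hq x *v (R x *v (2 *\<^sub>R (J *v z))))" by (rule loc_int_Hq_R) auto
    from loc_int_linear[OF loc_int_linear[OF this matrix_vector_mul_bounded_linear[of Ji]] bounded_linear_minus[OF bounded_linear_ident]]
    show "loc_int (\<lambda>x. B x *v z)" by (simp add: Bz)
  qed
  obtain y where y: "y \<in> borel_measurable M"
     "\<And>x. x \<in> I \<Longrightarrow> c \<le> x \<Longrightarrow> y x = y0 + (LINT s:{c..<x}|M. B s *v y s + l s)"
     "\<And>d. d \<in> I \<Longrightarrow> \<exists>C. \<forall>x\<in>{c..d}. norm (y x) \<le> C"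
    using volterra_solution[OF Bi li c, of y0] by blast
  define \<kappa> where "\<kappa> x = (if c \<le> x then B x *v y x + l x else 0)" for x
  obtain K where K: "K > 0" "\<And>A z. norm ((A :: complex^'n^'n) *v z) \<le> norm A * norm z * K"
    using bounded_bilinear.pos_bounded[OF bounded_bilinear_matrix_vector] by blast
  have \<kappa>i: "loc_int \<kappa>"
  proof (rule loc_int_mult_bounded[OF loc_int_add[OF loc_int_norm[OF Bi] loc_int_norm[OF li]]])
    have [measurable]: "(\<lambda>x. B x *v y x) \<in> borel_measurable M" "l \<in> borel_measurable M"
      by (intro bilinear_measurable[OF bounded_bilinear_matrix_vector] loc_int_measurable Bi li y(1))+
    show "\<kappa> \<in> borel_measurable M" unfolding \<kappa>_def by measurable
    fix s t assume st: "s \<in> I" "t \<in> I"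
    obtain C where C: "\<And>x. x \<in> {c..t} \<Longrightarrow> norm (y x) \<le> C" using y(3)[OF st(2)] by blast
    have "norm (\<kappa> x) \<le> (\<bar>C\<bar> * K + 1) * norm (norm (B x) + norm (l x))" if x: "x \<in> {s..t}" for x
    proof (cases "c \<le> x")
      case True
      then have yC: "norm (y x) \<le> \<bar>C\<bar>" using C[of x] x by auto
      have "norm (\<kappa> x) \<le> norm (B x *v y x) + norm (l x)" using True by (simp add: \<kappa>_def norm_triangle_ineq)
      also have "norm (B x *v y x) \<le> norm (B x) * norm (y x) * K" by (rule K(2))
      also have "\<dots> \<le> norm (B x) * \<bar>C\<bar> * K" using yC K(1) by (intro mult_right_mono mult_left_mono) auto
      also have "norm (B x) * \<bar>C\<bar> * K + norm (l x) \<le> (\<bar>C\<bar> * K + 1) * (norm (B x) + norm (l x))"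
        using K(1) by (simp add: algebra_simps)
      finally show ?thesis by simp
    qed (simp add: \<kappa>_def K(1) less_imp_le)
    then show "\<exists>B'. \<forall>x\<in>{s..t}. norm (\<kappa> x) \<le> B' * norm (norm (B x) + norm (l x))" by blast
  qed
  obtain U where U: "prim \<kappa> U" "U c = y0 + (1/2) *\<^sub>R atom \<kappa> c" using prim_exists[OF \<kappa>i c] by blast
  have Uc: "lft \<kappa> U c = y0" using U(2) by (simp add: lft_def)
  have lU: "lft \<kappa> U x = y x" if x: "x \<in> I" "c \<le> x" for x
  proof -
    have "(LINT s:{c..<x}|M. \<kappa> s) = (LINT s:{c..<x}|M. B s *v y s + l s)"
      using LB_M[OF LB_intervals(2)[OF c x(1)]] by (intro set_lebesgue_integral_cong) (auto simp: \<kappa>_def)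
    then show ?thesis using prim_lft[OF U(1) \<kappa>i c x] Uc y(2)[OF x] by (simp add: algebra_simps)
  qed
  have "J *v \<kappa> x = k x - Hq x *v U x" if x: "x \<in> I" "c \<le> x" for x
  proof -
    \<comment> \<open>The value that the jump condition prescribes; it turns out to be the balanced value \<open>U x\<close>.\<close>
    define v where "v = R x *v (2 *\<^sub>R (J *v y x) + atom k x)"
    have J\<kappa>: "J *v \<kappa> x = k x - Hq x *v v"
      using x(2) by (simp add: \<kappa>_def Bz l_def v_def matrix_vector_right_distrib matrix_vector_minus matrix_vector_diff J_Ji algebra_simps)
    have "J *v atom \<kappa> x = atom k x - atom Hq x *v v"
      using J\<kappa> by (simp add: atom_def matrix_vector_scaleR_right matrix_vector_scaleR_left scaleR_diff_right)
    moreover have e: "2 *\<^sub>R (J *v v) + atom Hq x *v v = 2 *\<^sub>R (J *v y x) + atom k x"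
      using R_inverse[OF x(1), of "2 *\<^sub>R (J *v y x) + atom k x"]
      by (simp add: v_def matrix_vector_mult_add_rdistrib matrix_vector_scaleR_left)
    moreover have "2 *\<^sub>R (J *v v) = (2 *\<^sub>R (J *v y x) + atom k x) - atom Hq x *v v"
      unfolding e[symmetric] by simp
    ultimately have "2 *\<^sub>R (J *v v) = 2 *\<^sub>R (J *v y x) + J *v atom \<kappa> x" by simp
    then have "J *v (2 *\<^sub>R v) = J *v (2 *\<^sub>R y x + atom \<kappa> x)"
      by (simp add: matrix_vector_right_distrib matrix_vector_scaleR_right)
    then have "2 *\<^sub>R v = 2 *\<^sub>R y x + atom \<kappa> x" using Ji_J by metis
    then have "(1/2) *\<^sub>R (2 *\<^sub>R v) = (1/2) *\<^sub>R (2 *\<^sub>R y x + atom \<kappa> x)" by simp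
    then have "v = y x + (1/2) *\<^sub>R atom \<kappa> x" by (simp add: scaleR_add_right)
    also have "\<dots> = U x" using lU[OF x] by (simp add: lft_def algebra_simps)
    finally show ?thesis using J\<kappa> by simp
  qed
  then have "sol_on {x \<in> I. c \<le> x} k U" unfolding sol_on_def using \<kappa>i U(1) by blast
  then show ?thesis using left_lim_prim[OF U(1) \<kappa>i c] Uc by blast
qed

text \<open>
  The Lagrange identity gives \<open>\<Phi>\<^sup>* J \<Phi> = J\<close> for a fundamental matrix, so \<open>\<Phi>\<close> stays invertible and
  every value at \<open>t\<close> is attained by a solution starting at \<open>c\<close>. This replaces solving the equation backward.
\<close>

lemma homogeneous_values:
  assumes c: "c \<in> I" and t: "t \<in> I" "c \<le> t"
  shows "\<exists>h. sol_on {x \<in> I. c \<le> x} (\<lambda>_. 0) h \<and> left_lim h t = y"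
proof -
  let ?X = "{x \<in> I. c \<le> x}"
  have l0: "loc_int (\<lambda>_. 0 :: complex^'n)" by (simp add: loc_int_def set_integrable_def)
  have "\<exists>h. sol_on ?X (\<lambda>_. 0) h \<and> left_lim h c = axis i 1" for i by (rule forward_solution[OF l0 c])
  then obtain \<Phi> where \<Phi>: "\<And>i. sol_on ?X (\<lambda>_. 0) (\<Phi> i)" "\<And>i. left_lim (\<Phi> i) c = axis i 1" by metis
  define F where "F = (\<chi> r j. left_lim (\<Phi> j) t $ r)"
  have X: "{c..<t} \<subseteq> ?X" using I_interval[OF c t(1)] by auto
  have "herm (left_lim (\<Phi> i) t) (J *v left_lim (\<Phi> j) t) = J $ i $ j" for i j
    using lagrange_identity[OF \<Phi>(1)[of j] \<Phi>(1)[of i] c t X] \<Phi>(2)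
    by (simp add: pairing_def matrix_axis_entry)
  then have "(cadjoint F ** (J ** F)) $ i $ j = J $ i $ j" for i j
    by (simp add: herm_def F_def cadjoint_def matrix_matrix_mult_def matrix_vector_mult_def)
  then have "cadjoint F ** (J ** F) = J" by (simp add: vec_eq_iff)
  then have "matrix_inv J ** (cadjoint F ** (J ** F)) = mat 1" using matrix_inv_left[OF J_inv] by simp
  then have "(matrix_inv J ** (cadjoint F ** J)) ** F = mat 1" by (simp add: matrix_mul_assoc)
  then have "invertible F" using invertible_left_inverse by blast
  define \<alpha> where "\<alpha> = matrix_inv F *v y"
  have "F *v \<alpha> = y" using matrix_inv_mult_vec(1)[OF \<open>invertible F\<close>] by (simp add: \<alpha>_def)
  moreover have "F *v \<alpha> = (\<Sum>j\<in>UNIV. \<alpha> $ j *s left_lim (\<Phi> j) t)"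
    by (simp add: vec_eq_iff matrix_vector_mult_def F_def mult.commute)
  ultimately show ?thesis
    using sol_on_sum[of UNIV ?X \<Phi> "\<lambda>j. \<alpha> $ j"] \<Phi>(1) t(1) by (intro exI[of _ "\<lambda>x. \<Sum>j\<in>UNIV. \<alpha> $ j *s \<Phi> j x"]) auto
qed

lemma half_line_solution:
  assumes k: "loc_int k" and c: "c \<in> I" and x0: "x0 \<in> I" "c \<le> x0"
  shows "\<exists>u. sol_on {x \<in> I. c \<le> x} k u \<and> left_lim u x0 = y0"
proof -
  obtain p where p: "sol_on {x \<in> I. c \<le> x} k p" using forward_solution[OF k c] by blast
  obtain h where h: "sol_on {x \<in> I. c \<le> x} (\<lambda>_. 0) h" "left_lim h x0 = y0 - left_lim p x0"
    using homogeneous_values[OF c x0] by blast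
  show ?thesis using sol_on_add_scale[OF p h(1), where c = 1] x0(1) h(2)
    by (intro exI[of _ "\<lambda>x. p x + 1 *s h x"]) simp
qed

text \<open>
  The difference \<open>d\<close> of two solutions has \<open>h\<^sup>* J d\<close> constant, hence zero, for every homogeneous solution \<open>h\<close>, and
  the values of \<open>h\<close> at a point are arbitrary.
\<close>

lemma half_line_unique:
  assumes u: "sol_on {x \<in> I. c \<le> x} k u" and v: "sol_on {x \<in> I. c \<le> x} k v"
    and c: "c \<in> I" and x0: "x0 \<in> I" "c \<le> x0" and eq: "left_lim u x0 = left_lim v x0"
    and x: "x \<in> I" "c \<le> x"
  shows "u x = v x"
proof -
  let ?X = "{x \<in> I. c \<le> x}"
  define d where "d = (\<lambda>x. u x + (- 1) *s v x)"
  have d: "sol_on ?X (\<lambda>_. 0) d" "left_lim d x0 = 0"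
    using sol_on_add_scale(1)[OF u v, where c = "- 1"] sol_on_add_scale(2)[OF u v x0(1), where c = "- 1"] eq
    by (simp_all add: d_def vector_smult_lneg)
  have "herm y (J *v left_lim d x) = 0" for y
  proof -
    obtain h where h: "sol_on ?X (\<lambda>_. 0) h" "left_lim h x = y" using homogeneous_values[OF c x] by blast
    have "pairing h d x = pairing h d x0"
    proof (cases "x0 \<le> x")
      case True
      have "{x0..<x} \<subseteq> ?X" using I_interval[OF x0(1) x(1)] x0(2) by auto
      from lagrange_identity[OF d(1) h(1) x0(1) x(1) True this] show ?thesis by simp
    next
      case False
      have "{x..<x0} \<subseteq> ?X" using I_interval[OF x(1) x0(1)] x(2) by auto
      from lagrange_identity[OF d(1) h(1) x(1) x0(1) _ this] False show ?thesis by simp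
    qed
    then show ?thesis using h(2) d(2) by (simp add: pairing_def)
  qed
  then have "J *v left_lim d x = 0" using herm_axis by (metis vec_eq_iff zero_index)
  then have "left_lim d x = 0" using Ji_J[of "left_lim d x"] by simp
  then have "d x = 0" using x by (intro sol_on_zero_if[OF d(1)]) auto
  then show ?thesis by (simp add: d_def vector_smult_lneg)
qed

lemma global_unique:
  assumes u: "sol_on I k u" and v: "sol_on I k v" and x0: "x0 \<in> I" and eq: "left_lim u x0 = left_lim v x0" and x: "x \<in> I"
  shows "u x = v x"
proof -
  have "min x x0 \<in> I" using x x0 by (simp add: min_def)
  then show ?thesis
    using half_line_unique[OF sol_on_mono[OF u] sol_on_mono[OF v] _ x0 _ eq x, of "min x x0"] by auto
qed

text \<open>
  The half-lines \<open>[c n, b)\<close> exhaust the interval as \<open>c n\<close> decreases to \<open>a\<close>. Their solutions with the same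
  value at \<open>x0\<close> agree where both are defined and can be glued.
\<close>

theorem global_solution:
  assumes k: "loc_int k" and x0: "x0 \<in> I"
  shows "\<exists>u. sol_on I k u \<and> left_lim u x0 = y0"
proof -
  obtain K where K: "incseq K" "(\<Union>n. K n) = I" "\<And>n::nat. \<exists>c d. c \<in> I \<and> d \<in> I \<and> c < d \<and> K n = {c..d}"
    using LB_exhaustion by metis
  then obtain c d where cd: "\<And>n. c n \<in> I" "\<And>n. d n \<in> I" "\<And>n. c n < d n" "\<And>n. K n = {c n..d n}" by metis
  define c' where "c' n = min (c n) x0" for n
  have c'I: "c' n \<in> I" and c'x0: "c' n \<le> x0" for n using cd(1)[of n] x0 by (auto simp: c'_def min_def)
  have dec: "c' n \<le> c' m" if "m \<le> n" for m n
  proof -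
    have "{c m..d m} \<subseteq> {c n..d n}" using K(1) that cd(4) by (auto simp: incseq_def)
    then show ?thesis using cd(3)[of m] by (auto simp: c'_def)
  qed
  have ex: "\<exists>n. c' n \<le> x" if xI: "x \<in> I" for x
  proof -
    obtain n where "x \<in> K n" using K(2) xI by auto
    then show ?thesis using cd(4)[of n] by (intro exI[of _ n]) (auto simp: c'_def)
  qed
  have "\<exists>u. sol_on {x \<in> I. c' n \<le> x} k u \<and> left_lim u x0 = y0" for n
    by (rule half_line_solution[OF k c'I x0 c'x0])
  then obtain U where U: "\<And>n. sol_on {x \<in> I. c' n \<le> x} k (U n)" "\<And>n. left_lim (U n) x0 = y0" by metis
  have agree: "U m x = U n x" if "m \<le> n" "x \<in> I" "c' m \<le> x" for m n x
  proof -
    have "sol_on {x \<in> I. c' m \<le> x} k (U n)" by (rule sol_on_mono[OF U(1)]) (use dec[OF that(1)] in auto)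
    then show ?thesis using half_line_unique[OF U(1)[of m] _ c'I x0 c'x0 _ that(2,3), of "U n"] U(2) by simp
  qed
  define u where "u x = U (LEAST n. c' n \<le> x) x" for x
  have uU: "u x = U n x" if "x \<in> I" "c' n \<le> x" for x n
  proof -
    have "(LEAST n. c' n \<le> x) \<le> n" "c' (LEAST n. c' n \<le> x) \<le> x" using that by (auto intro: Least_le LeastI)
    then show ?thesis unfolding u_def using agree that by auto
  qed
  define \<kappa> where "\<kappa> x = Ji *v (k x - Hq x *v u x)" for x
  have "\<exists>\<kappa>. loc_int \<kappa> \<and> prim \<kappa> (U n) \<and> (\<forall>x\<in>{x \<in> I. c' n \<le> x}. J *v \<kappa> x = k x - Hq x *v U n x)" for n
    using U(1)[of n] unfolding sol_on_def .
  then obtain \<kappa>n where \<kappa>n: "\<And>n. loc_int (\<kappa>n n)" "\<And>n. prim (\<kappa>n n) (U n)"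
    "\<And>n x. x \<in> I \<Longrightarrow> c' n \<le> x \<Longrightarrow> J *v \<kappa>n n x = k x - Hq x *v U n x" by (metis (mono_tags, lifting) mem_Collect_eq)
  have eq: "\<kappa> x = \<kappa>n n x" if "x \<in> I" "c' n \<le> x" for n x
    unfolding \<kappa>_def uU[OF that] \<kappa>n(3)[OF that, symmetric] by (rule Ji_J)
  have \<kappa>i: "loc_int \<kappa>" unfolding loc_int_def
  proof
    fix E assume E: "E \<in> LB"
    obtain s t where st: "a < ereal s" "ereal t < b" "E \<subseteq> {s..t}" using E by (auto simp: local_borel_def)
    show "set_integrable M E \<kappa>"
    proof (cases "s \<le> t")
      case True
      then have sI: "s \<in> I" "t \<in> I" using I_endpoints st by auto
      then obtain n where "c' n \<le> s" using ex by blast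
      then have "\<kappa> x = \<kappa>n n x" if "x \<in> E" for x using eq[of x n] st(3) that LB_subset_I[OF E] by force
      then show ?thesis using loc_int_E[OF \<kappa>n(1)[of n] E] by (subst set_integrable_cong[of M M E E \<kappa> "\<kappa>n n"]) auto
    next
      case False then have "E = {}" using st(3) by auto
      then show ?thesis by simp
    qed
  qed
  have pr: "prim \<kappa> u" unfolding prim_def
  proof (intro ballI impI)
    fix s t assume st: "s \<in> I" "t \<in> I" "s \<le> t"
    obtain n where n: "c' n \<le> s" using ex[OF st(1)] by blast
    have "Phi \<kappa> s t = Phi (\<kappa>n n) s t"
      unfolding Phi_def using eq[of _ n] n I_interval[OF st(1,2)] LB_M[OF LB_intervals(2)[OF st(1,2)]] LB_M[OF LB_intervals(3)[OF st(1,2)]]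
      by (intro arg_cong2[of _ _ _ _ "\<lambda>x y. (1/2) *\<^sub>R (x + y)"] set_lebesgue_integral_cong) auto
    then show "u t - u s = Phi \<kappa> s t"
      using primD[OF \<kappa>n(2)[of n] st] uU[OF st(1) n] uU[of t n] st n by simp
  qed
  have sol: "sol_on I k u" unfolding sol_on_def using \<kappa>i pr by (intro exI[of _ \<kappa>]) (auto simp: \<kappa>_def J_Ji)
  have "left_lim u x0 = left_lim (U 0) x0"
    unfolding left_lim_prim[OF pr \<kappa>i x0] left_lim_prim[OF \<kappa>n(2,1) x0] lft_def atom_def
    using uU[OF x0 c'x0[of 0]] eq[OF x0 c'x0[of 0]] by simp
  then show ?thesis using sol U(2) by metis
qed

end

section \<open>A common dominating measure\<close>

lemma bounded_linear_herm_matrix: "bounded_linear (\<lambda>B::complex^'n^'n. herm \<alpha> (B *v \<alpha>))"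
  by (rule bounded_linear_compose[OF bounded_bilinear.bounded_linear_right[OF herm_bounded_bilinear]
        bounded_bilinear.bounded_linear_left[OF bounded_bilinear_matrix_vector]])

lemma bounded_linear_trace: "bounded_linear (trace :: complex^'n^'n \<Rightarrow> complex)"
  unfolding linear_conv_bounded_linear[symmetric]
  by (intro linearI) (simp_all add: trace_def sum.distrib scaleR_sum_right)

lemma bounded_linear_cadjoint: "bounded_linear (cadjoint :: complex^'n^'m \<Rightarrow> complex^'m^'n)"
  unfolding linear_conv_bounded_linear[symmetric]
  by (intro linearI) (simp_all add: cadjoint_def vec_eq_iff)

lemma trace_scaleR: "trace (r *\<^sub>R B) = of_real r * trace B" for B :: "complex^'n^'n"
proof -
  have "trace (r *\<^sub>R B) = r *\<^sub>R trace B"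
    by (rule linear_scale[OF bounded_linear.linear[OF bounded_linear_trace]])
  then show ?thesis by (simp only: scaleR_conv_of_real)
qed

lemma cadjoint_scaleR: "cadjoint (r *\<^sub>R B) = r *\<^sub>R cadjoint B" for B :: "complex^'n^'m"
  by (rule linear_scale[OF bounded_linear.linear[OF bounded_linear_cadjoint]])

lemma closed_psd_trace_1: "closed {B :: complex^'n^'n. psd B \<and> trace B = 1}"
proof -
  have "closed ((\<lambda>B::complex^'n^'n. herm \<alpha> (B *v \<alpha>)) -` \<real>\<^sub>\<ge>\<^sub>0)" for \<alpha>
    using bounded_linear.linear[OF bounded_linear_herm_matrix]
    by (intro closed_vimage closed_nonneg_Reals_complex linear_continuous_on bounded_linear_herm_matrix)
  moreover have "closed ((trace :: complex^'n^'n \<Rightarrow> complex) -` {1})"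
    by (intro closed_vimage linear_continuous_on bounded_linear_trace) auto
  moreover have "{B :: complex^'n^'n. psd B \<and> trace B = 1}
      = (\<Inter>\<alpha>. (\<lambda>B. herm \<alpha> (B *v \<alpha>)) -` \<real>\<^sub>\<ge>\<^sub>0) \<inter> trace -` {1}"
    by (auto simp: psd_def)
  ultimately show ?thesis by auto
qed

lemma closed_hermitian: "closed {B :: complex^'n^'n. cadjoint B = B}"
  by (intro closed_Collect_eq linear_continuous_on bounded_linear_cadjoint continuous_on_id)

lemma psd_scaleR: "psd B \<Longrightarrow> 0 \<le> r \<Longrightarrow> psd (r *\<^sub>R B)"
  unfolding psd_def
proof
  fix \<alpha> assume B: "\<forall>\<alpha>. herm \<alpha> (B *v \<alpha>) \<in> \<real>\<^sub>\<ge>\<^sub>0" and r: "0 \<le> r"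
  have "herm \<alpha> ((r *\<^sub>R B) *v \<alpha>) = of_real r * herm \<alpha> (B *v \<alpha>)"
    by (simp add: matrix_vector_scaleR_left herm_scaleR)
  also have "\<dots> \<in> \<real>\<^sub>\<ge>\<^sub>0" using B[rule_format, of \<alpha>] r by (simp add: complex_nonneg_Reals_iff)
  finally show "herm \<alpha> ((r *\<^sub>R B) *v \<alpha>) \<in> \<real>\<^sub>\<ge>\<^sub>0" .
qed

lemma psd_0: "psd 0" by (simp add: psd_def matrix_vector_mult_def herm_def)

locale hermitian_system = open_interval +
  fixes J :: "complex^'n^'n" and q w :: "real set \<Rightarrow> complex^'n^'n"
  assumes J_inv: "invertible J" and J_skew: "cadjoint J = - J"
    and q_distr0: "distr0 a b q" and w_distr0: "distr0 a b w"
    and q_herm: "hermitian0 a b q" and w_nonneg: "nonneg0 a b w"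
    and jumps: "\<forall>x \<in> einterval a b. invertible (2 *\<^sub>R J + jump a b q x) \<and> invertible (2 *\<^sub>R J - jump a b q x)"
begin

lemma psd_w: "E \<in> LB \<Longrightarrow> psd (w E)"
  using w_nonneg by (simp add: nonneg0_def psd_def)

definition tau :: "real set \<Rightarrow> real" where "tau E = Re (trace (w E))"

lemma trace_w: assumes "E \<in> LB" shows "trace (w E) = of_real (tau E)"
proof -
  have "Im (w E $ i $ i) = 0" for i
    using psd_nonneg(2)[OF psd_w[OF assms], of "axis i 1"] by (simp add: matrix_axis_entry)
  then show ?thesis by (simp add: tau_def trace_def complex_eq_iff)
qed

lemma tau_nonneg: assumes "E \<in> LB" shows "0 \<le> tau E"
proof -
  have "0 \<le> Re (w E $ i $ i)" for i
    using psd_nonneg(1)[OF psd_w[OF assms], of "axis i 1"] by (simp add: matrix_axis_entry)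
  then show ?thesis by (simp add: tau_def trace_def sum_nonneg)
qed

lemma tau_distr0: "distr0 a b tau"
  unfolding tau_def[abs_def]
  by (rule distr0_linear[OF w_distr0 bounded_linear_compose[OF bounded_linear_Re bounded_linear_trace]])

text \<open>A nonnegative distribution is its own variation, so the results on \<open>variation\<close> apply to \<open>tr w\<close>.\<close>

lemma trace_measure_eq: "trace_measure a b w = variation a b tau"
proof -
  have "(SUP A \<in> {A \<in> LB. A \<subseteq> E}. ennreal (Re (trace (w A)))) = tot_var tau E" for E
  proof (rule antisym)
    show "(SUP A \<in> {A \<in> LB. A \<subseteq> E}. ennreal (Re (trace (w A)))) \<le> tot_var tau E"
    proof (rule SUP_least)
      fix A assume A: "A \<in> {A \<in> LB. A \<subseteq> E}"
      then show "ennreal (Re (trace (w A))) \<le> tot_var tau E"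
        using tot_var_ge[of "{A}" E tau] tau_nonneg[of A] by (auto simp: tau_def disjoint_def)
    qed
    show "tot_var tau E \<le> (SUP A \<in> {A \<in> LB. A \<subseteq> E}. ennreal (Re (trace (w A))))"
      unfolding tot_var_def
    proof (rule SUP_least)
      fix P assume "P \<in> {P. finite P \<and> disjoint P \<and> P \<subseteq> LB \<and> \<Union> P \<subseteq> E}"
      then have P: "finite P" "disjoint P" "P \<subseteq> LB" "\<Union> P \<subseteq> E" by auto
      have "(\<Sum>A\<in>P. ennreal (norm (tau A))) = (\<Sum>A\<in>P. ennreal (tau A))"
        using tau_nonneg P(3) by (intro sum.cong) auto
      also have "\<dots> = ennreal (tau (\<Union>P))"
        using tau_nonneg P by (subst sum_ennreal) (auto simp: distr0_Union[OF tau_distr0])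
      also have "\<dots> \<le> (SUP A \<in> {A \<in> LB. A \<subseteq> E}. ennreal (Re (trace (w A))))"
        unfolding tau_def using P LB_Union[OF P(1,3)] by (intro SUP_upper) auto
      finally show "(\<Sum>A\<in>P. ennreal (norm (tau A))) \<le> (SUP A \<in> {A \<in> LB. A \<subseteq> E}. ennreal (Re (trace (w A))))" .
    qed
  qed
  then show ?thesis unfolding trace_measure_def variation_def tot_var_def by presburger
qed

abbreviation M2 :: "real measure" where "M2 \<equiv> trace_measure a b w"
abbreviation M1 :: "real measure" where "M1 \<equiv> variation a b q"

lemma M1_loc_finite: "loc_finite M1" by (rule loc_finite_variation[OF q_distr0])

lemma M2_loc_finite: "loc_finite M2"
  unfolding trace_measure_eq by (rule loc_finite_variation[OF tau_distr0])

lemma measure_M2: "E \<in> LB \<Longrightarrow> measure M2 E = tau E"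
  using emeasure_variation_nonneg[OF tau_distr0 tau_nonneg, of E] tau_nonneg[of E]
  unfolding trace_measure_eq by (simp add: measure_def)

lemma norm_w_le: "E \<in> LB \<Longrightarrow> norm (w E) \<le> of_nat (CARD('n) * CARD('n)) * measure M2 E"
  using psd_norm_le[OF psd_w] by (simp add: measure_M2 tau_def)

lemma Wt_props:
  "Wt a b w \<in> borel_measurable M2"
  "E \<in> LB \<Longrightarrow> set_integrable M2 E (Wt a b w)"
  "E \<in> LB \<Longrightarrow> w E = (LINT x:E|M2. Wt a b w x)"
  unfolding Wt_def
  using RN_density_props[of M2 w "of_nat (CARD('n) * CARD('n))"] M2_loc_finite w_distr0 norm_w_le by blast+

lemma norm_q_le: "E \<in> LB \<Longrightarrow> norm (q E) \<le> 1 * measure M1 E"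
  using norm_le_emeasure_variation[OF q_distr0, of E] loc_finite_emeasure_eq[OF M1_loc_finite, of E] by simp

abbreviation qd :: "real \<Rightarrow> complex^'n^'n" where "qd \<equiv> RN_density a b M1 q"

lemma qd_props:
  "qd \<in> borel_measurable M1"
  "E \<in> LB \<Longrightarrow> set_integrable M1 E qd"
  "E \<in> LB \<Longrightarrow> q E = (LINT x:E|M1. qd x)"
  using RN_density_props[of M1 q 1] M1_loc_finite q_distr0 norm_q_le by blast+

lemma AE_Wt: "AE x in M2. Wt a b w x \<in> {B. psd B \<and> trace B = 1}"
proof (rule density_in_closed[OF M2_loc_finite Wt_props(2) closed_psd_trace_1])
  fix E assume E: "E \<in> LB" "measure M2 E > 0"
  have "trace ((1 / measure M2 E) *\<^sub>R w E) = of_real (1 / measure M2 E) * trace (w E)"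
    by (rule trace_scaleR)
  then show "(1 / measure M2 E) *\<^sub>R (LINT x:E|M2. Wt a b w x) \<in> {B. psd B \<and> trace B = 1}"
    using E psd_scaleR[OF psd_w[OF E(1)], of "1 / measure M2 E"] trace_w[OF E(1)]
    by (simp add: Wt_props(3)[OF E(1), symmetric] measure_M2)
qed auto

lemma AE_qd: "AE x in M1. qd x \<in> {B. cadjoint B = B}"
proof (rule density_in_closed[OF M1_loc_finite qd_props(2) closed_hermitian])
  fix E assume E: "E \<in> LB" "measure M1 E > 0"
  have "cadjoint ((1 / measure M1 E) *\<^sub>R q E) = (1 / measure M1 E) *\<^sub>R q E"
    using q_herm E(1) by (simp add: hermitian0_def cadjoint_scaleR)
  then show "(1 / measure M1 E) *\<^sub>R (LINT x:E|M1. qd x) \<in> {B. cadjoint B = B}"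
    by (simp add: qd_props(3)[OF E(1), symmetric])
qed auto

text \<open>Versions of the densities that are symmetric and nonnegative at every point, not only almost everywhere.\<close>

definition Wg :: "real \<Rightarrow> complex^'n^'n" where
  "Wg x = (if Wt a b w x \<in> {B. psd B \<and> trace B = 1} then Wt a b w x else 0)"

definition qg :: "real \<Rightarrow> complex^'n^'n" where
  "qg x = (if qd x \<in> {B. cadjoint B = B} then qd x else 0)"

lemma Wg_measurable: "Wg \<in> borel_measurable M2"
proof -
  note [measurable] = Wt_props(1)
  have [measurable]: "{B :: complex^'n^'n. psd B \<and> trace B = 1} \<in> sets borel"
    using closed_psd_trace_1 by (rule borel_closed)
  show ?thesis unfolding Wg_def[abs_def] by measurable
qed

lemma qg_measurable: "qg \<in> borel_measurable M1"
proof -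
  note [measurable] = qd_props(1)
  have [measurable]: "{B :: complex^'n^'n. cadjoint B = B} \<in> sets borel"
    using closed_hermitian by (rule borel_closed)
  show ?thesis unfolding qg_def[abs_def] by measurable
qed

lemma AE_Wg: "AE x in M2. Wt a b w x = Wg x" using AE_Wt by eventually_elim (simp add: Wg_def)

lemma AE_qg: "AE x in M1. qd x = qg x" using AE_qd by eventually_elim (simp add: qg_def)

lemma psd_Wg: "psd (Wg x)" by (simp add: Wg_def psd_0)

lemma qg_herm: "cadjoint (qg x) = qg x" by (simp add: qg_def cadjoint_def vec_eq_iff)

lemma norm_Wg_sq: "(norm (Wg x *v z))\<^sup>2 \<le> Re (herm z (Wg x *v z))"
proof (cases "Wt a b w x \<in> {B. psd B \<and> trace B = 1}")
  case True
  then show ?thesis using psd_norm_mult_sq[OF psd_Wg, of x z] by (simp add: Wg_def)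
next
  case False
  then have "Wg x = 0" by (simp only: Wg_def if_False)
  then show ?thesis by (simp add: matrix_vector_mult_def vec_eq_iff herm_def flip: zero_vec_def)
qed

text \<open>
  The variation of a nonnegative distribution is the measure it defines, so this is the sum of \<open>M1\<close> and
  \<open>M2\<close>. With respect to \<open>M\<close> both \<open>q u\<close> and \<open>w f\<close> have densities.
\<close>

definition M :: "real measure" where
  "M = variation a b (\<lambda>E. measure M1 E + measure M2 E)"

lemma M_sum_distr0: "distr0 a b (\<lambda>E. measure M1 E + measure M2 E)"
  by (intro distr0_add distr0_measure M1_loc_finite M2_loc_finite)

lemma M_loc_finite: "loc_finite M"
  unfolding M_def by (rule loc_finite_variation[OF M_sum_distr0])

lemma measure_M: "E \<in> LB \<Longrightarrow> measure M E = measure M1 E + measure M2 E"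
  unfolding M_def using emeasure_variation_nonneg[OF M_sum_distr0, of E]
  by (intro measure_eq_emeasure_eq_ennreal) auto

lemma ac_M: assumes N: "loc_finite N" and le: "\<And>E. E \<in> LB \<Longrightarrow> measure N E \<le> measure M E"
  shows "absolutely_continuous M N"
  unfolding absolutely_continuous_def
proof
  fix E assume E: "E \<in> null_sets M"
  have EN: "E \<in> sets N" using E M_loc_finite N by (auto simp: loc_finite_def)
  moreover have "emeasure N E = 0"
  proof (rule null_if_locally_null[OF N EN])
    fix F assume F: "F \<in> LB" "F \<subseteq> E"
    have "emeasure M F = 0" using E F(2) loc_finite_LB[OF M_loc_finite F(1)] by (auto intro: emeasure_eq_0)
    then have "measure N F = 0" using le[OF F(1)] measure_nonneg[of N F] by (simp add: measure_def[of M])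
    then show "emeasure N F = 0" using loc_finite_emeasure_eq[OF N F(1)] by simp
  qed
  ultimately show "E \<in> null_sets N" by auto
qed

definition is_density :: "real measure \<Rightarrow> (real \<Rightarrow> real) \<Rightarrow> bool" where
  "is_density N h \<longleftrightarrow> h \<in> borel_measurable M \<and> (\<forall>x. 0 \<le> h x) \<and> N = density M (\<lambda>x. ennreal (h x))"

definition h1 where "h1 = (SOME h. is_density M1 h)"
definition h2 where "h2 = (SOME h. is_density M2 h)"

lemma h1: "h1 \<in> borel_measurable M" "0 \<le> h1 x" "M1 = density M (\<lambda>x. ennreal (h1 x))"
  and h2: "h2 \<in> borel_measurable M" "0 \<le> h2 x" "M2 = density M (\<lambda>x. ennreal (h2 x))"
proof -
  have "\<exists>h. is_density M1 h" unfolding is_density_def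
    by (rule nonneg_density_exists[OF M_loc_finite M1_loc_finite ac_M[OF M1_loc_finite]]) (auto simp: measure_M)
  from someI_ex[OF this] have "is_density M1 h1" by (simp only: h1_def)
  then show "h1 \<in> borel_measurable M" "0 \<le> h1 x" "M1 = density M (\<lambda>x. ennreal (h1 x))"
    unfolding is_density_def by blast+
  have "\<exists>h. is_density M2 h" unfolding is_density_def
    by (rule nonneg_density_exists[OF M_loc_finite M2_loc_finite ac_M[OF M2_loc_finite]]) (auto simp: measure_M)
  from someI_ex[OF this] have "is_density M2 h2" by (simp only: h2_def)
  then show "h2 \<in> borel_measurable M" "0 \<le> h2 x" "M2 = density M (\<lambda>x. ennreal (h2 x))"
    unfolding is_density_def by blast+
qed

sublocale interval_measure a b M by unfold_locales (rule M_loc_finite)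

lemma sets_M1: "sets M1 = sets M" and sets_M2: "sets M2 = sets M"
  using M1_loc_finite M2_loc_finite M_loc_finite by (simp_all add: loc_finite_def)

lemma meas_M1: "f \<in> borel_measurable M1 \<longleftrightarrow> f \<in> borel_measurable M"
  and meas_M2: "f \<in> borel_measurable M2 \<longleftrightarrow> f \<in> borel_measurable M"
  using measurable_cong_sets[OF sets_M1 refl, of borel] measurable_cong_sets[OF sets_M2 refl, of borel] by auto

text \<open>The densities of \<open>q\<close> and \<open>w\<close> with respect to \<open>M\<close>.\<close>

definition Hq :: "real \<Rightarrow> complex^'n^'n" where "Hq x = h1 x *\<^sub>R qg x"
definition Hw :: "real \<Rightarrow> complex^'n^'n" where "Hw x = h2 x *\<^sub>R Wg x"

lemma Hq_herm: "cadjoint (Hq x) = Hq x"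
  by (simp add: Hq_def qg_herm cadjoint_scaleR)

lemma psd_Hw: "psd (Hw x)" unfolding Hw_def by (intro psd_scaleR psd_Wg h2)

lemma set_int_M1:
  fixes g :: "real \<Rightarrow> 'v::euclidean_space"
  assumes "g \<in> borel_measurable M" "E \<in> LB"
  shows "set_integrable M1 E g \<longleftrightarrow> set_integrable M E (\<lambda>x. h1 x *\<^sub>R g x)"
    and "(LINT x:E|M1. g x) = (LINT x:E|M. h1 x *\<^sub>R g x)"
  using density_set_integral[OF h1(1,2) assms(1) LB_M[OF assms(2)], folded h1(3)] by auto

lemma set_int_M2:
  fixes g :: "real \<Rightarrow> 'v::euclidean_space"
  assumes "g \<in> borel_measurable M" "E \<in> LB"
  shows "set_integrable M2 E g \<longleftrightarrow> set_integrable M E (\<lambda>x. h2 x *\<^sub>R g x)"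
    and "(LINT x:E|M2. g x) = (LINT x:E|M. h2 x *\<^sub>R g x)"
  using density_set_integral[OF h2(1,2) assms(1) LB_M[OF assms(2)], folded h2(3)] by auto

lemma qg_M: "qg \<in> borel_measurable M" using qg_measurable by (simp add: meas_M1)

lemma Wg_M: "Wg \<in> borel_measurable M" using Wg_measurable by (simp add: meas_M2)

lemma Hq_M: "Hq \<in> borel_measurable M" unfolding Hq_def[abs_def] by (intro borel_measurable_scaleR h1 qg_M)

lemma qd_qg_set:
  assumes E: "E \<in> LB"
  shows "set_integrable M1 E qg" "q E = (LINT x:E|M1. qg x)"
proof -
  have ae: "AE x in M1. x \<in> E \<longrightarrow> qd x = qg x" using AE_qg by eventually_elim simp
  have EM: "E \<in> sets M1" using LB_M[OF E] sets_M1 by simp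
  show "set_integrable M1 E qg"
    using set_integrable_cong_AE[of qd M1 qg E] qd_props(1) qg_measurable ae EM qd_props(2)[OF E] by auto
  show "q E = (LINT x:E|M1. qg x)"
    unfolding qd_props(3)[OF E] using qd_props(1) qg_measurable ae EM by (intro set_lebesgue_integral_cong_AE) auto
qed

lemma Hq_loc_int: "loc_int Hq"
  unfolding loc_int_def Hq_def[abs_def] using qd_qg_set(1) set_int_M1(1)[OF qg_M] by auto

lemma q_eq: "E \<in> LB \<Longrightarrow> q E = (LINT x:E|M. Hq x)"
  using qd_qg_set(2) set_int_M1(2)[OF qg_M] by (simp add: Hq_def)

text \<open>
  \<open>\<Delta>\<^sub>q(x)\<close> does not depend on the antiderivative chosen in \<open>jump\<close>, being the value of \<open>q\<close> on \<open>{x}\<close>. A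
  balanced primitive of \<open>Hq\<close> shows that some antiderivative exists.
\<close>

lemma jump_eq: assumes x: "x \<in> I" shows "jump a b q x = atom Hq x"
proof -
  obtain Q0 where "prim Hq Q0" using prim_exists[OF Hq_loc_int x] by blast
  then have "antideriv a b Q0 (\<lambda>E. LINT x:E|M. Hq x)" using Hq_loc_int by (rule prim_antideriv)
  then have "antideriv a b Q0 q"
    using q_eq LB_intervals(1) I_endpoints unfolding antideriv_def by auto
  then have ad: "antideriv a b (SOME Q. antideriv a b Q q) q"
    by (rule someI[of "\<lambda>Q. antideriv a b Q q"])
  have "a < ereal x" "ereal x < b" using x by (auto simp: einterval_def)
  then have "q {x..x} = jump a b q x" using ad unfolding antideriv_def jump_def Let_def by blast
  moreover have "q {x} = atom Hq x"
    using q_eq[OF LB_singleton[OF x]] LINT_singleton[OF x, of Hq] by (simp add: atom_def)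
  ultimately show ?thesis by simp
qed

sublocale canonical_system a b M J Hq
proof
  show "invertible (2 *\<^sub>R J + atom Hq x)" if "x \<in> I" for x using jumps jump_eq[OF that] that by auto
qed (use J_inv J_skew Hq_loc_int Hq_herm in auto)

lemma mv_measurable:
  fixes A :: "real \<Rightarrow> complex^'n^'n"
  shows "A \<in> borel_measurable N \<Longrightarrow> u \<in> borel_measurable N \<Longrightarrow> (\<lambda>x. A x *v u x) \<in> borel_measurable N"
  by (rule bilinear_measurable[OF bounded_bilinear_matrix_vector])

lemma herm_measurable:
  fixes u :: "real \<Rightarrow> complex^'n"
  shows "u \<in> borel_measurable N \<Longrightarrow> v \<in> borel_measurable N \<Longrightarrow> (\<lambda>x. herm (u x) (v x)) \<in> borel_measurable N"
  by (rule bilinear_measurable[OF herm_bounded_bilinear])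

lemma qmult_eq:
  assumes u: "u \<in> borel_measurable M" and E: "E \<in> LB"
  shows "qmult a b q u E = (LINT x:E|M. Hq x *v u x)"
proof -
  have um: "u \<in> borel_measurable M1" using u by (simp add: meas_M1)
  have "qmult a b q u E = (LINT x:E|M1. qg x *v u x)"
    unfolding qmult_def
  proof (rule set_lebesgue_integral_cong_AE)
    show "AE x\<in>E in M1. qd x *v u x = qg x *v u x" using AE_qg by eventually_elim simp
  qed (use LB_M[OF E] sets_M1 um qd_props(1) qg_measurable in \<open>auto intro!: mv_measurable\<close>)
  also have "\<dots> = (LINT x:E|M. h1 x *\<^sub>R (qg x *v u x))"
    by (rule set_int_M1(2)[OF mv_measurable[OF qg_M u] E])
  finally show ?thesis by (simp add: Hq_def matrix_vector_scaleR_left)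
qed

lemma wmult_eq:
  assumes u: "u \<in> borel_measurable M" and E: "E \<in> LB"
  shows "wmult a b w u E = (LINT x:E|M. Hw x *v u x)"
proof -
  have um: "u \<in> borel_measurable M2" using u by (simp add: meas_M2)
  have "wmult a b w u E = (LINT x:E|M2. Wg x *v u x)"
    unfolding wmult_def
  proof (rule set_lebesgue_integral_cong_AE)
    show "AE x\<in>E in M2. Wt a b w x *v u x = Wg x *v u x" using AE_Wg by eventually_elim simp
  qed (use LB_M[OF E] sets_M2 um Wt_props(1) Wg_measurable in \<open>auto intro!: mv_measurable\<close>)
  also have "\<dots> = (LINT x:E|M. h2 x *\<^sub>R (Wg x *v u x))"
    by (rule set_int_M2(2)[OF mv_measurable[OF Wg_M u] E])
  finally show ?thesis by (simp add: Hw_def matrix_vector_scaleR_left)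
qed

abbreviation L :: "(real \<Rightarrow> complex^'n) set" where "L \<equiv> calL2 a b w"

lemma L_iff: "f \<in> L \<longleftrightarrow> f \<in> borel_measurable M \<and> integrable M2 (\<lambda>x. herm (f x) (Wg x *v f x))"
proof -
  have "integrable M2 (\<lambda>x. herm (f x) (Wt a b w x *v f x)) \<longleftrightarrow> integrable M2 (\<lambda>x. herm (f x) (Wg x *v f x))"
    if f: "f \<in> borel_measurable M2"
  proof (rule integrable_cong_AE)
    show "AE x in M2. herm (f x) (Wt a b w x *v f x) = herm (f x) (Wg x *v f x)" using AE_Wg by eventually_elim simp
  qed (use f Wt_props(1) Wg_measurable in \<open>auto intro!: mv_measurable herm_measurable\<close>)
  then show ?thesis unfolding calL2_def by (auto simp: meas_M2)
qed

lemma L_measurable: "f \<in> L \<Longrightarrow> f \<in> borel_measurable M" by (simp add: L_iff)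

lemma L_integrable:
  assumes "f \<in> L" "g \<in> L" shows "integrable M2 (\<lambda>x. herm (f x) (Wg x *v g x))"
proof (rule Bochner_Integration.integrable_bound)
  show "integrable M2 (\<lambda>x. Re (herm (f x) (Wg x *v f x)) + Re (herm (g x) (Wg x *v g x)))"
    using assms by (intro Bochner_Integration.integrable_add integrable_Re) (auto simp: L_iff)
  show "(\<lambda>x. herm (f x) (Wg x *v g x)) \<in> borel_measurable M2"
    using assms Wg_measurable by (intro mv_measurable herm_measurable) (auto simp: L_iff meas_M2)
  show "AE x in M2. norm (herm (f x) (Wg x *v g x)) \<le> norm (Re (herm (f x) (Wg x *v f x)) + Re (herm (g x) (Wg x *v g x)))"
    using psd_amgm[OF psd_Wg] psd_nonneg(1)[OF psd_Wg] by (intro AE_I2) (auto intro: order_trans)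
qed

lemma M2_integral:
  fixes g :: "real \<Rightarrow> complex"
  assumes "g \<in> borel_measurable M"
  shows "integrable M2 g \<longleftrightarrow> integrable M (\<lambda>x. h2 x *\<^sub>R g x)" "(LINT x|M2. g x) = (LINT x|M. h2 x *\<^sub>R g x)"
  using integrable_density[OF assms h2(1)] integral_density[OF assms h2(1)] h2(2) h2(3) by auto

lemma h2_herm: "h2 x *\<^sub>R herm y (Wg x *v z) = herm y (Hw x *v z)"
proof -
  have "herm y (Hw x *v z) = of_real (h2 x) * herm y (Wg x *v z)"
    by (simp add: Hw_def matrix_vector_scaleR_left herm_scaleR)
  then show ?thesis by (simp only: scaleR_conv_of_real)
qed

lemma semi_inner_eq:
  assumes "f \<in> borel_measurable M" "g \<in> borel_measurable M"
  shows "semi_inner a b w f g = (LINT x|M2. herm (f x) (Wg x *v g x))"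
    and "semi_inner a b w f g = (LINT x|M. herm (f x) (Hw x *v g x))"
proof -
  show 1: "semi_inner a b w f g = (LINT x|M2. herm (f x) (Wg x *v g x))"
    unfolding semi_inner_def
  proof (rule integral_cong_AE)
    show "AE x in M2. herm (f x) (Wt a b w x *v g x) = herm (f x) (Wg x *v g x)" using AE_Wg by eventually_elim simp
  qed (use assms Wt_props(1) Wg_measurable in \<open>auto intro!: mv_measurable herm_measurable simp: meas_M2\<close>)
  have "(\<lambda>x. herm (f x) (Wg x *v g x)) \<in> borel_measurable M"
    by (intro herm_measurable mv_measurable assms Wg_M)
  then show "semi_inner a b w f g = (LINT x|M. herm (f x) (Hw x *v g x))"
    unfolding 1 by (simp only: M2_integral(2) h2_herm)
qed

lemma L_integrable_M:
  assumes "f \<in> L" "g \<in> L" shows "integrable M (\<lambda>x. herm (f x) (Hw x *v g x))"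
proof -
  have "(\<lambda>x. herm (f x) (Wg x *v g x)) \<in> borel_measurable M"
    by (intro herm_measurable mv_measurable L_measurable assms Wg_M)
  from M2_integral(1)[OF this] show ?thesis using L_integrable[OF assms] by (simp only: h2_herm)
qed

text \<open>For square integrable \<open>f\<close> the density of \<open>w f\<close> is locally integrable since \<open>|W f|\<^sup>2 \<le> f\<^sup>* W f\<close>.\<close>

lemma Hw_loc_int: assumes f: "f \<in> L" shows "loc_int (\<lambda>x. Hw x *v f x)"
  unfolding loc_int_def
proof
  fix E assume E: "E \<in> LB"
  have m: "(\<lambda>x. Wg x *v f x) \<in> borel_measurable M" using f by (intro mv_measurable Wg_M L_measurable)
  have EM: "E \<in> sets M2" using LB_M[OF E] sets_M2 by simp
  have "set_integrable M2 E (\<lambda>x. Wg x *v f x)"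
    unfolding set_integrable_def
  proof (rule Bochner_Integration.integrable_bound)
    have "set_integrable M2 E (\<lambda>_. 1 :: real)" by (rule set_integrable_const[OF M2_loc_finite E])
    then show "integrable M2 (\<lambda>x. indicat_real E x *\<^sub>R 1 + Re (herm (f x) (Wg x *v f x)))"
      using f unfolding set_integrable_def by (intro Bochner_Integration.integrable_add integrable_Re) (auto simp: L_iff)
    show "(\<lambda>x. indicat_real E x *\<^sub>R (Wg x *v f x)) \<in> borel_measurable M2"
      using m EM by (simp add: meas_M2[symmetric])
    have "norm (Wg x *v f x) \<le> 1 + Re (herm (f x) (Wg x *v f x))" for x
    proof -
      \<comment> \<open>\<open>t \<le> 1 + t\<^sup>2\<close>, by completing the square.\<close>
      have "norm (Wg x *v f x) \<le> 1 + (norm (Wg x *v f x))\<^sup>2"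
        using zero_le_power2[of "norm (Wg x *v f x) - 1/2"] by (simp add: power2_eq_square algebra_simps)
      then show ?thesis using norm_Wg_sq[of x "f x"] by linarith
    qed
    then show "AE x in M2. norm (indicat_real E x *\<^sub>R (Wg x *v f x)) \<le> norm (indicat_real E x *\<^sub>R 1 + Re (herm (f x) (Wg x *v f x)))"
      using psd_nonneg(1)[OF psd_Wg] by (intro AE_I2) (auto simp: indicator_def)
  qed
  then show "set_integrable M E (\<lambda>x. Hw x *v f x)"
    unfolding set_int_M2(1)[OF m E] by (simp add: Hw_def matrix_vector_scaleR_left)
qed

lemma BV_loc_bounded:
  fixes u :: "real \<Rightarrow> 'v::real_normed_vector"
  assumes u: "BV_loc a b u" and cd: "c \<in> I" "d \<in> I" shows "\<exists>B. \<forall>x\<in>{c..d}. norm (u x) \<le> B"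
proof -
  have "a < ereal c" "ereal d < b" using cd by (auto simp: einterval_def)
  then have "\<exists>B. \<forall>(t :: nat \<Rightarrow> real) k. mono t \<and> range t \<subseteq> {c..d} \<longrightarrow> (\<Sum>i<k. norm (u (t (Suc i)) - u (t i))) \<le> B"
    using u by (simp add: BV_loc_def)
  then obtain B where "\<forall>(t :: nat \<Rightarrow> real) k. mono t \<and> range t \<subseteq> {c..d} \<longrightarrow> (\<Sum>i<k. norm (u (t (Suc i)) - u (t i))) \<le> B" ..
  then have B: "(\<Sum>i<k. norm (u (t (Suc i)) - u (t i))) \<le> B" if "mono t" "range t \<subseteq> {c..d}" for t :: "nat \<Rightarrow> real" and k
    using that by simp
  have "norm (u x) \<le> norm (u c) + B" if x: "x \<in> {c..d}" for x
  proof -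
    define t :: "nat \<Rightarrow> real" where "t n = (if n = 0 then c else x)" for n
    have "mono t" using x by (auto simp: mono_def t_def)
    moreover have "range t \<subseteq> {c..d}" using x by (auto simp: t_def)
    ultimately have "norm (u x - u c) \<le> B" using B[of t 1] by (simp add: t_def)
    then show ?thesis using norm_triangle_ineq[of "u c" "u x - u c"] by simp
  qed
  then show ?thesis by blast
qed

lemma Hq_mult_loc_int:
  assumes u: "u \<in> borel_measurable M" and bd: "\<And>c d. c \<in> I \<Longrightarrow> d \<in> I \<Longrightarrow> \<exists>B. \<forall>x\<in>{c..d}. norm (u x) \<le> B"
  shows "loc_int (\<lambda>x. Hq x *v (u x :: complex^'n))"
proof (rule loc_int_mult_bounded[OF Hq_loc_int])
  show "(\<lambda>x. Hq x *v u x) \<in> borel_measurable M" by (intro mv_measurable Hq_M u)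
  obtain K where K: "K > 0" "\<And>A z. norm ((A :: complex^'n^'n) *v z) \<le> norm A * norm z * K"
    using bounded_bilinear.pos_bounded[OF bounded_bilinear_matrix_vector] by blast
  fix c d assume "c \<in> I" "d \<in> I"
  then obtain B where B: "\<And>x. x \<in> {c..d} \<Longrightarrow> norm (u x) \<le> B" using bd by blast
  have "norm (Hq x *v u x) \<le> (B * K) * norm (Hq x)" if "x \<in> {c..d}" for x
  proof -
    have "norm (Hq x) * norm (u x) * K \<le> norm (Hq x) * B * K"
      using B[OF that] K(1) by (intro mult_right_mono mult_left_mono) auto
    then show ?thesis using K(2)[of "Hq x" "u x"] by (simp add: algebra_simps)
  qed
  then show "\<exists>B. \<forall>x\<in>{c..d}. norm (Hq x *v u x) \<le> B * norm (Hq x)" by blast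
qed

text \<open>
  Translates the distributional equation into an equation between densities. In both directions
  \<open>u'\<close> has the density \<open>J\<^sup>-\<^sup>1 (Hw f - Hq u)\<close> with respect to \<open>M\<close>.
\<close>

theorem calTmax_iff: "(u, f) \<in> calTmax a b J q w \<longleftrightarrow> u \<in> L \<and> f \<in> L \<and> sol_on I (\<lambda>x. Hw x *v f x) u"
proof
  assume "(u, f) \<in> calTmax a b J q w"
  then have uf: "u \<in> L" "f \<in> L" "BV_loc a b u" "balanced a b u" "solves a b J q w u f" by (auto simp: calTmax_def)
  then obtain du where du: "antideriv a b u du"
    "\<And>E. E \<in> LB \<Longrightarrow> J *v du E + qmult a b q u E = wmult a b w f E" unfolding solves_def by blast
  have Hqu: "loc_int (\<lambda>x. Hq x *v u x)" by (intro Hq_mult_loc_int L_measurable uf(1) BV_loc_bounded[OF uf(3)])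
  define \<kappa> where "\<kappa> x = Ji *v (Hw x *v f x - Hq x *v u x)" for x
  have d: "loc_int (\<lambda>x. Hw x *v f x - Hq x *v u x)" by (intro loc_int_diff Hw_loc_int uf(2) Hqu)
  have \<kappa>: "loc_int \<kappa>" unfolding \<kappa>_def by (rule loc_int_linear[OF d matrix_vector_mul_bounded_linear])
  have "du E = (LINT x:E|M. \<kappa> x)" if E: "E \<in> LB" for E
  proof -
    have "J *v du E = (LINT x:E|M. Hw x *v f x) - (LINT x:E|M. Hq x *v u x)"
      using du(2)[OF E] qmult_eq[OF L_measurable[OF uf(1)] E] wmult_eq[OF L_measurable[OF uf(2)] E] by (simp add: algebra_simps)
    also have "\<dots> = (LINT x:E|M. Hw x *v f x - Hq x *v u x)"
      using loc_int_E[OF Hw_loc_int[OF uf(2)] E] loc_int_E[OF Hqu E] by (simp add: set_integral_diff)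
    finally have "Ji *v (J *v du E) = Ji *v (LINT x:E|M. Hw x *v f x - Hq x *v u x)" by simp
    then show ?thesis
      unfolding \<kappa>_def using set_integral_linear[OF loc_int_E[OF d E] matrix_vector_mul_bounded_linear[of Ji]] by (simp add: Ji_J)
  qed
  then have "prim \<kappa> u" by (rule antideriv_balanced_prim[OF \<kappa> du(1) uf(4)])
  then show "u \<in> L \<and> f \<in> L \<and> sol_on I (\<lambda>x. Hw x *v f x) u"
    using uf(1,2) \<kappa> unfolding sol_on_def by (auto simp: \<kappa>_def[abs_def] J_Ji)
next
  assume uf: "u \<in> L \<and> f \<in> L \<and> sol_on I (\<lambda>x. Hw x *v f x) u"
  then obtain \<kappa> where \<kappa>: "loc_int \<kappa>" "prim \<kappa> u" "\<And>x. x \<in> I \<Longrightarrow> J *v \<kappa> x = Hw x *v f x - Hq x *v u x" by (auto simp: sol_on_def)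
  have Hqu: "loc_int (\<lambda>x. Hq x *v u x)"
    by (intro Hq_mult_loc_int prim_measurable[OF \<kappa>(2,1)] prim_bounded[OF \<kappa>(2,1)])
  have "solves a b J q w u f" unfolding solves_def
  proof (intro exI conjI ballI)
    show "distr0 a b (\<lambda>E. LINT x:E|M. \<kappa> x)" by (rule distr0_LINT[OF \<kappa>(1)])
    show "antideriv a b u (\<lambda>E. LINT x:E|M. \<kappa> x)" by (rule prim_antideriv[OF \<kappa>(2,1)])
    fix E assume E: "E \<in> LB"
    have EI: "E \<subseteq> I" by (rule LB_subset_I[OF E])
    have "J *v (LINT x:E|M. \<kappa> x) = (LINT x:E|M. J *v \<kappa> x)"
      by (rule set_integral_linear[OF loc_int_E[OF \<kappa>(1) E] matrix_vector_mul_bounded_linear, symmetric])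
    also have "\<dots> = (LINT x:E|M. Hw x *v f x - Hq x *v u x)"
      using \<kappa>(3) EI LB_M[OF E] by (intro set_lebesgue_integral_cong) auto
    also have "\<dots> = (LINT x:E|M. Hw x *v f x) - (LINT x:E|M. Hq x *v u x)"
      using loc_int_E[OF Hw_loc_int E] loc_int_E[OF Hqu E] uf by (simp add: set_integral_diff)
    finally show "J *v (LINT x:E|M. \<kappa> x) + qmult a b q u E = wmult a b w f E"
      using qmult_eq[of u E] wmult_eq[of f E] L_measurable uf E by simp
  qed
  then show "(u, f) \<in> calTmax a b J q w"
    using uf prim_BV_loc[OF \<kappa>(2,1)] prim_balanced[OF \<kappa>(2,1)] by (auto simp: calTmax_def)
qed

end

section \<open>Completeness of the space of square integrable functions\<close>

lemma cmod_herm_norm: "cmod (herm x y) \<le> norm x * norm y"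
proof -
  have "psd (mat 1 :: complex^'n^'n)" by (simp add: psd_def herm_self complex_nonneg_Reals_iff del: of_real_power)
  from psd_cauchy_schwarz[OF this, of x y] have "(cmod (herm x y))\<^sup>2 \<le> (norm x * norm y)\<^sup>2"
    by (simp add: herm_self power_mult_distrib del: of_real_power)
  then show ?thesis by (rule power2_le_imp_le) simp
qed

text \<open>
  Properties of the density \<open>W\<close> of \<open>w\<close> at a point. A Cauchy sequence in \<open>L\<^sup>2(w)\<close> only controls \<open>W f\<^sub>k\<close>, so a limit
  has to be pulled back along the singular matrix \<open>W\<close>, by a formula that depends measurably on \<open>W\<close>.
\<close>

locale psd_contraction =
  fixes W :: "complex^'n^'n"
  assumes psd_W: "psd W" and norm_sq: "\<And>z. (norm (W *v z))\<^sup>2 \<le> Re (herm z (W *v z))"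
begin

lemma W_herm: "herm (W *v x) y = herm x (W *v y)"
  using psd_hermitian[OF psd_W, of x y] herm_cnj[of "W *v x" y] by simp

lemma norm_W_le: "norm (W *v z) \<le> norm z"
proof (cases "W *v z = 0")
  case False
  have "(norm (W *v z))\<^sup>2 \<le> norm z * norm (W *v z)"
    using norm_sq[of z] complex_Re_le_cmod[of "herm z (W *v z)"] cmod_herm_norm[of z "W *v z"] by linarith
  then show ?thesis using False by (simp add: power2_eq_square)
qed simp

lemma Re_herm_W_le: "Re (herm z (W *v z)) \<le> (norm z)\<^sup>2"
proof -
  have "Re (herm z (W *v z)) \<le> norm z * norm (W *v z)"
    using complex_Re_le_cmod[of "herm z (W *v z)"] cmod_herm_norm[of z "W *v z"] by linarith
  also have "\<dots> \<le> norm z * norm z" using norm_W_le by (intro mult_left_mono) auto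
  finally show ?thesis by (simp add: power2_eq_square)
qed

definition A :: "complex^'n \<Rightarrow> complex^'n" where "A v = v - W *v v"

lemma A_herm: "herm (A x) y = herm x (A y)" by (simp add: A_def herm_diff herm_diff_left W_herm)

lemma A_pow_herm: "herm ((A ^^ j) x) y = herm x ((A ^^ j) y)"
proof (induction j arbitrary: y)
  case (Suc j)
  have "herm ((A ^^ Suc j) x) y = herm ((A ^^ j) x) (A y)" by (simp add: A_herm)
  also have "\<dots> = herm x ((A ^^ Suc j) y)" using Suc[of "A y"] by (simp add: funpow_swap1)
  finally show ?case .
qed simp

lemma A_W: "A (W *v v) = W *v A v" by (simp add: A_def matrix_vector_diff)

lemma A_pow_W: "(A ^^ j) (W *v v) = W *v (A ^^ j) v"
  by (induction j) (simp_all add: A_W)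

text \<open>
  The powers of \<open>A = 1 - W\<close> converge because \<open>\<langle>A\<^sup>j z, z\<rangle>\<close> is decreasing and nonnegative: \<open>A\<close> is
  self-adjoint, so \<open>|A\<^sup>k z - A\<^sup>l z|\<^sup>2\<close> is a combination of these moments.
\<close>

definition moment :: "complex^'n \<Rightarrow> nat \<Rightarrow> real" where "moment z j = Re (herm ((A ^^ j) z) z)"

lemma half_power: "herm ((A ^^ (i + i)) z) y = herm ((A ^^ i) z) ((A ^^ i) y)"
  using A_pow_herm[of i "(A ^^ i) z" y] by (simp add: funpow_add)

lemma moment_nonneg: "0 \<le> moment z j"
proof -
  have "0 \<le> Re (herm v v)" "0 \<le> Re (herm v (A v))" for v :: "complex^'n"
    using Re_herm_W_le[of v] by (simp_all add: herm_self A_def herm_diff del: of_real_power)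
  note nn = this
  show ?thesis
  proof (cases "even j")
    case True
    then obtain i where "j = i + i" by (metis even_two_times_div_two mult_2)
    then show ?thesis using nn(1)[of "(A ^^ i) z"] half_power[of i z z] by (simp add: moment_def)
  next
    case False
    then obtain i where j: "j = Suc (i + i)" by (metis odd_two_times_div_two_succ mult_2 Suc_eq_plus1)
    have "herm ((A ^^ j) z) z = herm ((A ^^ i) z) ((A ^^ i) (A z))"
      using A_herm[of "(A ^^ (i + i)) z" z] half_power[of i z "A z"] by (simp add: j)
    then show ?thesis using nn(2)[of "(A ^^ i) z"] by (simp add: moment_def funpow_swap1)
  qed
qed

lemma moment_dec: "moment z (Suc j) \<le> moment z j"
proof -
  have diff: "moment z j - moment z (Suc j) = Re (herm ((A ^^ j) z) (W *v z))"
    by (simp add: moment_def A_herm) (simp add: A_def herm_diff)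
  have nn: "0 \<le> Re (herm v (W *v v))" "0 \<le> Re (herm v (A (W *v v)))" for v
  proof -
    have "Re (herm v (W *v (W *v v))) = (norm (W *v v))\<^sup>2"
      by (metis Re_complex_of_real W_herm herm_self)
    then show "0 \<le> Re (herm v (W *v v))" "0 \<le> Re (herm v (A (W *v v)))"
      using psd_nonneg(1)[OF psd_W, of v] norm_sq[of v] by (simp_all add: A_def herm_diff)
  qed
  have "0 \<le> Re (herm ((A ^^ j) z) (W *v z))"
  proof (cases "even j")
    case True
    then obtain i where "j = i + i" by (metis even_two_times_div_two mult_2)
    then show ?thesis using nn(1)[of "(A ^^ i) z"] half_power[of i z "W *v z"] by (simp add: A_pow_W)
  next
    case False
    then obtain i where j: "j = Suc (i + i)" by (metis odd_two_times_div_two_succ mult_2 Suc_eq_plus1)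
    have "herm ((A ^^ j) z) (W *v z) = herm ((A ^^ i) z) ((A ^^ i) (A (W *v z)))"
      using A_herm[of "(A ^^ (i + i)) z" "W *v z"] half_power[of i z "A (W *v z)"] by (simp add: j)
    also have "(A ^^ i) (A (W *v z)) = A (W *v (A ^^ i) z)" by (simp add: funpow_swap1[symmetric] A_pow_W)
    finally show ?thesis using nn(2)[of "(A ^^ i) z"] by simp
  qed
  then show ?thesis using diff by simp
qed

lemma A_pow_convergent: "convergent (\<lambda>j. (A ^^ j) z)"
proof (rule Cauchy_convergent, rule CauchyI)
  fix e :: real assume e: "0 < e"
  have "decseq (moment z)" using moment_dec by (rule decseq_SucI)
  then obtain l where "moment z \<longlonglongrightarrow> l" using decseq_convergent[of "moment z" 0] moment_nonneg by blast
  then have "convergent (moment z)" by (auto simp: convergent_def)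
  then have "Cauchy (moment z)" by (rule convergent_Cauchy)
  then obtain N where N: "\<And>m n. m \<ge> N \<Longrightarrow> n \<ge> N \<Longrightarrow> norm (moment z m - moment z n) < e\<^sup>2 / 2"
    using CauchyD[of "moment z" "e\<^sup>2 / 2"] e by auto
  have "norm ((A ^^ k) z - (A ^^ l) z) < e" if "k \<ge> N" "l \<ge> N" for k l
  proof -
    have p: "herm ((A ^^ i) z) ((A ^^ j) z) = herm ((A ^^ (j + i)) z) z" for i j
      using A_pow_herm[of j "(A ^^ i) z" z] by (simp add: funpow_add)
    have "(norm ((A ^^ k) z - (A ^^ l) z))\<^sup>2 = Re (herm ((A ^^ k) z - (A ^^ l) z) ((A ^^ k) z - (A ^^ l) z))"
      by (simp add: herm_self del: of_real_power)
    also have "\<dots> = (moment z (k + k) - moment z (l + k)) + (moment z (l + l) - moment z (k + l))"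
      by (simp add: herm_diff herm_diff_left p moment_def)
    also have "\<dots> < e\<^sup>2 / 2 + e\<^sup>2 / 2"
    proof (rule add_strict_mono)
      show "moment z (k + k) - moment z (l + k) < e\<^sup>2 / 2"
      proof (rule le_less_trans[OF abs_ge_self])
        show "\<bar>moment z (k + k) - moment z (l + k)\<bar> < e\<^sup>2 / 2"
          unfolding real_norm_def[symmetric] by (rule N) (use that in auto)
      qed
      show "moment z (l + l) - moment z (k + l) < e\<^sup>2 / 2"
      proof (rule le_less_trans[OF abs_ge_self])
        show "\<bar>moment z (l + l) - moment z (k + l)\<bar> < e\<^sup>2 / 2"
          unfolding real_norm_def[symmetric] by (rule N) (use that in auto)
      qed
    qed
    finally have "(norm ((A ^^ k) z - (A ^^ l) z))\<^sup>2 < e\<^sup>2" by simp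
    then show ?thesis using e by (simp add: power_less_imp_less_base)
  qed
  then show "\<exists>M. \<forall>m\<ge>M. \<forall>n\<ge>M. norm ((A ^^ m) z - (A ^^ n) z) < e" by blast
qed

text \<open>
  For \<open>y = W z\<close> the Neumann series \<open>\<Sum> A\<^sup>j y\<close> telescopes to \<open>z - lim A\<^sup>N z\<close>, and the limit is annihilated by \<open>W\<close>. The
  series thus inverts \<open>W\<close> on its range, and is measurable in \<open>W\<close> and \<open>y\<close>.
\<close>

lemma neumann_preimage:
  assumes y: "y = W *v z"
  shows "\<exists>f. (\<lambda>N. \<Sum>j<N. (A ^^ j) y) \<longlonglongrightarrow> f \<and> W *v f = y"
proof -
  obtain p where p: "(\<lambda>j. (A ^^ j) z) \<longlonglongrightarrow> p" using A_pow_convergent[of z] by (auto simp: convergent_def)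
  have "(\<Sum>j<N. (A ^^ j) y) = z - (A ^^ N) z" for N
  proof (induction N)
    case (Suc N)
    have "(A ^^ N) y = (A ^^ N) z - (A ^^ Suc N) z" unfolding y A_pow_W by (simp add: A_def)
    then show ?case using Suc by simp
  qed simp
  then have lim: "(\<lambda>N. \<Sum>j<N. (A ^^ j) y) \<longlonglongrightarrow> z - p" using tendsto_diff[OF tendsto_const p] by simp
  have cont: "(\<lambda>j. W *v (A ^^ j) z) \<longlonglongrightarrow> W *v p"
    by (rule bounded_linear.tendsto[OF matrix_vector_mul_bounded_linear p])
  have "(\<lambda>j. (A ^^ j) z - (A ^^ Suc j) z) \<longlonglongrightarrow> p - p" by (intro tendsto_diff p LIMSEQ_Suc)
  then have "(\<lambda>j. W *v (A ^^ j) z) \<longlonglongrightarrow> 0" by (simp add: A_def)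
  then have "W *v p = 0" using LIMSEQ_unique[OF cont] by simp
  then show ?thesis using lim by (intro exI[of _ "z - p"]) (simp add: matrix_vector_diff y)
qed

text \<open>
  The form depends only on \<open>W v\<close>, through a linear right inverse of \<open>W\<close> on its range. This turns
  convergence of \<open>W f\<^sub>k\<close> into convergence of the form. The constant depends on \<open>W\<close>, which does no harm
  pointwise.
\<close>

lemma form_le_norm: "\<exists>C. \<forall>v. Re (herm v (W *v v)) \<le> C * (norm (W *v v))\<^sup>2"
proof -
  have "linear ((*v) W)" by (rule bounded_linear.linear[OF matrix_vector_mul_bounded_linear])
  from linear_exists_right_inverse_on[OF this subspace_UNIV]
  obtain g where g: "linear g" "\<And>v. W *v g (W *v v) = W *v v" by auto
  obtain C where C: "\<And>v. norm (g v) \<le> C * norm v" using linear_bounded[OF g(1)] by auto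
  have "Re (herm v (W *v v)) \<le> C * (norm (W *v v))\<^sup>2" for v
  proof -
    have "herm v (W *v v) = herm (W *v v) (g (W *v v))" using W_herm[of v "g (W *v v)"] g(2)[of v] by simp
    then have "Re (herm v (W *v v)) \<le> norm (W *v v) * norm (g (W *v v))"
      using complex_Re_le_cmod[of "herm v (W *v v)"] cmod_herm_norm[of "W *v v" "g (W *v v)"] by simp
    also have "\<dots> \<le> norm (W *v v) * (C * norm (W *v v))" by (intro mult_left_mono C) simp
    finally show ?thesis by (simp add: power2_eq_square algebra_simps)
  qed
  then show ?thesis by blast
qed

lemma range_closed: assumes "\<And>k. y k \<in> range ((*v) W)" "y \<longlonglongrightarrow> l" shows "l \<in> range ((*v) W)"
proof -
  have "subspace (range ((*v) W))"
    by (intro linear_subspace_image bounded_linear.linear[OF matrix_vector_mul_bounded_linear] subspace_UNIV)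
  then have "closed (range ((*v) W))" by (rule closed_subspace)
  then show ?thesis using assms by (rule closed_sequentially)
qed

end

context hermitian_system
begin

lemma contraction: "psd_contraction (Wg x)"
  by unfold_locales (use psd_Wg norm_Wg_sq in auto)

definition scl :: "complex \<Rightarrow> (real \<Rightarrow> complex^'n) \<Rightarrow> real \<Rightarrow> complex^'n" where
  "scl c f = (\<lambda>x. c *s f x)"

lemma vector_space_scl: "vector_space scl"
  by unfold_locales (auto simp: scl_def fun_eq_iff vec_eq_iff algebra_simps)

lemma semi_inner_L: "f \<in> L \<Longrightarrow> g \<in> L \<Longrightarrow> semi_inner a b w f g = (LINT x|M2. herm (f x) (Wg x *v g x))"
  by (intro semi_inner_eq L_measurable)

lemma L_0: "0 \<in> L"
  unfolding L_iff zero_fun_def by simp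

lemma L_add: assumes "f \<in> L" "g \<in> L" shows "f + g \<in> L"
proof -
  have "herm ((f + g) x) (Wg x *v (f + g) x) = (herm (f x) (Wg x *v f x) + herm (f x) (Wg x *v g x)) +
     (herm (g x) (Wg x *v f x) + herm (g x) (Wg x *v g x))" for x
    by (simp add: matrix_vector_right_distrib herm_add herm_add_left)
  moreover have "f + g \<in> borel_measurable M"
    unfolding plus_fun_def by (intro borel_measurable_add L_measurable assms)
  ultimately show ?thesis unfolding L_iff using assms by (auto intro!: Bochner_Integration.integrable_add L_integrable)
qed

lemma scale_measurable: "f \<in> borel_measurable N \<Longrightarrow> (\<lambda>x. c *s (f x :: complex^'n)) \<in> borel_measurable N"
proof -
  assume f: "f \<in> borel_measurable N"
  have "linear (\<lambda>z::complex^'n. c *s z)" by (intro linearI) (auto simp: vec_eq_iff algebra_simps)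
  then have "continuous_on UNIV (\<lambda>z::complex^'n. c *s z)"
    by (intro linear_continuous_on) (simp add: linear_conv_bounded_linear)
  from measurable_compose[OF f borel_measurable_continuous_onI[OF this]] show ?thesis by simp
qed

lemma L_scl: assumes "f \<in> L" shows "scl c f \<in> L"
proof -
  have "scl c f \<in> borel_measurable M" unfolding scl_def by (intro scale_measurable L_measurable assms)
  moreover have "herm (scl c f x) (Wg x *v scl c f x) = (cnj c * c) * herm (f x) (Wg x *v f x)" for x
    by (simp add: scl_def matrix_vector_mult_scale herm_scale herm_scale_left)
  ultimately show ?thesis using assms unfolding L_iff by simp
qed

lemma L_semi_inner_space: "semi_inner_space scl L (semi_inner a b w)"
proof -
  interpret vector_space scl by (rule vector_space_scl)
  show ?thesis
  proof
    show "subspace L" by (intro subspaceI L_0 L_add L_scl)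
    fix x y z :: "real \<Rightarrow> complex^'n" and c :: complex
    show "semi_inner a b w x (y + z) = semi_inner a b w x y + semi_inner a b w x z" if "x \<in> L" "y \<in> L" "z \<in> L"
      using that by (simp add: semi_inner_L L_add matrix_vector_right_distrib herm_add L_integrable)
    show "semi_inner a b w x (scl c y) = c * semi_inner a b w x y" if "x \<in> L" "y \<in> L"
      using that by (simp add: semi_inner_L L_scl) (simp add: scl_def matrix_vector_mult_scale herm_scale)
    show "semi_inner a b w y x = cnj (semi_inner a b w x y)" if "x \<in> L" "y \<in> L"
    proof -
      have "semi_inner a b w y x = (LINT t|M2. cnj (herm (x t) (Wg t *v y t)))"
        unfolding semi_inner_L[OF that(2,1)]
        by (intro Bochner_Integration.integral_cong refl psd_hermitian psd_Wg)
      then show ?thesis by (simp add: semi_inner_L[OF that])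
    qed
    show "0 \<le> Re (semi_inner a b w x x)" if "x \<in> L"
    proof -
      have "0 \<le> (LINT t|M2. Re (herm (x t) (Wg t *v x t)))"
        by (intro integral_nonneg_AE AE_I2 psd_nonneg(1) psd_Wg)
      then show ?thesis using L_integrable[OF that that] by (simp add: semi_inner_L[OF that that])
    qed
  qed
qed

sublocale LS: semi_inner_space scl L "semi_inner a b w" by (rule L_semi_inner_space)

text \<open>The pointwise density \<open>f\<^sup>* W f\<close> of the squared norm with respect to \<open>tr w\<close>.\<close>

definition dens :: "(real \<Rightarrow> complex^'n) \<Rightarrow> real \<Rightarrow> real" where
  "dens f x = Re (herm (f x) (Wg x *v f x))"

lemma dens_nonneg: "0 \<le> dens f x" by (simp add: dens_def psd_nonneg(1)[OF psd_Wg])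

lemma dens_measurable: "f \<in> borel_measurable M \<Longrightarrow> dens f \<in> borel_measurable M2"
  unfolding dens_def[abs_def] meas_M2 by (intro measurable_compose[OF _ borel_measurable_Re] herm_measurable mv_measurable Wg_M)

lemma L_iff_dens: "f \<in> L \<longleftrightarrow> f \<in> borel_measurable M \<and> (\<integral>\<^sup>+x. ennreal (dens f x) \<partial>M2) < \<infinity>"
proof -
  have "integrable M2 (\<lambda>x. herm (f x) (Wg x *v f x)) \<longleftrightarrow> (\<integral>\<^sup>+x. ennreal (dens f x) \<partial>M2) < \<infinity>" if f: "f \<in> borel_measurable M"
  proof -
    have eq: "herm (f x) (Wg x *v f x) = of_real (dens f x)" for x
      using psd_nonneg(2)[OF psd_Wg] by (simp add: dens_def complex_eq_iff)
    have "integrable M2 (\<lambda>x. herm (f x) (Wg x *v f x)) \<longleftrightarrow> integrable M2 (dens f)"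
      unfolding eq by (rule complex_of_real_integrable_eq)
    also have "\<dots> \<longleftrightarrow> (\<integral>\<^sup>+x. ennreal (dens f x) \<partial>M2) < \<infinity>"
      using dens_measurable[OF f] dens_nonneg by (auto simp: integrable_iff_bounded)
    finally show ?thesis .
  qed
  then show ?thesis unfolding L_iff by blast
qed

lemma nrm_sq_nn_integral: assumes f: "f \<in> L" shows "(\<integral>\<^sup>+x. ennreal (dens f x) \<partial>M2) = ennreal ((LS.nrm f)\<^sup>2)"
proof -
  have i: "integrable M2 (dens f)" unfolding dens_def[abs_def] using L_integrable[OF f f] by simp
  have "(\<integral>\<^sup>+x. ennreal (dens f x) \<partial>M2) = ennreal (LINT x|M2. dens f x)"
    using dens_nonneg by (intro nn_integral_eq_integral i) auto
  also have "(LINT x|M2. dens f x) = Re (semi_inner a b w f f)"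
    unfolding dens_def[abs_def] semi_inner_L[OF f f] using L_integrable[OF f f] by simp
  finally show ?thesis using LS.nrm_sq[OF f] by simp
qed

lemma nrm_null_iff: assumes f: "f \<in> L" shows "LS.nrm f = 0 \<longleftrightarrow> (AE x in M2. dens f x = 0)"
proof -
  have "LS.nrm f = 0 \<longleftrightarrow> (\<integral>\<^sup>+x. ennreal (dens f x) \<partial>M2) = 0"
    unfolding nrm_sq_nn_integral[OF f] using LS.nrm_nonneg[OF f] by (simp add: ennreal_eq_0_iff)
  also have "\<dots> \<longleftrightarrow> (AE x in M2. ennreal (dens f x) = 0)"
    using dens_measurable[OF L_measurable[OF f]] by (intro nn_integral_0_iff_AE) auto
  also have "\<dots> \<longleftrightarrow> (AE x in M2. dens f x = 0)"
  proof -
    have "ennreal (dens f x) = 0 \<longleftrightarrow> dens f x = 0" for x using dens_nonneg[of f x] by (auto simp: ennreal_eq_0_iff)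
    then show ?thesis by simp
  qed
  finally show ?thesis .
qed

text \<open>
  The argument of Riesz and Fischer. Almost everywhere the weighted sum \<open>S\<close> is finite, which forces
  \<open>W Z\<^sub>k\<close> to converge pointwise; the Neumann series recovers a function \<open>f\<close> with \<open>W f = lim W Z\<^sub>k\<close>, and Fatou's
  lemma yields the estimate.
\<close>

lemma fast_Cauchy_limit:
  assumes Z: "\<And>k::nat. Z k \<in> L" and fast: "\<And>k l. k \<le> l \<Longrightarrow> LS.nrm (Z l - Z k) \<le> (1/2) ^ k"
  shows "\<exists>f\<in>L. \<forall>k. LS.nrm (f - Z k) \<le> (1/2) ^ k"
proof -
  have Zd: "Z l - Z k \<in> L" for k l using Z by auto
  have Zm: "Z k \<in> borel_measurable M" for k by (rule L_measurable[OF Z])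
  \<comment> \<open>The factor \<open>2\<^sup>k\<close> leaves a summable integral and makes the pointwise increments decay geometrically.\<close>
  define S where "S x = (\<Sum>k. ennreal (2 ^ k * dens (Z (Suc k) - Z k) x))" for x
  have dm: "dens (Z l - Z k) \<in> borel_measurable M2" for k l by (rule dens_measurable[OF L_measurable[OF Zd]])
  have "(\<integral>\<^sup>+x. S x \<partial>M2) = (\<Sum>k. \<integral>\<^sup>+x. ennreal (2 ^ k * dens (Z (Suc k) - Z k) x) \<partial>M2)"
    unfolding S_def
    by (intro nn_integral_suminf measurable_compose[OF _ measurable_ennreal] borel_measurable_times borel_measurable_const dm)
  also have "\<dots> \<le> (\<Sum>k. ennreal ((1/2) ^ k))"
  proof (rule suminf_le)
    fix k
    have "(\<integral>\<^sup>+x. ennreal (2 ^ k * dens (Z (Suc k) - Z k) x) \<partial>M2) = ennreal (2 ^ k) * ennreal ((LS.nrm (Z (Suc k) - Z k))\<^sup>2)"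
      unfolding nrm_sq_nn_integral[OF Zd, symmetric] using dm dens_nonneg
      by (subst nn_integral_cmult[symmetric]) (auto simp: ennreal_mult)
    also have "\<dots> = ennreal (2 ^ k * (LS.nrm (Z (Suc k) - Z k))\<^sup>2)" by (simp add: ennreal_mult)
    also have "\<dots> \<le> ennreal ((1/2) ^ k)"
    proof (rule ennreal_leI)
      have "(LS.nrm (Z (Suc k) - Z k))\<^sup>2 \<le> ((1/2) ^ k)\<^sup>2" using fast[of k "Suc k"] Zd by (intro power_mono) auto
      then have "2 ^ k * (LS.nrm (Z (Suc k) - Z k))\<^sup>2 \<le> 2 ^ k * ((1/2) ^ k)\<^sup>2" by (intro mult_left_mono) auto
      also have "\<dots> = (1/2) ^ k" by (simp add: power2_eq_square power_divide)
      finally show "2 ^ k * (LS.nrm (Z (Suc k) - Z k))\<^sup>2 \<le> (1/2) ^ k" .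
    qed
    finally show "(\<integral>\<^sup>+x. ennreal (2 ^ k * dens (Z (Suc k) - Z k) x) \<partial>M2) \<le> ennreal ((1/2) ^ k)" .
  qed auto
  also have "\<dots> = ennreal (\<Sum>k. (1/2) ^ k)" by (intro suminf_ennreal2 summable_geometric) auto
  also have "\<dots> < \<infinity>" by simp
  finally have "(\<integral>\<^sup>+x. S x \<partial>M2) \<noteq> \<infinity>" by auto
  moreover have "S \<in> borel_measurable M2" unfolding S_def[abs_def]
    by (intro borel_measurable_suminf_order measurable_compose[OF _ measurable_ennreal] borel_measurable_times borel_measurable_const dm)
  ultimately have "AE x in M2. S x \<noteq> \<infinity>" by (intro nn_integral_noteq_infinite) auto
  define y where "y x = lim (\<lambda>k. Wg x *v Z k x)" for x
  define f where "f x = lim (\<lambda>N. \<Sum>j<N. (psd_contraction.A (Wg x) ^^ j) (y x))" for x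
  have ym: "y \<in> borel_measurable M" unfolding y_def[abs_def]
    by (intro borel_measurable_lim_metric mv_measurable Wg_M Zm)
  have Am: "(\<lambda>x. (psd_contraction.A (Wg x) ^^ j) (y x)) \<in> borel_measurable M" for j
  proof (induction j)
    case (Suc j)
    have "(psd_contraction.A (Wg x) ^^ Suc j) (y x) = (psd_contraction.A (Wg x) ^^ j) (y x) - Wg x *v (psd_contraction.A (Wg x) ^^ j) (y x)" for x
      by (simp add: psd_contraction.A_def[OF contraction])
    then show ?case using Suc by (auto intro!: borel_measurable_diff mv_measurable Wg_M)
  qed (simp add: ym)
  have fm: "f \<in> borel_measurable M" unfolding f_def[abs_def]
    by (intro borel_measurable_lim_metric borel_measurable_sum Am)
  have conv: "(\<lambda>l. dens (Z l - Z k) x) \<longlonglongrightarrow> dens (f - Z k) x" if Sx: "S x \<noteq> \<infinity>" for x k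
  proof -
    interpret psd_contraction "Wg x" by (rule contraction)
    have le: "ennreal (2 ^ k * dens (Z (Suc k) - Z k) x) \<le> S x" for k
      unfolding S_def using sum_le_suminf[of "\<lambda>k. ennreal (2 ^ k * dens (Z (Suc k) - Z k) x)" "{k}"] by simp
    define C where "C = enn2real (S x)"
    have SC: "S x = ennreal C" "0 \<le> C" using Sx by (auto simp: C_def less_top)
    have bnd: "2 ^ k * dens (Z (Suc k) - Z k) x \<le> C" for k
      using le[of k] SC by (simp add: dens_nonneg)
    have step: "(norm (Wg x *v Z (Suc k) x - Wg x *v Z k x))\<^sup>2 \<le> C * (1/2) ^ k" for k
    proof -
      have "(norm (Wg x *v Z (Suc k) x - Wg x *v Z k x))\<^sup>2 \<le> dens (Z (Suc k) - Z k) x"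
        using norm_sq[of "Z (Suc k) x - Z k x"] by (simp add: dens_def matrix_vector_diff)
      also have "dens (Z (Suc k) - Z k) x = (1/2) ^ k * (2 ^ k * dens (Z (Suc k) - Z k) x)"
        by (simp add: power_one_over)
      also have "\<dots> \<le> (1/2) ^ k * C" by (intro mult_left_mono bnd) simp
      finally show ?thesis by (simp only: mult.commute)
    qed
    have "norm (Wg x *v Z (Suc k) x - Wg x *v Z k x) \<le> sqrt C * (sqrt (1/2)) ^ k" for k
      using real_le_rsqrt[OF step[of k]] by (simp add: real_sqrt_mult real_sqrt_power)
    note cs = this
    have sm: "summable (\<lambda>k. sqrt C * (sqrt (1/2)) ^ k)"
      by (intro summable_mult summable_geometric) (simp add: real_sqrt_divide)
    have "summable (\<lambda>k. Wg x *v Z (Suc k) x - Wg x *v Z k x)"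
      by (rule summable_comparison_test_ev[OF _ sm]) (intro always_eventually allI cs)
    then have "convergent (\<lambda>n. \<Sum>k<n. Wg x *v Z (Suc k) x - Wg x *v Z k x)" by (simp add: summable_iff_convergent)
    then have "convergent (\<lambda>n. Wg x *v Z n x - Wg x *v Z 0 x)" by (simp only: sum_lessThan_telescope[of "\<lambda>k. Wg x *v Z k x"])
    then have "convergent (\<lambda>n. (Wg x *v Z n x - Wg x *v Z 0 x) + Wg x *v Z 0 x)" by (intro convergent_add convergent_const)
    then have "convergent (\<lambda>k. Wg x *v Z k x)" by simp
    then have yl: "(\<lambda>k. Wg x *v Z k x) \<longlonglongrightarrow> y x" unfolding y_def by (rule convergent_LIMSEQ_iff[THEN iffD1])
    then have "y x \<in> range ((*v) (Wg x))" by (rule range_closed[rotated]) auto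
    then obtain z where "y x = Wg x *v z" by auto
    from neumann_preimage[OF this] have Wf: "Wg x *v f x = y x" unfolding f_def by (metis limI)
    obtain C' where C': "\<And>v. Re (herm v (Wg x *v v)) \<le> C' * (norm (Wg x *v v))\<^sup>2" using form_le_norm by blast
    have "(\<lambda>l. C' * (norm (Wg x *v (Z l x - f x)))\<^sup>2) \<longlonglongrightarrow> C' * (norm (y x - y x))\<^sup>2"
      unfolding matrix_vector_diff Wf
      by (rule tendsto_mult[OF tendsto_const tendsto_power[OF tendsto_norm[OF tendsto_diff[OF yl tendsto_const]]]])
    then have lim0: "(\<lambda>l. C' * (norm (Wg x *v (Z l x - f x)))\<^sup>2) \<longlonglongrightarrow> 0" by simp
    have p0: "(\<lambda>l. dens (Z l - f) x) \<longlonglongrightarrow> 0"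
    proof (rule tendsto_sandwich[OF always_eventually always_eventually tendsto_const lim0])
      show "\<forall>l. 0 \<le> dens (Z l - f) x" by (simp add: dens_nonneg)
      show "\<forall>l. dens (Z l - f) x \<le> C' * (norm (Wg x *v (Z l x - f x)))\<^sup>2" using C' by (simp add: dens_def)
    qed
    have form: "dens (Z l - Z k) x = dens (f - Z k) x + dens (Z l - f) x + 2 * Re (herm (f x - Z k x) (Wg x *v (Z l x - f x)))" for l
    proof -
      have "Z l x - Z k x = (f x - Z k x) + (Z l x - f x)" by simp
      then have "herm (Z l x - Z k x) (Wg x *v (Z l x - Z k x)) =
          herm (f x - Z k x) (Wg x *v (f x - Z k x)) + herm (f x - Z k x) (Wg x *v (Z l x - f x)) +
          (cnj (herm (f x - Z k x) (Wg x *v (Z l x - f x))) + herm (Z l x - f x) (Wg x *v (Z l x - f x)))"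
        using psd_hermitian[OF psd_W, of "Z l x - f x" "f x - Z k x"]
        by (simp only: matrix_vector_right_distrib herm_add herm_add_left) (simp add: algebra_simps)
      then show ?thesis by (simp add: dens_def)
    qed
    have "(\<lambda>l. Wg x *v (Z l x - f x)) \<longlonglongrightarrow> y x - y x" unfolding matrix_vector_diff Wf
      by (rule tendsto_diff[OF yl tendsto_const])
    then have "(\<lambda>l. herm (f x - Z k x) (Wg x *v (Z l x - f x))) \<longlonglongrightarrow> herm (f x - Z k x) (y x - y x)"
      by (rule bounded_linear.tendsto[OF bounded_bilinear.bounded_linear_right[OF herm_bounded_bilinear]])
    then have "(\<lambda>l. dens (f - Z k) x + dens (Z l - f) x + 2 * Re (herm (f x - Z k x) (Wg x *v (Z l x - f x)))) \<longlonglongrightarrow> dens (f - Z k) x + 0 + 2 * Re (herm (f x - Z k x) (y x - y x))"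
      by (intro tendsto_add tendsto_const p0 tendsto_mult_left tendsto_Re)
    then show ?thesis unfolding form by simp
  qed
  have bound: "(\<integral>\<^sup>+x. ennreal (dens (f - Z k) x) \<partial>M2) \<le> ennreal (((1/2) ^ k)\<^sup>2)" for k
  proof -
    have "(\<integral>\<^sup>+x. ennreal (dens (f - Z k) x) \<partial>M2) = (\<integral>\<^sup>+x. liminf (\<lambda>l. ennreal (dens (Z l - Z k) x)) \<partial>M2)"
    proof (rule nn_integral_cong_AE)
      show "AE x in M2. ennreal (dens (f - Z k) x) = liminf (\<lambda>l. ennreal (dens (Z l - Z k) x))"
        using \<open>AE x in M2. S x \<noteq> \<infinity>\<close>
      proof eventually_elim
        case (elim x)
        have "(\<lambda>l. ennreal (dens (Z l - Z k) x)) \<longlonglongrightarrow> ennreal (dens (f - Z k) x)"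
          by (intro tendsto_ennrealI conv elim)
        then show ?case by (intro lim_imp_Liminf[symmetric]) auto
      qed
    qed
    also have "\<dots> \<le> liminf (\<lambda>l. \<integral>\<^sup>+x. ennreal (dens (Z l - Z k) x) \<partial>M2)"
      by (intro nn_integral_liminf measurable_compose[OF _ measurable_ennreal] dm)
    also have "\<dots> \<le> ennreal (((1/2) ^ k)\<^sup>2)"
    proof -
      have "\<forall>\<^sub>F l in sequentially. (\<integral>\<^sup>+x. ennreal (dens (Z l - Z k) x) \<partial>M2) \<le> ennreal (((1/2) ^ k)\<^sup>2)"
        unfolding nrm_sq_nn_integral[OF Zd]
        using fast Zd by (intro eventually_sequentiallyI[of k] ennreal_leI power_mono) auto
      then have "liminf (\<lambda>l. \<integral>\<^sup>+x. ennreal (dens (Z l - Z k) x) \<partial>M2) \<le> liminf (\<lambda>l::nat. ennreal (((1/2) ^ k)\<^sup>2))"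
        by (rule Liminf_mono)
      then show ?thesis by (simp add: Liminf_const)
    qed
    finally show ?thesis .
  qed
  have fZ: "f - Z k \<in> L" for k
    unfolding L_iff_dens using fm Zm[of k] le_less_trans[OF bound[of k]]
    by (auto simp: fun_diff_def intro!: borel_measurable_diff)
  have "f \<in> L" using L_add[OF fZ[of 0] Z[of 0]] by simp
  moreover have "LS.nrm (f - Z k) \<le> (1/2) ^ k" for k
  proof -
    have "(LS.nrm (f - Z k))\<^sup>2 \<le> ((1/2) ^ k)\<^sup>2"
      using bound[of k] unfolding nrm_sq_nn_integral[OF fZ] by (simp add: ennreal_le_iff)
    then show ?thesis by (rule power2_le_imp_le) simp
  qed
  ultimately show ?thesis by blast
qed

theorem L_complete:
  assumes X: "\<And>n::nat. X n \<in> L" and C: "\<And>e. e > 0 \<Longrightarrow> \<exists>N. \<forall>m\<ge>N. \<forall>n\<ge>N. LS.nrm (X m - X n) < e"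
  shows "\<exists>x\<in>L. (\<lambda>n. LS.nrm (X n - x)) \<longlonglongrightarrow> 0"
proof -
  have "\<forall>k. \<exists>N. \<forall>m\<ge>N. \<forall>n\<ge>N. LS.nrm (X m - X n) < (1/2) ^ k" using C by simp
  then obtain N where N: "\<And>k m n. m \<ge> N k \<Longrightarrow> n \<ge> N k \<Longrightarrow> LS.nrm (X m - X n) < (1/2) ^ k" by metis
  define r where "r k = (\<Sum>i\<le>k. N i)" for k
  have rN: "N k \<le> r l" if "k \<le> l" for k l unfolding r_def using that by (intro member_le_sum) auto
  define Z where "Z k = X (r k)" for k
  have "LS.nrm (Z l - Z k) \<le> (1/2) ^ k" if "k \<le> l" for k l
    unfolding Z_def using N[of k "r l" "r k"] rN that by (simp add: less_imp_le)
  then obtain f where f: "f \<in> L" "\<And>k. LS.nrm (f - Z k) \<le> (1/2) ^ k"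
    using fast_Cauchy_limit[of Z] X unfolding Z_def by blast
  have "(\<lambda>n. LS.nrm (X n - f)) \<longlonglongrightarrow> 0"
  proof (rule LIMSEQ_I)
    fix e :: real assume e: "0 < e"
    obtain k where k: "(1/2 :: real) ^ k < e / 2" using real_arch_pow_inv[of "e/2" "1/2"] e by auto
    have "norm (LS.nrm (X n - f) - 0) < e" if n: "n \<ge> N k" for n
    proof -
      have "LS.nrm (X n - f) \<le> LS.nrm (X n - X (r k)) + LS.nrm (X (r k) - f)"
        by (rule LS.nrm_triangle_diff[OF X X f(1)])
      also have "LS.nrm (X (r k) - f) = LS.nrm (f - Z k)"
        unfolding Z_def by (rule LS.nrm_diff_commute[OF X f(1)])
      also have "LS.nrm (X n - X (r k)) + LS.nrm (f - Z k) < e"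
        using N[OF n rN[of k k]] f(2)[of k] k by simp
      finally show ?thesis
        using LS.nrm_nonneg[OF LS.H_diff[OF X f(1)]] by (simp only: diff_0_right real_norm_def abs_of_nonneg)
    qed
    then show "\<exists>no. \<forall>n\<ge>no. norm (LS.nrm (X n - f) - 0) < e" by blast
  qed
  then show ?thesis using f(1) by blast
qed

end

section \<open>The adjoint of the minimal relation\<close>

text \<open>
  A functional that vanishes on the common kernel of finitely many others is a linear combination of them. The
  operation \<open>comb x c y\<close> stands for \<open>x + c y\<close>. The proof eliminates one functional at a time.
\<close>

lemma functional_in_span:
  fixes l :: "'v \<Rightarrow> complex" and Ls :: "'i \<Rightarrow> 'v \<Rightarrow> complex" and comb :: "'v \<Rightarrow> complex \<Rightarrow> 'v \<Rightarrow> 'v"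
  assumes "finite A"
    and closed: "\<And>x y c. x \<in> S \<Longrightarrow> y \<in> S \<Longrightarrow> comb x c y \<in> S"
    and l: "\<And>x y c. x \<in> S \<Longrightarrow> y \<in> S \<Longrightarrow> l (comb x c y) = l x + c * l y"
    and Ls: "\<And>i x y c. x \<in> S \<Longrightarrow> y \<in> S \<Longrightarrow> Ls i (comb x c y) = Ls i x + c * Ls i y"
    and ker: "\<And>x. x \<in> S \<Longrightarrow> (\<And>i. i \<in> A \<Longrightarrow> Ls i x = 0) \<Longrightarrow> l x = 0"
  shows "\<exists>c. \<forall>x\<in>S. l x = (\<Sum>i\<in>A. c i * Ls i x)"
  using \<open>finite A\<close> l ker
proof (induction A arbitrary: l rule: finite_induct)
  case empty then show ?case by auto
next
  case (insert k A)
  show ?case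
  proof (cases "\<forall>x\<in>S. (\<forall>i\<in>A. Ls i x = 0) \<longrightarrow> Ls k x = 0")
    case True
    have "\<exists>c. \<forall>x\<in>S. l x = (\<Sum>i\<in>A. c i * Ls i x)"
      by (rule insert.IH[OF insert.prems(1)]) (use True insert.prems(2) in auto)
    then obtain c where c: "\<And>x. x \<in> S \<Longrightarrow> l x = (\<Sum>i\<in>A. c i * Ls i x)" by blast
    have "(\<Sum>i\<in>A. (c(k := 0)) i * Ls i x) = (\<Sum>i\<in>A. c i * Ls i x)" for x
      using insert.hyps(2) by (intro sum.cong) auto
    then show ?thesis using c insert.hyps by (intro exI[of _ "c(k := 0)"]) auto
  next
    case False
    then obtain x0 where x0: "x0 \<in> S" "\<And>i. i \<in> A \<Longrightarrow> Ls i x0 = 0" "Ls k x0 \<noteq> 0" by auto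
    define r where "r = l x0 / Ls k x0"
    define l' where "l' x = l x - r * Ls k x" for x
    have "\<exists>c. \<forall>x\<in>S. l' x = (\<Sum>i\<in>A. c i * Ls i x)"
    proof (rule insert.IH)
      show "l' (comb x c y) = l' x + c * l' y" if "x \<in> S" "y \<in> S" for x y c
        using that insert.prems(1) Ls by (simp add: l'_def algebra_simps)
      fix x assume x: "x \<in> S" "\<And>i. i \<in> A \<Longrightarrow> Ls i x = 0"
      define y where "y = comb x (- (Ls k x / Ls k x0)) x0"
      have y: "y \<in> S" unfolding y_def by (intro closed x x0)
      have "Ls i y = 0" if "i \<in> insert k A" for i
        using that x x0 by (auto simp: y_def Ls)
      then have "l y = 0" using insert.prems(2)[OF y] by blast
      then show "l' x = 0" using insert.prems(1)[OF x(1) x0(1)] x0(3) by (simp add: y_def l'_def r_def field_simps)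
    qed
    then obtain c where c: "\<And>x. x \<in> S \<Longrightarrow> l' x = (\<Sum>i\<in>A. c i * Ls i x)" by blast
    have "(\<Sum>i\<in>A. (c(k := r)) i * Ls i x) = (\<Sum>i\<in>A. c i * Ls i x)" for x
      using insert.hyps(2) by (intro sum.cong) auto
    then show ?thesis using c insert.hyps by (intro exI[of _ "c(k := r)"]) (auto simp: l'_def algebra_simps)
  qed
qed

context hermitian_system
begin

lemma Hw_herm: "herm (Hw x *v y) z = herm y (Hw x *v z)"
  using psd_hermitian[OF psd_Hw, of y x z] herm_cnj[of "Hw x *v y" z] by simp

lemma sol_on_props:
  assumes "sol_on I k u"
  shows "u \<in> borel_measurable M" "c \<in> I \<Longrightarrow> d \<in> I \<Longrightarrow> \<exists>B. \<forall>x\<in>{c..d}. norm (u x) \<le> B"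
proof -
  obtain \<kappa> where \<kappa>: "loc_int \<kappa>" "prim \<kappa> u" using assms by (auto simp: sol_on_def)
  show "u \<in> borel_measurable M" by (rule prim_measurable[OF \<kappa>(2,1)])
  show "c \<in> I \<Longrightarrow> d \<in> I \<Longrightarrow> \<exists>B. \<forall>x\<in>{c..d}. norm (u x) \<le> B" by (rule prim_bounded[OF \<kappa>(2,1)])
qed

definition cut :: "real \<Rightarrow> real \<Rightarrow> (real \<Rightarrow> complex^'n) \<Rightarrow> real \<Rightarrow> complex^'n" where
  "cut c d z x = (if x \<in> {c..<d} then z x else 0)"

text \<open>Locally square integrable functions. Solutions belong to this class but need not be in \<open>L\<close>.\<close>

definition locL :: "(real \<Rightarrow> complex^'n) \<Rightarrow> bool" where
  "locL z \<longleftrightarrow> z \<in> borel_measurable M \<and> (\<forall>c\<in>I. \<forall>d\<in>I. cut c d z \<in> L)"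

lemma cut_measurable: "c \<in> I \<Longrightarrow> d \<in> I \<Longrightarrow> z \<in> borel_measurable M \<Longrightarrow> cut c d z \<in> borel_measurable M"
  unfolding cut_def[abs_def] using LB_M[OF LB_intervals(2)] by (intro measurable_If_set) auto

lemma L_locL: assumes "f \<in> L" shows "locL f"
  unfolding locL_def
proof (intro conjI ballI L_measurable assms)
  fix c d assume cd: "c \<in> I" "d \<in> I"
  have "(\<integral>\<^sup>+x. ennreal (dens (cut c d f) x) \<partial>M2) \<le> (\<integral>\<^sup>+x. ennreal (dens f x) \<partial>M2)"
  proof (intro nn_integral_mono ennreal_leI)
    show "dens (cut c d f) x \<le> dens f x" for x
      using dens_nonneg[of f x] by (cases "x \<in> {c..<d}") (auto simp: dens_def cut_def)
  qed
  then show "cut c d f \<in> L" using assms cut_measurable[OF cd] unfolding L_iff_dens by (auto intro: le_less_trans)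
qed

lemma sol_locL: assumes "sol_on I k u" shows "locL u"
  unfolding locL_def
proof (intro conjI ballI sol_on_props(1)[OF assms])
  fix c d assume cd: "c \<in> I" "d \<in> I"
  obtain B where B: "\<And>x. x \<in> {c..d} \<Longrightarrow> norm (u x) \<le> B" using sol_on_props(2)[OF assms cd] by blast
  have "(\<integral>\<^sup>+x. ennreal (dens (cut c d u) x) \<partial>M2) \<le> (\<integral>\<^sup>+x. ennreal (B\<^sup>2) * indicator {c..<d} x \<partial>M2)"
  proof (rule nn_integral_mono)
    fix x
    show "ennreal (dens (cut c d u) x) \<le> ennreal (B\<^sup>2) * indicator {c..<d} x"
    proof (cases "x \<in> {c..<d}")
      case True
      have "dens (cut c d u) x \<le> (norm (u x))\<^sup>2"
        using psd_contraction.Re_herm_W_le[OF contraction] True by (simp add: dens_def cut_def)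
      also have "\<dots> \<le> B\<^sup>2" using B[of x] True by (intro power_mono) auto
      finally show ?thesis using True by (simp add: ennreal_leI)
    next
      case False
      then show ?thesis by (simp only: dens_def cut_def) simp
    qed
  qed
  also have "\<dots> = ennreal (B\<^sup>2) * emeasure M2 {c..<d}"
    using LB_M[OF LB_intervals(2)[OF cd]] sets_M2 by (intro nn_integral_cmult_indicator) auto
  also have "\<dots> < \<infinity>"
    using loc_finite_emeasure[OF M2_loc_finite LB_intervals(2)[OF cd]] by (simp add: ennreal_mult_less_top)
  finally show "cut c d u \<in> L" unfolding L_iff_dens using cut_measurable[OF cd sol_on_props(1)[OF assms]] by simp
qed

lemma locL_diff: assumes "locL z" "locL y" shows "locL (\<lambda>x. z x - y x)"
  unfolding locL_def
proof (intro conjI ballI)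
  show "(\<lambda>x. z x - y x) \<in> borel_measurable M" using assms by (intro borel_measurable_diff) (auto simp: locL_def)
  fix c d assume cd: "c \<in> I" "d \<in> I"
  have "cut c d (\<lambda>x. z x - y x) = cut c d z - cut c d y" by (auto simp: cut_def fun_eq_iff)
  then show "cut c d (\<lambda>x. z x - y x) \<in> L" using assms cd LS.H_diff by (auto simp: locL_def)
qed

definition compact_L :: "(real \<Rightarrow> complex^'n) set" where
  "compact_L = {f \<in> L. \<exists>c\<in>I. \<exists>d\<in>I. \<forall>x. x \<notin> {c..<d} \<longrightarrow> f x = 0}"

lemma herm_Hw_integrable:
  assumes z: "locL z" and f: "f \<in> compact_L"
  shows "integrable M (\<lambda>x. herm (z x) (Hw x *v f x))"
proof -
  obtain c d where cd: "c \<in> I" "d \<in> I" "\<And>x. x \<notin> {c..<d} \<Longrightarrow> f x = 0" and fL: "f \<in> L" using f by (auto simp: compact_L_def)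
  have "integrable M (\<lambda>x. herm (cut c d z x) (Hw x *v f x))"
    using z cd by (intro L_integrable_M fL) (auto simp: locL_def)
  moreover have "herm (cut c d z x) (Hw x *v f x) = herm (z x) (Hw x *v f x)" for x
    using cd(3)[of x] by (auto simp: cut_def)
  ultimately show ?thesis by simp
qed

lemma compact_L_comb:
  assumes "f \<in> compact_L" "g \<in> compact_L" shows "(\<lambda>x. f x + c *s g x) \<in> compact_L"
proof -
  obtain s t where 1: "s \<in> I" "t \<in> I" "\<And>x. x \<notin> {s..<t} \<Longrightarrow> f x = 0" "f \<in> L" using assms(1) by (auto simp: compact_L_def)
  obtain s' t' where 2: "s' \<in> I" "t' \<in> I" "\<And>x. x \<notin> {s'..<t'} \<Longrightarrow> g x = 0" "g \<in> L" using assms(2) by (auto simp: compact_L_def)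
  have "(\<lambda>x. f x + c *s g x) = f + scl c g" by (simp add: scl_def plus_fun_def)
  then have "(\<lambda>x. f x + c *s g x) \<in> L" using L_add[OF 1(4) L_scl[OF 2(4)]] by simp
  moreover have "min s s' \<in> I" "max t t' \<in> I" using 1 2 by (auto simp: min_def max_def)
  moreover have "f x + c *s g x = 0" if "x \<notin> {min s s'..<max t t'}" for x
  proof -
    have "x \<notin> {s..<t}" "x \<notin> {s'..<t'}" using that by auto
    then show ?thesis using 1(3) 2(3) by simp
  qed
  ultimately show ?thesis unfolding compact_L_def by blast
qed

lemma semi_inner_comb:
  assumes z: "locL z" and f: "f \<in> compact_L" and g: "g \<in> compact_L"
  shows "semi_inner a b w z (\<lambda>x. f x + c *s g x) = semi_inner a b w z f + c * semi_inner a b w z g"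
proof -
  have m: "z \<in> borel_measurable M" "f \<in> borel_measurable M" "g \<in> borel_measurable M" "(\<lambda>x. f x + c *s g x) \<in> borel_measurable M"
    using z f g compact_L_comb[OF f g, of c] by (auto simp: locL_def compact_L_def intro: L_measurable)
  have "herm (z x) (Hw x *v (f x + c *s g x)) = herm (z x) (Hw x *v f x) + c * herm (z x) (Hw x *v g x)" for x
    by (simp add: matrix_vector_right_distrib matrix_vector_mult_scale herm_add herm_scale)
  then show ?thesis
    unfolding semi_inner_eq(2)[OF m(1) m(4)] semi_inner_eq(2)[OF m(1,2)] semi_inner_eq(2)[OF m(1,3)]
    using herm_Hw_integrable[OF z f] herm_Hw_integrable[OF z g] by simp
qed

lemma semi_inner_diff_left:
  assumes z: "locL z" and y: "locL y" and f: "f \<in> compact_L"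
  shows "semi_inner a b w (\<lambda>x. z x - y x) f = semi_inner a b w z f - semi_inner a b w y f"
proof -
  have m: "z \<in> borel_measurable M" "y \<in> borel_measurable M" "f \<in> borel_measurable M" "(\<lambda>x. z x - y x) \<in> borel_measurable M"
    using z y f locL_diff[OF z y] by (auto simp: locL_def compact_L_def intro: L_measurable)
  show ?thesis
    unfolding semi_inner_eq(2)[OF m(4,3)] semi_inner_eq(2)[OF m(1,3)] semi_inner_eq(2)[OF m(2,3)] herm_diff_left
    using herm_Hw_integrable[OF z f] herm_Hw_integrable[OF y f] by (rule Bochner_Integration.integral_diff)
qed

lemma semi_inner_sum_left:
  assumes A: "finite A" and h: "\<And>i. i \<in> A \<Longrightarrow> locL (h i)" and f: "f \<in> compact_L"
    and m: "(\<lambda>x. \<Sum>i\<in>A. c i *s h i x) \<in> borel_measurable M"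
  shows "semi_inner a b w (\<lambda>x. \<Sum>i\<in>A. c i *s h i x) f = (\<Sum>i\<in>A. cnj (c i) * semi_inner a b w (h i) f)"
proof -
  have fm: "f \<in> borel_measurable M" using f by (auto simp: compact_L_def intro: L_measurable)
  have hm: "h i \<in> borel_measurable M" if "i \<in> A" for i using h[OF that] by (simp add: locL_def)
  have eq: "herm (\<Sum>i\<in>A. c i *s h i x) y = (\<Sum>i\<in>A. cnj (c i) * herm (h i x) y)" for x y
    using A by (induction A rule: finite_induct) (auto simp: herm_add_left herm_scale_left)
  show ?thesis
    unfolding semi_inner_eq(2)[OF m fm] eq using h herm_Hw_integrable[OF _ f]
    by (subst Bochner_Integration.integral_sum) (auto simp: semi_inner_eq(2)[OF hm fm])
qed

text \<open>
  The Lagrange identity over an interval that carries \<open>u\<close> and \<open>f\<close>, at whose ends \<open>u\<close> has left limit zero. It is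
  also applied to solutions \<open>v\<close> outside \<open>L\<close>.
\<close>

lemma compact_green:
  assumes u: "sol_on I (\<lambda>x. Hw x *v f x) u" and v: "sol_on I (\<lambda>x. Hw x *v g x) v"
    and uL: "u \<in> L" and gL: "g \<in> L" and fL: "f \<in> L"
    and cd: "c \<in> I" "d \<in> I" "c \<le> d" and supp: "\<And>x. x \<in> I \<Longrightarrow> x \<notin> {c..<d} \<Longrightarrow> f x = 0 \<and> u x = 0"
    and ends: "left_lim u c = 0" "left_lim u d = 0"
  shows "semi_inner a b w v f = semi_inner a b w g u"
proof -
  have "cut c d f \<in> L" using L_locL[OF fL] cd by (simp add: locL_def)
  then have "cut c d f \<in> compact_L" using cd unfolding compact_L_def cut_def by auto
  from herm_Hw_integrable[OF sol_locL[OF v] this]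
  have 1: "integrable M (\<lambda>x. herm (v x) (Hw x *v f x))"
  proof (rule Bochner_Integration.integrable_cong[THEN iffD1, OF refl, rotated])
    fix x assume "x \<in> space M"
    then show "herm (v x) (Hw x *v cut c d f x) = herm (v x) (Hw x *v f x)" using supp[of x] by (simp add: cut_def)
  qed
  have 2: "integrable M (\<lambda>x. herm (Hw x *v g x) (u x))" unfolding Hw_herm by (rule L_integrable_M[OF gL uL])
  have "0 = (LINT x:{c..<d}|M. herm (v x) (Hw x *v f x) - herm (Hw x *v g x) (u x))"
  proof -
    have "{c..<d} \<subseteq> I" using I_interval[OF cd(1,2)] by auto
    from lagrange_identity[OF u v cd this] show ?thesis using ends by (simp add: pairing_def)
  qed
  also have "\<dots> = (LINT x|M. herm (v x) (Hw x *v f x) - herm (Hw x *v g x) (u x))"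
    unfolding set_lebesgue_integral_def
  proof (rule Bochner_Integration.integral_cong[OF refl])
    fix x assume "x \<in> space M"
    then show "indicat_real {c..<d} x *\<^sub>R (herm (v x) (Hw x *v f x) - herm (Hw x *v g x) (u x)) =
        herm (v x) (Hw x *v f x) - herm (Hw x *v g x) (u x)" using supp[of x] by (cases "x \<in> {c..<d}") auto
  qed
  also have "\<dots> = (LINT x|M. herm (v x) (Hw x *v f x)) - (LINT x|M. herm (Hw x *v g x) (u x))"
    using 1 2 by (rule Bochner_Integration.integral_diff)
  also have "\<dots> = semi_inner a b w v f - semi_inner a b w g u"
    unfolding Hw_herm using L_measurable[OF fL] L_measurable[OF gL] L_measurable[OF uL] sol_on_props(1)[OF v]
    by (simp add: semi_inner_eq(2))
  finally show ?thesis by simp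
qed

text \<open>
  Elements of the maximal relation with compact support. The support is described by a half-open interval
  and left limits since these are what the Lagrange identity refers to; a jump at the left endpoint is possible.
\<close>

definition Tmin_rep :: "((real \<Rightarrow> complex^'n) \<times> (real \<Rightarrow> complex^'n)) set" where
  "Tmin_rep = {(u, f). (u, f) \<in> calTmax a b J q w \<and>
     (\<exists>c\<in>I. \<exists>d\<in>I. c \<le> d \<and> left_lim u c = 0 \<and> left_lim u d = 0 \<and> (\<forall>x\<in>I. x \<notin> {c..<d} \<longrightarrow> f x = 0 \<and> u x = 0))}"

lemma Tmin_rep_green:
  assumes "(u, f) \<in> Tmin_rep" "(v, g) \<in> calTmax a b J q w"
  shows "semi_inner a b w v f = semi_inner a b w g u"
proof -
  obtain c d where "c \<in> I" "d \<in> I" "c \<le> d" "left_lim u c = 0" "left_lim u d = 0"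
      "\<And>x. x \<in> I \<Longrightarrow> x \<notin> {c..<d} \<Longrightarrow> f x = 0 \<and> u x = 0"
    using assms(1) unfolding Tmin_rep_def by blast
  moreover have "(u, f) \<in> calTmax a b J q w" using assms(1) by (auto simp: Tmin_rep_def)
  ultimately show ?thesis using assms(2) by (intro compact_green[of f u g v c d]) (auto simp: calTmax_iff)
qed

lemma L_cong: assumes "\<And>x. x \<in> I \<Longrightarrow> f x = g x" "f \<in> L" shows "g \<in> L"
proof -
  have "g \<in> borel_measurable M" using L_measurable[OF assms(2)] measurable_cong[of M f g borel] assms(1) by simp
  moreover have "integrable M2 (\<lambda>x. herm (g x) (Wg x *v g x))"
    using assms loc_finite_space[OF M2_loc_finite] unfolding L_iff
    by (subst Bochner_Integration.integrable_cong[of M2 M2 _ "\<lambda>x. herm (f x) (Wg x *v f x)"]) auto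
  ultimately show ?thesis by (simp add: L_iff)
qed

text \<open>
  Let \<open>u\<close> solve the equation with left limit zero at the left end \<open>c\<close> of the support of \<open>f\<close>. To the left of \<open>c\<close>
  it vanishes; to the right of the support \<open>y\<^sup>* J u\<close> equals \<open>\<integral> y\<^sup>* w f\<close>, which is zero for all homogeneous
  solutions \<open>y\<close>, and their values are arbitrary.
\<close>

lemma compact_solution:
  assumes f: "f \<in> compact_L" and x0: "x0 \<in> I"
    and h: "\<And>i. sol_on I (\<lambda>_. 0) (h i)" "\<And>i. left_lim (h i) x0 = axis i 1"
    and orth: "\<And>i. semi_inner a b w (h i) f = 0"
  shows "\<exists>u. (u, f) \<in> Tmin_rep"
proof -
  have fL: "f \<in> L" using f by (simp add: compact_L_def)
  obtain c d0 where cd0: "c \<in> I" "d0 \<in> I" "\<And>x. x \<notin> {c..<d0} \<Longrightarrow> f x = 0" using f by (auto simp: compact_L_def)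
  define d where "d = max c d0"
  have cd: "c \<in> I" "d \<in> I" "c \<le> d" "\<And>x. x \<notin> {c..<d} \<Longrightarrow> f x = 0"
  proof -
    fix x assume "x \<notin> {c..<d}"
    then have "x \<notin> {c..<d0}" by (auto simp: d_def)
    then show "f x = 0" by (rule cd0(3))
  qed (use cd0 in \<open>auto simp: d_def max_def\<close>)
  obtain u where u: "sol_on I (\<lambda>x. Hw x *v f x) u" "left_lim u c = 0"
    using global_solution[OF Hw_loc_int[OF fL] cd(1)] by blast
  have orth': "(LINT x|M. herm (y x) (Hw x *v f x)) = 0" if y: "sol_on I (\<lambda>_. 0) y" for y
  proof -
    let ?s = "\<lambda>x. \<Sum>i\<in>UNIV. (left_lim y x0 $ i) *s h i x"
    have s: "sol_on I (\<lambda>_. 0) ?s" "left_lim ?s x0 = (\<Sum>i\<in>UNIV. (left_lim y x0 $ i) *s axis i 1)"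
      using sol_on_sum[of UNIV I h "\<lambda>i. left_lim y x0 $ i"] h x0 by auto
    have "(\<Sum>i\<in>UNIV. (left_lim y x0 $ i) *s axis i 1) = left_lim y x0"
      by (simp add: vec_eq_iff axis_def mult_delta_right)
    then have eq: "y x = ?s x" if "x \<in> I" for x using global_unique[OF y s(1) x0 _ that] s(2) by simp
    have ym: "y \<in> borel_measurable M" "?s \<in> borel_measurable M" using sol_on_props(1) y s(1) by auto
    have "(LINT x|M. herm (y x) (Hw x *v f x)) = (LINT x|M. herm (?s x) (Hw x *v f x))"
      using eq by (intro Bochner_Integration.integral_cong) auto
    also have "\<dots> = semi_inner a b w ?s f" using semi_inner_eq(2)[OF ym(2) L_measurable[OF fL]] by simp
    also have "\<dots> = (\<Sum>i\<in>UNIV. cnj (left_lim y x0 $ i) * semi_inner a b w (h i) f)"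
      by (rule semi_inner_sum_left[OF _ sol_locL[OF h(1)] f ym(2)]) auto
    finally show ?thesis by (simp add: orth)
  qed
  have zero: "left_lim u x = 0" if x: "x \<in> I" "x \<le> c \<or> d \<le> x" for x
  proof -
    have "herm z (J *v left_lim u x) = 0" for z
    proof -
      have "loc_int (\<lambda>_. 0 :: complex^'n)" by (simp add: loc_int_def set_integrable_def)
      from global_solution[OF this x(1)] obtain y where y: "sol_on I (\<lambda>_. 0) y" "left_lim y x = z" by blast
      have "pairing y u x = 0"
      proof (cases "x \<le> c")
        case True
        have "{x..<c} \<subseteq> I" using I_interval[OF x(1) cd(1)] by auto
        from lagrange_identity[OF u(1) y(1) x(1) cd(1) True this]
        have "- pairing y u x = (LINT t:{x..<c}|M. herm (y t) (Hw t *v f t))"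
          using u(2) by (simp add: pairing_def)
        also have "\<dots> = (LINT t:{x..<c}|M. 0)"
          using cd(4) LB_M[OF LB_intervals(2)[OF x(1) cd(1)]] by (intro set_lebesgue_integral_cong) auto
        finally show ?thesis by simp
      next
        case False
        then have xd: "c \<le> x" "d \<le> x" using x(2) by auto
        have "{c..<x} \<subseteq> I" using I_interval[OF cd(1) x(1)] by auto
        from lagrange_identity[OF u(1) y(1) cd(1) x(1) xd(1) this]
        have "pairing y u x = (LINT t:{c..<x}|M. herm (y t) (Hw t *v f t))"
          using u(2) by (simp add: pairing_def)
        also have "\<dots> = (LINT t|M. herm (y t) (Hw t *v f t))"
          unfolding set_lebesgue_integral_def
        proof (rule Bochner_Integration.integral_cong[OF refl])
          fix t show "indicat_real {c..<x} t *\<^sub>R herm (y t) (Hw t *v f t) = herm (y t) (Hw t *v f t)"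
            using cd(4)[of t] xd by (cases "t \<in> {c..<x}") auto
        qed
        finally show ?thesis using orth'[OF y(1)] by simp
      qed
      then show ?thesis by (simp add: pairing_def y(2))
    qed
    then have "J *v left_lim u x = 0" using herm_axis by (metis vec_eq_iff zero_index)
    then show ?thesis using Ji_J[of "left_lim u x"] by simp
  qed
  have supp: "f x = 0 \<and> u x = 0" if x: "x \<in> I" "x \<notin> {c..<d}" for x
  proof
    show "f x = 0" by (rule cd(4)[OF x(2)])
    then show "u x = 0" using x zero[of x] by (intro sol_on_zero_if[OF u(1)]) auto
  qed
  have "cut c d u \<in> L" using sol_locL[OF u(1)] cd by (simp add: locL_def)
  then have uL: "u \<in> L" by (rule L_cong[rotated]) (use supp in \<open>auto simp: cut_def\<close>)
  have "left_lim u c = 0" "left_lim u d = 0" using zero cd by auto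
  then show ?thesis using cd(1-3) uL fL u(1) supp unfolding Tmin_rep_def by (auto simp: calTmax_iff)
qed

text \<open>
  The nontrivial inclusion in the computation of the adjoint. For some solution \<open>v1\<close> for the right-hand side \<open>g\<close>,
  \<open>v - v1\<close> annihilates every compactly supported \<open>f\<close> that the homogeneous solutions annihilate, hence acts on
  compactly supported functions like a homogeneous solution \<open>s\<close>. Then \<open>v1 + s\<close> is the representative of \<open>v\<close>.
\<close>

theorem orthogonal_to_Tmin:
  assumes v: "v \<in> L" and g: "g \<in> L"
    and orth: "\<And>u f. (u, f) \<in> Tmin_rep \<Longrightarrow> semi_inner a b w g u = semi_inner a b w v f"
  shows "\<exists>v'. (v', g) \<in> calTmax a b J q w \<and> LS.nrm (v - v') = 0"
proof -
  obtain x0 where x0: "x0 \<in> I" using LB_exhaustion by metis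
  have "loc_int (\<lambda>_. 0 :: complex^'n)" by (simp add: loc_int_def set_integrable_def)
  then have "\<exists>h. sol_on I (\<lambda>_. 0) h \<and> left_lim h x0 = axis i 1" for i by (rule global_solution[OF _ x0])
  then obtain h where h: "\<And>i. sol_on I (\<lambda>_. 0) (h i)" "\<And>i. left_lim (h i) x0 = axis i 1" by metis
  obtain v1 where v1: "sol_on I (\<lambda>x. Hw x *v g x) v1" using global_solution[OF Hw_loc_int[OF g] x0] by blast
  have lv: "locL v" "locL v1" "locL (h i)" for i using L_locL[OF v] sol_locL[OF v1] sol_locL[OF h(1)] by auto
  have "\<exists>c. \<forall>f\<in>compact_L. semi_inner a b w (\<lambda>x. v x - v1 x) f = (\<Sum>i\<in>UNIV. c i * semi_inner a b w (h i) f)"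
  proof (rule functional_in_span[where comb = "\<lambda>f c g x. f x + c *s g x"])
    fix f assume f: "f \<in> compact_L" and z: "\<And>i. i \<in> UNIV \<Longrightarrow> semi_inner a b w (h i) f = 0"
    obtain u where u: "(u, f) \<in> Tmin_rep" using compact_solution[OF f x0 h] z by blast
    obtain c d where cd: "c \<in> I" "d \<in> I" "c \<le> d" "left_lim u c = 0" "left_lim u d = 0"
      "\<And>x. x \<in> I \<Longrightarrow> x \<notin> {c..<d} \<Longrightarrow> f x = 0 \<and> u x = 0"
      using u unfolding Tmin_rep_def by blast
    have T: "u \<in> L" "f \<in> L" "sol_on I (\<lambda>x. Hw x *v f x) u" using u by (auto simp: Tmin_rep_def calTmax_iff)
    have "semi_inner a b w v1 f = semi_inner a b w g u" using compact_green[OF T(3) v1 T(1) g T(2) cd(1-3,6,4,5)] .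
    then show "semi_inner a b w (\<lambda>x. v x - v1 x) f = 0"
      using orth[OF u] semi_inner_diff_left[OF lv(1,2) f] by simp
  qed (auto intro: compact_L_comb semi_inner_comb lv locL_diff)
  then obtain \<alpha> where \<alpha>: "\<And>f. f \<in> compact_L \<Longrightarrow> semi_inner a b w (\<lambda>x. v x - v1 x) f = (\<Sum>i\<in>UNIV. \<alpha> i * semi_inner a b w (h i) f)" by blast
  define s where "s = (\<lambda>x. \<Sum>i\<in>UNIV. cnj (\<alpha> i) *s h i x)"
  have s: "sol_on I (\<lambda>_. 0) s" unfolding s_def using sol_on_sum[of UNIV I h "\<lambda>i. cnj (\<alpha> i)"] h(1) by auto
  define v' where "v' = (\<lambda>x. v1 x + 1 *s s x)"
  have v': "sol_on I (\<lambda>x. Hw x *v g x) v'" using sol_on_add_scale(1)[OF v1 s, of 1] by (simp add: v'_def)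
  define z where "z = v - v'"
  have zeq: "z = (\<lambda>x. (v x - v1 x) - s x)" by (auto simp: z_def v'_def fun_eq_iff)
  have zl: "locL z" unfolding zeq by (intro locL_diff lv sol_locL[OF s])
  have z0: "semi_inner a b w z f = 0" if f: "f \<in> compact_L" for f
    unfolding zeq semi_inner_diff_left[OF locL_diff[OF lv(1,2)] sol_locL[OF s] f] \<alpha>[OF f]
    using semi_inner_sum_left[of UNIV h f "\<lambda>i. cnj (\<alpha> i)"] lv(3) f sol_on_props(1)[OF s] by (simp add: s_def)
  have "AE x in M2. dens z x = 0"
  proof (rule AE_locally[OF M2_loc_finite])
    fix E assume E: "E \<in> LB"
    obtain c d where cd: "a < ereal c" "ereal d < b" "E \<subseteq> {c..d}" using E by (auto simp: local_borel_def)
    show "AE x in M2. x \<in> E \<longrightarrow> dens z x = 0"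
    proof (cases "c \<le> d")
      case False then have "E = {}" using cd(3) by auto
      then show ?thesis by simp
    next
      case True
      then have I: "c \<in> I" "d \<in> I" using I_endpoints cd by auto
      obtain e where e: "e \<in> I" "d < e" using I_right[OF I(2)] by auto
      have cL: "cut c e z \<in> L" using zl I e by (simp add: locL_def)
      then have cC: "cut c e z \<in> compact_L" using I e unfolding compact_L_def cut_def by auto
      have "semi_inner a b w (cut c e z) (cut c e z) = semi_inner a b w z (cut c e z)"
        using L_measurable[OF cL] zl
        by (simp add: semi_inner_eq(1) locL_def) (auto intro!: Bochner_Integration.integral_cong simp: cut_def)
      then have "LS.nrm (cut c e z) = 0" using z0[OF cC] LS.nrm_zero_iff[OF cL] by simp
      then have "AE x in M2. dens (cut c e z) x = 0" using nrm_null_iff[OF cL] by simp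
      then show ?thesis
      proof eventually_elim
        case (elim x)
        have "x \<in> {c..<e}" if "x \<in> E" using that cd(3) e(2) by auto
        then show ?case using elim by (auto simp: dens_def cut_def)
      qed
    qed
  qed
  note ae = this
  have zL: "z \<in> L"
  proof -
    have "(\<integral>\<^sup>+x. ennreal (dens z x) \<partial>M2) = (\<integral>\<^sup>+x. 0 \<partial>M2)" using ae by (intro nn_integral_cong_AE) auto
    then show ?thesis unfolding L_iff_dens using zl by (simp add: locL_def)
  qed
  have nz: "LS.nrm z = 0" using nrm_null_iff[OF zL] ae by simp
  have "v' = v - z" by (simp add: z_def)
  then have "v' \<in> L" using LS.H_diff[OF v zL] by simp
  then show ?thesis using v' g nz by (intro exI[of _ v']) (auto simp: calTmax_iff z_def)
qed

section \<open>Boundary terms\<close>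

text \<open>Passing from left to right limits adds the contribution of the atom at \<open>x\<close> to the Lagrange identity.\<close>

lemma right_pairing:
  assumes u: "sol_on I k u" and v: "sol_on I h v" and x: "x \<in> I"
  shows "herm (right_lim v x) (J *v right_lim u x) = pairing v u x + measure M {x} *\<^sub>R (herm (v x) (k x) - herm (h x) (u x))"
proof -
  obtain \<kappa> where \<kappa>: "loc_int \<kappa>" "prim \<kappa> u" "\<And>x. x \<in> I \<Longrightarrow> J *v \<kappa> x = k x - Hq x *v u x" using u by (auto simp: sol_on_def)
  obtain \<mu> where \<mu>: "loc_int \<mu>" "prim \<mu> v" "\<And>x. x \<in> I \<Longrightarrow> J *v \<mu> x = h x - Hq x *v v x" using v by (auto simp: sol_on_def)
  define r where "r = measure M {x}"
  have "herm (right_lim v x) (J *v right_lim u x) - pairing v u x = of_real r * (herm (v x) (J *v \<kappa> x) + herm (\<mu> x) (J *v u x))"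
    unfolding pairing_def prim_one_sided[OF \<kappa>(2,1) x] prim_one_sided[OF \<mu>(2,1) x] rgt_def lft_def atom_def r_def[symmetric]
    by (simp add: matrix_vector_right_distrib matrix_vector_diff matrix_vector_scaleR_right herm_add herm_add_left
        herm_diff herm_diff_left herm_scaleR herm_scaleR_left algebra_simps)
  also have "\<dots> = r *\<^sub>R (herm (v x) (k x) - herm (h x) (u x))"
    unfolding lagrange_density[OF \<kappa>(3)[OF x] \<mu>(3)[OF x]] by (rule scaleR_conv_of_real[symmetric])
  finally show ?thesis by (simp add: r_def algebra_simps)
qed

text \<open>
  For square integrable data the density in the Lagrange identity is integrable up to the endpoints, so both
  limits exist and their difference is the integral over the whole interval. The bracket at \<open>a\<close> uses right limits,
  which turns half-open intervals into open ones.
\<close>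

theorem bracket_difference:
  assumes u: "(u, f) \<in> calTmax a b J q w" and v: "(v, g) \<in> calTmax a b J q w"
  shows "bracket_b b J v u - bracket_a a J v u = semi_inner a b w v f - semi_inner a b w g u"
proof -
  have U: "u \<in> L" "f \<in> L" "sol_on I (\<lambda>x. Hw x *v f x) u" using u by (auto simp: calTmax_iff)
  have V: "v \<in> L" "g \<in> L" "sol_on I (\<lambda>x. Hw x *v g x) v" using v by (auto simp: calTmax_iff)
  define \<omega> where "\<omega> x = herm (v x) (Hw x *v f x) - herm (Hw x *v g x) (u x)" for x
  have i1: "integrable M (\<lambda>x. herm (v x) (Hw x *v f x))" by (rule L_integrable_M[OF V(1) U(2)])
  have i2: "integrable M (\<lambda>x. herm (Hw x *v g x) (u x))" unfolding Hw_herm by (rule L_integrable_M[OF V(2) U(1)])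
  have \<omega>i: "integrable M \<omega>" unfolding \<omega>_def[abs_def] using i1 i2 by (rule Bochner_Integration.integrable_diff)
  have \<omega>int: "(LINT x|M. \<omega> x) = semi_inner a b w v f - semi_inner a b w g u"
    unfolding \<omega>_def using Bochner_Integration.integral_diff[OF i1 i2] U(1,2) V(1,2)
    by (simp add: Hw_herm semi_inner_eq(2) L_measurable)
  have \<omega>l: "loc_int \<omega>" unfolding loc_int_def set_integrable_def using \<omega>i LB_M by (auto intro!: integrable_mult_indicator)
  have lag: "pairing v u t - pairing v u s = (LINT x:{s..<t}|M. \<omega> x)" if "s \<in> I" "t \<in> I" "s \<le> t" for s t
    unfolding \<omega>_def using I_interval[OF that(1,2)] by (intro lagrange_identity[OF U(3) V(3) that]) auto
  obtain x0 where x0: "x0 \<in> I" using LB_exhaustion by metis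
  have x0ab: "a < ereal x0" "ereal x0 < b" using x0 by (auto simp: einterval_def)
  have realI: "real_of_ereal y \<in> I \<and> ereal (real_of_ereal y) = y" if "a < y" "y < b" for y
    using that by (cases y) (auto simp: einterval_def)
  have cutm: "{x \<in> I. x0 \<le> x} \<in> sets M" "{x \<in> I. x < x0} \<in> sets M" by (auto simp: sets_M)
  define B where "B = pairing v u x0 + (LINT x:{x \<in> I. x0 \<le> x}|M. \<omega> x)"
  define A where "A = pairing v u x0 - (LINT x:{x \<in> I. x < x0}|M. \<omega> x)"
  have "((\<lambda>y. herm (left_lim v (real_of_ereal y)) (J *v left_lim u (real_of_ereal y))) \<longlongrightarrow> B) (at_left b)"
  proof (rule tendsto_at_left_sequentially[OF x0ab(2)])
    fix S :: "nat \<Rightarrow> ereal" assume S: "\<And>n. S n < b" "\<And>n. ereal x0 < S n" "incseq S" "S \<longlonglongrightarrow> b"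
    define t where "t n = real_of_ereal (S n)" for n
    have t: "t n \<in> I" "ereal (t n) = S n" for n using realI[of "S n"] S(1,2)[of n] x0ab less_trans by (auto simp: t_def)
    have tx: "x0 < t n" for n using S(2)[of n] t(2)[of n] by (metis less_ereal.simps(1))
    have "(\<lambda>n. LINT x:{x0..<t n}|M. \<omega> x) \<longlonglongrightarrow> (LINT x:{x \<in> I. x0 \<le> x}|M. \<omega> x)"
      unfolding set_lebesgue_integral_def
    proof (rule integral_dominated_convergence[where w = "\<lambda>x. norm (\<omega> x)"])
      show "(\<lambda>x. indicat_real {x \<in> I. x0 \<le> x} x *\<^sub>R \<omega> x) \<in> borel_measurable M"
        using cutm \<omega>i by (intro borel_measurable_scaleR borel_measurable_indicator) auto
      show "(\<lambda>x. indicat_real {x0..<t n} x *\<^sub>R \<omega> x) \<in> borel_measurable M" for n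
        using LB_M[OF LB_intervals(2)[OF x0 t(1)]] \<omega>i by (intro borel_measurable_scaleR borel_measurable_indicator) auto
      show "integrable M (\<lambda>x. norm (\<omega> x))" using \<omega>i by simp
      show "AE x in M. norm (indicat_real {x0..<t n} x *\<^sub>R \<omega> x) \<le> norm (\<omega> x)" for n
        by (intro AE_I2) (auto simp: indicator_def)
      show "AE x in M. (\<lambda>n. indicat_real {x0..<t n} x *\<^sub>R \<omega> x) \<longlonglongrightarrow> indicat_real {x \<in> I. x0 \<le> x} x *\<^sub>R \<omega> x"
      proof (intro AE_I2 tendsto_eventually)
        fix x assume x: "x \<in> space M"
        then have "ereal x < b" by (auto simp: einterval_def)
        then have "eventually (\<lambda>n. ereal x < S n) sequentially" using S(4) by (rule order_tendstoD(1)[rotated])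
        then show "eventually (\<lambda>n. indicat_real {x0..<t n} x *\<^sub>R \<omega> x = indicat_real {x \<in> I. x0 \<le> x} x *\<^sub>R \<omega> x) sequentially"
        proof eventually_elim
          case (elim n)
          then have "x < t n" using t(2)[of n] by (metis less_ereal.simps(1))
          then show ?case using x by (auto simp: indicator_def)
        qed
      qed
    qed
    then have "(\<lambda>n. pairing v u x0 + (LINT x:{x0..<t n}|M. \<omega> x)) \<longlonglongrightarrow> B" unfolding B_def by (intro tendsto_intros)
    moreover have "pairing v u x0 + (LINT x:{x0..<t n}|M. \<omega> x) = pairing v u (t n)" for n
      using lag[OF x0 t(1)[of n]] tx[of n] by (simp add: algebra_simps)
    ultimately show "(\<lambda>n. herm (left_lim v (real_of_ereal (S n))) (J *v left_lim u (real_of_ereal (S n)))) \<longlonglongrightarrow> B"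
      by (simp add: pairing_def t_def)
  qed
  moreover have nb: "at_left b \<noteq> bot"
  proof
    assume "at_left b = bot"
    then have "eventually (\<lambda>_. False) (at_left b)" by simp
    then have "\<exists>e<b. \<forall>y>e. y < b \<longrightarrow> False" by (simp only: eventually_at_left[OF x0ab(2)])
    then show False by (metis dense)
  qed
  ultimately have bb: "bracket_b b J v u = B" unfolding bracket_b_def by (intro tendsto_Lim)
  have "((\<lambda>y. herm (right_lim v (real_of_ereal y)) (J *v right_lim u (real_of_ereal y))) \<longlongrightarrow> A) (at_right a)"
  proof (rule tendsto_at_right_sequentially[OF x0ab(1)])
    fix S :: "nat \<Rightarrow> ereal" assume S: "\<And>n. a < S n" "\<And>n. S n < ereal x0" "decseq S" "S \<longlonglongrightarrow> a"
    define t where "t n = real_of_ereal (S n)" for n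
    have t: "t n \<in> I" "ereal (t n) = S n" for n using realI[of "S n"] S(1,2)[of n] x0ab less_trans by (auto simp: t_def)
    have tx: "t n < x0" for n using S(2)[of n] t(2)[of n] by (metis less_ereal.simps(1))
    have "(\<lambda>n. LINT x:{t n<..<x0}|M. \<omega> x) \<longlonglongrightarrow> (LINT x:{x \<in> I. x < x0}|M. \<omega> x)"
      unfolding set_lebesgue_integral_def
    proof (rule integral_dominated_convergence[where w = "\<lambda>x. norm (\<omega> x)"])
      show "(\<lambda>x. indicat_real {x \<in> I. x < x0} x *\<^sub>R \<omega> x) \<in> borel_measurable M"
        using cutm \<omega>i by (intro borel_measurable_scaleR borel_measurable_indicator) auto
      show "(\<lambda>x. indicat_real {t n<..<x0} x *\<^sub>R \<omega> x) \<in> borel_measurable M" for n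
        using LB_M[OF LB_intervals(4)[OF t(1) x0]] \<omega>i by (intro borel_measurable_scaleR borel_measurable_indicator) auto
      show "integrable M (\<lambda>x. norm (\<omega> x))" using \<omega>i by simp
      show "AE x in M. norm (indicat_real {t n<..<x0} x *\<^sub>R \<omega> x) \<le> norm (\<omega> x)" for n
        by (intro AE_I2) (auto simp: indicator_def)
      show "AE x in M. (\<lambda>n. indicat_real {t n<..<x0} x *\<^sub>R \<omega> x) \<longlonglongrightarrow> indicat_real {x \<in> I. x < x0} x *\<^sub>R \<omega> x"
      proof (intro AE_I2 tendsto_eventually)
        fix x assume x: "x \<in> space M"
        then have "a < ereal x" by (auto simp: einterval_def)
        then have "eventually (\<lambda>n. S n < ereal x) sequentially" using S(4) by (rule order_tendstoD(2)[rotated])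
        then show "eventually (\<lambda>n. indicat_real {t n<..<x0} x *\<^sub>R \<omega> x = indicat_real {x \<in> I. x < x0} x *\<^sub>R \<omega> x) sequentially"
        proof eventually_elim
          case (elim n)
          then have "t n < x" using t(2)[of n] by (metis less_ereal.simps(1))
          then show ?case using x by (auto simp: indicator_def)
        qed
      qed
    qed
    then have "(\<lambda>n. pairing v u x0 - (LINT x:{t n<..<x0}|M. \<omega> x)) \<longlonglongrightarrow> A" unfolding A_def by (intro tendsto_intros)
    moreover have "pairing v u x0 - (LINT x:{t n<..<x0}|M. \<omega> x) = herm (right_lim v (t n)) (J *v right_lim u (t n))" for n
      using lag[OF t(1)[of n] x0] tx[of n] LINT_Ico_left[OF \<omega>l t(1)[of n] x0 tx[of n]]
        right_pairing[OF U(3) V(3) t(1)[of n]]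
      by (simp add: \<omega>_def[of "t n", symmetric] atom_def algebra_simps)
    ultimately show "(\<lambda>n. herm (right_lim v (real_of_ereal (S n))) (J *v right_lim u (real_of_ereal (S n)))) \<longlonglongrightarrow> A"
      by (simp add: t_def)
  qed
  moreover have na: "at_right a \<noteq> bot"
  proof
    assume "at_right a = bot"
    then have "eventually (\<lambda>_. False) (at_right a)" by simp
    then have "\<exists>e>a. \<forall>y>a. y < e \<longrightarrow> False" by (simp only: eventually_at_right[OF x0ab(1)])
    then show False by (metis dense)
  qed
  ultimately have ba: "bracket_a a J v u = A" unfolding bracket_a_def by (intro tendsto_Lim)
  have "(LINT x|M. \<omega> x) = (LINT x:{x \<in> I. x0 \<le> x} \<union> {x \<in> I. x < x0}|M. \<omega> x)"
    unfolding set_lebesgue_integral_def by (intro Bochner_Integration.integral_cong) (auto simp: indicator_def)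
  also have "\<dots> = (LINT x:{x \<in> I. x0 \<le> x}|M. \<omega> x) + (LINT x:{x \<in> I. x < x0}|M. \<omega> x)"
    using \<omega>i cutm by (intro set_integral_Un) (auto simp: set_integrable_def intro!: integrable_mult_indicator)
  finally show ?thesis unfolding bb ba A_def B_def using \<omega>int by simp
qed

end

section \<open>Pairs of square integrable functions\<close>

context hermitian_system
begin

type_synonym (in -) 'm fpair = "(real \<Rightarrow> complex^'m) \<times> (real \<Rightarrow> complex^'m)"

definition scl2 :: "complex \<Rightarrow> 'n fpair \<Rightarrow> 'n fpair" where
  "scl2 c X = (scl c (fst X), scl c (snd X))"

definition ip2 :: "'n fpair \<Rightarrow> 'n fpair \<Rightarrow> complex" where
  "ip2 X Y = semi_inner a b w (fst X) (fst Y) + semi_inner a b w (snd X) (snd Y)"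

definition rot :: "'n fpair \<Rightarrow> 'n fpair" where
  "rot X = (snd X, - fst X)"

lemma pair_semi_inner_space: "semi_inner_space scl2 (L \<times> L) ip2"
proof -
  interpret vector_space scl2
    by unfold_locales (simp_all add: scl2_def prod_eq_iff LS.scale_right_distrib LS.scale_left_distrib)
  show ?thesis
  proof
    show "subspace (L \<times> L)"
      by (intro subspaceI) (auto simp: scl2_def zero_prod_def mem_Times_iff)
    fix X Y Z :: "'n fpair" and c :: complex
    show "ip2 X (Y + Z) = ip2 X Y + ip2 X Z" if "X \<in> L \<times> L" "Y \<in> L \<times> L" "Z \<in> L \<times> L"
      using that by (auto simp: ip2_def LS.ip_add)
    show "ip2 X (scl2 c Y) = c * ip2 X Y" if "X \<in> L \<times> L" "Y \<in> L \<times> L"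
      using that by (auto simp: ip2_def scl2_def LS.ip_scale distrib_left)
    show "ip2 Y X = cnj (ip2 X Y)" if "X \<in> L \<times> L" "Y \<in> L \<times> L"
      unfolding ip2_def complex_cnj_add using that
      by (intro arg_cong2[of _ _ _ _ "(+)"] LS.ip_cnj) (auto simp: mem_Times_iff)
    show "0 \<le> Re (ip2 X X)" if "X \<in> L \<times> L"
      using that LS.ip_pos[of "fst X"] LS.ip_pos[of "snd X"] by (auto simp: ip2_def)
  qed
qed

sublocale PS: semi_inner_space scl2 "L \<times> L" ip2 by (rule pair_semi_inner_space)

lemma pair_nrm_sq: "X \<in> L \<times> L \<Longrightarrow> (PS.nrm X)\<^sup>2 = (LS.nrm (fst X))\<^sup>2 + (LS.nrm (snd X))\<^sup>2"
  using PS.nrm_sq[of X] LS.nrm_sq[of "fst X"] LS.nrm_sq[of "snd X"] by (auto simp: ip2_def mem_Times_iff)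

lemma pair_null_iff: "X \<in> L \<times> L \<Longrightarrow> PS.nrm X = 0 \<longleftrightarrow> LS.nrm (fst X) = 0 \<and> LS.nrm (snd X) = 0"
  using pair_nrm_sq[of X] sum_power2_eq_zero_iff[of "LS.nrm (fst X)" "LS.nrm (snd X)"] by auto

lemma pair_nrm_le:
  assumes "X \<in> L \<times> L" shows "LS.nrm (fst X) \<le> PS.nrm X" "LS.nrm (snd X) \<le> PS.nrm X"
    "PS.nrm X \<le> LS.nrm (fst X) + LS.nrm (snd X)"
proof -
  have n: "0 \<le> LS.nrm (fst X)" "0 \<le> LS.nrm (snd X)" "0 \<le> PS.nrm X"
    using assms by (auto simp: mem_Times_iff)
  show "LS.nrm (fst X) \<le> PS.nrm X" by (rule power2_le_imp_le) (use pair_nrm_sq[OF assms] n in auto)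
  show "LS.nrm (snd X) \<le> PS.nrm X" by (rule power2_le_imp_le) (use pair_nrm_sq[OF assms] n in auto)
  show "PS.nrm X \<le> LS.nrm (fst X) + LS.nrm (snd X)"
    by (rule power2_le_imp_le) (use pair_nrm_sq[OF assms] n in \<open>auto simp: power2_sum\<close>)
qed

lemma pair_complete:
  assumes X: "\<And>n::nat. X n \<in> L \<times> L"
    and C: "\<And>e. e > 0 \<Longrightarrow> \<exists>N. \<forall>m\<ge>N. \<forall>n\<ge>N. PS.nrm (X m - X n) < e"
  shows "\<exists>x\<in>L \<times> L. (\<lambda>n. PS.nrm (X n - x)) \<longlonglongrightarrow> 0"
proof -
  have XL: "fst (X n) \<in> L" "snd (X n) \<in> L" for n using X[of n] by (auto simp: mem_Times_iff)
  have D: "X m - X n \<in> L \<times> L" for m n by (intro PS.H_diff X)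
  have "\<exists>x\<in>L. (\<lambda>n. LS.nrm (fst (X n) - x)) \<longlonglongrightarrow> 0"
  proof (rule L_complete[OF XL(1)])
    fix e :: real assume "0 < e"
    then obtain N where "\<forall>m\<ge>N. \<forall>n\<ge>N. PS.nrm (X m - X n) < e" using C by blast
    then show "\<exists>N. \<forall>m\<ge>N. \<forall>n\<ge>N. LS.nrm (fst (X m) - fst (X n)) < e"
      using pair_nrm_le(1)[OF D] le_less_trans unfolding fst_diff by blast
  qed
  then obtain x where x: "x \<in> L" "(\<lambda>n. LS.nrm (fst (X n) - x)) \<longlonglongrightarrow> 0" by blast
  have "\<exists>x\<in>L. (\<lambda>n. LS.nrm (snd (X n) - x)) \<longlonglongrightarrow> 0"
  proof (rule L_complete[OF XL(2)])
    fix e :: real assume "0 < e"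
    then obtain N where "\<forall>m\<ge>N. \<forall>n\<ge>N. PS.nrm (X m - X n) < e" using C by blast
    then show "\<exists>N. \<forall>m\<ge>N. \<forall>n\<ge>N. LS.nrm (snd (X m) - snd (X n)) < e"
      using pair_nrm_le(2)[OF D] le_less_trans unfolding snd_diff by blast
  qed
  then obtain y where y: "y \<in> L" "(\<lambda>n. LS.nrm (snd (X n) - y)) \<longlonglongrightarrow> 0" by blast
  have xy: "(x, y) \<in> L \<times> L" using x y by simp
  have lim: "(\<lambda>n. LS.nrm (fst (X n) - x) + LS.nrm (snd (X n) - y)) \<longlonglongrightarrow> 0"
    using tendsto_add[OF x(2) y(2)] by simp
  have "(\<lambda>n. PS.nrm (X n - (x, y))) \<longlonglongrightarrow> 0"
  proof (rule tendsto_sandwich[OF always_eventually always_eventually tendsto_const lim])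
    show "\<forall>n. 0 \<le> PS.nrm (X n - (x, y))" using PS.nrm_nonneg PS.H_diff X xy by blast
    show "\<forall>n. PS.nrm (X n - (x, y)) \<le> LS.nrm (fst (X n) - x) + LS.nrm (snd (X n) - y)"
      using pair_nrm_le(3)[OF PS.H_diff[OF X xy]] by simp
  qed
  then show ?thesis using xy by blast
qed

text \<open>In contrast to \<open>calTmax\<close> this is closed under changes of norm zero, as adjoints are.\<close>

definition Tmax_rep :: "'n fpair set" where
  "Tmax_rep = {X \<in> L \<times> L. \<exists>Y \<in> calTmax a b J q w. PS.nrm (X - Y) = 0}"

lemma calTmax_L: "calTmax a b J q w \<subseteq> L \<times> L" by (auto simp: calTmax_iff)

lemma rot_L: "X \<in> L \<times> L \<Longrightarrow> rot X \<in> L \<times> L" by (auto simp: rot_def)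

lemma ip2_rot: "X \<in> L \<times> L \<Longrightarrow> Y \<in> L \<times> L \<Longrightarrow>
    ip2 (rot X) Y = semi_inner a b w (snd X) (fst Y) - semi_inner a b w (fst X) (snd Y)"
  by (auto simp: ip2_def rot_def LS.ip_minus_left)

text \<open>Green's formula gives one inclusion and \<open>orthogonal_to_Tmin\<close> the other.\<close>

lemma Tmax_rep_adjoint: "Tmax_rep = {X \<in> L \<times> L. \<forall>Y\<in>Tmin_rep. ip2 (rot X) Y = 0}"
proof (intro equalityI subsetI)
  fix X assume "X \<in> Tmax_rep"
  then obtain Z where X: "X \<in> L \<times> L" and Z: "Z \<in> calTmax a b J q w" "PS.nrm (X - Z) = 0"
    by (auto simp: Tmax_rep_def)
  have ZL: "Z \<in> L \<times> L" using Z calTmax_L by blast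
  have n: "LS.nrm (fst X - fst Z) = 0" "LS.nrm (snd X - snd Z) = 0"
    using pair_null_iff[OF PS.H_diff[OF X ZL]] Z by auto
  have "ip2 (rot X) Y = 0" if Y: "Y \<in> Tmin_rep" for Y
  proof -
    have YT: "Y \<in> calTmax a b J q w" using Y by (auto simp: Tmin_rep_def)
    then have YL: "Y \<in> L \<times> L" using calTmax_L by blast
    have "semi_inner a b w (fst X) (snd Y) = semi_inner a b w (fst Z) (snd Y)"
      "semi_inner a b w (snd X) (fst Y) = semi_inner a b w (snd Z) (fst Y)"
      using n X YL ZL by (intro LS.null_congr(2); auto simp: mem_Times_iff)+
    then show ?thesis
      using Tmin_rep_green[of "fst Y" "snd Y" "fst Z" "snd Z"] Y Z(1) X YL by (simp add: ip2_rot)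
  qed
  then show "X \<in> {X \<in> L \<times> L. \<forall>Y\<in>Tmin_rep. ip2 (rot X) Y = 0}" using X by blast
next
  fix X assume "X \<in> {X \<in> L \<times> L. \<forall>Y\<in>Tmin_rep. ip2 (rot X) Y = 0}"
  then have X: "X \<in> L \<times> L" and o: "\<And>Y. Y \<in> Tmin_rep \<Longrightarrow> ip2 (rot X) Y = 0" by auto
  have XL: "fst X \<in> L" "snd X \<in> L" using X by (auto simp: mem_Times_iff)
  have "\<exists>v'. (v', snd X) \<in> calTmax a b J q w \<and> LS.nrm (fst X - v') = 0"
  proof (rule orthogonal_to_Tmin[OF XL])
    fix u f assume Y: "(u, f) \<in> Tmin_rep"
    then have "(u, f) \<in> L \<times> L" using calTmax_L by (auto simp: Tmin_rep_def)
    then show "semi_inner a b w (snd X) u = semi_inner a b w (fst X) f"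
      using o[OF Y] X by (simp add: ip2_rot)
  qed
  then obtain v' where v': "(v', snd X) \<in> calTmax a b J q w" "LS.nrm (fst X - v') = 0" by blast
  have "(v', snd X) \<in> L \<times> L" using v'(1) calTmax_L by blast
  then have "PS.nrm (X - (v', snd X)) = 0"
    using pair_null_iff[OF PS.H_diff[OF X, of "(v', snd X)"]] v'(2) by simp
  then show "X \<in> Tmax_rep" using X v'(1) by (auto simp: Tmax_rep_def)
qed

lemma Tmax_linear_relation: "linear_relation scl2 (L \<times> L) ip2 rot Tmin_rep Tmax_rep"
proof
  show "\<exists>x\<in>L \<times> L. (\<lambda>n. PS.nrm (X n - x)) \<longlonglongrightarrow> 0"
    if "\<And>n::nat. X n \<in> L \<times> L" "\<And>e. e > 0 \<Longrightarrow> \<exists>N. \<forall>m\<ge>N. \<forall>n\<ge>N. PS.nrm (X m - X n) < e" for X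
    by (rule pair_complete[OF that])
  fix X Y :: "'n fpair" and c :: complex
  show "rot X \<in> L \<times> L" if "X \<in> L \<times> L" by (rule rot_L[OF that])
  show "rot (X + Y) = rot X + rot Y" by (simp add: rot_def prod_eq_iff)
  show "rot (scl2 c X) = scl2 c (rot X)" by (simp add: rot_def scl2_def prod_eq_iff LS.scale_minus_right)
  show "rot (rot X) = - X" by (simp add: rot_def prod_eq_iff)
  show "ip2 (rot X) (rot Y) = ip2 X Y" if "X \<in> L \<times> L" "Y \<in> L \<times> L"
    using that by (auto simp: ip2_def rot_def LS.ip_minus LS.ip_minus_left)
  show "Tmin_rep \<subseteq> Tmax_rep"
  proof
    fix X assume "X \<in> Tmin_rep"
    then have "X \<in> calTmax a b J q w" by (auto simp: Tmin_rep_def)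
    moreover have "PS.nrm (X - X) = 0" by simp
    ultimately show "X \<in> Tmax_rep" using calTmax_L unfolding Tmax_rep_def by blast
  qed
  show "Tmax_rep = {X \<in> L \<times> L. \<forall>Y\<in>Tmin_rep. ip2 (rot X) Y = 0}" by (rule Tmax_rep_adjoint)
qed

sublocale LR: linear_relation scl2 "L \<times> L" ip2 rot Tmin_rep Tmax_rep by (rule Tmax_linear_relation)

section \<open>From functions to classes\<close>

lemma mem_cls: assumes "f \<in> L" shows "g \<in> cls a b w f \<longleftrightarrow> g \<in> L \<and> LS.nrm (f - g) = 0"
proof -
  have "(\<lambda>x. f x - g x) = f - g" by (simp add: fun_diff_def)
  then show ?thesis using LS.nrm_zero_iff[of "f - g"] assms by (auto simp: cls_def)
qed

lemma cls_eq: assumes f: "f \<in> L" and g: "g \<in> L" shows "cls a b w f = cls a b w g \<longleftrightarrow> LS.nrm (f - g) = 0"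
proof
  assume "cls a b w f = cls a b w g"
  moreover have "g \<in> cls a b w g" using mem_cls[OF g] g by simp
  ultimately show "LS.nrm (f - g) = 0" using mem_cls[OF f] by simp
next
  assume n: "LS.nrm (f - g) = 0"
  have "LS.nrm (f - h) = 0 \<longleftrightarrow> LS.nrm (g - h) = 0" if h: "h \<in> L" for h
    using LS.nrm_triangle_diff[OF f g h] LS.nrm_triangle_diff[OF g f h] LS.nrm_diff_commute[OF f g] n
      LS.nrm_nonneg[OF LS.H_diff[OF f h]] LS.nrm_nonneg[OF LS.H_diff[OF g h]] by argo
  then show "cls a b w f = cls a b w g" using mem_cls[OF f] mem_cls[OF g] by blast
qed

definition Cl :: "'n fpair \<Rightarrow> 'n l2pair" where
  "Cl X = (cls a b w (fst X), cls a b w (snd X))"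

lemma Cl_eq: assumes "X \<in> L \<times> L" "Y \<in> L \<times> L" shows "Cl X = Cl Y \<longleftrightarrow> PS.nrm (X - Y) = 0"
  using assms cls_eq[of "fst X" "fst Y"] cls_eq[of "snd X" "snd Y"] pair_null_iff[OF PS.H_diff[OF assms]]
  by (auto simp: Cl_def mem_Times_iff)

lemma rep_cls: assumes f: "f \<in> L" shows "rep (cls a b w f) \<in> L" "LS.nrm (rep (cls a b w f) - f) = 0"
proof -
  have "f \<in> cls a b w f" using mem_cls[OF f] f by simp
  then have "rep (cls a b w f) \<in> cls a b w f" unfolding rep_def by (rule someI[of "\<lambda>g. g \<in> cls a b w f"])
  then show r: "rep (cls a b w f) \<in> L" and "LS.nrm (rep (cls a b w f) - f) = 0"
    using mem_cls[OF f] LS.nrm_diff_commute[OF f] by auto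
qed

lemma l2_inner_cls: assumes f: "f \<in> L" and g: "g \<in> L"
  shows "l2_inner a b w (cls a b w f) (cls a b w g) = semi_inner a b w f g"
  unfolding l2_inner_def
  using LS.null_congr(1)[OF rep_cls(1)[OF g] g rep_cls(1)[OF f] rep_cls(2)[OF g]]
    LS.null_congr(2)[OF rep_cls(1)[OF f] f g rep_cls(2)[OF f]] by simp

lemma l2_add_cls: assumes f: "f \<in> L" and g: "g \<in> L"
  shows "l2_add a b w (cls a b w f) (cls a b w g) = cls a b w (f + g)"
proof -
  let ?f = "rep (cls a b w f)" and ?g = "rep (cls a b w g)"
  note r = rep_cls[OF f] rep_cls[OF g]
  have "LS.nrm ((?f - f) + (?g - g)) = 0" using r f g by (intro LS.null_add LS.H_diff)
  moreover have "(?f - f) + (?g - g) = (?f + ?g) - (f + g)" by simp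
  ultimately have "cls a b w (?f + ?g) = cls a b w (f + g)" using r f g by (subst cls_eq) auto
  then show ?thesis by (simp add: l2_add_def plus_fun_def)
qed

lemma l2_scale_cls: assumes f: "f \<in> L"
  shows "l2_scale a b w c (cls a b w f) = cls a b w (scl c f)"
proof -
  let ?f = "rep (cls a b w f)"
  note r = rep_cls[OF f]
  have "LS.nrm (scl c (?f - f)) = 0" using r f by (simp add: LS.nrm_scale)
  then have "cls a b w (scl c ?f) = cls a b w (scl c f)"
    using r f by (subst cls_eq) (auto simp: LS.scale_right_diff_distrib)
  then show ?thesis by (simp add: l2_scale_def scl_def)
qed

lemma pair_of_classes_simps:
  "pair_zero a b w = Cl 0"
  "X \<in> L \<times> L \<Longrightarrow> Y \<in> L \<times> L \<Longrightarrow> pair_add a b w (Cl X) (Cl Y) = Cl (X + Y)"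
  "X \<in> L \<times> L \<Longrightarrow> pair_scale a b w c (Cl X) = Cl (scl2 c X)"
  "X \<in> L \<times> L \<Longrightarrow> Y \<in> L \<times> L \<Longrightarrow> pair_inner a b w (Cl X) (Cl Y) = ip2 X Y"
  "X \<in> L \<times> L \<Longrightarrow> flip a b w (Cl X) = Cl (rot X)"
proof -
  have "scl (- 1) f = - f" for f by (auto simp: scl_def fun_eq_iff vec_eq_iff)
  then show "X \<in> L \<times> L \<Longrightarrow> flip a b w (Cl X) = Cl (rot X)"
    by (auto simp: flip_def Cl_def rot_def l2_scale_cls)
qed (auto simp: pair_zero_def pair_add_def pair_scale_def pair_inner_def Cl_def zero_fun_def
    l2_add_cls l2_scale_cls l2_inner_cls scl2_def ip2_def)

lemma L2_pair_iff: "A \<in> L2 a b w \<times> L2 a b w \<longleftrightarrow> (\<exists>X\<in>L \<times> L. A = Cl X)"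
  by (cases A) (auto simp: L2_def Cl_def)

lemma class_rep: "S \<subseteq> L2 a b w \<times> L2 a b w \<Longrightarrow> A \<in> S \<Longrightarrow> \<exists>X. X \<in> L \<times> L \<and> A = Cl X"
  unfolding Bex_def[symmetric] by (rule L2_pair_iff[THEN iffD1]) (rule subsetD)

lemma lincomb_Cl:
  assumes "\<And>j. j < k \<Longrightarrow> p j \<in> L \<times> L" "\<And>j. j < k \<Longrightarrow> P j = Cl (p j)"
  shows "lincomb a b w c P k = Cl (PS.comb c p {..<k})"
  using assms
proof (induction k)
  case 0 then show ?case by (simp add: PS.comb_def pair_of_classes_simps(1))
next
  case (Suc k)
  have "PS.comb c p {..<k} \<in> L \<times> L" using Suc.prems by (intro PS.comb_H) auto
  moreover have "scl2 c' (p k) \<in> L \<times> L" "p k \<in> L \<times> L" for c' using Suc.prems PS.H_scale by auto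
  moreover have "PS.comb c p {..<Suc k} = PS.comb c p {..<k} + scl2 (c k) (p k)" by (simp add: PS.comb_def)
  ultimately show ?case using Suc.IH Suc.prems by (simp add: pair_of_classes_simps)
qed

lemma lin_indep_Cl:
  assumes "\<And>j. j < k \<Longrightarrow> p j \<in> L \<times> L" "\<And>j. j < k \<Longrightarrow> P j = Cl (p j)"
  shows "lin_indep a b w P k \<longleftrightarrow> PS.indep p {..<k}"
proof -
  have "PS.comb c p {..<k} \<in> L \<times> L" for c using assms by (intro PS.comb_H) auto
  then have "lincomb a b w c P k = pair_zero a b w \<longleftrightarrow> PS.nrm (PS.comb c p {..<k}) = 0" for c
    using lincomb_Cl[OF assms, where c = c] Cl_eq[of "PS.comb c p {..<k}" 0] PS.H_0 by (simp add: pair_of_classes_simps(1))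
  then show ?thesis by (simp add: lin_indep_def PS.indep_def Ball_def)
qed

lemma Tmax_eq: "Tmax a b J q w = Cl ` calTmax a b J q w"
  by (force simp: Tmax_def Cl_def)

lemma Cl_Tmax: assumes X: "X \<in> L \<times> L" shows "Cl X \<in> Tmax a b J q w \<longleftrightarrow> X \<in> Tmax_rep"
proof -
  have "Cl X = Cl Y \<longleftrightarrow> PS.nrm (X - Y) = 0" if "Y \<in> calTmax a b J q w" for Y
    using Cl_eq[OF X] that calTmax_L by blast
  then show ?thesis unfolding Tmax_eq Tmax_rep_def using X by blast
qed

lemma Tmax_L2: "Tmax a b J q w \<subseteq> L2 a b w \<times> L2 a b w"
  using calTmax_L L2_pair_iff unfolding Tmax_eq by blast

text \<open>\<open>rot X - z X\<close> has the components \<open>d\<close> and \<open>-z d\<close> with \<open>d = f - z u\<close>; the second uses \<open>z\<^sup>2 = -1\<close>.\<close>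

lemma Cl_Dspace: assumes X: "X \<in> L \<times> L" and z: "z * z = - 1"
  shows "Cl X \<in> Dspace a b J q w z \<longleftrightarrow> X \<in> LR.D z"
proof -
  have XL: "fst X \<in> L" "snd X \<in> L" using X by (auto simp: mem_Times_iff)
  define d where "d = snd X - scl z (fst X)"
  have dL: "d \<in> L" using XL by (auto simp: d_def)
  have e: "rot X - scl2 z X = (d, - (scl z d))"
    unfolding rot_def scl2_def prod_eq_iff d_def
    by (simp add: LS.scale_right_diff_distrib LS.scale_scale z LS.scale_minus_left)
  have "LS.nrm (scl z d) = cmod z * LS.nrm d" by (rule LS.nrm_scale[OF dL])
  moreover have "LS.nrm (- (scl z d)) = LS.nrm (scl z d)" using dL by (intro LS.nrm_minus) auto
  moreover have "(d, - (scl z d)) \<in> L \<times> L" using dL by auto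
  ultimately have "PS.nrm (rot X - scl2 z X) = 0 \<longleftrightarrow> LS.nrm d = 0"
    unfolding e by (subst pair_null_iff) auto
  moreover have "cls a b w (snd X) = l2_scale a b w z (cls a b w (fst X)) \<longleftrightarrow> LS.nrm d = 0"
    unfolding l2_scale_cls[OF XL(1)] d_def using XL by (intro cls_eq) auto
  ultimately show ?thesis
    using Cl_Tmax[OF X] by (auto simp: Dspace_def LR.D_def Cl_def)
qed

lemma Dspace_L2: "Dspace a b J q w z \<subseteq> L2 a b w \<times> L2 a b w"
  using Tmax_L2 by (auto simp: Dspace_def)

lemma V_null: assumes x: "x \<in> LR.V" and y: "y \<in> L \<times> L" and n: "PS.nrm (x - y) = 0" shows "y \<in> LR.V"
proof -
  have xL: "x \<in> L \<times> L" using x LR.V_H by blast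
  have "PS.nrm (rot x - rot y) = 0" using LR.nrm_JJ[OF PS.H_diff[OF xL y]] n by (simp add: LR.JJ_diff)
  moreover have xT: "x \<in> Tmax_rep" "rot x \<in> Tmax_rep" using x by (auto simp: LR.V_def)
  ultimately have "rot y \<in> Tmax_rep" using LR.Tmax_null[OF xT(2) rot_L[OF y]] by blast
  then show ?thesis using LR.Tmax_null[OF xT(1) y n] by (simp add: LR.V_def)
qed

lemma Cl_Vspace: assumes X: "X \<in> L \<times> L" shows "Cl X \<in> Vspace a b J q w \<longleftrightarrow> X \<in> LR.V"
proof
  assume "Cl X \<in> Vspace a b J q w"
  then obtain A B where AB: "A \<in> Dspace a b J q w \<i>" "B \<in> Dspace a b J q w (- \<i>)" "Cl X = pair_add a b w A B"
    by (auto simp: Vspace_def)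
  obtain x where x: "x \<in> L \<times> L" "A = Cl x" using class_rep[OF Dspace_L2 AB(1)] by (elim exE conjE)
  obtain y where y: "y \<in> L \<times> L" "B = Cl y" using class_rep[OF Dspace_L2 AB(2)] by (elim exE conjE)
  have "x \<in> LR.D \<i>" "y \<in> LR.D (- \<i>)" using AB x y Cl_Dspace by auto
  then have "x + y \<in> LR.V" unfolding LR.V_eq by blast
  moreover have "PS.nrm (x + y - X) = 0"
    using AB(3) x y X Cl_eq[of "x + y" X] by (simp add: pair_of_classes_simps PS.H_add)
  ultimately show "X \<in> LR.V" using V_null X by blast
next
  assume "X \<in> LR.V"
  then obtain x y where xy: "X = x + y" "x \<in> LR.D \<i>" "y \<in> LR.D (- \<i>)" unfolding LR.V_eq by blast
  then have L: "x \<in> L \<times> L" "y \<in> L \<times> L" using LR.D_H by blast+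
  then have "Cl x \<in> Dspace a b J q w \<i>" "Cl y \<in> Dspace a b J q w (- \<i>)" using xy Cl_Dspace by auto
  moreover have "Cl X = pair_add a b w (Cl x) (Cl y)" using L xy(1) by (simp add: pair_of_classes_simps)
  ultimately show "Cl X \<in> Vspace a b J q w" unfolding Vspace_def by blast
qed

lemma Vspace_L2: "Vspace a b J q w \<subseteq> L2 a b w \<times> L2 a b w"
proof
  fix C assume "C \<in> Vspace a b J q w"
  then obtain A B where AB: "A \<in> Dspace a b J q w \<i>" "B \<in> Dspace a b J q w (- \<i>)" "C = pair_add a b w A B"
    by (auto simp: Vspace_def)
  obtain x where x: "x \<in> L \<times> L" "A = Cl x" using class_rep[OF Dspace_L2 AB(1)] by (elim exE conjE)
  obtain y where y: "y \<in> L \<times> L" "B = Cl y" using class_rep[OF Dspace_L2 AB(2)] by (elim exE conjE)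
  show "C \<in> L2 a b w \<times> L2 a b w" unfolding L2_pair_iff
    using AB(3) x y PS.H_add by (auto simp only: pair_of_classes_simps)
qed

lemma has_cdim_basis:
  assumes "has_cdim a b w (Dspace a b J q w z) k" and z: "z * z = - 1"
  shows "\<exists>p. (\<forall>j<k. p j \<in> LR.D z) \<and> PS.indep p {..<k} \<and> PS.spans p {..<k} (LR.D z)"
proof -
  obtain P where P: "\<And>j. j < k \<Longrightarrow> P j \<in> Dspace a b J q w z" "lin_indep a b w P k"
      "\<And>X. X \<in> Dspace a b J q w z \<Longrightarrow> \<exists>c. X = lincomb a b w c P k"
    using assms unfolding has_cdim_def by blast
  have "\<forall>j. \<exists>x. j < k \<longrightarrow> x \<in> L \<times> L \<and> P j = Cl x" using class_rep[OF Dspace_L2 P(1)] by meson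
  then obtain p where p: "\<And>j. j < k \<Longrightarrow> p j \<in> L \<times> L" "\<And>j. j < k \<Longrightarrow> P j = Cl (p j)" by metis
  have "p j \<in> LR.D z" if "j < k" for j using P(1)[OF that] p[OF that] Cl_Dspace[OF _ z] by simp
  moreover have "PS.indep p {..<k}" using lin_indep_Cl[OF p] P(2) by simp
  moreover have "PS.spans p {..<k} (LR.D z)" unfolding PS.spans_def
  proof
    fix x assume x: "x \<in> LR.D z"
    then have xL: "x \<in> L \<times> L" using LR.D_H by blast
    then have "Cl x \<in> Dspace a b J q w z" using x Cl_Dspace[OF _ z] by simp
    then obtain c where "Cl x = lincomb a b w c P k" using P(3) by blast
    then have "Cl x = Cl (PS.comb c p {..<k})" using lincomb_Cl[of k p P c] p by simp
    moreover have "PS.comb c p {..<k} \<in> L \<times> L" using p by (intro PS.comb_H) auto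
    ultimately have "PS.nrm (x - PS.comb c p {..<k}) = 0" using Cl_eq[OF xL, of "PS.comb c p {..<k}"] by simp
    then show "\<exists>c. PS.nrm (x - PS.comb c p {..<k}) = 0" by (rule exI[of _ c])
  qed
  ultimately show ?thesis by blast
qed

text \<open>Classes are nonempty, so \<open>T\<close> can be recovered from its lift.\<close>

definition lift :: "'n l2pair set \<Rightarrow> 'n fpair set" where
  "lift T = {X \<in> L \<times> L. Cl X \<in> T}"

lemma image_lift: assumes "S \<subseteq> L2 a b w \<times> L2 a b w" shows "Cl ` lift S = S"
proof (intro equalityI subsetI)
  fix A assume "A \<in> S"
  then show "A \<in> Cl ` lift S" using class_rep[OF assms, of A] by (auto simp: lift_def)
qed (auto simp: lift_def)

lemma lift_eq_iff:
  assumes "S \<subseteq> L2 a b w \<times> L2 a b w" "T \<subseteq> L2 a b w \<times> L2 a b w" shows "lift S = lift T \<longleftrightarrow> S = T"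
  using image_lift[OF assms(1)] image_lift[OF assms(2)] by metis

lemma linear_subspace_iff:
  assumes T: "T \<subseteq> L2 a b w \<times> L2 a b w"
  shows "linear_subspace a b w T \<longleftrightarrow> PS.subspace (lift T)"
proof
  assume l: "linear_subspace a b w T"
  show "PS.subspace (lift T)"
  proof (rule PS.subspaceI)
    show "0 \<in> lift T" using l PS.H_0 by (simp add: lift_def linear_subspace_def pair_of_classes_simps(1))
    show "X + Y \<in> lift T" if "X \<in> lift T" "Y \<in> lift T" for X Y
    proof -
      have "pair_add a b w (Cl X) (Cl Y) \<in> T" using l that by (simp add: lift_def linear_subspace_def)
      then show ?thesis using that PS.H_add by (simp add: lift_def pair_of_classes_simps)
    qed
    show "scl2 c X \<in> lift T" if "X \<in> lift T" for c X
    proof -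
      have "pair_scale a b w c (Cl X) \<in> T" using l that by (simp add: lift_def linear_subspace_def)
      then show ?thesis using that PS.H_scale by (simp add: lift_def pair_of_classes_simps)
    qed
  qed
next
  assume s: "PS.subspace (lift T)"
  have ex: "\<exists>x\<in>lift T. X = Cl x" if "X \<in> T" for X using that image_lift[OF T] by auto
  show "linear_subspace a b w T" unfolding linear_subspace_def
  proof (intro conjI T ballI allI)
    show "pair_zero a b w \<in> T" using PS.subspace_0[OF s] by (simp add: lift_def pair_of_classes_simps(1))
    fix X assume "X \<in> T"
    then obtain x where x: "x \<in> lift T" "X = Cl x" using ex by blast
    then have xL: "x \<in> L \<times> L" by (simp add: lift_def)
    show "pair_scale a b w c X \<in> T" for c
      using PS.subspace_scale[OF s x(1), of c] xL by (simp add: x(2) pair_of_classes_simps lift_def)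
    fix Y assume "Y \<in> T"
    then obtain y where y: "y \<in> lift T" "Y = Cl y" using ex by blast
    then have yL: "y \<in> L \<times> L" by (simp add: lift_def)
    show "pair_add a b w X Y \<in> T"
      using PS.subspace_add[OF s x(1) y(1)] xL yL by (simp add: x(2) y(2) pair_of_classes_simps lift_def)
  qed
qed

lemma lift_adjoint:
  assumes T: "T \<subseteq> L2 a b w \<times> L2 a b w"
  shows "lift (rel_adjoint a b w T) = LR.adj (lift T)"
proof -
  have "Cl X \<in> rel_adjoint a b w T \<longleftrightarrow> (\<forall>Y\<in>lift T. ip2 (rot X) Y = 0)" if X: "X \<in> L \<times> L" for X
  proof -
    have XL: "fst X \<in> L" "snd X \<in> L" using X by (auto simp: mem_Times_iff)
    have "Cl X \<in> L2 a b w \<times> L2 a b w" using X L2_pair_iff by blast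
    then have "Cl X \<in> rel_adjoint a b w T \<longleftrightarrow>
       (\<forall>A\<in>T. l2_inner a b w (snd (Cl X)) (fst A) = l2_inner a b w (fst (Cl X)) (snd A))"
      by (auto simp: rel_adjoint_def)
    also have "\<dots> \<longleftrightarrow> (\<forall>Y\<in>lift T. l2_inner a b w (snd (Cl X)) (fst (Cl Y)) = l2_inner a b w (fst (Cl X)) (snd (Cl Y)))"
      by (subst image_lift[OF T, symmetric]) (rule ball_simps(9))
    also have "\<dots> \<longleftrightarrow> (\<forall>Y\<in>lift T. ip2 (rot X) Y = 0)"
    proof (rule ball_cong[OF refl])
      fix Y assume "Y \<in> lift T"
      then have Y: "Y \<in> L \<times> L" by (simp add: lift_def)
      then have "fst Y \<in> L" "snd Y \<in> L" by (auto simp: mem_Times_iff)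
      then show "l2_inner a b w (snd (Cl X)) (fst (Cl Y)) = l2_inner a b w (fst (Cl X)) (snd (Cl Y)) \<longleftrightarrow> ip2 (rot X) Y = 0"
        using XL X Y by (simp add: Cl_def l2_inner_cls ip2_rot)
    qed
    finally show ?thesis .
  qed
  then show ?thesis unfolding lift_def LR.adj_def by blast
qed

lemma balanced_rep:
  assumes "A \<in> Tmax a b J q w"
  obtains f where "(balanced_rep a b J q w A, f) \<in> calTmax a b J q w" "A = Cl (balanced_rep a b J q w A, f)"
proof -
  let ?P = "\<lambda>p. p \<in> calTmax a b J q w \<and> A = (cls a b w (fst p), cls a b w (snd p))"
  have "\<exists>p. ?P p" using assms by (auto simp: Tmax_def)
  then have "?P (SOME p. ?P p)" by (rule someI_ex)
  then show ?thesis using that[of "snd (SOME p. ?P p)"] unfolding balanced_rep_def Cl_def by simp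
qed

text \<open>
  The boundary condition of \<open>p\<close> is orthogonality to \<open>p\<close>. Since \<open>bracket_difference\<close> holds for all balanced
  representatives, the choice in \<open>balanced_rep\<close> does not matter; the sign comes from \<open>rot (rot p) = -p\<close>.
\<close>

lemma boundary_form_eq:
  assumes p: "p \<in> LR.V" and x: "x \<in> Tmax_rep"
  shows "boundary_form a b J q w (flip a b w (Cl p)) (Cl x) = ip2 p x"
proof -
  have pL: "p \<in> L \<times> L" and xL: "x \<in> L \<times> L" using p x LR.V_H LR.Tmax_H by auto
  have rL: "rot p \<in> L \<times> L" using pL by (rule rot_L)
  have F: "flip a b w (Cl p) = Cl (rot p)" using pL by (rule pair_of_classes_simps)
  have "Cl (rot p) \<in> Tmax a b J q w" using Cl_Tmax[OF rL] p by (simp add: LR.V_def)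
  then obtain g where g: "(balanced_rep a b J q w (Cl (rot p)), g) \<in> calTmax a b J q w"
      "Cl (rot p) = Cl (balanced_rep a b J q w (Cl (rot p)), g)" by (rule balanced_rep)
  have "Cl x \<in> Tmax a b J q w" using Cl_Tmax[OF xL] x by simp
  then obtain f where f: "(balanced_rep a b J q w (Cl x), f) \<in> calTmax a b J q w"
      "Cl x = Cl (balanced_rep a b J q w (Cl x), f)" by (rule balanced_rep)
  define v where "v = (balanced_rep a b J q w (Cl (rot p)), g)"
  define u where "u = (balanced_rep a b J q w (Cl x), f)"
  have vL: "v \<in> L \<times> L" and uL: "u \<in> L \<times> L" using f(1) g(1) calTmax_L by (auto simp: u_def v_def)
  have "boundary_form a b J q w (Cl (rot p)) (Cl x) = semi_inner a b w (fst v) (snd u) - semi_inner a b w (snd v) (fst u)"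
    unfolding boundary_form_def using bracket_difference[OF f(1) g(1)] by (simp add: u_def v_def)
  also have "\<dots> = - ip2 (rot v) u" using vL uL by (simp add: ip2_rot)
  also have "\<dots> = - pair_inner a b w (flip a b w (Cl v)) (Cl u)"
    using vL uL rot_L by (simp add: pair_of_classes_simps)
  also have "\<dots> = - pair_inner a b w (flip a b w (Cl (rot p))) (Cl x)"
    using f(2) g(2) by (simp add: u_def v_def)
  also have "\<dots> = - ip2 (rot (rot p)) x" using rL xL rot_L[OF rL] by (simp add: pair_of_classes_simps)
  also have "\<dots> = ip2 p x" using pL xL by (simp add: LR.JJ_JJ PS.ip_minus_left)
  finally show ?thesis by (simp add: F)
qed

text \<open>
  The abstract theorem, with both sides rewritten in terms of representatives: \<open>T\<close> is replaced by
  \<open>lift T\<close> and each class \<open>P j\<close> by a pair \<open>p j\<close> representing it.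
\<close>

theorem self_adjoint_restriction_iff:
  assumes dims: "has_cdim a b w (Dspace a b J q w \<i>) m" "has_cdim a b w (Dspace a b J q w (- \<i>)) m"
  shows "sa_restriction a b J q w T \<longleftrightarrow>
    (\<exists>P. (\<forall>j<m. P j \<in> Vspace a b J q w) \<and>
         lin_indep a b w P m \<and>
         (\<forall>k<m. \<forall>l<m. pair_inner a b w (P k) (flip a b w (P l)) = 0) \<and>
         T = {X \<in> Tmax a b J q w. \<forall>j<m. boundary_form a b J q w (flip a b w (P j)) X = 0})" (is "?L \<longleftrightarrow> ?R")
proof -
  obtain Pp where Pp: "\<And>j. j < m \<Longrightarrow> Pp j \<in> LR.D \<i>" "PS.indep Pp {..<m}" "PS.spans Pp {..<m} (LR.D \<i>)"
    using has_cdim_basis[OF dims(1)] by auto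
  obtain Pm where Pm: "\<And>j. j < m \<Longrightarrow> Pm j \<in> LR.D (- \<i>)" "PS.indep Pm {..<m}" "PS.spans Pm {..<m} (LR.D (- \<i>))"
    using has_cdim_basis[OF dims(2)] by auto
  interpret ED: equal_deficiency scl2 "L \<times> L" ip2 rot Tmin_rep Tmax_rep m Pp Pm
    by unfold_locales (use Pp Pm in auto)
  have lift_Tmax: "lift (Tmax a b J q w) = Tmax_rep"
    using Cl_Tmax LR.Tmax_H unfolding lift_def by blast
  let ?T = "\<lambda>P. {X \<in> Tmax a b J q w. \<forall>j<m. boundary_form a b J q w (flip a b w (P j)) X = 0}"
  have lift_T: "lift (?T P) = {x \<in> Tmax_rep. \<forall>j<m. ip2 (p j) x = 0}"
    if "\<And>j. j < m \<Longrightarrow> p j \<in> LR.V" "\<And>j. j < m \<Longrightarrow> P j = Cl (p j)" for p P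
  proof -
    have "lift (?T P) = {x \<in> Tmax_rep. \<forall>j<m. boundary_form a b J q w (flip a b w (P j)) (Cl x) = 0}"
      using lift_Tmax unfolding lift_def by blast
    also have "\<dots> = {x \<in> Tmax_rep. \<forall>j<m. ip2 (p j) x = 0}"
      using boundary_form_eq[OF that(1)] that(2) by (intro Collect_cong conj_cong refl) simp
    finally show ?thesis .
  qed
  have TL: "?T P \<subseteq> L2 a b w \<times> L2 a b w" for P using Tmax_L2 by blast
  have "?L \<longleftrightarrow> T \<subseteq> L2 a b w \<times> L2 a b w \<and> PS.subspace (lift T) \<and> lift T \<subseteq> Tmax_rep \<and> lift T = LR.adj (lift T)"
  proof (cases "T \<subseteq> L2 a b w \<times> L2 a b w")
    case True
    have "T \<subseteq> Tmax a b J q w \<longleftrightarrow> lift T \<subseteq> Tmax_rep"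
    proof
      show "lift T \<subseteq> Tmax_rep" if "T \<subseteq> Tmax a b J q w"
        unfolding lift_Tmax[symmetric] using that by (auto simp: lift_def)
      show "T \<subseteq> Tmax a b J q w" if "lift T \<subseteq> Tmax_rep"
        using image_mono[OF that, of Cl] image_lift[OF True] image_lift[OF Tmax_L2] lift_Tmax by simp
    qed
    moreover have "T = rel_adjoint a b w T \<longleftrightarrow> lift T = LR.adj (lift T)"
    proof -
      have "rel_adjoint a b w T \<subseteq> L2 a b w \<times> L2 a b w" by (auto simp: rel_adjoint_def)
      then show ?thesis using lift_eq_iff[OF True, of "rel_adjoint a b w T"] lift_adjoint[OF True] by metis
    qed
    ultimately show ?thesis unfolding sa_restriction_def using linear_subspace_iff[OF True] True by simp
  next
    case False then show ?thesis by (simp add: sa_restriction_def linear_subspace_def)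
  qed
  also have "\<dots> \<longleftrightarrow> T \<subseteq> L2 a b w \<times> L2 a b w \<and> (\<exists>p. (\<forall>j<m. p j \<in> LR.V) \<and> PS.indep p {..<m} \<and>
      (\<forall>k<m. \<forall>l<m. ip2 (p k) (rot (p l)) = 0) \<and> lift T = {x \<in> Tmax_rep. \<forall>j<m. ip2 (p j) x = 0})"
  proof -
    have "lift T \<subseteq> L \<times> L" by (auto simp: lift_def)
    moreover have "y \<in> lift T" if "x \<in> lift T" "y \<in> L \<times> L" "PS.nrm (x - y) = 0" for x y
      using that Cl_eq[of x y] by (auto simp: lift_def)
    ultimately show ?thesis using ED.self_adjoint_iff[of "lift T"] by blast
  qed
  also have "\<dots> \<longleftrightarrow> ?R"
  proof
    assume "T \<subseteq> L2 a b w \<times> L2 a b w \<and> (\<exists>p. (\<forall>j<m. p j \<in> LR.V) \<and> PS.indep p {..<m} \<and>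
      (\<forall>k<m. \<forall>l<m. ip2 (p k) (rot (p l)) = 0) \<and> lift T = {x \<in> Tmax_rep. \<forall>j<m. ip2 (p j) x = 0})"
    then obtain p where T: "T \<subseteq> L2 a b w \<times> L2 a b w" and p: "\<And>j. j < m \<Longrightarrow> p j \<in> LR.V" "PS.indep p {..<m}"
      "\<And>k l. k < m \<Longrightarrow> l < m \<Longrightarrow> ip2 (p k) (rot (p l)) = 0" "lift T = {x \<in> Tmax_rep. \<forall>j<m. ip2 (p j) x = 0}" by blast
    have pL: "p j \<in> L \<times> L" if "j < m" for j using p(1)[OF that] LR.V_H by blast
    show ?R
    proof (intro exI[of _ "\<lambda>j. Cl (p j)"] conjI allI impI)
      show "Cl (p j) \<in> Vspace a b J q w" if "j < m" for j using Cl_Vspace[OF pL[OF that]] p(1)[OF that] by simp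
      show "lin_indep a b w (\<lambda>j. Cl (p j)) m" using lin_indep_Cl[of m p "\<lambda>j. Cl (p j)"] pL p(2) by simp
      show "pair_inner a b w (Cl (p k)) (flip a b w (Cl (p l))) = 0" if "k < m" "l < m" for k l
        using p(3)[OF that] pL that rot_L by (simp add: pair_of_classes_simps)
      have "lift T = lift (?T (\<lambda>j. Cl (p j)))" unfolding p(4) using p(1) by (intro lift_T[symmetric] refl)
      then show "T = ?T (\<lambda>j. Cl (p j))" by (rule lift_eq_iff[OF T TL, THEN iffD1])
    qed
  next
    assume ?R
    then obtain P where P: "\<And>j. j < m \<Longrightarrow> P j \<in> Vspace a b J q w" "lin_indep a b w P m"
      "\<And>k l. k < m \<Longrightarrow> l < m \<Longrightarrow> pair_inner a b w (P k) (flip a b w (P l)) = 0" "T = ?T P" by blast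
    have "\<forall>j. \<exists>x. j < m \<longrightarrow> x \<in> L \<times> L \<and> P j = Cl x" using class_rep[OF Vspace_L2 P(1)] by meson
    then obtain p where p: "\<And>j. j < m \<Longrightarrow> p j \<in> L \<times> L" "\<And>j. j < m \<Longrightarrow> P j = Cl (p j)" by metis
    have pV: "p j \<in> LR.V" if "j < m" for j using P(1)[OF that] p[OF that] Cl_Vspace by simp
    have "PS.indep p {..<m}" using lin_indep_Cl[OF p] P(2) by simp
    moreover have "ip2 (p k) (rot (p l)) = 0" if "k < m" "l < m" for k l
      using P(3)[OF that] p that rot_L by (simp add: pair_of_classes_simps)
    moreover have "lift T = {x \<in> Tmax_rep. \<forall>j<m. ip2 (p j) x = 0}" using lift_T[OF pV p(2)] P(4) by simp
    moreover have "T \<subseteq> L2 a b w \<times> L2 a b w" using P(4) TL by blast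
    ultimately show "T \<subseteq> L2 a b w \<times> L2 a b w \<and> (\<exists>p. (\<forall>j<m. p j \<in> LR.V) \<and> PS.indep p {..<m} \<and>
      (\<forall>k<m. \<forall>l<m. ip2 (p k) (rot (p l)) = 0) \<and> lift T = {x \<in> Tmax_rep. \<forall>j<m. ip2 (p j) x = 0})"
      using pV by blast
  qed
  finally show ?thesis .
qed

end

theorem theorem4p1:
  fixes a b :: ereal
    and J :: "complex^'n^'n"
    and q w :: "real set \<Rightarrow> complex^'n^'n"
    and m :: nat
    and T :: "'n l2pair set"
  assumes "a < b"
    and "invertible J"
    and "cadjoint J = - J"
    and "distr0 a b q"
    and "distr0 a b w"
    and "hermitian0 a b q"
    and "nonneg0 a b w"
    and "\<forall>x \<in> einterval a b. invertible (2 *\<^sub>R J + jump a b q x) \<and>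
                              invertible (2 *\<^sub>R J - jump a b q x)"
    and "has_cdim a b w (Dspace a b J q w \<i>) m"
    and "has_cdim a b w (Dspace a b J q w (- \<i>)) m"
    and "m > 0"
  shows "sa_restriction a b J q w T \<longleftrightarrow>
    (\<exists>P. (\<forall>j<m. P j \<in> Vspace a b J q w) \<and>
         lin_indep a b w P m \<and>
         (\<forall>k<m. \<forall>l<m. pair_inner a b w (P k) (flip a b w (P l)) = 0) \<and>
         T = {X \<in> Tmax a b J q w. \<forall>j<m. boundary_form a b J q w (flip a b w (P j)) X = 0})"
proof -
  interpret hermitian_system a b J q w
    by unfold_locales (use assms(1-8) in auto)
  show ?thesis using assms(9,10) by (rule self_adjoint_restriction_iff)
qed

end
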